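(* Consider the Inverse Linear Feasibility Problem with polyhedral target set: given $A\in\mathbb{Q}^{m\times n}$, $B\in\mathbb{Q}^{m\times k}$, $b\in\mathbb{Q}^m$, $C\in\mathbb{Q}^{n\times k}$, $c\in\mathbb{Q}^n$, a polyhedron $X=\{x\in\mathbb{R}^k \mid Dx\le d\}$ with $D\in\mathbb{Q}^{g\times k}$, $d\in\mathbb{Q}^g$, and a polyhedron $Y=\{y\in\mathbb{R}^n\mid Sy\le t\}$ with $S\in\mathbb{Q}^{r\times n}$, $t\in\mathbb{Q}^r$, let $\mathrm{Opt}(x)$ denote the set of optimal solutions of the parametric LP with parameter $x$, which is either in natural form, $\min\{(Cx+c)^\top y \mid Ay\le Bx+b,\ y\in\mathbb{R}^n\}$, or in standard form, $\min\{(Cx+c)^\top y \mid Ay= Bx+b,\ y\in\mathbb{R}^n,\ y\ge 0\}$. Decide (optimistic scenario) whether there exists $x\in X$ with $\mathrm{Opt}(x)\cap Y\ne\emptyset$; (pessimistic scenario) whether there exists $x\in X$ with $\emptyset\ne\mathrm{Opt}(x)\subseteq Y$. For each of the two forms of the LP, both the optimistic and the pessimistic decision problem belong to NP.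
   Context: All input data, including $D,d,S,t$, are rational and given in the usual binary encoding. $\mathrm{Opt}(x)$ is empty if the LP for parameter $x$ is infeasible or unbounded. *)

theory Defs
  imports
    Complex_Main
    "HOL-Library.Log_Nat"
    "HOL-Computational_Algebra.Polynomial"
    "Jordan_Normal_Form.Matrix"
begin

section \<open>The machine model\<close>

text \<open>
  Random access machines under the logarithmic cost criterion (Aho, Hopcroft, Ullman; Cook, Reckhow),
  with structured control flow instead of jumps. Registers are addressed by integers and hold integers.
  Every step is charged the binary length of each literal, address and register content involved,
  including the result, so this model and multitape Turing machines simulate each other with polynomial
  overhead.
\<close>

type_synonym memory = "int \<Rightarrow> int"

datatype loc = Reg int | Ind int

datatype operand = Lit int | Load loc

datatype arith = Add | Sub | Mul | Div

datatype com =
    Skip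
  | Op loc arith operand operand
  | Seq com com
  | IfPos operand com com
  | WhilePos operand com

text \<open>The extra unit accounts for the sign, and makes the length of \<open>0\<close> positive.\<close>

definition int_len :: "int \<Rightarrow> nat" where
  "int_len z = Suc (floorlog 2 (nat \<bar>z\<bar>))"

fun addr :: "memory \<Rightarrow> loc \<Rightarrow> int" where
  "addr M (Reg i) = i"
| "addr M (Ind i) = M i"

fun addr_cost :: "memory \<Rightarrow> loc \<Rightarrow> nat" where
  "addr_cost M (Reg i) = int_len i"
| "addr_cost M (Ind i) = int_len i + int_len (M i)"

fun opval :: "memory \<Rightarrow> operand \<Rightarrow> int" where
  "opval M (Lit z) = z"
| "opval M (Load l) = M (addr M l)"

fun opval_cost :: "memory \<Rightarrow> operand \<Rightarrow> nat" where
  "opval_cost M (Lit z) = int_len z"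
| "opval_cost M (Load l) = addr_cost M l + int_len (M (addr M l))"

fun arith_fun :: "arith \<Rightarrow> int \<Rightarrow> int \<Rightarrow> int" where
  "arith_fun Add x y = x + y"
| "arith_fun Sub x y = x - y"
| "arith_fun Mul x y = x * y"
| "arith_fun Div x y = x div y"

text \<open>\<open>exec c M s M'\<close>: started in memory \<open>M\<close>, the program \<open>c\<close> halts with memory \<open>M'\<close> after time \<open>s\<close>.\<close>

inductive exec :: "com \<Rightarrow> memory \<Rightarrow> nat \<Rightarrow> memory \<Rightarrow> bool" where
  Skip: "exec Skip M 1 M"
| Op: "v = arith_fun f (opval M a) (opval M b) \<Longrightarrow>
    exec (Op l f a b) M (1 + opval_cost M a + opval_cost M b + addr_cost M l + int_len v)
      (M(addr M l := v))"
| Seq: "exec c M s M' \<Longrightarrow> exec c' M' s' M'' \<Longrightarrow> exec (Seq c c') M (s + s') M''"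
| IfTrue: "opval M a > 0 \<Longrightarrow> exec c M s M' \<Longrightarrow>
    exec (IfPos a c c') M (1 + opval_cost M a + s) M'"
| IfFalse: "opval M a \<le> 0 \<Longrightarrow> exec c' M s M' \<Longrightarrow>
    exec (IfPos a c c') M (1 + opval_cost M a + s) M'"
| WhileFalse: "opval M a \<le> 0 \<Longrightarrow> exec (WhilePos a c) M (1 + opval_cost M a) M"
| WhileTrue: "opval M a > 0 \<Longrightarrow> exec c M s M' \<Longrightarrow> exec (WhilePos a c) M' s' M'' \<Longrightarrow>
    exec (WhilePos a c) M (1 + opval_cost M a + s + s') M''"

text \<open>
  The input word occupies registers \<open>1, 2, \<dots>\<close>, one symbol per register, and register \<open>0\<close> holds its
  length; all other registers are initially \<open>0\<close>.
\<close>

definition init_memory :: "int list \<Rightarrow> memory" where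
  "init_memory u = (\<lambda>i. if i = 0 then int (length u)
     else if 1 \<le> i \<and> i \<le> int (length u) then u ! nat (i - 1) else 0)"

definition accepts :: "com \<Rightarrow> int list \<Rightarrow> bool" where
  "accepts c u \<longleftrightarrow> (\<exists>s M. exec c (init_memory u) s M \<and> M 0 = 1)"

definition halts_within :: "com \<Rightarrow> int list \<Rightarrow> nat \<Rightarrow> bool" where
  "halts_within c u T \<longleftrightarrow> (\<exists>s M. exec c (init_memory u) s M \<and> s \<le> T)"

section \<open>The class NP\<close>

text \<open>The symbol \<open>2\<close> separates the input word from the certificate.\<close>

definition pair_word :: "bool list \<Rightarrow> bool list \<Rightarrow> int list" where
  "pair_word x w = map of_bool x @ [2] @ map of_bool w"

definition NP :: "bool list set set" where
  "NP = {L. \<exists>V (p :: nat poly) (q :: nat poly).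
     (\<forall>x w. halts_within V (pair_word x w) (poly q (length (pair_word x w)))) \<and>
     (\<forall>x. x \<in> L \<longleftrightarrow> (\<exists>w. length w \<le> poly p (length x) \<and> accepts V (pair_word x w)))}"

section \<open>Inverse linear feasibility with polyhedral target set\<close>

record ilfp =
  lhs_A :: "rat mat"
  rhs_B :: "rat mat"
  rhs_b :: "rat vec"
  obj_C :: "rat mat"
  obj_c :: "rat vec"
  par_D :: "rat mat"
  par_d :: "rat vec"
  tgt_S :: "rat mat"
  tgt_t :: "rat vec"

abbreviation dim_m :: "ilfp \<Rightarrow> nat" where "dim_m I \<equiv> dim_row (lhs_A I)"
abbreviation dim_n :: "ilfp \<Rightarrow> nat" where "dim_n I \<equiv> dim_col (lhs_A I)"
abbreviation dim_k :: "ilfp \<Rightarrow> nat" where "dim_k I \<equiv> dim_col (rhs_B I)"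
abbreviation dim_g :: "ilfp \<Rightarrow> nat" where "dim_g I \<equiv> dim_row (par_D I)"
abbreviation dim_r :: "ilfp \<Rightarrow> nat" where "dim_r I \<equiv> dim_row (tgt_S I)"

definition wf_ilfp :: "ilfp \<Rightarrow> bool" where
  "wf_ilfp I \<longleftrightarrow>
     lhs_A I \<in> carrier_mat (dim_m I) (dim_n I) \<and>
     rhs_B I \<in> carrier_mat (dim_m I) (dim_k I) \<and>
     rhs_b I \<in> carrier_vec (dim_m I) \<and>
     obj_C I \<in> carrier_mat (dim_n I) (dim_k I) \<and>
     obj_c I \<in> carrier_vec (dim_n I) \<and>
     par_D I \<in> carrier_mat (dim_g I) (dim_k I) \<and>
     par_d I \<in> carrier_vec (dim_g I) \<and>
     tgt_S I \<in> carrier_mat (dim_r I) (dim_n I) \<and>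
     tgt_t I \<in> carrier_vec (dim_r I)"

abbreviation real_mat :: "rat mat \<Rightarrow> real mat" where "real_mat \<equiv> map_mat real_of_rat"
abbreviation real_vec :: "rat vec \<Rightarrow> real vec" where "real_vec \<equiv> map_vec real_of_rat"

definition polyhedron :: "rat mat \<Rightarrow> rat vec \<Rightarrow> real vec set" where
  "polyhedron P p = {x \<in> carrier_vec (dim_col P). real_mat P *\<^sub>v x \<le> real_vec p}"

definition param_set :: "ilfp \<Rightarrow> real vec set" where
  "param_set I = polyhedron (par_D I) (par_d I)"

definition target_set :: "ilfp \<Rightarrow> real vec set" where
  "target_set I = polyhedron (tgt_S I) (tgt_t I)"

datatype lp_form = Natural | Standard

definition lp_rhs :: "ilfp \<Rightarrow> real vec \<Rightarrow> real vec" where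
  "lp_rhs I x = real_mat (rhs_B I) *\<^sub>v x + real_vec (rhs_b I)"

definition lp_obj :: "ilfp \<Rightarrow> real vec \<Rightarrow> real vec" where
  "lp_obj I x = real_mat (obj_C I) *\<^sub>v x + real_vec (obj_c I)"

fun lp_feasible :: "lp_form \<Rightarrow> ilfp \<Rightarrow> real vec \<Rightarrow> real vec set" where
  "lp_feasible Natural I x =
     {y \<in> carrier_vec (dim_n I). real_mat (lhs_A I) *\<^sub>v y \<le> lp_rhs I x}"
| "lp_feasible Standard I x =
     {y \<in> carrier_vec (dim_n I). real_mat (lhs_A I) *\<^sub>v y = lp_rhs I x \<and> 0\<^sub>v (dim_n I) \<le> y}"

definition Opt :: "lp_form \<Rightarrow> ilfp \<Rightarrow> real vec \<Rightarrow> real vec set" where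
  "Opt F I x = {y \<in> lp_feasible F I x.
     \<forall>y' \<in> lp_feasible F I x. lp_obj I x \<bullet> y \<le> lp_obj I x \<bullet> y'}"

definition optimistic :: "lp_form \<Rightarrow> ilfp \<Rightarrow> bool" where
  "optimistic F I \<longleftrightarrow> (\<exists>x \<in> param_set I. Opt F I x \<inter> target_set I \<noteq> {})"

definition pessimistic :: "lp_form \<Rightarrow> ilfp \<Rightarrow> bool" where
  "pessimistic F I \<longleftrightarrow> (\<exists>x \<in> param_set I. Opt F I x \<noteq> {} \<and> Opt F I x \<subseteq> target_set I)"

section \<open>Binary encoding of instances\<close>

text \<open>Binary digits, least significant first.\<close>

definition bin :: "nat \<Rightarrow> bool list" where
  "bin a = map (bit a) [0..<floorlog 2 a]"

text \<open>Every digit is preceded by the marker \<open>True\<close>, and \<open>False\<close> ends the number, so that codes can be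
  concatenated without loss of information.\<close>

definition enc_nat :: "nat \<Rightarrow> bool list" where
  "enc_nat a = concat (map (\<lambda>\<beta>. [True, \<beta>]) (bin a)) @ [False]"

definition enc_int :: "int \<Rightarrow> bool list" where
  "enc_int z = (z < 0) # enc_nat (nat \<bar>z\<bar>)"

text \<open>Numerator and positive denominator, in lowest terms.\<close>

definition enc_rat :: "rat \<Rightarrow> bool list" where
  "enc_rat q = (case quotient_of q of (a, b) \<Rightarrow> enc_int a @ enc_nat (nat b))"

definition enc_vec :: "rat vec \<Rightarrow> bool list" where
  "enc_vec v = concat (map (\<lambda>i. enc_rat (v $ i)) [0..<dim_vec v])"

definition enc_mat :: "rat mat \<Rightarrow> bool list" where
  "enc_mat P = concat (map (\<lambda>i. enc_vec (row P i)) [0..<dim_row P])"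

text \<open>Dimensions are written in unary, as all entries are listed anyway.\<close>

definition enc_dim :: "nat \<Rightarrow> bool list" where
  "enc_dim a = replicate a True @ [False]"

definition encode :: "ilfp \<Rightarrow> bool list" where
  "encode I =
     enc_dim (dim_m I) @ enc_dim (dim_n I) @ enc_dim (dim_k I) @ enc_dim (dim_g I) @ enc_dim (dim_r I) @
     enc_mat (lhs_A I) @ enc_mat (rhs_B I) @ enc_vec (rhs_b I) @
     enc_mat (obj_C I) @ enc_vec (obj_c I) @
     enc_mat (par_D I) @ enc_vec (par_d I) @
     enc_mat (tgt_S I) @ enc_vec (tgt_t I)"

definition optimistic_ILFP :: "lp_form \<Rightarrow> bool list set" where
  "optimistic_ILFP F = {encode I | I. wf_ilfp I \<and> optimistic F I}"

definition pessimistic_ILFP :: "lp_form \<Rightarrow> bool list set" where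
  "pessimistic_ILFP F = {encode I | I. wf_ilfp I \<and> pessimistic F I}"

end

theory Submission
  imports Defs "Jordan_Normal_Form.Determinant"
begin

text \<open>
  Both forms of the LP are systems of inequalities \<open>A y \<le> B x + b\<close>. Let \<open>y\<close> be optimal for \<open>x\<close>, let \<open>\<lambda>\<close> be
  a dual solution, and let \<open>J\<close> be its support. For fixed \<open>J\<close>, complementary slackness
  turns optimality into linear conditions on \<open>x\<close>, \<open>y\<close>, \<open>\<lambda>\<close> jointly, so by Cramer's rule there is a solution of
  polynomial size. This certifies the optimistic problem.

  For the pessimistic problem, Farkas' lemma expresses every row \<open>S\<^sub>i y \<le> t\<^sub>i\<close> as a combination of the constraints
  and of the optimality of the objective, with nonnegative multipliers \<open>\<mu>\<^sub>i\<close> and \<open>K\<^sub>i\<close>. These conditions are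
  bilinear in the unknowns, but the multiplier \<open>K\<^sub>i\<close> can be eliminated: since \<open>C x + c = - A\<^sup>T \<lambda>\<close>, it suffices
  to find \<open>\<mu>\<^sub>i\<close> that is nonnegative outside \<open>J\<close>, because \<open>\<mu>\<^sub>i + K\<^sub>i \<lambda>\<close> is nonnegative for large
  \<open>K\<^sub>i\<close>. The multipliers can then be chosen small and independent of \<open>x\<close>, and afterwards \<open>x\<close>, \<open>y\<close>, \<open>\<lambda>\<close>
  solve a linear system with small coefficients.

  The certificate lists these numbers with slack variables, so that correctness is a fixed list of polynomial equations.
  The verifier parses its word into memory and adds up the squared errors of all equations. It uses no
  division: lowest terms are certified by Bezout coefficients, and a common denominator of the input is part of the certificate.
\<close>


section \<open>Fourier-Motzkin elimination and Farkas' lemma\<close>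

section \<open>Linear inequalities\<close>

text \<open>That all optimal solutions lie in the target is a bilinear condition, so no single
  linear system yields a small witness. For fixed \<open>x\<close>, however, the multipliers of a
  target row form a polyhedron that depends only on \<open>A\<close>, \<open>S\<close> and the
  support \<open>J\<close>; the right-hand side \<open>B x + b\<close> is merely a cost vector on
  it. A basic solution of no larger cost is bounded independently of \<open>x\<close>; it exists
  because a point of the optimal face is a dual solution and excludes rays of negative cost. With
  these multipliers frozen, the cost inequality is linear in \<open>x\<close>. Its coefficients have
  polynomial bit length, so nesting the bound for basic solutions twice is harmless. The second
  solution must keep the dual variables positive on \<open>J\<close>, because this positivity is
  what a large \<open>K\<close> amplifies.

  The time bound must hold for every pair of words. Parsing is therefore total; malformed words are
  rejected by equations on the parsed numbers, and the separator, the only symbol 2, is recognized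
  as the sign of the item after the last entry.\<close>

inductive_set cone :: "((nat \<Rightarrow> real) \<times> real) set \<Rightarrow> ((nat \<Rightarrow> real) \<times> real) set" for S where
  base: "p \<in> S \<Longrightarrow> p \<in> cone S"
| add: "(a, \<alpha>) \<in> cone S \<Longrightarrow> (b, \<beta>) \<in> cone S \<Longrightarrow> (\<lambda>e. a e + b e, \<alpha> + \<beta>) \<in> cone S"
| scale: "(a, \<alpha>) \<in> cone S \<Longrightarrow> c > 0 \<Longrightarrow> (\<lambda>e. c * a e, c * \<alpha>) \<in> cone S"

lemma cone_mono: "p \<in> cone S' \<Longrightarrow> S' \<subseteq> cone S \<Longrightarrow> p \<in> cone S"
  by (induction rule: cone.induct) (auto intro: cone.intros)

lemma cone_coord_zero:
  "p \<in> cone S \<Longrightarrow> \<forall>q\<in>S. fst q n = 0 \<Longrightarrow> fst p n = 0"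
  by (induction rule: cone.induct) auto

text \<open>Yields the value of the eliminated variable between its lower and upper bounds. Either
  set may be empty, so an extremum is taken only of a set known to be nonempty.\<close>

lemma finite_sets_separated:
  fixes A B :: "real set"
  assumes "finite A" "finite B" and le: "\<And>a b. a \<in> A \<Longrightarrow> b \<in> B \<Longrightarrow> a \<le> b"
  shows "\<exists>t. (\<forall>a\<in>A. a \<le> t) \<and> (\<forall>b\<in>B. t \<le> b)"
proof (cases "A = {}")
  case True
  show ?thesis
  proof (cases "B = {}")
    case False
    then show ?thesis using True \<open>finite B\<close> by (intro exI[of _ "Min B"]) auto
  qed (use True in auto)
next
  case False
  then show ?thesis using assms by (intro exI[of _ "Max A"]) auto
qed

text \<open>A pair \<open>(a, \<beta>)\<close> stands for the inequality
  \<open>a y \<le> \<beta>\<close>, and \<open>cone S\<close> for its positive combinations.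
  Induction on the number of variables: the last one is eliminated by combining each row in which
  its coefficient is positive with each row in which it is negative. A contradiction among the new
  rows is one among the old rows, since the new rows lie in \<open>cone S\<close> and have
  coefficient 0 at the eliminated variable.\<close>

lemma fourier_motzkin:
  assumes "finite S"
  shows "(\<exists>y. \<forall>(a, \<beta>)\<in>S. (\<Sum>e<n. a e * y e) \<le> \<beta>) \<or>
    (\<exists>a \<gamma>. (a, \<gamma>) \<in> cone S \<and> (\<forall>e<n. a e = 0) \<and> \<gamma> < 0)"
  using assms
proof (induction n arbitrary: S)
  case 0
  show ?case
  proof (cases "\<forall>(a, \<beta>)\<in>S. 0 \<le> \<beta>")
    case False
    then obtain a \<beta> where "(a, \<beta>) \<in> S" "\<beta> < 0" by force
    then show ?thesis using cone.base by fastforce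
  qed auto
next
  case (Suc n)
  define P where "P = {p \<in> S. fst p n > 0}"
  define Q where "Q = {p \<in> S. fst p n < 0}"
  define Z where "Z = {p \<in> S. fst p n = 0}"
  \<comment> \<open>Scaling makes the coefficients of variable \<open>n\<close> equal to 1 and -1,
    so they cancel in the sum; both factors are positive.\<close>
  define comb where "comb = (\<lambda>(p :: (nat \<Rightarrow> real) \<times> real, q :: (nat \<Rightarrow> real) \<times> real).
    (\<lambda>e. (1 / fst p n) * fst p e + (1 / (- fst q n)) * fst q e,
      (1 / fst p n) * snd p + (1 / (- fst q n)) * snd q))"
  define S' where "S' = Z \<union> comb ` (P \<times> Q)"
  have fin: "finite P" "finite Q" "finite Z" using Suc.prems by (auto simp: P_def Q_def Z_def)
  have coord: "\<forall>q\<in>S'. fst q n = 0"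
    by (auto simp: S'_def Z_def comb_def P_def Q_def)
  have sub: "S' \<subseteq> cone S"
  proof
    fix v assume "v \<in> S'"
    then consider "v \<in> Z" | p q where "p \<in> P" "q \<in> Q" "v = comb (p, q)" by (auto simp: S'_def)
    then show "v \<in> cone S"
    proof cases
      case 1
      then show ?thesis by (auto simp: Z_def intro: cone.base)
    next
      case 2
      then have "p \<in> S" "q \<in> S" "fst p n > 0" "- fst q n > 0" by (auto simp: P_def Q_def)
      then have "(fst p, snd p) \<in> cone S" "(fst q, snd q) \<in> cone S"
          "1 / fst p n > 0" "1 / (- fst q n) > 0"
        by (auto intro: cone.base)
      then show ?thesis unfolding 2(3) comb_def prod.case by (intro cone.add cone.scale) auto
    qed
  qed
  have "finite S'" using fin by (auto simp: S'_def)
  from Suc.IH[OF this] show ?case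
  proof
    assume "\<exists>a \<gamma>. (a, \<gamma>) \<in> cone S' \<and> (\<forall>e<n. a e = 0) \<and> \<gamma> < 0"
    then obtain a \<gamma> where *: "(a, \<gamma>) \<in> cone S'" "\<forall>e<n. a e = 0" "\<gamma> < 0" by blast
    have "a n = 0" using cone_coord_zero[OF *(1) coord] by simp
    then have "\<forall>e<Suc n. a e = 0" using * by (auto simp: less_Suc_eq)
    then show ?thesis using * cone_mono[OF *(1) sub] by blast
  next
    assume "\<exists>y. \<forall>(a, \<beta>)\<in>S'. (\<Sum>e<n. a e * y e) \<le> \<beta>"
    then obtain y where y: "\<And>p. p \<in> S' \<Longrightarrow> (\<Sum>e<n. fst p e * y e) \<le> snd p" by fastforce
    \<comment> \<open>Solving a row for variable \<open>n\<close> gives the bound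
      \<open>b p\<close>: an upper one if the coefficient is positive, a lower one if it is
      negative.\<close>
    define b where "b = (\<lambda>p. (snd p - (\<Sum>e<n. fst p e * y e)) / fst p n)"
    have "\<exists>t. (\<forall>l\<in>b ` Q. l \<le> t) \<and> (\<forall>u\<in>b ` P. t \<le> u)"
    proof (rule finite_sets_separated)
      fix l u assume "l \<in> b ` Q" "u \<in> b ` P"
      then obtain p q where pq: "p \<in> P" "q \<in> Q" "u = b p" "l = b q" by auto
      then have pos: "fst p n > 0" "fst q n < 0" by (auto simp: P_def Q_def)
      have "comb (p, q) \<in> S'" using pq by (auto simp: S'_def)
      from y[OF this]
      have "(1 / fst p n) * (\<Sum>e<n. fst p e * y e) + (1 / (- fst q n)) * (\<Sum>e<n. fst q e * y e)
        \<le> (1 / fst p n) * snd p + (1 / (- fst q n)) * snd q"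
        by (simp add: comb_def sum_distrib_left sum.distrib[symmetric] sum_subtractf[symmetric] algebra_simps)
      moreover have "u = (1 / fst p n) * snd p - (1 / fst p n) * (\<Sum>e<n. fst p e * y e)"
        unfolding pq b_def by (simp add: diff_divide_distrib)
      moreover have "l = (1 / (- fst q n)) * (\<Sum>e<n. fst q e * y e) - (1 / (- fst q n)) * snd q"
        unfolding pq b_def by (simp add: diff_divide_distrib)
      ultimately show "l \<le> u" by linarith
    qed (use fin in auto)
    then obtain t where t: "\<And>q. q \<in> Q \<Longrightarrow> b q \<le> t" "\<And>p. p \<in> P \<Longrightarrow> t \<le> b p" by auto
    have "(\<Sum>e<Suc n. fst p e * (y(n := t)) e) \<le> snd p" if "p \<in> S" for p
    proof -
      have eq: "(\<Sum>e<Suc n. fst p e * (y(n := t)) e) = (\<Sum>e<n. fst p e * y e) + fst p n * t" by simp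
      consider "p \<in> Z" | "p \<in> P" | "p \<in> Q" using \<open>p \<in> S\<close> by (fastforce simp: Z_def P_def Q_def)
      then show ?thesis
      proof cases
        case 1
        then show ?thesis using y[of p] eq by (auto simp: S'_def Z_def)
      next
        case 2
        then have "fst p n > 0" by (auto simp: P_def)
        then show ?thesis using t(2)[OF 2] unfolding eq b_def by (simp add: field_simps)
      next
        case 3
        then have "fst p n < 0" by (auto simp: Q_def)
        then show ?thesis using t(1)[OF 3] unfolding eq b_def by (simp add: field_simps)
      qed
    qed
    then show ?thesis
      by (intro disjI1 exI[of _ "y(n := t)"] ballI)
        (simp add: split_beta del: fun_upd_apply sum.lessThan_Suc)
  qed
qed

lemma cone_imp_combination:
  assumes "p \<in> cone ((\<lambda>r. (a r, \<beta> r)) ` R)" "finite R"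
  shows "\<exists>\<mu>. (\<forall>r. 0 \<le> \<mu> r) \<and> (\<forall>e. fst p e = (\<Sum>r\<in>R. \<mu> r * a r e)) \<and>
    snd p = (\<Sum>r\<in>R. \<mu> r * \<beta> r)"
  using assms(1)
proof (induction rule: cone.induct)
  case (base p)
  then obtain r where r: "r \<in> R" "p = (a r, \<beta> r)" by auto
  have "(\<Sum>r'\<in>R. (if r' = r then 1 else 0) * f r') = f r" for f :: "_ \<Rightarrow> real"
    using r(1) assms(2) by (simp add: if_distrib[of "\<lambda>x. x * _"] cong: if_cong)
  then show ?case using r by (intro exI[of _ "\<lambda>r'. if r' = r then 1 else 0"]) simp
next
  case (add a1 \<alpha>1 a2 \<alpha>2)
  then obtain \<mu>1 \<mu>2 where
    "\<forall>r. 0 \<le> \<mu>1 r" "\<forall>e. a1 e = (\<Sum>r\<in>R. \<mu>1 r * a r e)" "\<alpha>1 = (\<Sum>r\<in>R. \<mu>1 r * \<beta> r)"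
    "\<forall>r. 0 \<le> \<mu>2 r" "\<forall>e. a2 e = (\<Sum>r\<in>R. \<mu>2 r * a r e)" "\<alpha>2 = (\<Sum>r\<in>R. \<mu>2 r * \<beta> r)"
    by auto
  then show ?case
    by (intro exI[of _ "\<lambda>r. \<mu>1 r + \<mu>2 r"]) (simp add: algebra_simps sum.distrib)
next
  case (scale a1 \<alpha>1 c)
  then obtain \<mu> where
    "\<forall>r. 0 \<le> \<mu> r" "\<forall>e. a1 e = (\<Sum>r\<in>R. \<mu> r * a r e)" "\<alpha>1 = (\<Sum>r\<in>R. \<mu> r * \<beta> r)" by auto
  then show ?case using \<open>c > 0\<close>
    by (intro exI[of _ "\<lambda>r. c * \<mu> r"]) (simp add: sum_distrib_left algebra_simps)
qed

text \<open>Homogenization by an extra variable turns validity of \<open>s y \<le> t\<close> into infeasibility of a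
  system without strict inequalities.\<close>

lemma farkas:
  fixes a :: "'r \<Rightarrow> nat \<Rightarrow> real"
  assumes "finite R" and feas: "\<And>r. r \<in> R \<Longrightarrow> (\<Sum>e<n. a r e * y0 e) \<le> \<beta> r"
    and valid: "\<And>y. (\<And>r. r \<in> R \<Longrightarrow> (\<Sum>e<n. a r e * y e) \<le> \<beta> r) \<Longrightarrow> (\<Sum>e<n. s e * y e) \<le> t"
  shows "\<exists>\<mu>. (\<forall>r. 0 \<le> \<mu> r) \<and> (\<forall>e<n. (\<Sum>r\<in>R. \<mu> r * a r e) = s e) \<and> (\<Sum>r\<in>R. \<mu> r * \<beta> r) \<le> t"
proof -
  \<comment> \<open>Coordinate \<open>n\<close> is the homogenizing variable. The rows
    \<open>Inl r\<close> say \<open>a r y \<le> \<beta> r * y n\<close>, the row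
    \<open>Inr True\<close> says that \<open>s y\<close> is at least \<open>t * y n + 1\<close>, and
    \<open>Inr False\<close> says that \<open>y n\<close> is nonnegative.\<close>
  define a' :: "'r + bool \<Rightarrow> nat \<Rightarrow> real" where "a' = (\<lambda>i. case i of
      Inl r \<Rightarrow> (a r)(n := - \<beta> r) | Inr True \<Rightarrow> (\<lambda>e. - s e)(n := t) | Inr False \<Rightarrow> (\<lambda>_. 0)(n := -1))"
  define \<beta>' :: "'r + bool \<Rightarrow> real" where "\<beta>' = (\<lambda>i. if i = Inr True then -1 else 0)"
  define R' :: "('r + bool) set" where "R' = Inl ` R \<union> {Inr True, Inr False}"
  have R': "finite R'" using \<open>finite R\<close> by (auto simp: R'_def)
  have sumR': "(\<Sum>i\<in>R'. f i) = (\<Sum>r\<in>R. f (Inl r)) + f (Inr True) + f (Inr False)" for f :: "_ \<Rightarrow> real"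
    unfolding R'_def using \<open>finite R\<close>
    by (subst sum.union_disjoint) (auto simp: sum.reindex)
  have "\<not> (\<exists>y. \<forall>(b, \<gamma>)\<in>(\<lambda>i. (a' i, \<beta>' i)) ` R'. (\<Sum>e<Suc n. b e * y e) \<le> \<gamma>)"
  proof
    assume "\<exists>y. \<forall>(b, \<gamma>)\<in>(\<lambda>i. (a' i, \<beta>' i)) ` R'. (\<Sum>e<Suc n. b e * y e) \<le> \<gamma>"
    then obtain y where y: "\<And>i. i \<in> R' \<Longrightarrow> (\<Sum>e<n. a' i e * y e) + a' i n * y n \<le> \<beta>' i" by auto
    have 1: "(\<Sum>e<n. a r e * y e) \<le> \<beta> r * y n" if "r \<in> R" for r
      using y[of "Inl r"] that by (auto simp: R'_def a'_def \<beta>'_def)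
    have 2: "y n \<ge> 0" using y[of "Inr False"] by (auto simp: R'_def a'_def \<beta>'_def)
    have 3: "(\<Sum>e<n. s e * y e) \<ge> t * y n + 1"
      using y[of "Inr True"] by (auto simp: R'_def a'_def \<beta>'_def sum_negf)
    show False
    proof (cases "y n = 0")
      case True
      \<comment> \<open>Here \<open>y\<close> is a recession direction along which \<open>s\<close>
        grows by at least 1. A step of length \<open>c\<close> from \<open>y0\<close> stays feasible
        and overshoots \<open>t\<close>, which contradicts validity.\<close>
      define c where "c = t - (\<Sum>e<n. s e * y0 e) + 1"
      have "c \<ge> 0" using valid[of y0] feas by (simp add: c_def)
      have "(\<Sum>e<n. s e * (y0 e + c * y e)) \<le> t"
      proof (rule valid)
        fix r assume r: "r \<in> R"
        have "(\<Sum>e<n. a r e * (y0 e + c * y e)) = (\<Sum>e<n. a r e * y0 e) + c * (\<Sum>e<n. a r e * y e)"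
          by (simp add: algebra_simps sum.distrib sum_distrib_left)
        moreover have "c * (\<Sum>e<n. a r e * y e) \<le> 0"
          using 1[OF r] True \<open>c \<ge> 0\<close> by (simp add: mult_nonneg_nonpos)
        ultimately show "(\<Sum>e<n. a r e * (y0 e + c * y e)) \<le> \<beta> r" using feas[OF r] by linarith
      qed
      moreover have "(\<Sum>e<n. s e * (y0 e + c * y e)) = (\<Sum>e<n. s e * y0 e) + c * (\<Sum>e<n. s e * y e)"
        by (simp add: algebra_simps sum.distrib sum_distrib_left)
      moreover have "c * (\<Sum>e<n. s e * y e) \<ge> c * 1" using 3 True \<open>c \<ge> 0\<close> by (intro mult_left_mono) auto
      ultimately show False by (simp add: c_def)
    next
      case False
      then have pos: "y n > 0" using 2 by simp
      have div: "(\<Sum>e<n. f e * (y e / y n)) = (\<Sum>e<n. f e * y e) / y n" for f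
        by (simp add: sum_divide_distrib)
      have "(\<Sum>e<n. s e * (y e / y n)) \<le> t"
        by (rule valid, simp only: div) (use 1 pos in \<open>simp add: divide_le_eq\<close>)
      then show False using 3 pos by (simp only: div) (simp add: field_simps)
    qed
  qed
  then obtain b \<gamma> where b: "(b, \<gamma>) \<in> cone ((\<lambda>i. (a' i, \<beta>' i)) ` R')" "\<forall>e<Suc n. b e = 0" "\<gamma> < 0"
    using fourier_motzkin[of "(\<lambda>i. (a' i, \<beta>' i)) ` R'" "Suc n"] R' by blast
  obtain \<mu> where \<mu>: "\<And>r. 0 \<le> \<mu> r" "\<And>e. b e = (\<Sum>r\<in>R'. \<mu> r * a' r e)" "\<gamma> = (\<Sum>r\<in>R'. \<mu> r * \<beta>' r)"
    using cone_imp_combination[OF b(1) R'] by auto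
  define c where "c = \<mu> (Inr True)"
  \<comment> \<open>Only the row \<open>Inr True\<close> has a nonzero right-hand side, namely -1,
    so the negative \<open>\<gamma>\<close> forces its multiplier to be positive; dividing by it
    gives the Farkas multipliers.\<close>
  have c: "c > 0" using b(3) \<mu>(3) unfolding sumR' by (simp add: \<beta>'_def c_def)
  have 1: "(\<Sum>r\<in>R. \<mu> (Inl r) * a r e) = c * s e" if "e < n" for e
    using \<mu>(2)[of e] b(2) that unfolding sumR' by (simp add: a'_def c_def)
  have 2: "(\<Sum>r\<in>R. \<mu> (Inl r) * \<beta> r) \<le> c * t"
    using \<mu>(2)[of n] \<mu>(1)[of "Inr False"] b(2) unfolding sumR' by (simp add: a'_def c_def sum_negf)
  have div: "(\<Sum>r\<in>R. \<mu> (Inl r) / c * f r) = (\<Sum>r\<in>R. \<mu> (Inl r) * f r) / c" for f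
    by (simp add: sum_divide_distrib)
  show ?thesis
    by (intro exI[of _ "\<lambda>r. \<mu> (Inl r) / c"], unfold div) (use 1 2 c \<mu>(1) in \<open>auto simp: field_simps\<close>)
qed

section \<open>Determinant bounds, basic solutions and bounded solutions of linear systems\<close>

section \<open>Small solutions\<close>

text \<open>The Leibniz formula has \<open>p!\<close> terms, each a product of \<open>p\<close>
  entries up to sign, and \<open>p! \<le> p ^ p\<close>.\<close>

lemma abs_det_le:
  fixes A :: "int mat"
  assumes A: "A \<in> carrier_mat p p" and le: "\<And>i j. i < p \<Longrightarrow> j < p \<Longrightarrow> \<bar>A $$ (i, j)\<bar> \<le> X"
  shows "\<bar>det A\<bar> \<le> (int p * X) ^ p"
proof -
  have "\<bar>det A\<bar> \<le> (\<Sum>f | f permutes {0..<p}. \<bar>of_int (sign f) * (\<Prod>i = 0..<p. A $$ (i, f i))\<bar>)"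
    unfolding det_def'[OF A] by (rule sum_abs)
  also have "\<dots> \<le> (\<Sum>f | f permutes {0..<p}. X ^ p)"
  proof (rule sum_mono)
    fix f assume "f \<in> {f. f permutes {0..<p}}"
    then have f: "f i < p" if "i < p" for i using that permutes_in_image[of f "{0..<p}" i] by auto
    have "\<bar>of_int (sign f) * (\<Prod>i = 0..<p. A $$ (i, f i))\<bar> = (\<Prod>i = 0..<p. \<bar>A $$ (i, f i)\<bar>)"
      by (simp add: abs_mult abs_prod sign_def)
    also have "\<dots> \<le> (\<Prod>i = 0..<p. X)" by (rule prod_mono) (use f le in auto)
    finally show "\<bar>of_int (sign f) * (\<Prod>i = 0..<p. A $$ (i, f i))\<bar> \<le> X ^ p" by simp
  qed
  also have "\<dots> = fact p * X ^ p" by (simp add: card_permutations)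
  also have "\<dots> \<le> int p ^ p * X ^ p"
  proof (rule mult_right_mono)
    have "(fact p :: int) \<le> of_nat (p ^ p)" by (rule fact_le_power)
    then show "(fact p :: int) \<le> int p ^ p" by simp
    show "0 \<le> X ^ p"
    \<comment> \<open>Nonnegativity of \<open>X\<close> is read off from a matrix entry, hence the
      separate treatment of the empty matrix.\<close>
    proof (cases "p = 0")
      case False
      then have "X \<ge> 0" using le[of 0 0] by linarith
      then show ?thesis by simp
    qed simp
  qed
  finally show ?thesis by (simp add: power_mult_distrib)
qed

text \<open>The Gram matrix of linearly independent columns is nonsingular, which replaces the choice of
  a nonsingular square submatrix in Cramer's rule.\<close>

lemma cramer_independent:
  fixes M :: "'e \<Rightarrow> 'v \<Rightarrow> int" and z :: "'v \<Rightarrow> real"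
  assumes fin: "finite E" "finite U"
    and W: "\<And>e v. e \<in> E \<Longrightarrow> v \<in> U \<Longrightarrow> \<bar>M e v\<bar> \<le> W" "\<And>e. e \<in> E \<Longrightarrow> \<bar>s e\<bar> \<le> W"
    and N: "card E \<le> N" "card U \<le> N" and W1: "1 \<le> W"
    and indep: "\<And>d. (\<And>e. e \<in> E \<Longrightarrow> (\<Sum>v\<in>U. M e v * d v) = 0) \<Longrightarrow> \<forall>v\<in>U. d v = (0 :: int)"
    and sol: "\<And>e. e \<in> E \<Longrightarrow> (\<Sum>v\<in>U. real_of_int (M e v) * z v) = real_of_int (s e)"
  shows "\<exists>u \<delta>. 1 \<le> \<delta> \<and> \<delta> \<le> (int N * W) ^ (2 * N) \<and>
    (\<forall>v\<in>U. \<bar>u v\<bar> \<le> (int N * W) ^ (2 * N) \<and> real_of_int (u v) = real_of_int \<delta> * z v)"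
proof -
  define p where "p = card U"
  obtain f where f: "bij_betw f {0..<p} U" using ex_bij_betw_nat_finite[OF fin(2)] p_def by blast
  have fU: "f i \<in> U" if "i < p" for i using f that by (auto simp: bij_betw_def)
  have reidx: "(\<Sum>v\<in>U. h v) = (\<Sum>i<p. h (f i))" for h :: "'v \<Rightarrow> 'z :: comm_monoid_add"
    using sum.reindex_bij_betw[OF f, of h] by (simp add: atLeast0LessThan)
  \<comment> \<open>These are the normal equations: \<open>G\<close> is the transposed column matrix
    times the matrix itself, \<open>h\<close> the transpose times \<open>s\<close>.\<close>
  define G where "G = mat p p (\<lambda>(i, j). \<Sum>e\<in>E. M e (f i) * M e (f j))"
  define h where "h = vec p (\<lambda>i. \<Sum>e\<in>E. M e (f i) * s e)"
  define zv where "zv = vec p (\<lambda>i. z (f i))"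
  have G: "G \<in> carrier_mat p p" by (simp add: G_def)
  \<comment> \<open>Bounds the entries of \<open>G\<close> and \<open>h\<close>, which are sums of
    at most \<open>N\<close> products. A \<open>p\<close> by \<open>p\<close> determinant is then at
    most \<open>(N * X) ^ p\<close>, and \<open>N * X\<close> is the square of \<open>N * W\<close>;
    this is the origin of the exponent \<open>2 * N\<close>.\<close>
  define X where "X = int N * W\<^sup>2"
  have gram: "\<bar>\<Sum>e\<in>E. a e * b e\<bar> \<le> X"
    if "\<And>e. e \<in> E \<Longrightarrow> \<bar>a e\<bar> \<le> W" "\<And>e. e \<in> E \<Longrightarrow> \<bar>b e\<bar> \<le> W" for a b
  proof -
    have "\<bar>\<Sum>e\<in>E. a e * b e\<bar> \<le> (\<Sum>e\<in>E. \<bar>a e * b e\<bar>)" by (rule sum_abs)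
    also have "\<dots> \<le> (\<Sum>e\<in>E. W\<^sup>2)"
      by (rule sum_mono) (use that W1 in \<open>auto simp: abs_mult power2_eq_square intro!: mult_mono\<close>)
    also have "\<dots> \<le> X" using N(1) by (simp add: X_def mult_right_mono)
    finally show ?thesis .
  qed
  have detle: "\<bar>det A\<bar> \<le> (int N * W) ^ (2 * N)"
    if "A \<in> carrier_mat p p" "\<And>i j. i < p \<Longrightarrow> j < p \<Longrightarrow> \<bar>A $$ (i, j)\<bar> \<le> X" for A
  proof (cases "p = 0")
    case True
    have "(1 :: int) \<le> (int N * W) ^ (2 * N)"
    proof (cases "N = 0")
      case False
      then have "1 \<le> int N * W" using W1 mult_mono[of 1 "int N" 1 W] by simp
      then show ?thesis by simp
    qed simp
    then show ?thesis using abs_det_le[OF that] True by simp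
  next
    case False
    then have pN: "1 \<le> p" "p \<le> N" using N(2) p_def by auto
    have NW: "1 \<le> int N * W" using W1 pN mult_mono[of 1 "int N" 1 W] by simp
    have X0: "0 \<le> X" by (simp add: X_def)
    have "\<bar>det A\<bar> \<le> (int p * X) ^ p" using abs_det_le[OF that] .
    also have "\<dots> \<le> (int N * X) ^ p"
      by (rule power_mono) (use pN X0 in \<open>auto intro: mult_right_mono\<close>)
    also have "int N * X = (int N * W)\<^sup>2" by (simp add: X_def power2_eq_square)
    also have "((int N * W)\<^sup>2) ^ p \<le> ((int N * W)\<^sup>2) ^ N"
      by (rule power_increasing) (use pN NW in auto)
    finally show ?thesis by (simp add: power_mult)
  qed
  have Gle: "\<bar>G $$ (i, j)\<bar> \<le> X" if "i < p" "j < p" for i j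
    using that gram[of "\<lambda>e. M e (f i)" "\<lambda>e. M e (f j)"] W fU by (simp add: G_def)
  have hle: "\<bar>h $ i\<bar> \<le> X" if "i < p" for i
    using that gram[of "\<lambda>e. M e (f i)" s] W fU by (simp add: h_def)
  \<comment> \<open>A kernel vector \<open>v\<close> of the Gram matrix satisfies
    \<open>v G v = 0\<close>, and this number is the sum of the squares of the entries of
    \<open>M v\<close>. So \<open>v\<close> is an integer dependency of the columns.\<close>
  have det0: "det G \<noteq> 0"
  proof
    assume "det G = 0"
    then obtain v where v: "v \<in> carrier_vec p" "v \<noteq> 0\<^sub>v p" "G *\<^sub>v v = 0\<^sub>v p"
      using det_0_iff_vec_prod_zero[OF G] by auto
    define q where "q = (\<lambda>e. \<Sum>i<p. M e (f i) * v $ i)"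
    have "(\<Sum>e\<in>E. M e (f i) * q e) = 0" if "i < p" for i
    proof -
      have "(G *\<^sub>v v) $ i = (\<Sum>j<p. (\<Sum>e\<in>E. M e (f i) * M e (f j)) * v $ j)"
        using that v(1) by (simp add: G_def scalar_prod_def atLeast0LessThan)
      also have "\<dots> = (\<Sum>e\<in>E. M e (f i) * q e)"
        unfolding q_def sum_distrib_left sum_distrib_right
        by (subst sum.swap) (simp add: algebra_simps)
      finally show ?thesis using v(3) that by simp
    qed
    then have "(\<Sum>i<p. v $ i * (\<Sum>e\<in>E. M e (f i) * q e)) = 0" by simp
    also have "(\<Sum>i<p. v $ i * (\<Sum>e\<in>E. M e (f i) * q e)) = (\<Sum>e\<in>E. q e * q e)"
    proof -
      have "(\<Sum>i<p. v $ i * (\<Sum>e\<in>E. M e (f i) * q e)) = (\<Sum>e\<in>E. \<Sum>i<p. v $ i * (M e (f i) * q e))"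
        unfolding sum_distrib_left by (rule sum.swap)
      also have "\<dots> = (\<Sum>e\<in>E. q e * q e)"
      proof (rule sum.cong[OF refl])
        fix e
        have "(\<Sum>i<p. v $ i * (M e (f i) * q e)) = (\<Sum>i<p. M e (f i) * v $ i) * q e"
          unfolding sum_distrib_right by (simp add: mult_ac)
        then show "(\<Sum>i<p. v $ i * (M e (f i) * q e)) = q e * q e" by (simp add: q_def)
      qed
      finally show ?thesis .
    qed
    finally have "\<forall>e\<in>E. q e = 0" using fin(1) by (subst (asm) sum_nonneg_eq_0_iff) auto
    moreover have "(\<Sum>w\<in>U. M e w * v $ the_inv_into {0..<p} f w) = q e" for e
      unfolding reidx q_def using f
      by (intro sum.cong) (auto simp: bij_betw_def the_inv_into_f_f)
    ultimately have "\<forall>w\<in>U. v $ the_inv_into {0..<p} f w = 0"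
      using indep[of "\<lambda>w. v $ the_inv_into {0..<p} f w"] by simp
    then have "v $ i = 0" if "i < p" for i
      using fU[OF that] f that by (force simp: bij_betw_def the_inv_into_f_f)
    then show False using v(1,2) by auto
  qed
  let ?r = "map_mat real_of_int" and ?rv = "map_vec real_of_int"
  have Gz: "?r G *\<^sub>v zv = ?rv h"
  proof (rule eq_vecI)
    fix i assume "i < dim_vec (?rv h)"
    then have i: "i < p" by (simp add: h_def)
    have "(?r G *\<^sub>v zv) $ i = (\<Sum>j<p. (\<Sum>e\<in>E. real_of_int (M e (f i)) * real_of_int (M e (f j))) * z (f j))"
      using i by (simp add: G_def zv_def scalar_prod_def atLeast0LessThan)
    also have "\<dots> = (\<Sum>e\<in>E. real_of_int (M e (f i)) * (\<Sum>j<p. real_of_int (M e (f j)) * z (f j)))"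
      unfolding sum_distrib_left sum_distrib_right
      by (subst sum.swap) (simp add: algebra_simps)
    also have "\<dots> = (\<Sum>e\<in>E. real_of_int (M e (f i)) * real_of_int (s e))"
      using sol by (intro sum.cong) (auto simp: reidx)
    finally show "(?r G *\<^sub>v zv) $ i = ?rv h $ i" using i by (simp add: h_def)
  qed (simp add: G_def h_def)
  define D where "D = (\<lambda>i. det (replace_col G h i))"
  have Dle: "\<bar>D i\<bar> \<le> (int N * W) ^ (2 * N)" if "i < p" for i
    unfolding D_def
    by (rule detle) (use G Gle hle in \<open>auto simp: replace_col_def\<close>)
  have Deq: "real_of_int (D i) = z (f i) * real_of_int (det G)" if "i < p" for i
  proof -
    have "real_of_int (D i) = det (?r (replace_col G h i))" by (simp add: D_def)
    also have "?r (replace_col G h i) = replace_col (?r G) (?rv h) i"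
      using G by (intro eq_matI) (auto simp: replace_col_def h_def)
    also have "\<dots> = replace_col (?r G) (?r G *\<^sub>v zv) i" by (simp add: Gz)
    also have "det \<dots> = zv $ i * det (?r G)"
      by (rule cramer_lemma_mat) (use G that in \<open>auto simp: zv_def\<close>)
    finally show ?thesis using that by (simp add: zv_def)
  qed
  \<comment> \<open>The sign makes the common denominator \<open>\<bar>det G\<bar>\<close>
    positive.\<close>
  define u where "u = (\<lambda>v. sgn (det G) * D (the_inv_into {0..<p} f v))"
  have uf: "u (f i) = sgn (det G) * D i" if "i < p" for i
    using f that by (simp add: u_def bij_betw_def the_inv_into_f_f)
  have u: "\<bar>u v\<bar> \<le> (int N * W) ^ (2 * N) \<and> real_of_int (u v) = real_of_int \<bar>det G\<bar> * z v"
    if "v \<in> U" for v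
  proof -
    have "v \<in> f ` {0..<p}" using that f by (simp add: bij_betw_def)
    then obtain i where i: "i < p" "v = f i" by auto
    have "\<bar>u v\<bar> = \<bar>D i\<bar>" using det0 by (simp add: i uf abs_mult)
    moreover have "real_of_int (u v) = real_of_int (sgn (det G)) * (real_of_int (det G) * z v)"
      using Deq[OF i(1)] by (simp add: i uf)
    moreover have "sgn (det G) * det G = \<bar>det G\<bar>" by (simp add: abs_sgn mult.commute)
    ultimately show ?thesis using Dle[OF i(1)]
      by (metis mult.assoc of_int_mult)
  qed
  have "1 \<le> \<bar>det G\<bar>" using det0 by linarith
  moreover have "\<bar>det G\<bar> \<le> (int N * W) ^ (2 * N)" by (rule detle[OF G Gle])
  ultimately show ?thesis using u by blast
qed

text \<open>Among the solutions of cost at most that of \<open>z\<close>, one of minimal support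
  uses linearly independent columns, so Cramer's rule applies to it. The real cost vector
  \<open>q\<close> never enters the determinants, so the bound depends on \<open>M\<close> and
  \<open>s\<close> alone; \<open>y\<close> is a dual solution for \<open>q\<close> and keeps the
  cost bounded from below.\<close>

lemma basic_solution:
  fixes M :: "'e \<Rightarrow> 'v \<Rightarrow> int" and z q :: "'v \<Rightarrow> real" and y :: "'e \<Rightarrow> real"
  assumes fin: "finite E" "finite V"
    and W: "\<And>e v. e \<in> E \<Longrightarrow> v \<in> V \<Longrightarrow> \<bar>M e v\<bar> \<le> W" "\<And>e. e \<in> E \<Longrightarrow> \<bar>s e\<bar> \<le> W"
    and N: "card E \<le> N" "card V \<le> N" and W1: "1 \<le> W"
    and z0: "\<And>v. v \<in> V \<Longrightarrow> 0 \<le> z v"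
    and sol: "\<And>e. e \<in> E \<Longrightarrow> (\<Sum>v\<in>V. real_of_int (M e v) * z v) = real_of_int (s e)"
    and dual: "\<And>v. v \<in> V \<Longrightarrow> (\<Sum>e\<in>E. real_of_int (M e v) * y e) \<le> q v"
  shows "\<exists>u \<delta>. 1 \<le> \<delta> \<and> \<delta> \<le> (int N * W) ^ (2 * N) \<and>
    (\<forall>v\<in>V. 0 \<le> u v \<and> u v \<le> (int N * W) ^ (2 * N)) \<and>
    (\<forall>e\<in>E. (\<Sum>v\<in>V. M e v * u v) = \<delta> * s e) \<and>
    (\<Sum>v\<in>V. q v * real_of_int (u v)) \<le> real_of_int \<delta> * (\<Sum>v\<in>V. q v * z v)"
proof -
  define good where "good = (\<lambda>x :: 'v \<Rightarrow> real. (\<forall>v\<in>V. 0 \<le> x v) \<and>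
    (\<forall>e\<in>E. (\<Sum>v\<in>V. real_of_int (M e v) * x v) = real_of_int (s e)) \<and>
    (\<Sum>v\<in>V. q v * x v) \<le> (\<Sum>v\<in>V. q v * z v))"
  define supp where "supp = (\<lambda>x :: 'v \<Rightarrow> real. {v \<in> V. x v \<noteq> 0})"
  have "good z" using z0 sol by (simp add: good_def)
  then obtain x where x: "good x" and min: "\<And>x'. good x' \<Longrightarrow> card (supp x) \<le> card (supp x')"
    using ex_has_least_nat[of good z "\<lambda>x. card (supp x)"] by blast
  have x0: "\<And>v. v \<in> V \<Longrightarrow> 0 \<le> x v"
    and xs: "\<And>e. e \<in> E \<Longrightarrow> (\<Sum>v\<in>V. real_of_int (M e v) * x v) = real_of_int (s e)"
    and xq: "(\<Sum>v\<in>V. q v * x v) \<le> (\<Sum>v\<in>V. q v * z v)"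
    using x by (auto simp: good_def)
  define U where "U = supp x"
  have U: "U \<subseteq> V" "finite U" using fin by (auto simp: U_def supp_def)
  have xU: "x v > 0" if "v \<in> U" for v using that x0[of v] by (auto simp: U_def supp_def)
  have restrict: "(\<Sum>v\<in>V. g v * (if v \<in> U then d v else 0)) = (\<Sum>v\<in>U. g v * d v)"
    for g d :: "'v \<Rightarrow> 'z :: comm_ring_1"
    using U fin by (intro sum.mono_neutral_cong_right) auto
  text \<open>Moving along a kernel direction in the support keeps the cost from increasing until some
    variable vanishes, which contradicts minimality; rays of negative cost are excluded by the
    dual solution \<open>y\<close>.\<close>
  have no_dir: False
    if kern: "\<And>e. e \<in> E \<Longrightarrow> (\<Sum>v\<in>V. real_of_int (M e v) * d v) = 0"
      and dU: "\<And>v. v \<in> V \<Longrightarrow> v \<notin> U \<Longrightarrow> d v = 0" and cost: "(\<Sum>v\<in>V. q v * d v) \<le> 0"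
      and neg: "w \<in> V" "d w < 0" for d w
  proof -
    define B where "B = {v \<in> V. d v < 0}"
    have B: "finite B" "w \<in> B" "B \<subseteq> U" using fin neg dU by (force simp: B_def)+
    \<comment> \<open>The ratio test: the largest step that keeps the solution nonnegative.\<close>
    define t where "t = Min ((\<lambda>v. x v / - d v) ` B)"
    have tle: "t \<le> x v / - d v" if "v \<in> B" for v using that B by (auto simp: t_def)
    have "t \<in> (\<lambda>v. x v / - d v) ` B" unfolding t_def using B by (intro Min_in) auto
    then obtain v0 where v0: "v0 \<in> B" "t = x v0 / - d v0" by auto
    have "x v0 > 0" "- d v0 > 0" using v0 xU[of v0] B by (auto simp: B_def)
    then have t0: "t > 0" unfolding v0(2) by (rule divide_pos_pos)
    define x' where "x' = (\<lambda>v. x v + t * d v)"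
    have "good x'" unfolding good_def
    proof (intro conjI ballI)
      fix v assume v: "v \<in> V"
      show "0 \<le> x' v"
      proof (cases "d v < 0")
        case True
        then show ?thesis using tle[of v] v by (simp add: B_def x'_def field_simps)
      next
        case False
        then show ?thesis using x0[OF v] t0 by (simp add: x'_def)
      qed
    next
      fix e assume e: "e \<in> E"
      have "(\<Sum>v\<in>V. real_of_int (M e v) * x' v) =
          (\<Sum>v\<in>V. real_of_int (M e v) * x v) + t * (\<Sum>v\<in>V. real_of_int (M e v) * d v)"
        by (simp add: x'_def algebra_simps sum.distrib sum_distrib_left)
      then show "(\<Sum>v\<in>V. real_of_int (M e v) * x' v) = real_of_int (s e)" using xs[OF e] kern[OF e] by simp
    next
      have "(\<Sum>v\<in>V. q v * x' v) = (\<Sum>v\<in>V. q v * x v) + t * (\<Sum>v\<in>V. q v * d v)"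
        by (simp add: x'_def algebra_simps sum.distrib sum_distrib_left)
      moreover have "t * (\<Sum>v\<in>V. q v * d v) \<le> 0" using t0 cost by (simp add: mult_le_0_iff)
      ultimately show "(\<Sum>v\<in>V. q v * x' v) \<le> (\<Sum>v\<in>V. q v * z v)" using xq by linarith
    qed
    from min[OF this] have "card U \<le> card (supp x')" by (simp add: U_def)
    moreover have "supp x' \<subseteq> U - {v0}"
    proof
      fix v assume v: "v \<in> supp x'"
      then have "v \<in> V" "x' v \<noteq> 0" by (auto simp: supp_def)
      moreover have "x' v0 = 0" using v0 by (auto simp: x'_def B_def)
      moreover have "x' v = 0" if "v \<in> V" "v \<notin> U" using that dU by (auto simp: x'_def U_def supp_def)
      ultimately show "v \<in> U - {v0}" by auto
    qed
    then have "card (supp x') < card U"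
      using v0 B U by (intro psubset_card_mono) auto
    ultimately show False by simp
  qed
  have "\<exists>u \<delta>. 1 \<le> \<delta> \<and> \<delta> \<le> (int N * W) ^ (2 * N) \<and>
    (\<forall>v\<in>U. \<bar>u v\<bar> \<le> (int N * W) ^ (2 * N) \<and> real_of_int (u v) = real_of_int \<delta> * x v)"
  proof (rule cramer_independent[where M = M and s = s and E = E])
    fix d :: "'v \<Rightarrow> int"
    assume d: "\<And>e. e \<in> E \<Longrightarrow> (\<Sum>v\<in>U. M e v * d v) = 0"
    show "\<forall>v\<in>U. d v = 0"
    proof (rule ccontr)
      assume "\<not> (\<forall>v\<in>U. d v = 0)"
      then obtain w where w: "w \<in> U" "d w \<noteq> 0" by auto
      define D where "D = (\<lambda>v. if v \<in> U then real_of_int (d v) else 0)"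
      have kern: "(\<Sum>v\<in>V. real_of_int (M e v) * D v) = 0" if "e \<in> E" for e
      proof -
        have "(\<Sum>v\<in>V. real_of_int (M e v) * D v) = (\<Sum>v\<in>U. real_of_int (M e v) * real_of_int (d v))"
          unfolding D_def by (rule restrict)
        also have "\<dots> = real_of_int (\<Sum>v\<in>U. M e v * d v)" by simp
        finally show ?thesis using d[OF that] by simp
      qed
      have kern': "(\<Sum>v\<in>V. real_of_int (M e v) * - D v) = 0" if "e \<in> E" for e
        using kern[OF that] by (simp add: sum_negf)
      have costneg: "(\<Sum>v\<in>V. q v * - D v) = - (\<Sum>v\<in>V. q v * D v)" by (simp add: sum_negf)
      \<comment> \<open>Weak duality: a nonnegative kernel direction \<open>c\<close> has cost at
        least \<open>y M c = 0\<close>.\<close>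
      have ray: False if "(\<Sum>v\<in>V. q v * c v) < 0" "\<And>v. v \<in> V \<Longrightarrow> 0 \<le> c v"
        and k: "\<And>e. e \<in> E \<Longrightarrow> (\<Sum>v\<in>V. real_of_int (M e v) * c v) = 0" for c :: "'v \<Rightarrow> real"
      proof -
        have "(\<Sum>v\<in>V. (\<Sum>e\<in>E. real_of_int (M e v) * y e) * c v) \<le> (\<Sum>v\<in>V. q v * c v)"
          by (rule sum_mono) (use dual that in \<open>auto intro: mult_right_mono\<close>)
        moreover have "(\<Sum>v\<in>V. (\<Sum>e\<in>E. real_of_int (M e v) * y e) * c v) =
            (\<Sum>e\<in>E. y e * (\<Sum>v\<in>V. real_of_int (M e v) * c v))"
          unfolding sum_distrib_left sum_distrib_right
          by (subst sum.swap) (simp add: algebra_simps)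
        ultimately show False using that by simp
      qed
      have wV: "w \<in> V" using w U by auto
      have Dw: "D w \<noteq> 0" using w by (simp add: D_def)
      have D0: "D v = 0" if "v \<in> V" "v \<notin> U" for v using that by (simp add: D_def)
      have D0': "- D v = 0" if "v \<in> V" "v \<notin> U" for v using that by (simp add: D_def)
      \<comment> \<open>Whichever of \<open>D\<close> and \<open>- D\<close> does not increase the
        cost serves as the direction, and it must have a negative entry. For nonzero cost,
        \<open>ray\<close> provides one; for zero cost, the sign at \<open>w\<close> decides between
        the two.\<close>
      consider "(\<Sum>v\<in>V. q v * D v) < 0" | "(\<Sum>v\<in>V. q v * D v) > 0" | "(\<Sum>v\<in>V. q v * D v) = 0"
        by linarith
      then show False
      proof cases
        case 1
        then obtain v where "v \<in> V" "D v < 0" using ray[of D] kern by force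
        then show False using no_dir[of D v] kern D0 1 by simp
      next
        case 2
        then obtain v where "v \<in> V" "- D v < 0" using ray[of "\<lambda>v. - D v"] kern' costneg by force
        then show False using no_dir[of "\<lambda>v. - D v" v, OF kern' D0'] costneg 2 by simp
      next
        case 3
        show False
        proof (cases "D w < 0")
          case True
          then show False using no_dir[of D w, OF kern D0] 3 wV by simp
        next
          case False
          then show False using no_dir[of "\<lambda>v. - D v" w, OF kern' D0'] costneg 3 wV Dw by simp
        qed
      qed
    qed
  next
    fix e assume "e \<in> E"
    have "(\<Sum>v\<in>V. real_of_int (M e v) * x v) = (\<Sum>v\<in>U. real_of_int (M e v) * x v)"
      using U fin by (intro sum.mono_neutral_right) (auto simp: U_def supp_def)
    then show "(\<Sum>v\<in>U. real_of_int (M e v) * x v) = real_of_int (s e)" using xs[OF \<open>e \<in> E\<close>] by simp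
  next
    show "card U \<le> N" using U fin N card_mono[of V U] by linarith
  qed (use fin U W N W1 in auto)
  then obtain u \<delta> where \<delta>: "1 \<le> \<delta>" "\<delta> \<le> (int N * W) ^ (2 * N)"
    and u: "\<And>v. v \<in> U \<Longrightarrow> \<bar>u v\<bar> \<le> (int N * W) ^ (2 * N) \<and> real_of_int (u v) = real_of_int \<delta> * x v"
    by blast
  define u' where "u' = (\<lambda>v. if v \<in> U then u v else 0)"
  have u': "real_of_int (u' v) = real_of_int \<delta> * x v" if "v \<in> V" for v
    using u[of v] that by (auto simp: u'_def U_def supp_def)
  have b0: "(0 :: int) \<le> (int N * W) ^ (2 * N)" using \<delta> by linarith
  have nn: "0 \<le> u' v" if "v \<in> V" for v
  proof -
    have "0 \<le> real_of_int (u' v)" using u'[OF that] \<delta>(1) x0[OF that] by simp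
    then show ?thesis by simp
  qed
  have le: "u' v \<le> (int N * W) ^ (2 * N)" for v using u[of v] b0 by (auto simp: u'_def)
  have eq: "(\<Sum>v\<in>V. M e v * u' v) = \<delta> * s e" if e: "e \<in> E" for e
  proof -
    have "real_of_int (\<Sum>v\<in>V. M e v * u' v) = (\<Sum>v\<in>V. real_of_int (M e v) * (real_of_int \<delta> * x v))"
      by (simp add: u')
    also have "\<dots> = real_of_int \<delta> * (\<Sum>v\<in>V. real_of_int (M e v) * x v)"
      by (simp add: sum_distrib_left algebra_simps)
    also have "\<dots> = real_of_int (\<delta> * s e)" using xs[OF e] by simp
    finally show ?thesis by (simp only: of_int_eq_iff)
  qed
  have "(\<Sum>v\<in>V. q v * real_of_int (u' v)) = real_of_int \<delta> * (\<Sum>v\<in>V. q v * x v)"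
    by (simp add: u' sum_distrib_left algebra_simps)
  also have "\<dots> \<le> real_of_int \<delta> * (\<Sum>v\<in>V. q v * z v)"
    using xq \<delta>(1) by (intro mult_left_mono) auto
  finally show ?thesis using \<delta> nn le eq by blast
qed

text \<open>Free variables are split into differences of nonnegative ones and every row gets a
  slack, which accounts for \<open>2 * card V + card E\<close>. With zero cost, the zero vector is a
  dual solution. The slack of a row in \<open>Q\<close> has coefficient 0, so the row remains an
  equation.\<close>

lemma small_solution:
  fixes M :: "'e \<Rightarrow> 'v \<Rightarrow> int" and x :: "'v \<Rightarrow> real"
  assumes fin: "finite E" "finite V"
    and W: "\<And>e v. e \<in> E \<Longrightarrow> v \<in> V \<Longrightarrow> \<bar>M e v\<bar> \<le> W" "\<And>e. e \<in> E \<Longrightarrow> \<bar>s e\<bar> \<le> W"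
    and N: "2 * card V + card E \<le> N" and W1: "1 \<le> W"
    and le: "\<And>e. e \<in> E \<Longrightarrow> (\<Sum>v\<in>V. real_of_int (M e v) * x v) \<le> real_of_int (s e)"
    and eq: "\<And>e. e \<in> E \<Longrightarrow> e \<in> Q \<Longrightarrow> (\<Sum>v\<in>V. real_of_int (M e v) * x v) = real_of_int (s e)"
  shows "\<exists>u \<delta>. 1 \<le> \<delta> \<and> \<delta> \<le> (int N * W) ^ (2 * N) \<and> (\<forall>v\<in>V. \<bar>u v\<bar> \<le> (int N * W) ^ (2 * N)) \<and>
    (\<forall>e\<in>E. (\<Sum>v\<in>V. M e v * u v) \<le> \<delta> * s e) \<and>
    (\<forall>e\<in>E \<inter> Q. (\<Sum>v\<in>V. M e v * u v) = \<delta> * s e)"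
proof -
  define V' :: "(('v + 'v) + 'e) set" where "V' = ((V <+> V) <+> E)"
  define M' :: "'e \<Rightarrow> ('v + 'v) + 'e \<Rightarrow> int" where "M' = (\<lambda>e v. case v of
     Inl (Inl v) \<Rightarrow> M e v | Inl (Inr v) \<Rightarrow> - M e v | Inr e' \<Rightarrow> if e' = e \<and> e \<notin> Q then 1 else 0)"
  define z :: "('v + 'v) + 'e \<Rightarrow> real" where "z = (\<lambda>v. case v of
     Inl (Inl v) \<Rightarrow> max (x v) 0 | Inl (Inr v) \<Rightarrow> max (- x v) 0 |
     Inr e \<Rightarrow> real_of_int (s e) - (\<Sum>v\<in>V. real_of_int (M e v) * x v))"
  have sumV': "(\<Sum>v\<in>V'. f v) = (\<Sum>v\<in>V. f (Inl (Inl v))) + (\<Sum>v\<in>V. f (Inl (Inr v))) + (\<Sum>e\<in>E. f (Inr e))"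
    for f :: "_ \<Rightarrow> 'z :: comm_monoid_add"
    unfolding V'_def using fin by (simp add: sum.Plus)
  have slack: "(\<Sum>e'\<in>E. (if e' = e \<and> e \<notin> Q then 1 else 0) * f e') = (if e \<in> Q then 0 else f e)"
    if "e \<in> E" for e and f :: "'e \<Rightarrow> 'z :: comm_ring_1"
    using that fin by (cases "e \<in> Q") (simp_all add: if_distrib[of "\<lambda>x. x * _"] cong: if_cong)
  have pm: "max t 0 - max (- t) 0 = t" for t :: real by auto
  have "\<exists>u \<delta>. 1 \<le> \<delta> \<and> \<delta> \<le> (int N * W) ^ (2 * N) \<and>
    (\<forall>v\<in>V'. 0 \<le> u v \<and> u v \<le> (int N * W) ^ (2 * N)) \<and>
    (\<forall>e\<in>E. (\<Sum>v\<in>V'. M' e v * u v) = \<delta> * s e) \<and>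
    (\<Sum>v\<in>V'. 0 * real_of_int (u v)) \<le> real_of_int \<delta> * (\<Sum>v\<in>V'. 0 * z v)"
  proof (rule basic_solution[where y = "\<lambda>_. 0"])
    show "finite V'" using fin by (simp add: V'_def)
    show "card V' \<le> N" using fin N by (simp add: V'_def card_Plus)
    show "card E \<le> N" using N by simp
    show "\<bar>M' e v\<bar> \<le> W" if "e \<in> E" "v \<in> V'" for e v
      using that W W1 by (auto simp: V'_def M'_def)
    show "0 \<le> z v" if "v \<in> V'" for v using that le by (auto simp: V'_def z_def)
    show "(\<Sum>v\<in>V'. real_of_int (M' e v) * z v) = real_of_int (s e)" if e: "e \<in> E" for e
    proof -
      have "(\<Sum>v\<in>V'. real_of_int (M' e v) * z v) =
        (\<Sum>v\<in>V. real_of_int (M e v) * (max (x v) 0 - max (- x v) 0)) +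
        (\<Sum>e'\<in>E. (if e' = e \<and> e \<notin> Q then 1 else 0) * z (Inr e'))"
        unfolding sumV' M'_def by (simp add: z_def right_diff_distrib sum_subtractf sum_negf if_distrib cong: if_cong)
      also have "\<dots> = real_of_int (s e)"
        using eq[OF e] by (simp only: pm slack[OF e]) (simp add: z_def)
      finally show ?thesis .
    qed
  qed (use fin W W1 in auto)
  then obtain u \<delta> where \<delta>: "1 \<le> \<delta>" "\<delta> \<le> (int N * W) ^ (2 * N)"
    and u: "\<And>v. v \<in> V' \<Longrightarrow> 0 \<le> u v \<and> u v \<le> (int N * W) ^ (2 * N)"
    and eq': "\<And>e. e \<in> E \<Longrightarrow> (\<Sum>v\<in>V'. M' e v * u v) = \<delta> * s e" by blast
  define w where "w = (\<lambda>v. u (Inl (Inl v)) - u (Inl (Inr v)))"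
  have w: "(\<Sum>v\<in>V. M e v * w v) + (if e \<in> Q then 0 else u (Inr e)) = \<delta> * s e" if "e \<in> E" for e
    unfolding eq'[OF that, symmetric] sumV' slack[OF that, of "\<lambda>e. u (Inr e)", symmetric]
    by (simp add: M'_def w_def right_diff_distrib sum_subtractf sum_negf)
  have "\<bar>w v\<bar> \<le> (int N * W) ^ (2 * N)" if "v \<in> V" for v
    using u[of "Inl (Inl v)"] u[of "Inl (Inr v)"] that by (auto simp: V'_def w_def Plus_def)
  moreover have "(\<Sum>v\<in>V. M e v * w v) \<le> \<delta> * s e" if "e \<in> E" for e
    using w[OF that] u[of "Inr e"] that by (auto simp: V'_def Plus_def split: if_splits)
  moreover have "(\<Sum>v\<in>V. M e v * w v) = \<delta> * s e" if "e \<in> E \<inter> Q" for e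
    using w[of e] that by auto
  ultimately show ?thesis using \<delta> by blast
qed

text \<open>Farkas' lemma, with the rows of \<open>J\<close> taken in both directions, gives real
  multipliers. They solve a system whose matrix is built from \<open>a\<close> and whose right-hand
  side is \<open>s\<close>; here \<open>h\<close> is the cost and the feasible point
  \<open>y0\<close> a dual solution. Hence a basic solution keeps the cost inequality, and its size
  does not depend on \<open>h\<close>.\<close>

lemma small_multipliers:
  fixes a :: "'r \<Rightarrow> nat \<Rightarrow> int" and h :: "'r \<Rightarrow> real"
  assumes fin: "finite R" and J: "J \<subseteq> R"
    and W: "\<And>r j. r \<in> R \<Longrightarrow> j < n \<Longrightarrow> \<bar>a r j\<bar> \<le> W" "\<And>j. j < n \<Longrightarrow> \<bar>s j\<bar> \<le> W"
    and N: "2 * card R \<le> N" "n \<le> N" and W1: "1 \<le> W"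
    and feas: "\<And>r. r \<in> R \<Longrightarrow> (\<Sum>j<n. real_of_int (a r j) * y0 j) \<le> h r"
      "\<And>r. r \<in> J \<Longrightarrow> (\<Sum>j<n. real_of_int (a r j) * y0 j) = h r"
    and valid: "\<And>y. (\<And>r. r \<in> R \<Longrightarrow> (\<Sum>j<n. real_of_int (a r j) * y j) \<le> h r) \<Longrightarrow>
      (\<And>r. r \<in> J \<Longrightarrow> (\<Sum>j<n. real_of_int (a r j) * y j) = h r) \<Longrightarrow>
      (\<Sum>j<n. real_of_int (s j) * y j) \<le> t"
  shows "\<exists>\<mu> \<delta>. 1 \<le> \<delta> \<and> \<delta> \<le> (int N * W) ^ (2 * N) \<and> (\<forall>r\<in>R. \<bar>\<mu> r\<bar> \<le> (int N * W) ^ (2 * N)) \<and>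
    (\<forall>r\<in>R - J. 0 \<le> \<mu> r) \<and> (\<forall>j<n. (\<Sum>r\<in>R. \<mu> r * a r j) = \<delta> * s j) \<and>
    (\<Sum>r\<in>R. real_of_int (\<mu> r) * h r) \<le> real_of_int \<delta> * t"
proof -
  have finJ: "finite J" using fin J finite_subset by blast
  define R' where "R' = R <+> J"
  define a' where "a' = case_sum a (\<lambda>r j. - a r j)"
  define h' where "h' = case_sum h (\<lambda>r. - h r)"
  have sumR': "(\<Sum>i\<in>R'. f i) = (\<Sum>r\<in>R. f (Inl r)) + (\<Sum>r\<in>J. f (Inr r))"
    for f :: "_ \<Rightarrow> 'z :: comm_monoid_add"
    unfolding R'_def using fin finJ by (simp add: sum.Plus)
  have "\<exists>\<mu>. (\<forall>i. 0 \<le> \<mu> i) \<and> (\<forall>j<n. (\<Sum>i\<in>R'. \<mu> i * real_of_int (a' i j)) = real_of_int (s j)) \<and>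
      (\<Sum>i\<in>R'. \<mu> i * h' i) \<le> t"
  proof (rule farkas[where a = "\<lambda>i j. real_of_int (a' i j)" and ?y0.0 = y0])
    show "finite R'" using fin finJ by (simp add: R'_def)
    show "(\<Sum>j<n. real_of_int (a' i j) * y0 j) \<le> h' i" if "i \<in> R'" for i
      using that feas by (auto simp: R'_def a'_def h'_def sum_negf)
    show "(\<Sum>j<n. real_of_int (s j) * y j) \<le> t"
      if y: "\<And>i. i \<in> R' \<Longrightarrow> (\<Sum>j<n. real_of_int (a' i j) * y j) \<le> h' i" for y
    proof (rule valid)
      show le: "(\<Sum>j<n. real_of_int (a r j) * y j) \<le> h r" if "r \<in> R" for r
        using y[of "Inl r"] that by (auto simp: R'_def a'_def h'_def)
      show "(\<Sum>j<n. real_of_int (a r j) * y j) = h r" if "r \<in> J" for r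
        using y[of "Inr r"] le[of r] that J by (force simp: R'_def a'_def h'_def sum_negf)
    qed
  qed
  then obtain \<mu> where \<mu>: "\<And>i. 0 \<le> \<mu> i" "\<And>j. j < n \<Longrightarrow> (\<Sum>i\<in>R'. \<mu> i * real_of_int (a' i j)) = real_of_int (s j)"
    "(\<Sum>i\<in>R'. \<mu> i * h' i) \<le> t" by blast
  have "\<exists>u \<delta>. 1 \<le> \<delta> \<and> \<delta> \<le> (int N * W) ^ (2 * N) \<and>
    (\<forall>i\<in>R'. 0 \<le> u i \<and> u i \<le> (int N * W) ^ (2 * N)) \<and>
    (\<forall>j\<in>{..<n}. (\<Sum>i\<in>R'. a' i j * u i) = \<delta> * s j) \<and>
    (\<Sum>i\<in>R'. h' i * real_of_int (u i)) \<le> real_of_int \<delta> * (\<Sum>i\<in>R'. h' i * \<mu> i)"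
  proof (rule basic_solution[where y = y0])
    show "finite R'" using fin finJ by (simp add: R'_def)
    have "card J \<le> card R" using fin J by (rule card_mono)
    then show "card R' \<le> N" using N fin finJ by (simp add: R'_def card_Plus)
    show "\<bar>a' i j\<bar> \<le> W" if "j \<in> {..<n}" "i \<in> R'" for i j
      using that W J by (auto simp: R'_def a'_def)
    show "(\<Sum>i\<in>R'. real_of_int (a' i j) * \<mu> i) = real_of_int (s j)" if "j \<in> {..<n}" for j
      using \<mu>(2)[of j] that by (simp add: mult.commute)
    show "(\<Sum>j<n. real_of_int (a' i j) * y0 j) \<le> h' i" if "i \<in> R'" for i
      using that feas by (auto simp: R'_def a'_def h'_def sum_negf)
  qed (use N W W1 \<mu> in auto)
  then obtain u \<delta> where \<delta>: "1 \<le> \<delta>" "\<delta> \<le> (int N * W) ^ (2 * N)"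
    and u: "\<And>i. i \<in> R' \<Longrightarrow> 0 \<le> u i \<and> u i \<le> (int N * W) ^ (2 * N)"
    and eq: "\<And>j. j < n \<Longrightarrow> (\<Sum>i\<in>R'. a' i j * u i) = \<delta> * s j"
    and cost: "(\<Sum>i\<in>R'. h' i * real_of_int (u i)) \<le> real_of_int \<delta> * (\<Sum>i\<in>R'. h' i * \<mu> i)"
    by blast
  \<comment> \<open>Recombining the two directions of a row of \<open>J\<close> gives a multiplier
    of either sign; outside \<open>J\<close> it stays nonnegative.\<close>
  define m where "m = (\<lambda>r. u (Inl r) - (if r \<in> J then u (Inr r) else 0))"
  have summ: "(\<Sum>r\<in>R. f r * of_int (m r)) = (\<Sum>r\<in>R. f r * of_int (u (Inl r))) - (\<Sum>r\<in>J. f r * of_int (u (Inr r)))"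
    for f :: "_ \<Rightarrow> 'z :: comm_ring_1"
  proof -
    have "(\<Sum>r\<in>R. f r * of_int (m r)) =
        (\<Sum>r\<in>R. f r * of_int (u (Inl r))) - (\<Sum>r\<in>R. if r \<in> J then f r * of_int (u (Inr r)) else 0)"
      unfolding sum_subtractf[symmetric] by (rule sum.cong) (auto simp: m_def right_diff_distrib)
    also have "(\<Sum>r\<in>R. if r \<in> J then f r * of_int (u (Inr r)) else 0) = (\<Sum>r\<in>J. f r * of_int (u (Inr r)))"
      using fin J by (simp add: sum.inter_restrict[symmetric] Int_absorb1)
    finally show ?thesis .
  qed
  have "(\<Sum>r\<in>R. m r * a r j) = \<delta> * s j" if "j < n" for j
    using eq[OF that] summ[of "\<lambda>r. a r j"] unfolding sumR' by (simp add: a'_def mult.commute sum_negf)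
  moreover have "(\<Sum>r\<in>R. real_of_int (m r) * h r) \<le> real_of_int \<delta> * t"
  proof -
    have "(\<Sum>r\<in>R. real_of_int (m r) * h r) = (\<Sum>i\<in>R'. h' i * real_of_int (u i))"
      using summ[of h] unfolding sumR' by (simp add: h'_def mult.commute sum_negf)
    also have "\<dots> \<le> real_of_int \<delta> * (\<Sum>i\<in>R'. \<mu> i * h' i)" using cost by (simp add: mult.commute)
    also have "\<dots> \<le> real_of_int \<delta> * t" using \<mu>(3) \<delta>(1) by (intro mult_left_mono) auto
    finally show ?thesis .
  qed
  moreover have "\<forall>r\<in>R. \<bar>m r\<bar> \<le> (int N * W) ^ (2 * N)"
  proof
    fix r assume "r \<in> R"
    then show "\<bar>m r\<bar> \<le> (int N * W) ^ (2 * N)"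
      using u[of "Inl r"] u[of "Inr r"] by (auto simp: m_def R'_def Plus_def)
  qed
  moreover have "\<forall>r\<in>R - J. 0 \<le> m r" using u by (auto simp: m_def R'_def Plus_def)
  ultimately show ?thesis using \<delta> by blast
qed

text \<open>Since \<open>q\<close> homogenizes the system, requiring \<open>\<lambda> \<ge> 1\<close> on \<open>J\<close> loses nothing and
  keeps the support of the multipliers.\<close>

datatype 'r lpvar = VX nat | VY nat | VQ | VL 'r
datatype ('g, 'r) lprow = Side 'g | Primal 'r | Dual nat | Scale | Supp 'r

text \<open>The side constraints \<open>G\<close> carry what differs between the two scenarios.
  Complementary slackness needs no quadratic equation here: the rows of \<open>J\<close> are tight,
  and only they have multipliers.\<close>

lemma small_primal_dual:
  fixes a B :: "'r \<Rightarrow> nat \<Rightarrow> int" and e e' :: "'g \<Rightarrow> nat \<Rightarrow> int" and lam :: "'r \<Rightarrow> real"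
  assumes fin: "finite R" "finite G" and J: "J \<subseteq> R"
    and W: "\<And>r j. r \<in> R \<Longrightarrow> j < n \<Longrightarrow> \<bar>a r j\<bar> \<le> W" "\<And>r l. r \<in> R \<Longrightarrow> l < k \<Longrightarrow> \<bar>B r l\<bar> \<le> W"
      "\<And>r. r \<in> R \<Longrightarrow> \<bar>b r\<bar> \<le> W" "\<And>j l. j < n \<Longrightarrow> l < k \<Longrightarrow> \<bar>C j l\<bar> \<le> W" "\<And>j. j < n \<Longrightarrow> \<bar>c j\<bar> \<le> W"
      "\<And>g l. g \<in> G \<Longrightarrow> l < k \<Longrightarrow> \<bar>e g l\<bar> \<le> W" "\<And>g j. g \<in> G \<Longrightarrow> j < n \<Longrightarrow> \<bar>e' g j\<bar> \<le> W"
      "\<And>g. g \<in> G \<Longrightarrow> \<bar>e0 g\<bar> \<le> W"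
    and W1: "1 \<le> W" and N: "2 * k + 3 * n + 4 * card R + card G + 3 \<le> N"
    and side: "\<And>g. g \<in> G \<Longrightarrow> (\<Sum>l<k. real_of_int (e g l) * x l) + (\<Sum>j<n. real_of_int (e' g j) * y j)
      + real_of_int (e0 g) \<le> 0"
    and feas: "\<And>r. r \<in> R \<Longrightarrow>
      (\<Sum>j<n. real_of_int (a r j) * y j) \<le> (\<Sum>l<k. real_of_int (B r l) * x l) + real_of_int (b r)"
    and tight: "\<And>r. r \<in> J \<Longrightarrow>
      (\<Sum>j<n. real_of_int (a r j) * y j) = (\<Sum>l<k. real_of_int (B r l) * x l) + real_of_int (b r)"
    and dual: "\<And>j. j < n \<Longrightarrow> (\<Sum>r\<in>J. real_of_int (a r j) * lam r)
      + (\<Sum>l<k. real_of_int (C j l) * x l) + real_of_int (c j) = 0"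
    and pos: "\<And>r. r \<in> J \<Longrightarrow> 0 < lam r"
  shows "\<exists>q \<xi> \<eta> p. 1 \<le> q \<and> q \<le> (int N * W) ^ (2 * N) \<and>
    (\<forall>l<k. \<bar>\<xi> l\<bar> \<le> (int N * W) ^ (2 * N)) \<and> (\<forall>j<n. \<bar>\<eta> j\<bar> \<le> (int N * W) ^ (2 * N)) \<and>
    (\<forall>r\<in>J. 1 \<le> p r \<and> p r \<le> (int N * W) ^ (2 * N)) \<and>
    (\<forall>g\<in>G. (\<Sum>l<k. e g l * \<xi> l) + (\<Sum>j<n. e' g j * \<eta> j) + e0 g * q \<le> 0) \<and>
    (\<forall>r\<in>R. (\<Sum>j<n. a r j * \<eta> j) \<le> (\<Sum>l<k. B r l * \<xi> l) + b r * q) \<and>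
    (\<forall>r\<in>J. (\<Sum>j<n. a r j * \<eta> j) = (\<Sum>l<k. B r l * \<xi> l) + b r * q) \<and>
    (\<forall>j<n. (\<Sum>r\<in>J. a r j * p r) + (\<Sum>l<k. C j l * \<xi> l) + c j * q = 0)"
proof -
  have finJ: "finite J" using fin J finite_subset by blast
  define V where "V = VX ` {..<k} \<union> (VY ` {..<n} \<union> ({VQ} \<union> VL ` J))"
  define E :: "('g, 'r) lprow set" where
    "E = Side ` G \<union> (Primal ` R \<union> (Dual ` {..<n} \<union> ({Scale} \<union> Supp ` J)))"
  define M :: "('g, 'r) lprow \<Rightarrow> 'r lpvar \<Rightarrow> int" where "M = (\<lambda>i v. case i of
      Side g \<Rightarrow> (case v of VX l \<Rightarrow> e g l | VY j \<Rightarrow> e' g j | VQ \<Rightarrow> e0 g | VL r \<Rightarrow> 0)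
    | Primal r \<Rightarrow> (case v of VX l \<Rightarrow> - B r l | VY j \<Rightarrow> a r j | VQ \<Rightarrow> - b r | VL r \<Rightarrow> 0)
    | Dual j \<Rightarrow> (case v of VX l \<Rightarrow> C j l | VY j \<Rightarrow> 0 | VQ \<Rightarrow> c j | VL r \<Rightarrow> a r j)
    | Scale \<Rightarrow> (case v of VQ \<Rightarrow> -1 | _ \<Rightarrow> 0)
    | Supp r \<Rightarrow> (case v of VL r' \<Rightarrow> if r' = r then -1 else 0 | _ \<Rightarrow> 0))"
  define s :: "('g, 'r) lprow \<Rightarrow> int" where "s = (\<lambda>i. case i of Scale \<Rightarrow> -1 | Supp r \<Rightarrow> -1 | _ \<Rightarrow> 0)"
  define T :: "('g, 'r) lprow set" where "T = Primal ` J \<union> range Dual"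
  have finE: "finite E" and finV: "finite V" using fin finJ by (auto simp: E_def V_def)
  have sumV: "(\<Sum>v\<in>V. f v) = (\<Sum>l<k. f (VX l)) + ((\<Sum>j<n. f (VY j)) + (f VQ + (\<Sum>r\<in>J. f (VL r))))"
    for f :: "_ \<Rightarrow> 'z :: comm_monoid_add"
  proof -
    have inj: "inj_on VX A" "inj_on VY A" "inj_on VL A'" for A and A' :: "'r set" by (auto simp: inj_on_def)
    show ?thesis unfolding V_def using finJ
      by (subst sum.union_disjoint sum.insert; auto simp: sum.reindex inj ac_simps)+
  qed
  have delta: "(\<Sum>r'\<in>J. (if r' = r then -1 else 0) * f r') = - f r" if "r \<in> J" for r and f :: "'r \<Rightarrow> 'z :: comm_ring_1"
    using that finJ by (simp add: if_distrib[of "\<lambda>x. x * _"] cong: if_cong)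
  have cardV: "card V \<le> k + n + 1 + card R"
  proof -
    have "card V \<le> card (VX ` {..<k} :: 'r lpvar set) + (card (VY ` {..<n} :: 'r lpvar set) + (card {VQ :: 'r lpvar} + card (VL ` J)))"
      unfolding V_def by (intro order.trans[OF card_Un_le] add_left_mono order.refl)
    also have "\<dots> \<le> k + (n + (1 + card J))"
      using card_image_le[of "{..<k}" "VX :: _ \<Rightarrow> 'r lpvar"] card_image_le[of "{..<n}" "VY :: _ \<Rightarrow> 'r lpvar"]
        card_image_le[OF finJ, of VL] by simp
    finally show ?thesis using card_mono[OF fin(1) J] by linarith
  qed
  have cardE: "card E \<le> card G + 2 * card R + n + 1"
  proof -
    have "card E \<le> card (Side ` G :: ('g, 'r) lprow set) + (card (Primal ` R :: ('g, 'r) lprow set) +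
      (card (Dual ` {..<n} :: ('g, 'r) lprow set) + (card {Scale :: ('g, 'r) lprow} + card (Supp ` J :: ('g, 'r) lprow set))))"
      unfolding E_def by (intro order.trans[OF card_Un_le] add_left_mono order.refl)
    also have "\<dots> \<le> card G + (card R + (n + (1 + card J)))"
      using card_image_le[OF fin(2), of "Side :: _ \<Rightarrow> ('g, 'r) lprow"] card_image_le[OF fin(1), of "Primal :: _ \<Rightarrow> ('g, 'r) lprow"]
        card_image_le[of "{..<n}" "Dual :: _ \<Rightarrow> ('g, 'r) lprow"] card_image_le[OF finJ, of "Supp :: _ \<Rightarrow> ('g, 'r) lprow"] by simp
    finally show ?thesis using card_mono[OF fin(1) J] by linarith
  qed
  \<comment> \<open>Scaling the whole solution by \<open>\<tau>\<close> makes every multiplier in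
    \<open>J\<close> at least 1; the leading 1 ensures the same for the homogenizing
    variable.\<close>
  define \<tau> where "\<tau> = 1 + (\<Sum>r\<in>J. 1 / lam r)"
  have \<tau>1: "\<tau> \<ge> 1" unfolding \<tau>_def using pos by (simp add: sum_nonneg less_imp_le)
  have \<tau>lam: "1 \<le> \<tau> * lam r" if "r \<in> J" for r
  proof -
    have "1 / lam r \<le> (\<Sum>r\<in>J. 1 / lam r)" using finJ that pos by (intro member_le_sum) (auto simp: less_imp_le)
    then have "1 / lam r \<le> \<tau>" by (simp add: \<tau>_def)
    then show ?thesis using pos[OF that] by (simp add: field_simps)
  qed
  define z where "z = (\<lambda>v. \<tau> * (case v of VX l \<Rightarrow> x l | VY j \<Rightarrow> y j | VQ \<Rightarrow> 1 | VL r \<Rightarrow> lam r))"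
  have scaled: "(\<Sum>v\<in>V. f v * z v) = \<tau> * (\<Sum>v\<in>V. f v * (case v of VX l \<Rightarrow> x l | VY j \<Rightarrow> y j | VQ \<Rightarrow> 1 | VL r \<Rightarrow> lam r))" for f
    by (simp add: z_def sum_distrib_left mult_ac)
  have "\<exists>u \<delta>. 1 \<le> \<delta> \<and> \<delta> \<le> (int N * W) ^ (2 * N) \<and> (\<forall>v\<in>V. \<bar>u v\<bar> \<le> (int N * W) ^ (2 * N)) \<and>
    (\<forall>i\<in>E. (\<Sum>v\<in>V. M i v * u v) \<le> \<delta> * s i) \<and>
    (\<forall>i\<in>E \<inter> T. (\<Sum>v\<in>V. M i v * u v) = \<delta> * s i)"
  proof (rule small_solution[where x = z])
    show "2 * card V + card E \<le> N" using cardV cardE N by linarith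
    show "\<bar>M i v\<bar> \<le> W" if "i \<in> E" "v \<in> V" for i v
      using that W W1 J by (auto simp: E_def V_def M_def)
    show "\<bar>s i\<bar> \<le> W" if "i \<in> E" for i using W1 by (auto simp: s_def split: lprow.splits)
    show eq: "(\<Sum>v\<in>V. real_of_int (M i v) * z v) = real_of_int (s i)" if "i \<in> E" "i \<in> T" for i
    proof -
      consider (1) r where "r \<in> J" "i = Primal r" | (2) j where "j < n" "i = Dual j"
        using \<open>i \<in> E\<close> \<open>i \<in> T\<close> by (auto simp: E_def T_def)
      then show ?thesis
      proof cases
        case 1
        then show ?thesis unfolding scaled sumV using tight[of r] by (simp add: M_def s_def sum_negf)
      next
        case 2
        then show ?thesis unfolding scaled sumV using dual[of j] by (simp add: M_def s_def ac_simps)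
      qed
    qed
    show "(\<Sum>v\<in>V. real_of_int (M i v) * z v) \<le> real_of_int (s i)" if i: "i \<in> E" for i
    proof -
      consider (1) g where "g \<in> G" "i = Side g" | (2) r where "r \<in> R" "i = Primal r" | (3) "i \<in> T"
        | (4) "i = Scale" | (5) r where "r \<in> J" "i = Supp r"
        using i by (auto simp: E_def T_def)
      then show ?thesis
      proof cases
        case 1
        then show ?thesis unfolding scaled sumV using side[of g] \<tau>1
          by (auto simp: M_def s_def mult_le_0_iff)
      next
        case 2
        then show ?thesis unfolding scaled sumV using feas[of r] \<tau>1
          by (auto simp: M_def s_def sum_negf mult_le_0_iff)
      next
        case 3
        then show ?thesis using eq[OF i] by simp
      next
        case 4
        then show ?thesis unfolding scaled sumV using \<tau>1 by (simp add: M_def s_def)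
      next
        case 5
        then show ?thesis unfolding scaled sumV using \<tau>lam[of r] delta[of r lam]
          by (simp add: M_def s_def if_distrib[of real_of_int] cong: if_cong)
      qed
    qed
  qed (use finE finV W1 in auto)
  then obtain u \<delta> where \<delta>: "1 \<le> \<delta>" "\<delta> \<le> (int N * W) ^ (2 * N)"
    and u: "\<And>v. v \<in> V \<Longrightarrow> \<bar>u v\<bar> \<le> (int N * W) ^ (2 * N)"
    and le: "\<And>i. i \<in> E \<Longrightarrow> (\<Sum>v\<in>V. M i v * u v) \<le> \<delta> * s i"
    and eq: "\<And>i. i \<in> E \<inter> T \<Longrightarrow> (\<Sum>v\<in>V. M i v * u v) = \<delta> * s i" by blast
  \<comment> \<open>Apart from \<open>Scale\<close> and \<open>Supp\<close>, all right-hand sides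
    are 0, so the numerators \<open>u\<close> satisfy those rows as they stand and
    \<open>u VQ\<close> becomes the common denominator. \<open>Scale\<close> and \<open>Supp\<close>
    turn into lower bounds by \<open>\<delta>\<close>, which is at least 1.\<close>
  have q: "1 \<le> u VQ" using le[of Scale] \<delta>(1) unfolding sumV by (auto simp: E_def M_def s_def)
  have ulam: "1 \<le> u (VL r)" if "r \<in> J" for r
    using le[of "Supp r"] \<delta>(1) that delta[OF that, of "\<lambda>r. u (VL r)"] unfolding sumV
    by (auto simp: E_def M_def s_def)
  show ?thesis
  proof (rule exI[of _ "u VQ"], rule exI[of _ "\<lambda>l. u (VX l)"], rule exI[of _ "\<lambda>j. u (VY j)"],
      rule exI[of _ "\<lambda>r. u (VL r)"], intro conjI allI impI ballI)
    show "1 \<le> u VQ" by (rule q)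
    show "u VQ \<le> (int N * W) ^ (2 * N)" using u[of VQ] by (auto simp: V_def)
    show "\<bar>u (VX l)\<bar> \<le> (int N * W) ^ (2 * N)" if "l < k" for l using u[of "VX l"] that by (auto simp: V_def)
    show "\<bar>u (VY j)\<bar> \<le> (int N * W) ^ (2 * N)" if "j < n" for j using u[of "VY j"] that by (auto simp: V_def)
    show "1 \<le> u (VL r)" if "r \<in> J" for r by (rule ulam[OF that])
    show "u (VL r) \<le> (int N * W) ^ (2 * N)" if "r \<in> J" for r using u[of "VL r"] that by (auto simp: V_def)
    show "(\<Sum>l<k. e g l * u (VX l)) + (\<Sum>j<n. e' g j * u (VY j)) + e0 g * u VQ \<le> 0" if "g \<in> G" for g
      using le[of "Side g"] that unfolding sumV by (auto simp: E_def M_def s_def)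
    show "(\<Sum>j<n. a r j * u (VY j)) \<le> (\<Sum>l<k. B r l * u (VX l)) + b r * u VQ" if "r \<in> R" for r
      using le[of "Primal r"] that unfolding sumV by (auto simp: E_def M_def s_def sum_negf)
    show "(\<Sum>j<n. a r j * u (VY j)) = (\<Sum>l<k. B r l * u (VX l)) + b r * u VQ" if "r \<in> J" for r
      using eq[of "Primal r"] that J unfolding sumV by (auto simp: E_def T_def M_def s_def sum_negf)
    show "(\<Sum>r\<in>J. a r j * u (VL r)) + (\<Sum>l<k. C j l * u (VX l)) + c j * u VQ = 0" if "j < n" for j
      using eq[of "Dual j"] that unfolding sumV by (auto simp: E_def T_def M_def s_def)
  qed
qed

section \<open>Integer certificates: soundness by weak duality, completeness by small
  solutions\<close>

section \<open>Certificates for parametric linear programs\<close>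

text \<open>The row set is arbitrary so that both forms of the LP become instances. Integer data
  suffice, because multiplying the input by a positive common denominator changes neither the
  feasible points nor the optimal ones.\<close>

locale param_lp =
  fixes R :: "'r set" and n k g r :: nat
    and a :: "'r \<Rightarrow> nat \<Rightarrow> int" and B :: "'r \<Rightarrow> nat \<Rightarrow> int" and b :: "'r \<Rightarrow> int"
    and C :: "nat \<Rightarrow> nat \<Rightarrow> int" and c :: "nat \<Rightarrow> int"
    and D :: "nat \<Rightarrow> nat \<Rightarrow> int" and d :: "nat \<Rightarrow> int"
    and S :: "nat \<Rightarrow> nat \<Rightarrow> int" and t :: "nat \<Rightarrow> int"
  assumes finR: "finite R"
begin

definition rhs :: "'r \<Rightarrow> (nat \<Rightarrow> real) \<Rightarrow> real" where
  "rhs i x = (\<Sum>l<k. real_of_int (B i l) * x l) + real_of_int (b i)"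

definition obj :: "nat \<Rightarrow> (nat \<Rightarrow> real) \<Rightarrow> real" where
  "obj j x = (\<Sum>l<k. real_of_int (C j l) * x l) + real_of_int (c j)"

definition feas :: "(nat \<Rightarrow> real) \<Rightarrow> (nat \<Rightarrow> real) \<Rightarrow> bool" where
  "feas x y \<longleftrightarrow> (\<forall>i\<in>R. (\<Sum>j<n. real_of_int (a i j) * y j) \<le> rhs i x)"

definition isopt :: "(nat \<Rightarrow> real) \<Rightarrow> (nat \<Rightarrow> real) \<Rightarrow> bool" where
  "isopt x y \<longleftrightarrow> feas x y \<and> (\<forall>y'. feas x y' \<longrightarrow> (\<Sum>j<n. obj j x * y j) \<le> (\<Sum>j<n. obj j x * y' j))"

definition inX :: "(nat \<Rightarrow> real) \<Rightarrow> bool" where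
  "inX x \<longleftrightarrow> (\<forall>i<g. (\<Sum>l<k. real_of_int (D i l) * x l) \<le> real_of_int (d i))"

definition inY :: "(nat \<Rightarrow> real) \<Rightarrow> bool" where
  "inY y \<longleftrightarrow> (\<forall>i<r. (\<Sum>j<n. real_of_int (S i j) * y j) \<le> real_of_int (t i))"

definition irhs :: "'r \<Rightarrow> int \<Rightarrow> (nat \<Rightarrow> int) \<Rightarrow> int" where
  "irhs i q \<xi> = (\<Sum>l<k. B i l * \<xi> l) + b i * q"

definition iobj :: "nat \<Rightarrow> int \<Rightarrow> (nat \<Rightarrow> int) \<Rightarrow> int" where
  "iobj j q \<xi> = (\<Sum>l<k. C j l * \<xi> l) + c j * q"

text \<open>The vectors \<open>\<xi>\<close>, \<open>\<eta>\<close>, \<open>p\<close> are a parameter, a primal and a dual solution,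
  multiplied by the common denominator \<open>q\<close>.\<close>

definition primal_dual :: "int \<Rightarrow> (nat \<Rightarrow> int) \<Rightarrow> (nat \<Rightarrow> int) \<Rightarrow> ('r \<Rightarrow> int) \<Rightarrow> bool" where
  "primal_dual q \<xi> \<eta> p \<longleftrightarrow> 1 \<le> q \<and> (\<forall>i<g. (\<Sum>l<k. D i l * \<xi> l) \<le> d i * q) \<and>
     (\<forall>i\<in>R. (\<Sum>j<n. a i j * \<eta> j) \<le> irhs i q \<xi>) \<and> (\<forall>i\<in>R. 0 \<le> p i) \<and>
     (\<forall>j<n. (\<Sum>i\<in>R. a i j * p i) + iobj j q \<xi> = 0) \<and>
     (\<Sum>i\<in>R. p i * irhs i q \<xi>) + (\<Sum>j<n. iobj j q \<xi> * \<eta> j) = 0"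

definition target_cert :: "int \<Rightarrow> (nat \<Rightarrow> int) \<Rightarrow> bool" where
  "target_cert q \<eta> \<longleftrightarrow> (\<forall>i<r. (\<Sum>j<n. S i j * \<eta> j) \<le> t i * q)"

text \<open>Row \<open>i\<close> of the target is a combination of the constraints with multipliers \<open>\<mu> i\<close> and of
  the optimality constraint with multiplier \<open>K i\<close>, up to the denominator \<open>\<delta>\<close>.\<close>

definition farkas_cert ::
  "int \<Rightarrow> (nat \<Rightarrow> int) \<Rightarrow> (nat \<Rightarrow> int) \<Rightarrow> int \<Rightarrow> (nat \<Rightarrow> 'r \<Rightarrow> int) \<Rightarrow> (nat \<Rightarrow> int) \<Rightarrow> bool" where
  "farkas_cert q \<xi> \<eta> \<delta> \<mu> K \<longleftrightarrow> 1 \<le> \<delta> \<and> (\<forall>i<r. 0 \<le> K i \<and> (\<forall>h\<in>R. 0 \<le> \<mu> i h) \<and>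
     (\<forall>j<n. (\<Sum>h\<in>R. a h j * \<mu> i h) + K i * iobj j q \<xi> = S i j * \<delta>) \<and>
     (\<Sum>h\<in>R. \<mu> i h * irhs h q \<xi>) + K i * (\<Sum>j<n. iobj j q \<xi> * \<eta> j) \<le> t i * (\<delta> * q))"

lemma irhs_eq: "1 \<le> q \<Longrightarrow> real_of_int (irhs i q \<xi>) = real_of_int q * rhs i (\<lambda>l. real_of_int (\<xi> l) / real_of_int q)"
  by (simp add: irhs_def rhs_def distrib_left sum_distrib_left)

lemma iobj_eq: "1 \<le> q \<Longrightarrow> real_of_int (iobj j q \<xi>) = real_of_int q * obj j (\<lambda>l. real_of_int (\<xi> l) / real_of_int q)"
  by (simp add: iobj_def obj_def distrib_left sum_distrib_left)

context
  fixes q :: int and \<xi> \<eta> :: "nat \<Rightarrow> int" and p :: "'r \<Rightarrow> int"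
  assumes pd: "primal_dual q \<xi> \<eta> p"
begin

private definition "x0 = (\<lambda>l. real_of_int (\<xi> l) / real_of_int q)"
private definition "y0 = (\<lambda>j. real_of_int (\<eta> j) / real_of_int q)"

private lemma q1: "1 \<le> q" and qpos: "0 < real_of_int q"
  using pd by (auto simp: primal_dual_def)

private lemma sum_y0: "(\<Sum>j<n. real_of_int (f j) * y0 j) = real_of_int (\<Sum>j<n. f j * \<eta> j) / real_of_int q"
  by (simp add: y0_def sum_divide_distrib)

private lemma iobj_y0: "real_of_int (\<Sum>j<n. iobj j q \<xi> * \<eta> j) = real_of_int q ^ 2 * (\<Sum>j<n. obj j x0 * y0 j)"
  using qpos by (simp add: iobj_eq[OF q1] x0_def[symmetric] y0_def sum_distrib_left power2_eq_square mult_ac)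

private lemma inX_x0: "inX x0"
  unfolding inX_def
proof (intro allI impI)
  fix i assume "i < g"
  then have "(\<Sum>l<k. D i l * \<xi> l) \<le> d i * q" using pd by (simp add: primal_dual_def)
  then have "real_of_int (\<Sum>l<k. D i l * \<xi> l) \<le> real_of_int (d i * q)" by (simp only: of_int_le_iff)
  moreover have "(\<Sum>l<k. real_of_int (D i l) * x0 l) = real_of_int (\<Sum>l<k. D i l * \<xi> l) / real_of_int q"
    by (simp add: x0_def sum_divide_distrib)
  ultimately show "(\<Sum>l<k. real_of_int (D i l) * x0 l) \<le> real_of_int (d i)"
    using qpos by (simp add: divide_le_eq)
qed

text \<open>Weak duality: for feasible \<open>y'\<close>, \<open>q\<close> times the objective value
  is at least \<open>- (\<Sum>i\<in>R. p i * rhs i x0)\<close>. The last equation of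
  \<open>primal_dual\<close> says that \<open>y0\<close> attains this bound.\<close>

private lemma isopt_y0: "isopt x0 y0"
  unfolding isopt_def
proof (intro conjI allI impI)
  show "feas x0 y0" unfolding feas_def
  proof
    fix i assume "i \<in> R"
    then have "(\<Sum>j<n. a i j * \<eta> j) \<le> irhs i q \<xi>" using pd by (simp add: primal_dual_def)
    then have "real_of_int (\<Sum>j<n. a i j * \<eta> j) \<le> real_of_int (irhs i q \<xi>)" by (simp only: of_int_le_iff)
    then show "(\<Sum>j<n. real_of_int (a i j) * y0 j) \<le> rhs i x0"
      unfolding sum_y0 irhs_eq[OF q1] x0_def[symmetric] using qpos by (simp add: divide_le_eq mult.commute)
  qed
  fix y' assume y': "feas x0 y'"
  have dual: "real_of_int (iobj j q \<xi>) = - (\<Sum>i\<in>R. real_of_int (a i j * p i))" if "j < n" for j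
  proof -
    have "iobj j q \<xi> = - (\<Sum>i\<in>R. a i j * p i)" using pd that by (simp add: primal_dual_def algebra_simps eq_neg_iff_add_eq_0)
    then show ?thesis by simp
  qed
  have "real_of_int q * (\<Sum>j<n. obj j x0 * y' j) = (\<Sum>j<n. real_of_int (iobj j q \<xi>) * y' j)"
    by (simp add: iobj_eq[OF q1] x0_def[symmetric] sum_distrib_left mult_ac)
  also have "\<dots> = (\<Sum>j<n. - (\<Sum>i\<in>R. real_of_int (a i j * p i)) * y' j)" using dual by simp
  also have "\<dots> = - (\<Sum>i\<in>R. real_of_int (p i) * (\<Sum>j<n. real_of_int (a i j) * y' j))"
    unfolding sum_distrib_left sum_distrib_right
    by (simp add: sum_negf sum_distrib_left sum_distrib_right, subst sum.swap) (simp add: algebra_simps)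
  also have "\<dots> \<ge> - (\<Sum>i\<in>R. real_of_int (p i) * rhs i x0)"
    using y' pd by (auto simp: feas_def primal_dual_def intro!: sum_mono mult_left_mono)
  finally have 1: "real_of_int q * (\<Sum>j<n. obj j x0 * y' j) \<ge> - (\<Sum>i\<in>R. real_of_int (p i) * rhs i x0)" .
  have "(\<Sum>j<n. iobj j q \<xi> * \<eta> j) = - (\<Sum>i\<in>R. p i * irhs i q \<xi>)"
    using pd by (simp add: primal_dual_def)
  then have "real_of_int q ^ 2 * (\<Sum>j<n. obj j x0 * y0 j) = - real_of_int (\<Sum>i\<in>R. p i * irhs i q \<xi>)"
    using iobj_y0 by simp
  also have "\<dots> = real_of_int q * (- (\<Sum>i\<in>R. real_of_int (p i) * rhs i x0))"
    by (simp add: irhs_eq[OF q1] x0_def[symmetric] sum_distrib_left mult_ac)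
  also have "\<dots> \<le> real_of_int q * (real_of_int q * (\<Sum>j<n. obj j x0 * y' j))"
    using 1 qpos by (intro mult_left_mono) auto
  finally show "(\<Sum>j<n. obj j x0 * y0 j) \<le> (\<Sum>j<n. obj j x0 * y' j)"
    using qpos by (simp add: power2_eq_square mult.assoc)
qed

lemma target_cert_sound:
  assumes "target_cert q \<eta>"
  shows "\<exists>x y. inX x \<and> isopt x y \<and> inY y"
proof -
  have "inY y0" unfolding inY_def
  proof (intro allI impI)
    fix i assume "i < r"
    then have "(\<Sum>j<n. S i j * \<eta> j) \<le> t i * q" using assms by (simp add: target_cert_def)
    then have "real_of_int (\<Sum>j<n. S i j * \<eta> j) \<le> real_of_int (t i * q)" by (simp only: of_int_le_iff)
    then show "(\<Sum>j<n. real_of_int (S i j) * y0 j) \<le> real_of_int (t i)"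
      unfolding sum_y0 using qpos by (simp add: divide_le_eq)
  qed
  then show ?thesis using inX_x0 isopt_y0 by blast
qed

text \<open>All optimal solutions share the value \<open>v\<close> of \<open>y0\<close>. The
  multiplier \<open>K i\<close> is therefore applied to an equation for the objective, and the
  multipliers \<open>\<mu> i\<close> to the feasibility of \<open>y\<close>.\<close>

lemma farkas_cert_sound:
  assumes fc: "farkas_cert q \<xi> \<eta> \<delta> \<mu> K"
  shows "\<exists>x. inX x \<and> (\<exists>y. isopt x y) \<and> (\<forall>y. isopt x y \<longrightarrow> inY y)"
proof -
  have "inY y" if y: "isopt x0 y" for y
    unfolding inY_def
  proof (intro allI impI)
    fix i assume i: "i < r"
    have \<delta>: "0 < real_of_int \<delta>" using fc by (simp add: farkas_cert_def)
    define v where "v = (\<Sum>j<n. obj j x0 * y j)"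
    have v: "v = (\<Sum>j<n. obj j x0 * y0 j)" using y isopt_y0 by (force simp: isopt_def v_def)
    have row: "real_of_int (S i j * \<delta>) = (\<Sum>h\<in>R. real_of_int (a h j * \<mu> i h)) + real_of_int (K i) * (real_of_int q * obj j x0)"
      if "j < n" for j
    proof -
      have "S i j * \<delta> = (\<Sum>h\<in>R. a h j * \<mu> i h) + K i * iobj j q \<xi>" using fc i that by (simp add: farkas_cert_def)
      then show ?thesis by (simp add: iobj_eq[OF q1] x0_def)
    qed
    have "real_of_int \<delta> * (\<Sum>j<n. real_of_int (S i j) * y j) = (\<Sum>j<n. real_of_int (S i j * \<delta>) * y j)"
      by (simp add: sum_distrib_left mult_ac)
    also have "\<dots> = (\<Sum>j<n. ((\<Sum>h\<in>R. real_of_int (a h j * \<mu> i h)) + real_of_int (K i) * (real_of_int q * obj j x0)) * y j)"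
      by (intro sum.cong refl arg_cong2[where f = times] row) simp
    also have "\<dots> = (\<Sum>j<n. (\<Sum>h\<in>R. real_of_int (a h j * \<mu> i h)) * y j) + real_of_int (K i) * real_of_int q * v"
      unfolding distrib_right sum.distrib v_def sum_distrib_left by (simp add: mult_ac)
    also have "(\<Sum>j<n. (\<Sum>h\<in>R. real_of_int (a h j * \<mu> i h)) * y j) = (\<Sum>h\<in>R. real_of_int (\<mu> i h) * (\<Sum>j<n. real_of_int (a h j) * y j))"
      unfolding sum_distrib_left sum_distrib_right by (subst sum.swap) (simp add: algebra_simps)
    also have "\<dots> \<le> (\<Sum>h\<in>R. real_of_int (\<mu> i h) * rhs h x0)"
      using y fc i by (auto simp: isopt_def feas_def farkas_cert_def intro!: sum_mono mult_left_mono)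
    finally have 1: "real_of_int \<delta> * (\<Sum>j<n. real_of_int (S i j) * y j)
      \<le> (\<Sum>h\<in>R. real_of_int (\<mu> i h) * rhs h x0) + real_of_int (K i) * real_of_int q * v" by simp
    have "(\<Sum>h\<in>R. \<mu> i h * irhs h q \<xi>) + K i * (\<Sum>j<n. iobj j q \<xi> * \<eta> j) \<le> t i * (\<delta> * q)"
      using fc i by (simp add: farkas_cert_def)
    then have "real_of_int ((\<Sum>h\<in>R. \<mu> i h * irhs h q \<xi>) + K i * (\<Sum>j<n. iobj j q \<xi> * \<eta> j)) \<le> real_of_int (t i * (\<delta> * q))"
      by (simp only: of_int_le_iff)
    \<comment> \<open>\<open>irhs\<close> carries one factor \<open>q\<close> and the objective
      value of \<open>\<eta>\<close> two; one of them is matched by the factor \<open>q\<close> in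
      \<open>t i * (\<delta> * q)\<close>.\<close>
    moreover have "real_of_int ((\<Sum>h\<in>R. \<mu> i h * irhs h q \<xi>) + K i * (\<Sum>j<n. iobj j q \<xi> * \<eta> j))
      = real_of_int q * ((\<Sum>h\<in>R. real_of_int (\<mu> i h) * rhs h x0) + real_of_int (K i) * real_of_int q * v)"
      unfolding of_int_add of_int_mult iobj_y0 v[symmetric]
      by (simp add: irhs_eq[OF q1] x0_def[symmetric] sum_distrib_left power2_eq_square algebra_simps)
    ultimately have "real_of_int q * ((\<Sum>h\<in>R. real_of_int (\<mu> i h) * rhs h x0) + real_of_int (K i) * real_of_int q * v)
      \<le> real_of_int q * (real_of_int \<delta> * real_of_int (t i))"
      by (simp only: of_int_mult mult_ac)
    then have "real_of_int \<delta> * (\<Sum>j<n. real_of_int (S i j) * y j) \<le> real_of_int \<delta> * real_of_int (t i)"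
      using 1 qpos by (simp only: mult_le_cancel_left_pos)
    then show "(\<Sum>j<n. real_of_int (S i j) * y j) \<le> real_of_int (t i)"
      using \<delta> by simp
  qed
  then show ?thesis using inX_x0 isopt_y0 by blast
qed

end

text \<open>Farkas' lemma is applied to the valid inequality that no feasible point has a smaller
  objective value. The terms of the complementarity sum are nonnegative and add up to at most 0, so
  each of them vanishes.\<close>

lemma strong_duality:
  assumes "isopt x y"
  shows "\<exists>p. (\<forall>i. 0 \<le> p i) \<and> (\<forall>j<n. (\<Sum>i\<in>R. real_of_int (a i j) * p i) + obj j x = 0) \<and>
    (\<forall>i\<in>R. 0 < p i \<longrightarrow> (\<Sum>j<n. real_of_int (a i j) * y j) = rhs i x)"
proof -
  have feas: "(\<Sum>j<n. real_of_int (a i j) * y j) \<le> rhs i x" if "i \<in> R" for i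
    using assms that by (simp add: isopt_def feas_def)
  have "\<exists>p. (\<forall>i. 0 \<le> p i) \<and> (\<forall>j<n. (\<Sum>i\<in>R. p i * real_of_int (a i j)) = - obj j x) \<and>
      (\<Sum>i\<in>R. p i * rhs i x) \<le> - (\<Sum>j<n. obj j x * y j)"
  proof (rule farkas[OF finR])
    show "(\<Sum>j<n. real_of_int (a i j) * y j) \<le> rhs i x" if "i \<in> R" for i by (rule feas[OF that])
    show "(\<Sum>j<n. - obj j x * y' j) \<le> - (\<Sum>j<n. obj j x * y j)"
      if "\<And>i. i \<in> R \<Longrightarrow> (\<Sum>j<n. real_of_int (a i j) * y' j) \<le> rhs i x" for y'
      using assms that by (simp add: isopt_def feas_def sum_negf)
  qed
  then obtain p where p: "\<And>i. 0 \<le> p i" "\<And>j. j < n \<Longrightarrow> (\<Sum>i\<in>R. p i * real_of_int (a i j)) = - obj j x"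
    "(\<Sum>i\<in>R. p i * rhs i x) \<le> - (\<Sum>j<n. obj j x * y j)" by blast
  have "(\<Sum>i\<in>R. p i * (\<Sum>j<n. real_of_int (a i j) * y j)) = (\<Sum>j<n. (\<Sum>i\<in>R. p i * real_of_int (a i j)) * y j)"
    unfolding sum_distrib_left sum_distrib_right by (subst sum.swap) (simp add: mult_ac)
  also have "\<dots> = - (\<Sum>j<n. obj j x * y j)" using p(2) by (simp add: sum_negf)
  finally have "(\<Sum>i\<in>R. p i * (rhs i x - (\<Sum>j<n. real_of_int (a i j) * y j))) \<le> 0"
    using p(3) by (simp add: right_diff_distrib sum_subtractf)
  moreover have nn: "0 \<le> p i * (rhs i x - (\<Sum>j<n. real_of_int (a i j) * y j))" if "i \<in> R" for i
    using p(1) feas[OF that] by simp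
  ultimately have "(\<Sum>i\<in>R. p i * (rhs i x - (\<Sum>j<n. real_of_int (a i j) * y j))) = 0"
    by (intro antisym sum_nonneg)
  then have "\<forall>i\<in>R. p i * (rhs i x - (\<Sum>j<n. real_of_int (a i j) * y j)) = 0"
    using nn finR by (subst (asm) sum_nonneg_eq_0_iff) auto
  then show ?thesis using p by (intro exI[of _ p]) (auto simp: mult.commute)
qed

end

locale bounded_param_lp = param_lp +
  fixes N :: nat and W :: int
  assumes W: "\<And>i j. i \<in> R \<Longrightarrow> j < n \<Longrightarrow> \<bar>a i j\<bar> \<le> W" "\<And>i l. i \<in> R \<Longrightarrow> l < k \<Longrightarrow> \<bar>B i l\<bar> \<le> W"
      "\<And>i. i \<in> R \<Longrightarrow> \<bar>b i\<bar> \<le> W" "\<And>j l. j < n \<Longrightarrow> l < k \<Longrightarrow> \<bar>C j l\<bar> \<le> W" "\<And>j. j < n \<Longrightarrow> \<bar>c j\<bar> \<le> W"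
      "\<And>i l. i < g \<Longrightarrow> l < k \<Longrightarrow> \<bar>D i l\<bar> \<le> W" "\<And>i. i < g \<Longrightarrow> \<bar>d i\<bar> \<le> W"
      "\<And>i j. i < r \<Longrightarrow> j < n \<Longrightarrow> \<bar>S i j\<bar> \<le> W" "\<And>i. i < r \<Longrightarrow> \<bar>t i\<bar> \<le> W"
    and W1: "1 \<le> W" and N: "2 * k + 3 * n + 4 * card R + g + r + 3 \<le> N"
begin

text \<open>\<open>bd1\<close> bounds the multipliers of the target rows and their denominators.
  They enter the coefficients of the second system, which are at most
  \<open>2 * N * W * bd1\<close>, and \<open>bd2\<close> bounds its solution. The product in
  \<open>bd\<close> covers the common denominator of all target rows, the constant \<open>K\<close>,
  and the repaired multipliers, which are sums of two terms.\<close>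

definition "bd1 = (int N * W) ^ (2 * N)"
definition "bd2 = (int N * (2 * int N * W * bd1)) ^ (2 * N)"
definition "bd = 2 * bd1 ^ (N + 1) * bd2"

lemma bd1_ge: "1 \<le> bd1"
  unfolding bd1_def using W1 N mult_mono[of 1 "int N" 1 W] by (intro one_le_power) auto

lemma W2_ge: "1 \<le> 2 * int N * W * bd1" "W \<le> 2 * int N * W * bd1"
proof -
  have "1 \<le> int N" using N by simp
  then have "1 \<le> 2 * int N * bd1" using bd1_ge mult_mono[of 1 "2 * int N" 1 bd1] by simp
  then have "W * 1 \<le> W * (2 * int N * bd1)" using W1 by (intro mult_left_mono) auto
  then show 1: "W \<le> 2 * int N * W * bd1" by (simp add: mult_ac)
  show "1 \<le> 2 * int N * W * bd1" using W1 1 by linarith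
qed

lemma bd2_ge: "1 \<le> bd2"
  unfolding bd2_def using W2_ge N mult_mono[of 1 "int N" 1 "2 * int N * W * bd1"]
  by (intro one_le_power) auto

lemma bd_ge: "bd2 \<le> bd" "bd1 ^ (N + 1) \<le> bd" "bd1 ^ N \<le> bd"
proof -
  have p: "1 \<le> bd1 ^ e" for e using bd1_ge by (rule one_le_power)
  show "bd2 \<le> bd" unfolding bd_def using p[of "N + 1"] bd2_ge mult_mono[of 1 "2 * bd1 ^ (N + 1)" bd2 bd2] by simp
  show 1: "bd1 ^ (N + 1) \<le> bd"
    unfolding bd_def using p[of "N + 1"] bd2_ge mult_mono[of "bd1 ^ (N + 1)" "2 * bd1 ^ (N + 1)" 1 bd2] by simp
  have "bd1 ^ N \<le> bd1 ^ (N + 1)" using bd1_ge by (intro power_increasing) auto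
  then show "bd1 ^ N \<le> bd" using 1 by linarith
qed

text \<open>The parameter set joins the side constraints, and the dual solution is extended by 0
  outside \<open>J\<close>. The coefficient bound is \<open>2 * N * W * bd1\<close> rather than
  \<open>W\<close> because in the pessimistic scenario the side constraints contain sums over the
  multipliers.\<close>

lemma small_primal_dual_support:
  fixes G :: "'g set" and e e' :: "'g \<Rightarrow> nat \<Rightarrow> int" and e0 :: "'g \<Rightarrow> int"
  assumes fin: "finite G" and cG: "card G \<le> r"
    and W': "\<And>h l. h \<in> G \<Longrightarrow> l < k \<Longrightarrow> \<bar>e h l\<bar> \<le> 2 * int N * W * bd1"
      "\<And>h j. h \<in> G \<Longrightarrow> j < n \<Longrightarrow> \<bar>e' h j\<bar> \<le> 2 * int N * W * bd1"
      "\<And>h. h \<in> G \<Longrightarrow> \<bar>e0 h\<bar> \<le> 2 * int N * W * bd1"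
    and X: "inX x" and side: "\<And>h. h \<in> G \<Longrightarrow> (\<Sum>l<k. real_of_int (e h l) * x l) +
      (\<Sum>j<n. real_of_int (e' h j) * y j) + real_of_int (e0 h) \<le> 0"
    and feas: "feas x y" and J: "J = {i \<in> R. 0 < p i}"
    and p: "\<And>i. 0 \<le> p i" "\<And>j. j < n \<Longrightarrow> (\<Sum>i\<in>R. real_of_int (a i j) * p i) + obj j x = 0"
    and tight: "\<And>i. i \<in> J \<Longrightarrow> (\<Sum>j<n. real_of_int (a i j) * y j) = rhs i x"
  shows "\<exists>q \<xi> \<eta> p. primal_dual q \<xi> \<eta> p \<and> (\<forall>i\<in>J. 1 \<le> p i) \<and> q \<le> bd2 \<and> (\<forall>l<k. \<bar>\<xi> l\<bar> \<le> bd2) \<and>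
    (\<forall>j<n. \<bar>\<eta> j\<bar> \<le> bd2) \<and> (\<forall>i\<in>R. p i \<le> bd2) \<and> (\<forall>i\<in>R - J. p i = 0) \<and>
    (\<forall>h\<in>G. (\<Sum>l<k. e h l * \<xi> l) + (\<Sum>j<n. e' h j * \<eta> j) + e0 h * q \<le> 0)"
proof -
  define G' where "G' = {..<g} <+> G"
  define f where "f = case_sum D e"
  define f' where "f' = case_sum (\<lambda>(_ :: nat) _. 0) e'"
  define f0 where "f0 = case_sum (\<lambda>i. - d i) e0"
  note W2 = W2_ge
  have W20: "0 \<le> 2 * int N * W * bd1" using W2_ge(1) by linarith
  have JR: "J \<subseteq> R" by (auto simp: J)
  have sumJ: "(\<Sum>i\<in>J. f i) = (\<Sum>i\<in>R. f i)" if "\<And>i. i \<in> R - J \<Longrightarrow> f i = 0" for f :: "_ \<Rightarrow> 'z :: comm_monoid_add"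
    using that JR finR by (intro sum.mono_neutral_left) auto
  have p0: "p i = 0" if "i \<in> R - J" for i using that p(1)[of i] by (auto simp: J)
  have le: "z \<le> 2 * int N * W * bd1" if "z \<le> W" for z using that W2(2) by linarith
  have "\<exists>q \<xi> \<eta> p. 1 \<le> q \<and> q \<le> bd2 \<and>
    (\<forall>l<k. \<bar>\<xi> l\<bar> \<le> bd2) \<and> (\<forall>j<n. \<bar>\<eta> j\<bar> \<le> bd2) \<and> (\<forall>i\<in>J. 1 \<le> p i \<and> p i \<le> bd2) \<and>
    (\<forall>h\<in>G'. (\<Sum>l<k. f h l * \<xi> l) + (\<Sum>j<n. f' h j * \<eta> j) + f0 h * q \<le> 0) \<and>
    (\<forall>i\<in>R. (\<Sum>j<n. a i j * \<eta> j) \<le> irhs i q \<xi>) \<and>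
    (\<forall>i\<in>J. (\<Sum>j<n. a i j * \<eta> j) = irhs i q \<xi>) \<and>
    (\<forall>j<n. (\<Sum>i\<in>J. a i j * p i) + iobj j q \<xi> = 0)"
    unfolding bd2_def irhs_def iobj_def add.assoc[symmetric]
  proof (rule small_primal_dual[where lam = p and x = x and y = y])
    show "finite G'" using fin by (simp add: G'_def)
    show "2 * k + 3 * n + 4 * card R + card G' + 3 \<le> N"
      using N cG fin by (simp add: G'_def card_Plus)
    show "\<bar>f h l\<bar> \<le> 2 * int N * W * bd1" if "h \<in> G'" "l < k" for h l
      using that W'(1) le W(6) by (auto simp: G'_def f_def)
    show "\<bar>f' h j\<bar> \<le> 2 * int N * W * bd1" if "h \<in> G'" "j < n" for h j
      using that W'(2) W20 by (auto simp: G'_def f'_def)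
    show "\<bar>f0 h\<bar> \<le> 2 * int N * W * bd1" if "h \<in> G'" for h
      using that W'(3) le W(7) by (auto simp: G'_def f0_def)
    show "(\<Sum>l<k. real_of_int (f h l) * x l) + (\<Sum>j<n. real_of_int (f' h j) * y j) + real_of_int (f0 h) \<le> 0"
      if "h \<in> G'" for h
      using that side X by (auto simp: G'_def f_def f'_def f0_def inX_def)
    show "(\<Sum>j<n. real_of_int (a i j) * y j) \<le> (\<Sum>l<k. real_of_int (B i l) * x l) + real_of_int (b i)"
      if "i \<in> R" for i using feas that by (simp add: feas_def rhs_def)
    show "(\<Sum>j<n. real_of_int (a i j) * y j) = (\<Sum>l<k. real_of_int (B i l) * x l) + real_of_int (b i)"
      if "i \<in> J" for i using tight[OF that] by (simp add: rhs_def)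
    show "(\<Sum>i\<in>J. real_of_int (a i j) * p i) + (\<Sum>l<k. real_of_int (C j l) * x l) + real_of_int (c j) = 0"
      if "j < n" for j using p(2)[OF that] p0 by (subst sumJ) (auto simp: obj_def)
  qed (use finR JR in \<open>auto simp: J intro!: le W W2\<close>)
  then obtain q \<xi> \<eta> \<pi> where all: "1 \<le> q \<and> q \<le> bd2 \<and>
    (\<forall>l<k. \<bar>\<xi> l\<bar> \<le> bd2) \<and> (\<forall>j<n. \<bar>\<eta> j\<bar> \<le> bd2) \<and> (\<forall>i\<in>J. 1 \<le> \<pi> i \<and> \<pi> i \<le> bd2) \<and>
    (\<forall>h\<in>G'. (\<Sum>l<k. f h l * \<xi> l) + (\<Sum>j<n. f' h j * \<eta> j) + f0 h * q \<le> 0) \<and>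
    (\<forall>i\<in>R. (\<Sum>j<n. a i j * \<eta> j) \<le> irhs i q \<xi>) \<and>
    (\<forall>i\<in>J. (\<Sum>j<n. a i j * \<eta> j) = irhs i q \<xi>) \<and>
    (\<forall>j<n. (\<Sum>i\<in>J. a i j * \<pi> i) + iobj j q \<xi> = 0)" by (elim exE) (rule that)
  from all have *: "1 \<le> q" "q \<le> bd2" "\<forall>l<k. \<bar>\<xi> l\<bar> \<le> bd2" "\<forall>j<n. \<bar>\<eta> j\<bar> \<le> bd2"
    and \<pi>: "\<And>i. i \<in> J \<Longrightarrow> 1 \<le> \<pi> i \<and> \<pi> i \<le> bd2"
    and G': "\<And>h. h \<in> G' \<Longrightarrow> (\<Sum>l<k. f h l * \<xi> l) + (\<Sum>j<n. f' h j * \<eta> j) + f0 h * q \<le> 0"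
    and R: "\<And>i. i \<in> R \<Longrightarrow> (\<Sum>j<n. a i j * \<eta> j) \<le> irhs i q \<xi>"
    and RJ: "\<And>i. i \<in> J \<Longrightarrow> (\<Sum>j<n. a i j * \<eta> j) = irhs i q \<xi>"
    and dual: "\<And>j. j < n \<Longrightarrow> (\<Sum>i\<in>J. a i j * \<pi> i) + iobj j q \<xi> = 0" by simp_all
  define \<pi>' where "\<pi>' = (\<lambda>i. if i \<in> J then \<pi> i else 0)"
  have J0: "\<pi>' i = 0" if "i \<in> R - J" for i using that by (simp add: \<pi>'_def)
  have dual': "(\<Sum>i\<in>R. a i j * \<pi>' i) + iobj j q \<xi> = 0" if "j < n" for j
    using dual[OF that] J0 by (subst sumJ[symmetric]) (auto simp: \<pi>'_def)
  \<comment> \<open>Equality of the two objectives: \<open>\<pi>'\<close> vanishes outside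
    \<open>J\<close>, and the rows of \<open>J\<close> are tight.\<close>
  have "(\<Sum>j<n. iobj j q \<xi> * \<eta> j) = (\<Sum>j<n. - (\<Sum>i\<in>R. a i j * \<pi>' i) * \<eta> j)"
    using dual' by (intro sum.cong arg_cong2[where f = times]) (auto simp: eq_neg_iff_add_eq_0 add.commute)
  also have "\<dots> = - (\<Sum>i\<in>R. \<pi>' i * (\<Sum>j<n. a i j * \<eta> j))"
    unfolding sum_distrib_left sum_distrib_right
    by (simp add: sum_negf sum_distrib_left sum_distrib_right, subst sum.swap) (simp add: algebra_simps)
  also have "(\<Sum>i\<in>R. \<pi>' i * (\<Sum>j<n. a i j * \<eta> j)) = (\<Sum>i\<in>R. \<pi>' i * irhs i q \<xi>)"
    using RJ J0 by (intro sum.cong) (auto simp: \<pi>'_def)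
  finally have compl: "(\<Sum>i\<in>R. \<pi>' i * irhs i q \<xi>) + (\<Sum>j<n. iobj j q \<xi> * \<eta> j) = 0" by simp
  have "(\<Sum>l<k. D i l * \<xi> l) \<le> d i * q" if "i < g" for i
    using G'[of "Inl i"] that by (simp add: G'_def f_def f'_def f0_def Plus_def)
  moreover have "\<forall>i\<in>R. 0 \<le> \<pi>' i"
  proof
    fix i show "0 \<le> \<pi>' i" using \<pi>[of i] by (auto simp: \<pi>'_def)
  qed
  ultimately have "primal_dual q \<xi> \<eta> \<pi>'" unfolding primal_dual_def using * R dual' compl by blast
  moreover have "\<forall>i\<in>J. 1 \<le> \<pi>' i" using \<pi> by (auto simp: \<pi>'_def)
  moreover have "\<forall>i\<in>R. \<pi>' i \<le> bd2" using \<pi> bd2_ge by (auto simp: \<pi>'_def)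
  moreover have "\<forall>h\<in>G. (\<Sum>l<k. e h l * \<xi> l) + (\<Sum>j<n. e' h j * \<eta> j) + e0 h * q \<le> 0"
    using G'[of "Inr _"] by (force simp: G'_def f_def f'_def f0_def Plus_def)
  ultimately show ?thesis using * J0
    by - (rule exI[of _ q], rule exI[of _ \<xi>], rule exI[of _ \<eta>], rule exI[of _ \<pi>'], simp)
qed

text \<open>The rows of the target enter as side constraints on \<open>y\<close> alone.\<close>

lemma target_cert_complete:
  assumes "inX x" "isopt x y" "inY y"
  shows "\<exists>q \<xi> \<eta> p. primal_dual q \<xi> \<eta> p \<and> target_cert q \<eta> \<and> q \<le> bd \<and> (\<forall>l<k. \<bar>\<xi> l\<bar> \<le> bd) \<and>
    (\<forall>j<n. \<bar>\<eta> j\<bar> \<le> bd) \<and> (\<forall>i\<in>R. p i \<le> bd)"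
proof -
  obtain p where p: "\<And>i. 0 \<le> p i" "\<And>j. j < n \<Longrightarrow> (\<Sum>i\<in>R. real_of_int (a i j) * p i) + obj j x = 0"
    "\<And>i. i \<in> R \<Longrightarrow> 0 < p i \<Longrightarrow> (\<Sum>j<n. real_of_int (a i j) * y j) = rhs i x"
    using strong_duality[OF assms(2)] by blast
  have le: "z \<le> 2 * int N * W * bd1" if "z \<le> W" for z using that W2_ge(2) by linarith
  have "\<exists>q \<xi> \<eta> p'. primal_dual q \<xi> \<eta> p' \<and> (\<forall>i\<in>{i \<in> R. 0 < p i}. 1 \<le> p' i) \<and> q \<le> bd2 \<and>
    (\<forall>l<k. \<bar>\<xi> l\<bar> \<le> bd2) \<and> (\<forall>j<n. \<bar>\<eta> j\<bar> \<le> bd2) \<and> (\<forall>i\<in>R. p' i \<le> bd2) \<and>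
    (\<forall>i\<in>R - {i \<in> R. 0 < p i}. p' i = 0) \<and>
    (\<forall>h\<in>{..<r}. (\<Sum>l<k. 0 * \<xi> l) + (\<Sum>j<n. S h j * \<eta> j) + (- t h) * q \<le> 0)"
  proof (rule small_primal_dual_support[where e = "\<lambda>_ _. 0" and x = x and y = y and p = p])
    show "(\<Sum>l<k. real_of_int 0 * x l) + (\<Sum>j<n. real_of_int (S h j) * y j) + real_of_int (- t h) \<le> 0"
      if "h \<in> {..<r}" for h using assms(3) that by (simp add: inY_def)
    have "0 \<le> 2 * int N * W * bd1" using W2_ge(1) by linarith
    then show "\<bar>0 :: int\<bar> \<le> 2 * int N * W * bd1" by simp
  qed (use assms p in \<open>auto simp: isopt_def intro!: le W\<close>)
  then obtain q \<xi> \<eta> p' where *: "primal_dual q \<xi> \<eta> p'" "q \<le> bd2" "\<forall>l<k. \<bar>\<xi> l\<bar> \<le> bd2" "\<forall>j<n. \<bar>\<eta> j\<bar> \<le> bd2"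
    "\<forall>i\<in>R. p' i \<le> bd2" "\<forall>h<r. (\<Sum>j<n. S h j * \<eta> j) \<le> t h * q" by auto
  have tr: "z \<le> bd" if "z \<le> bd2" for z using that bd_ge(1) by linarith
  have "target_cert q \<eta>" "q \<le> bd" "\<forall>l<k. \<bar>\<xi> l\<bar> \<le> bd" "\<forall>j<n. \<bar>\<eta> j\<bar> \<le> bd" "\<forall>i\<in>R. p' i \<le> bd"
    using * by (auto simp: target_cert_def intro: tr)
  with *(1) show ?thesis
    by - (rule exI[of _ q], rule exI[of _ \<xi>], rule exI[of _ \<eta>], rule exI[of _ p'], simp)
qed

text \<open>\<open>J\<close> is the support of one dual solution at the given \<open>x\<close>.
  Validity of the target rows on the face where \<open>J\<close> is tight gives small multipliers
  that are free in sign on \<open>J\<close>; their cost inequality becomes a side constraint on the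
  new parameter. A multiple of the new dual solution then repairs the signs.\<close>

lemma farkas_cert_complete:
  assumes X: "inX x" and opt: "isopt x y" and sub: "\<And>y. isopt x y \<Longrightarrow> inY y"
  shows "\<exists>q \<xi> \<eta> p \<delta> \<mu> K. primal_dual q \<xi> \<eta> p \<and> farkas_cert q \<xi> \<eta> \<delta> \<mu> K \<and> q \<le> bd \<and> (\<forall>l<k. \<bar>\<xi> l\<bar> \<le> bd) \<and>
    (\<forall>j<n. \<bar>\<eta> j\<bar> \<le> bd) \<and> (\<forall>i\<in>R. p i \<le> bd) \<and> \<delta> \<le> bd \<and>
    (\<forall>i<r. K i \<le> bd \<and> (\<forall>h\<in>R. \<mu> i h \<le> bd))"
proof -
  obtain p where p: "\<And>i. 0 \<le> p i" "\<And>j. j < n \<Longrightarrow> (\<Sum>i\<in>R. real_of_int (a i j) * p i) + obj j x = 0"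
    "\<And>i. i \<in> R \<Longrightarrow> 0 < p i \<Longrightarrow> (\<Sum>j<n. real_of_int (a i j) * y j) = rhs i x"
    using strong_duality[OF opt] by blast
  define J where "J = {i \<in> R. 0 < p i}"
  have JR: "J \<subseteq> R" by (auto simp: J_def)
  \<comment> \<open>Complementary slackness: at feasible points that are tight on \<open>J\<close>
    the objective equals the dual value, so they are optimal.\<close>
  have face: "isopt x y'" if y': "feas x y'" "\<And>i. i \<in> J \<Longrightarrow> (\<Sum>j<n. real_of_int (a i j) * y' j) = rhs i x" for y'
  proof -
    have val: "(\<Sum>j<n. obj j x * z j) = - (\<Sum>i\<in>R. p i * (\<Sum>j<n. real_of_int (a i j) * z j))" for z
    proof -
      have "(\<Sum>j<n. obj j x * z j) = (\<Sum>j<n. - (\<Sum>i\<in>R. real_of_int (a i j) * p i) * z j)"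
        using p(2) by (intro sum.cong arg_cong2[where f = times]) (auto simp: eq_neg_iff_add_eq_0 add.commute)
      also have "\<dots> = - (\<Sum>i\<in>R. p i * (\<Sum>j<n. real_of_int (a i j) * z j))"
        unfolding sum_distrib_left sum_distrib_right
        by (simp add: sum_negf sum_distrib_left sum_distrib_right, subst sum.swap) (simp add: algebra_simps)
      finally show ?thesis .
    qed
    have "(\<Sum>i\<in>R. p i * (\<Sum>j<n. real_of_int (a i j) * y' j)) = (\<Sum>i\<in>R. p i * rhs i x)"
    proof (rule sum.cong[OF refl])
      fix i assume "i \<in> R"
      then show "p i * (\<Sum>j<n. real_of_int (a i j) * y' j) = p i * rhs i x"
        using y'(2)[of i] p(1)[of i] by (cases "i \<in> J") (auto simp: J_def)
    qed
    moreover have "(\<Sum>i\<in>R. p i * (\<Sum>j<n. real_of_int (a i j) * z j)) \<le> (\<Sum>i\<in>R. p i * rhs i x)" if "feas x z" for z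
      using that p(1) by (auto simp: feas_def intro!: sum_mono mult_left_mono)
    ultimately show ?thesis using y'(1) by (simp add: isopt_def val)
  qed
  define P where "P = (\<lambda>i (\<mu> :: _ \<Rightarrow> int) \<delta>. 1 \<le> \<delta> \<and> \<delta> \<le> bd1 \<and> (\<forall>h\<in>R. \<bar>\<mu> h\<bar> \<le> bd1) \<and>
    (\<forall>h\<in>R - J. 0 \<le> \<mu> h) \<and> (\<forall>j<n. (\<Sum>h\<in>R. \<mu> h * a h j) = \<delta> * S i j) \<and>
    (\<Sum>h\<in>R. real_of_int (\<mu> h) * rhs h x) \<le> real_of_int \<delta> * real_of_int (t i))"
  have "\<exists>\<mu> \<delta>. P i \<mu> \<delta>" if i: "i < r" for i
    unfolding bd1_def P_def
  proof (rule small_multipliers[where ?y0.0 = y])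
    show "(\<Sum>j<n. real_of_int (a h j) * y j) \<le> rhs h x" if "h \<in> R" for h
      using opt that by (simp add: isopt_def feas_def)
    show "(\<Sum>j<n. real_of_int (S i j) * y' j) \<le> real_of_int (t i)"
      if "\<And>h. h \<in> R \<Longrightarrow> (\<Sum>j<n. real_of_int (a h j) * y' j) \<le> rhs h x"
        "\<And>h. h \<in> J \<Longrightarrow> (\<Sum>j<n. real_of_int (a h j) * y' j) = rhs h x" for y'
    proof -
      have "isopt x y'" by (rule face) (use that in \<open>auto simp: feas_def\<close>)
      then show ?thesis using sub i by (simp add: inY_def)
    qed
  qed (use finR JR W W1 N i p(3) in \<open>auto simp: J_def\<close>)
  then obtain \<mu> \<delta> where P: "\<And>i. i < r \<Longrightarrow> P i (\<mu> i) (\<delta> i)" by metis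
  note P = P[unfolded P_def]
  have mu: "\<And>i. i < r \<Longrightarrow> 1 \<le> \<delta> i \<and> \<delta> i \<le> bd1"
      "\<And>i h. i < r \<Longrightarrow> h \<in> R \<Longrightarrow> \<bar>\<mu> i h\<bar> \<le> bd1" "\<And>i h. i < r \<Longrightarrow> h \<in> R - J \<Longrightarrow> 0 \<le> \<mu> i h"
      "\<And>i j. i < r \<Longrightarrow> j < n \<Longrightarrow> (\<Sum>h\<in>R. \<mu> i h * a h j) = \<delta> i * S i j"
      "\<And>i. i < r \<Longrightarrow> (\<Sum>h\<in>R. real_of_int (\<mu> i h) * rhs h x) \<le> real_of_int (\<delta> i) * real_of_int (t i)"
    using P by auto
  have musum: "\<bar>\<Sum>h\<in>R. \<mu> i h * f h\<bar> \<le> int N * W * bd1" if "i < r" "\<And>h. h \<in> R \<Longrightarrow> \<bar>f h\<bar> \<le> W" for i f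
  proof -
    have "\<bar>\<Sum>h\<in>R. \<mu> i h * f h\<bar> \<le> (\<Sum>h\<in>R. \<bar>\<mu> i h * f h\<bar>)" by (rule sum_abs)
    also have "\<dots> \<le> (\<Sum>h\<in>R. bd1 * W)"
      by (rule sum_mono) (use mu(2) that bd1_ge in \<open>auto simp: abs_mult intro!: mult_mono\<close>)
    also have "\<dots> \<le> int N * (bd1 * W)"
      using N bd1_ge W1 by (simp add: mult_right_mono)
    finally show ?thesis by (simp add: mult_ac)
  qed
  \<comment> \<open>With \<open>\<mu>\<close> and \<open>\<delta>\<close> fixed, the cost inequality
    for each target row is linear in \<open>x\<close>. Its coefficients are sums over all rows, plus
    the term \<open>\<delta> i * t i\<close>, hence the factor 2 in their bound.\<close>
  have "\<exists>q \<xi> \<eta> p'. primal_dual q \<xi> \<eta> p' \<and> (\<forall>i\<in>J. 1 \<le> p' i) \<and> q \<le> bd2 \<and>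
    (\<forall>l<k. \<bar>\<xi> l\<bar> \<le> bd2) \<and> (\<forall>j<n. \<bar>\<eta> j\<bar> \<le> bd2) \<and> (\<forall>i\<in>R. p' i \<le> bd2) \<and> (\<forall>i\<in>R - J. p' i = 0) \<and>
    (\<forall>i\<in>{..<r}. (\<Sum>l<k. (\<Sum>h\<in>R. \<mu> i h * B h l) * \<xi> l) + (\<Sum>j<n. 0 * \<eta> j) +
      ((\<Sum>h\<in>R. \<mu> i h * b h) - \<delta> i * t i) * q \<le> 0)"
  proof (rule small_primal_dual_support[where e' = "\<lambda>_ _. 0" and x = x and y = y and p = p])
    fix i assume "i \<in> {..<r}"
    then have i: "i < r" by simp
    have pos: "0 \<le> int N * W * bd1" using W1 bd1_ge by simp
    show "\<bar>\<Sum>h\<in>R. \<mu> i h * B h l\<bar> \<le> 2 * int N * W * bd1" if "l < k" for l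
      using musum[OF i, of "\<lambda>h. B h l"] W(2) that pos by simp
    have "\<bar>\<delta> i * t i\<bar> \<le> bd1 * W" unfolding abs_mult
      by (rule mult_mono) (use mu(1)[OF i] W(9)[OF i] W1 in auto)
    also have "\<dots> \<le> int N * (bd1 * W)" using W1 bd1_ge N mult_right_mono[of 1 "int N" "bd1 * W"] by simp
    finally have "\<bar>\<delta> i * t i\<bar> \<le> int N * W * bd1" by (simp add: mult_ac)
    then show "\<bar>(\<Sum>h\<in>R. \<mu> i h * b h) - \<delta> i * t i\<bar> \<le> 2 * int N * W * bd1"
      using musum[OF i, of b] W(3) by (simp add: mult.assoc)
    have "(\<Sum>h\<in>R. real_of_int (\<mu> i h) * rhs h x) =
      (\<Sum>l<k. real_of_int (\<Sum>h\<in>R. \<mu> i h * B h l) * x l) + real_of_int (\<Sum>h\<in>R. \<mu> i h * b h)"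
      unfolding rhs_def distrib_left sum.distrib of_int_sum sum_distrib_left sum_distrib_right
      by (subst sum.swap) (simp add: mult_ac)
    then show "(\<Sum>l<k. real_of_int (\<Sum>h\<in>R. \<mu> i h * B h l) * x l) + (\<Sum>j<n. real_of_int 0 * y j) +
        real_of_int ((\<Sum>h\<in>R. \<mu> i h * b h) - \<delta> i * t i) \<le> 0"
      using mu(5)[OF i] by simp
    show "\<bar>0 :: int\<bar> \<le> 2 * int N * W * bd1" using pos by (simp add: mult_ac)
  qed (use X opt p in \<open>auto simp: isopt_def J_def\<close>)
  then obtain q \<xi> \<eta> p' where pd: "primal_dual q \<xi> \<eta> p'"
    and p': "\<forall>i\<in>J. 1 \<le> p' i" "\<forall>i\<in>R. p' i \<le> bd2" "\<forall>i\<in>R - J. p' i = 0"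
    and bnd: "q \<le> bd2" "\<forall>l<k. \<bar>\<xi> l\<bar> \<le> bd2" "\<forall>j<n. \<bar>\<eta> j\<bar> \<le> bd2"
    and side: "\<And>i. i < r \<Longrightarrow> (\<Sum>l<k. (\<Sum>h\<in>R. \<mu> i h * B h l) * \<xi> l) +
      ((\<Sum>h\<in>R. \<mu> i h * b h) - \<delta> i * t i) * q \<le> 0" by auto
  have side': "(\<Sum>h\<in>R. \<mu> i h * irhs h q \<xi>) \<le> \<delta> i * t i * q" if "i < r" for i
  proof -
    have "(\<Sum>h\<in>R. \<mu> i h * irhs h q \<xi>) = (\<Sum>l<k. (\<Sum>h\<in>R. \<mu> i h * B h l) * \<xi> l) + (\<Sum>h\<in>R. \<mu> i h * b h) * q"
      unfolding irhs_def distrib_left sum.distrib sum_distrib_left sum_distrib_right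
      by (subst sum.swap) (simp add: mult_ac)
    then show ?thesis using side[OF that] by (simp add: algebra_simps)
  qed
  \<comment> \<open>One denominator for all target rows; there are at most \<open>N\<close> factors,
    so it stays below \<open>bd1 ^ N\<close>.\<close>
  define \<Delta> where "\<Delta> = (\<Prod>i<r. \<delta> i)"
  have \<Delta>1: "1 \<le> \<Delta>" unfolding \<Delta>_def using mu(1) by (intro prod_ge_1) auto
  have "\<Delta> \<le> (\<Prod>i<r. bd1)" unfolding \<Delta>_def using mu(1) by (intro prod_mono) force
  also have "\<dots> \<le> bd1 ^ N" using bd1_ge N by (simp add: power_increasing)
  finally have \<Delta>le: "\<Delta> \<le> bd1 ^ N" .
  define D' where "D' = (\<lambda>i. \<Delta> div \<delta> i)"
  have D': "D' i * \<delta> i = \<Delta>" "1 \<le> D' i" "D' i \<le> \<Delta>" if i: "i < r" for i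
  proof -
    have "\<delta> i dvd \<Delta>" unfolding \<Delta>_def using i by (intro dvd_prodI) auto
    then show 1: "D' i * \<delta> i = \<Delta>" by (simp add: D'_def)
    have "0 < \<delta> i" using mu(1)[OF i] by simp
    moreover have "0 < D' i * \<delta> i" using 1 \<Delta>1 by simp
    ultimately show "1 \<le> D' i" by (simp add: zero_less_mult_iff)
    then have "D' i * 1 \<le> D' i * \<delta> i" using mu(1)[OF i] by (intro mult_left_mono) auto
    then show "D' i \<le> \<Delta>" using 1 by simp
  qed
  \<comment> \<open>\<open>K\<close> dominates every rescaled multiplier
    \<open>D' i * \<mu> i h\<close>, and \<open>p'\<close> is at least 1 on \<open>J\<close>, so
    \<open>K * p'\<close> outweighs the negative ones. One value serves all target rows.\<close>
  define K where "K = \<Delta> * bd1"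
  have K: "0 \<le> K" "K \<le> bd1 ^ (N + 1)" using \<Delta>le \<Delta>1 bd1_ge by (auto simp: K_def mult_right_mono mult.commute)
  define \<mu>' where "\<mu>' = (\<lambda>i h. D' i * \<mu> i h + K * p' h)"
  have pnn: "0 \<le> p' h" if "h \<in> R" for h using pd that by (simp add: primal_dual_def)
  have prodle: "\<bar>D' i * \<mu> i h\<bar> \<le> K" if "i < r" "h \<in> R" for i h
    unfolding K_def abs_mult
    by (rule mult_mono) (use D'[OF that(1)] mu(2)[OF that] \<Delta>1 in auto)
  have \<mu>'0: "0 \<le> \<mu>' i h" if "i < r" "h \<in> R" for i h
  proof (cases "h \<in> J")
    case True
    then have "K * 1 \<le> K * p' h" using p'(1) K(1) by (intro mult_left_mono) auto
    then show ?thesis using prodle[OF that] by (simp add: \<mu>'_def)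
  next
    case False
    then have "0 \<le> \<mu> i h" using mu(3) that by simp
    then show ?thesis using D'(2)[OF that(1)] K(1) pnn[OF that(2)] by (simp add: \<mu>'_def)
  qed
  have \<mu>'le: "\<mu>' i h \<le> bd" if "i < r" "h \<in> R" for i h
  proof -
    have "K * p' h \<le> bd1 ^ (N + 1) * bd2" using K p'(2) that pnn[OF that(2)] bd1_ge by (intro mult_mono) auto
    moreover have "K \<le> bd1 ^ (N + 1) * bd2"
      using K bd2_ge mult_mono[of K "bd1 ^ (N + 1)" 1 bd2] by simp
    ultimately show ?thesis using prodle[OF that] by (simp add: \<mu>'_def bd_def)
  qed
  have "farkas_cert q \<xi> \<eta> \<Delta> \<mu>' (\<lambda>_. K)"
    unfolding farkas_cert_def
  proof (intro conjI allI impI ballI)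
    fix i assume i: "i < r"
    have dual: "(\<Sum>h\<in>R. a h j * p' h) + iobj j q \<xi> = 0" if "j < n" for j
      using pd that by (simp add: primal_dual_def)
    \<comment> \<open>By dual feasibility, the added \<open>K * p'\<close> contributes
      \<open>- K * iobj j q \<xi>\<close>, which the multiplier \<open>K\<close> of the objective
      cancels. On the right-hand sides, \<open>compl\<close> produces the same cancellation.\<close>
    show "(\<Sum>h\<in>R. a h j * \<mu>' i h) + K * iobj j q \<xi> = S i j * \<Delta>" if j: "j < n" for j
    proof -
      have "(\<Sum>h\<in>R. a h j * \<mu>' i h) = D' i * (\<Sum>h\<in>R. \<mu> i h * a h j) + K * (\<Sum>h\<in>R. a h j * p' h)"
        by (simp add: \<mu>'_def sum_distrib_left sum.distrib algebra_simps)
      also have "\<dots> = D' i * \<delta> i * S i j - K * iobj j q \<xi>"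
        using dual[OF j] mu(4)[OF i j] by (simp add: eq_neg_iff_add_eq_0[symmetric])
      finally show ?thesis using D'(1)[OF i] by simp
    qed
    have compl: "(\<Sum>h\<in>R. p' h * irhs h q \<xi>) + (\<Sum>j<n. iobj j q \<xi> * \<eta> j) = 0"
      using pd by (simp add: primal_dual_def)
    have "(\<Sum>h\<in>R. \<mu>' i h * irhs h q \<xi>) = D' i * (\<Sum>h\<in>R. \<mu> i h * irhs h q \<xi>) + K * (\<Sum>h\<in>R. p' h * irhs h q \<xi>)"
      by (simp add: \<mu>'_def sum_distrib_left sum.distrib algebra_simps)
    moreover have "D' i * (\<Sum>h\<in>R. \<mu> i h * irhs h q \<xi>) \<le> D' i * (\<delta> i * t i * q)"
      using side'[OF i] D'(2)[OF i] by (intro mult_left_mono) auto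
    moreover have "D' i * (\<delta> i * t i * q) = t i * (\<Delta> * q)" using D'(1)[OF i] by (simp add: algebra_simps)
    moreover have "K * (\<Sum>h\<in>R. p' h * irhs h q \<xi>) + K * (\<Sum>j<n. iobj j q \<xi> * \<eta> j) = 0"
      using compl by (simp add: distrib_left[symmetric])
    ultimately show "(\<Sum>h\<in>R. \<mu>' i h * irhs h q \<xi>) + K * (\<Sum>j<n. iobj j q \<xi> * \<eta> j) \<le> t i * (\<Delta> * q)"
      by linarith
  qed (use \<Delta>1 K \<mu>'0 in auto)
  moreover have tr: "z \<le> bd" if "z \<le> bd2" for z using that bd_ge(1) by linarith
  moreover have "\<Delta> \<le> bd" "K \<le> bd" using \<Delta>le K bd_ge by linarith+
  moreover have "q \<le> bd" "\<forall>l<k. \<bar>\<xi> l\<bar> \<le> bd" "\<forall>j<n. \<bar>\<eta> j\<bar> \<le> bd" "\<forall>i\<in>R. p' i \<le> bd"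
    using bnd p'(2) by (auto intro: tr)
  ultimately show ?thesis using pd \<mu>'le
    by - (rule exI[of _ q], rule exI[of _ \<xi>], rule exI[of _ \<eta>], rule exI[of _ p'], rule exI[of _ \<Delta>],
      rule exI[of _ \<mu>'], rule exI[of _ "\<lambda>_. K"], simp)
qed

end

section \<open>Compilation of arithmetic expressions and a cost calculus for programs\<close>

section \<open>Expressions and structured programs\<close>

datatype expr = Cn int | Vr int | Pl expr expr | Ti expr expr | Rd expr

text \<open>The registers \<open>-1, \<dots>, -64\<close> hold intermediate results; states abstract from them.\<close>

definition temp :: "int set" where "temp = {-64..-1}"

definition view :: "memory \<Rightarrow> memory" where "view M = (\<lambda>i. if i \<in> temp then 0 else M i)"

text \<open>Serves as a bound for two quantities: the number of temporaries used by the evaluation,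
  and the factor by which the bit length of the value may exceed that of the registers.\<close>

fun esize :: "expr \<Rightarrow> nat" where
  "esize (Cn z) = 1"
| "esize (Vr i) = 1"
| "esize (Pl e f) = esize e + esize f"
| "esize (Ti e f) = esize e + esize f"
| "esize (Rd e) = Suc (esize e)"

fun val :: "expr \<Rightarrow> memory \<Rightarrow> int" where
  "val (Cn z) \<sigma> = z"
| "val (Vr i) \<sigma> = \<sigma> i"
| "val (Pl e f) \<sigma> = val e \<sigma> + val f \<sigma>"
| "val (Ti e f) \<sigma> = val e \<sigma> * val f \<sigma>"
| "val (Rd e) \<sigma> = \<sigma> (val e \<sigma>)"

text \<open>Excludes access to the temporaries, whose contents change during evaluation and are
  invisible in \<open>view\<close>, and limits literals and direct addresses to \<open>s\<close>
  bits so that the charge for them is covered.\<close>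

fun safe :: "nat \<Rightarrow> memory \<Rightarrow> expr \<Rightarrow> bool" where
  "safe s \<sigma> (Cn z) \<longleftrightarrow> \<bar>z\<bar> \<le> 2 ^ s"
| "safe s \<sigma> (Vr i) \<longleftrightarrow> \<bar>i\<bar> \<le> 2 ^ s \<and> i \<notin> temp"
| "safe s \<sigma> (Pl e f) \<longleftrightarrow> safe s \<sigma> e \<and> safe s \<sigma> f"
| "safe s \<sigma> (Ti e f) \<longleftrightarrow> safe s \<sigma> e \<and> safe s \<sigma> f"
| "safe s \<sigma> (Rd e) \<longleftrightarrow> safe s \<sigma> e \<and> val e \<sigma> \<notin> temp"

text \<open>\<open>d\<close> is the depth of an evaluation stack that grows downwards from register
  -1. Shallower levels are preserved, so the left operand survives the evaluation of the right
  one.\<close>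

fun compile :: "expr \<Rightarrow> nat \<Rightarrow> com" where
  "compile (Cn z) d = Op (Reg (- int d)) arith.Add (Lit z) (Lit 0)"
| "compile (Vr i) d = Op (Reg (- int d)) arith.Add (Load (Reg i)) (Lit 0)"
| "compile (Pl e f) d = Seq (compile e d) (Seq (compile f (Suc d))
     (Op (Reg (- int d)) arith.Add (Load (Reg (- int d))) (Load (Reg (- int (Suc d))))))"
| "compile (Ti e f) d = Seq (compile e d) (Seq (compile f (Suc d))
     (Op (Reg (- int d)) arith.Mul (Load (Reg (- int d))) (Load (Reg (- int (Suc d))))))"
| "compile (Rd e) d = Seq (compile e d) (Op (Reg (- int d)) arith.Add (Load (Ind (- int d))) (Lit 0))"

definition bounded :: "nat \<Rightarrow> memory \<Rightarrow> bool" where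
  "bounded s \<sigma> \<longleftrightarrow> (\<forall>i. \<bar>\<sigma> i\<bar> \<le> 2 ^ s)"

lemma int_len_le: "\<bar>z\<bar> \<le> 2 ^ s \<Longrightarrow> int_len z \<le> s + 2"
proof -
  assume "\<bar>z\<bar> \<le> 2 ^ s"
  then have "nat \<bar>z\<bar> \<le> nat (2 ^ s)" by (rule nat_mono)
  then have "nat \<bar>z\<bar> \<le> 2 ^ s" by (simp add: nat_power_eq)
  also have "\<dots> < 2 ^ Suc s" by simp
  finally have "floorlog 2 (nat \<bar>z\<bar>) \<le> Suc s" by (simp add: floorlog_leI)
  then show ?thesis by (simp add: int_len_def)
qed

lemma esize_pos: "1 \<le> esize e" by (induction e) auto

text \<open>A sum is bounded by the product of the two bounds, so that \<open>Pl\<close> and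
  \<open>Ti\<close> are treated alike. This needs both bounds to be at least 2, which is where
  \<open>1 \<le> s\<close> enters.\<close>

lemma val_le:
  assumes "bounded s \<sigma>" "1 \<le> s" "safe s \<sigma> e"
  shows "\<bar>val e \<sigma>\<bar> \<le> 2 ^ (s * esize e)"
  using assms(3)
proof (induction e)
  case (Pl e f)
  have *: "2 \<le> (2 :: int) ^ (s * esize g)" for g
    using power_increasing[of 1 "s * esize g" "2 :: int"] esize_pos[of g] assms(2) by auto
  have "\<bar>val (Pl e f) \<sigma>\<bar> \<le> 2 ^ (s * esize e) + 2 ^ (s * esize f)" using Pl by simp
  also have "\<dots> \<le> (2 ^ (s * esize e) * 2 ^ (s * esize f) :: int)"
  proof -
    have "x + y \<le> x * y" if "2 \<le> x" "2 \<le> y" for x y :: int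
    proof -
      have "0 \<le> (x - 2) * (y - 2) + (x - 2) + (y - 2)" using that by (intro add_nonneg_nonneg mult_nonneg_nonneg) auto
      then show ?thesis by (simp add: algebra_simps)
    qed
    then show ?thesis using * by blast
  qed
  finally show ?case by (simp add: power_add distrib_left)
next
  case (Ti e f)
  then show ?case by (auto simp: power_add distrib_left abs_mult intro!: mult_mono)
next
  case (Rd e)
  have "\<bar>val (Rd e) \<sigma>\<bar> \<le> 2 ^ s" using assms(1) by (simp add: bounded_def)
  also have "\<dots> \<le> 2 ^ (s * esize (Rd e))" by (rule power_increasing) auto
  finally show ?case .
qed (use assms(1) in \<open>auto simp: bounded_def\<close>)

lemma view_upd_temp: "i \<in> temp \<Longrightarrow> view (M(i := v)) = view M"
  by (auto simp: view_def)

lemma view_upd: "i \<notin> temp \<Longrightarrow> view (M(i := v)) = (view M)(i := v)"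
  by (auto simp: view_def)

lemma view_apply: "i \<notin> temp \<Longrightarrow> M i = view M i"
  by (simp add: view_def)

lemma temp_len: "1 \<le> d \<Longrightarrow> d \<le> 64 \<Longrightarrow> int_len (- int d) \<le> 8"
  using int_len_le[of "- int d" 6] by simp

text \<open>There are linearly many operations, and each handles values of up to
  \<open>s * esize e\<close> bits, hence the quadratic cost.\<close>

lemma compile_correct:
  assumes "bounded s \<sigma>" "1 \<le> s" "safe s \<sigma> e" "view M = \<sigma>" "1 \<le> d" "d + esize e \<le> 65"
  shows "\<exists>u M'. exec (compile e d) M u M' \<and> view M' = \<sigma> \<and> M' (- int d) = val e \<sigma> \<and>
    (\<forall>j<d. M' (- int j) = M (- int j)) \<and> u \<le> 40 * s * (esize e)\<^sup>2"
  using assms(3-)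
proof (induction e arbitrary: d M)
  case (Cn z)
  have len: "int_len z \<le> s + 2" "int_len 0 \<le> 2" "int_len (- int d) \<le> 8"
    using Cn int_len_le[of z s] int_len_le[of 0 0] temp_len by auto
  have d: "- int d \<in> temp" using Cn by (simp add: temp_def)
  define u M' where "u = 1 + int_len z + int_len 0 + int_len (- int d) + int_len z" and "M' = M(- int d := z)"
  have ex: "exec (compile (Cn z) d) M u M'"
    using exec.Op[OF refl, of "Reg (- int d)" arith.Add "Lit z" "Lit 0" M] by (simp add: u_def M'_def)
  have "u \<le> 40 * s * (esize (Cn z))\<^sup>2" using len assms(2) by (simp add: u_def)
  moreover have "view M' = \<sigma>" "M' (- int d) = val (Cn z) \<sigma>" "\<forall>j<d. M' (- int j) = M (- int j)"
    using d Cn(2) by (simp_all add: M'_def view_upd_temp)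
  ultimately show ?case using ex by blast
next
  case (Vr i)
  have v: "M i = \<sigma> i" using Vr by (simp add: view_apply[of i M])
  have len: "int_len i \<le> s + 2" "int_len 0 \<le> 2" "int_len (\<sigma> i) \<le> s + 2" "int_len (- int d) \<le> 8"
    using Vr int_len_le[of i s] int_len_le[of 0 0] int_len_le[of "\<sigma> i" s] assms(1) temp_len by (auto simp: bounded_def)
  have d: "- int d \<in> temp" using Vr by (simp add: temp_def)
  define u M' where "u = 1 + (int_len i + int_len (\<sigma> i)) + int_len 0 + int_len (- int d) + int_len (\<sigma> i)"
    and "M' = M(- int d := \<sigma> i)"
  have ex: "exec (compile (Vr i) d) M u M'"
    using exec.Op[OF refl, of "Reg (- int d)" arith.Add "Load (Reg i)" "Lit 0" M] by (simp add: u_def M'_def v)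
  have "u \<le> 40 * s * (esize (Vr i))\<^sup>2" using len assms(2) by (simp add: u_def)
  moreover have "view M' = \<sigma>" "M' (- int d) = val (Vr i) \<sigma>" "\<forall>j<d. M' (- int j) = M (- int j)"
    using d Vr(2) by (simp_all add: M'_def view_upd_temp)
  ultimately show ?case using ex by blast
next
  case (Rd e)
  from Rd.prems have pre: "safe s \<sigma> e" "view M = \<sigma>" "1 \<le> d" "d + esize e \<le> 65" by auto
  obtain u M' where M': "exec (compile e d) M u M'" "view M' = \<sigma>" "M' (- int d) = val e \<sigma>"
    "\<forall>j<d. M' (- int j) = M (- int j)" "u \<le> 40 * s * (esize e)\<^sup>2"
    using Rd.IH[OF pre] by blast
  have d: "- int d \<in> temp" "int_len (- int d) \<le> 8" using Rd.prems esize_pos[of e] temp_len by (auto simp: temp_def)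
  have v: "M' (val e \<sigma>) = \<sigma> (val e \<sigma>)" using Rd.prems(1) M'(2) view_apply[of "val e \<sigma>" M'] by simp
  let ?v = "\<sigma> (val e \<sigma>)"
  define M'' where "M'' = M'(- int d := ?v)"
  define u' where "u' = 1 + (int_len (- int d) + int_len (val e \<sigma>) + int_len ?v) + int_len 0 + int_len (- int d) + int_len ?v"
  have "exec (Op (Reg (- int d)) arith.Add (Load (Ind (- int d))) (Lit 0)) M' u' M''"
    using exec.Op[OF refl, of "Reg (- int d)" arith.Add "Load (Ind (- int d))" "Lit 0" M']
    by (simp add: M'(3) v u'_def M''_def)
  then have ex: "exec (compile (Rd e) d) M (u + u') M''" using M'(1) by (auto intro: exec.Seq)
  have "int_len 0 \<le> 2" "int_len ?v \<le> s + 2" "int_len (val e \<sigma>) \<le> s * esize e + 2"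
    using int_len_le[of 0 0] int_len_le[of ?v s] int_len_le[OF val_le[OF assms(1,2) pre(1)]] assms(1)
    by (auto simp: bounded_def)
  then have "u' \<le> 27 + 2 * s + s * esize e" using d by (simp add: u'_def)
  also have "\<dots> \<le> 40 * s * Suc (esize e)" using assms(2) by simp
  finally have u': "u' \<le> 40 * s * Suc (esize e)" .
  \<comment> \<open>The difference of consecutive squares, \<open>2 * esize e + 1\<close>, pays for
    the final load.\<close>
  have "Suc (esize e) \<le> 2 * esize e + 1" by simp
  then have "40 * s * Suc (esize e) \<le> 40 * s * (2 * esize e + 1)" by (rule mult_le_mono2)
  then have "u + u' \<le> 40 * s * (esize (Rd e))\<^sup>2" using M'(5) u' by (simp add: power2_eq_square algebra_simps)
  moreover have "view M'' = \<sigma>" "M'' (- int d) = val (Rd e) \<sigma>" "\<forall>j<d. M'' (- int j) = M (- int j)"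
    using M'(2,4) d by (simp_all add: M''_def view_upd_temp)
  ultimately show ?case using ex by blast
next
  case (Pl e f)
  from Pl.prems have pre: "safe s \<sigma> e" "view M = \<sigma>" "1 \<le> d" "d + esize e \<le> 65"
    and pf: "safe s \<sigma> f" "1 \<le> Suc d" "Suc d + esize f \<le> 65" using esize_pos[of f] esize_pos[of e] by auto
  obtain u M' where M': "exec (compile e d) M u M'" "view M' = \<sigma>" "M' (- int d) = val e \<sigma>"
    "\<forall>j<d. M' (- int j) = M (- int j)" "u \<le> 40 * s * (esize e)\<^sup>2"
    using Pl.IH(1)[OF pre] by blast
  obtain u2 M2 where M2: "exec (compile f (Suc d)) M' u2 M2" "view M2 = \<sigma>" "M2 (- int (Suc d)) = val f \<sigma>"
    "\<forall>j<Suc d. M2 (- int j) = M' (- int j)" "u2 \<le> 40 * s * (esize f)\<^sup>2"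
    using Pl.IH(2)[OF pf(1) M'(2) pf(2,3)] by blast
  have d: "- int d \<in> temp" "int_len (- int d) \<le> 8" "int_len (- int (Suc d)) \<le> 8"
    using Pl.prems pf esize_pos[of f] temp_len[of d] temp_len[of "Suc d"] by (auto simp: temp_def)
  have v: "M2 (- int d) = val e \<sigma>" using M2(4) M'(3) by simp
  let ?v = "val e \<sigma> + val f \<sigma>"
  define M'' where "M'' = M2(- int d := ?v)"
  define u' where "u' = 1 + (int_len (- int d) + int_len (val e \<sigma>)) + (int_len (- int (Suc d)) + int_len (val f \<sigma>)) + int_len (- int d) + int_len ?v"
  have "exec (Op (Reg (- int d)) arith.Add (Load (Reg (- int d))) (Load (Reg (- int (Suc d))))) M2 u' M''"
    using exec.Op[OF refl, of "Reg (- int d)" arith.Add "Load (Reg (- int d))" "Load (Reg (- int (Suc d)))" M2]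
    unfolding opval.simps addr.simps opval_cost.simps addr_cost.simps v M2(3) u'_def M''_def by simp
  then have ex: "exec (compile (Pl e f) d) M (u + (u2 + u')) M''" using M'(1) M2(1)
    unfolding compile.simps by (intro exec.Seq)
  have "int_len (val e \<sigma>) \<le> s * esize e + 2" "int_len (val f \<sigma>) \<le> s * esize f + 2" "int_len ?v \<le> s * (esize e + esize f) + 2"
    using int_len_le[OF val_le[OF assms(1,2) pre(1)]] int_len_le[OF val_le[OF assms(1,2) pf(1)]]
      int_len_le[OF val_le[OF assms(1,2) Pl.prems(1)]] by simp_all
  then have "u' \<le> 31 + 2 * (s * (esize e + esize f))" using d by (simp add: u'_def distrib_left)
  also have "\<dots> \<le> 40 * s * (esize e + esize f)"
  proof -
    have "1 * 1 \<le> s * (esize e + esize f)" using assms(2) esize_pos[of e] by (intro mult_le_mono) auto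
    then show ?thesis unfolding mult.assoc by linarith
  qed
  finally have u': "u' \<le> 40 * s * (esize e + esize f)" .
  have "esize e * 1 \<le> esize e * esize f" "1 * esize f \<le> esize e * esize f"
    by (intro mult_le_mono order.refl esize_pos)+
  then have "esize e + esize f \<le> 2 * (esize e * esize f)" by linarith
  then have "40 * s * (esize e + esize f) \<le> 40 * s * (2 * (esize e * esize f))" by (rule mult_le_mono2)
  then have "u + (u2 + u') \<le> 40 * s * (esize (Pl e f))\<^sup>2"
    using M'(5) M2(5) u' by (simp add: power2_eq_square algebra_simps)
  moreover have "view M'' = \<sigma>" "M'' (- int d) = val (Pl e f) \<sigma>" "\<forall>j<d. M'' (- int j) = M (- int j)"
    using M'(4) M2(2,4) d by (simp_all add: M''_def view_upd_temp)
  ultimately show ?case using ex by blast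
next
  case (Ti e f)
  from Ti.prems have pre: "safe s \<sigma> e" "view M = \<sigma>" "1 \<le> d" "d + esize e \<le> 65"
    and pf: "safe s \<sigma> f" "1 \<le> Suc d" "Suc d + esize f \<le> 65" using esize_pos[of f] esize_pos[of e] by auto
  obtain u M' where M': "exec (compile e d) M u M'" "view M' = \<sigma>" "M' (- int d) = val e \<sigma>"
    "\<forall>j<d. M' (- int j) = M (- int j)" "u \<le> 40 * s * (esize e)\<^sup>2"
    using Ti.IH(1)[OF pre] by blast
  obtain u2 M2 where M2: "exec (compile f (Suc d)) M' u2 M2" "view M2 = \<sigma>" "M2 (- int (Suc d)) = val f \<sigma>"
    "\<forall>j<Suc d. M2 (- int j) = M' (- int j)" "u2 \<le> 40 * s * (esize f)\<^sup>2"
    using Ti.IH(2)[OF pf(1) M'(2) pf(2,3)] by blast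
  have d: "- int d \<in> temp" "int_len (- int d) \<le> 8" "int_len (- int (Suc d)) \<le> 8"
    using Ti.prems pf esize_pos[of f] temp_len[of d] temp_len[of "Suc d"] by (auto simp: temp_def)
  have v: "M2 (- int d) = val e \<sigma>" using M2(4) M'(3) by simp
  let ?v = "val e \<sigma> * val f \<sigma>"
  define M'' where "M'' = M2(- int d := ?v)"
  define u' where "u' = 1 + (int_len (- int d) + int_len (val e \<sigma>)) + (int_len (- int (Suc d)) + int_len (val f \<sigma>)) + int_len (- int d) + int_len ?v"
  have "exec (Op (Reg (- int d)) arith.Mul (Load (Reg (- int d))) (Load (Reg (- int (Suc d))))) M2 u' M''"
    using exec.Op[OF refl, of "Reg (- int d)" arith.Mul "Load (Reg (- int d))" "Load (Reg (- int (Suc d)))" M2]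
    unfolding opval.simps addr.simps opval_cost.simps addr_cost.simps v M2(3) u'_def M''_def by simp
  then have ex: "exec (compile (Ti e f) d) M (u + (u2 + u')) M''" using M'(1) M2(1)
    unfolding compile.simps by (intro exec.Seq)
  have "int_len (val e \<sigma>) \<le> s * esize e + 2" "int_len (val f \<sigma>) \<le> s * esize f + 2" "int_len ?v \<le> s * (esize e + esize f) + 2"
    using int_len_le[OF val_le[OF assms(1,2) pre(1)]] int_len_le[OF val_le[OF assms(1,2) pf(1)]]
      int_len_le[OF val_le[OF assms(1,2) Ti.prems(1)]] by simp_all
  then have "u' \<le> 31 + 2 * (s * (esize e + esize f))" using d by (simp add: u'_def distrib_left)
  also have "\<dots> \<le> 40 * s * (esize e + esize f)"
  proof -
    have "1 * 1 \<le> s * (esize e + esize f)" using assms(2) esize_pos[of e] by (intro mult_le_mono) auto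
    then show ?thesis unfolding mult.assoc by linarith
  qed
  finally have u': "u' \<le> 40 * s * (esize e + esize f)" .
  have "esize e * 1 \<le> esize e * esize f" "1 * esize f \<le> esize e * esize f"
    by (intro mult_le_mono order.refl esize_pos)+
  then have "esize e + esize f \<le> 2 * (esize e * esize f)" by linarith
  then have "40 * s * (esize e + esize f) \<le> 40 * s * (2 * (esize e * esize f))" by (rule mult_le_mono2)
  then have "u + (u2 + u') \<le> 40 * s * (esize (Ti e f))\<^sup>2"
    using M'(5) M2(5) u' by (simp add: power2_eq_square algebra_simps)
  moreover have "view M'' = \<sigma>" "M'' (- int d) = val (Ti e f) \<sigma>" "\<forall>j<d. M'' (- int j) = M (- int j)"
    using M'(4) M2(2,4) d by (simp_all add: M''_def view_upd_temp)
  ultimately show ?case using ex by blast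
qed

text \<open>A total-correctness triple on states seen through \<open>view\<close>; the contents of
  the temporaries are arbitrary at the start. Costs are counted in units of \<open>s\<close>, so
  that \<open>k\<close> can be computed from the program and the numbers of loop rounds
  alone.\<close>

definition runs :: "nat \<Rightarrow> com \<Rightarrow> nat \<Rightarrow> memory \<Rightarrow> (memory \<Rightarrow> bool) \<Rightarrow> bool" where
  "runs s c k \<sigma> Q \<longleftrightarrow> (\<forall>M. view M = \<sigma> \<longrightarrow> (\<exists>u M'. exec c M u M' \<and> Q (view M') \<and> u \<le> k * s))"

definition asg :: "int \<Rightarrow> expr \<Rightarrow> com" where
  "asg i e = Seq (compile e 1) (Op (Reg i) arith.Add (Load (Reg (-1))) (Lit 0))"

definition store :: "expr \<Rightarrow> expr \<Rightarrow> com" where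
  "store f e = Seq (compile f 1) (Seq (compile e 2) (Op (Ind (-1)) arith.Add (Load (Reg (-2))) (Lit 0)))"

text \<open>The machine tests a single operand, so the condition is evaluated into register -1
  before the loop and again at the end of each round.\<close>

definition while_loop :: "expr \<Rightarrow> com \<Rightarrow> com" where
  "while_loop e c = Seq (compile e 1) (WhilePos (Load (Reg (-1))) (Seq c (compile e 1)))"

text \<open>Counting down evaluates the bound only once and leaves the counter at 0, the value that
  the invariants of later loops assume.\<close>

definition for_loop :: "int \<Rightarrow> expr \<Rightarrow> com \<Rightarrow> com" where
  "for_loop i e c = Seq (asg i e) (while_loop (Vr i) (Seq (asg i (Pl (Vr i) (Cn (-1)))) c))"

text \<open>The constant is 40 for the evaluation by \<open>compile_correct\<close> plus 20 for the
  operation that consumes the value.\<close>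

definition ecost :: "expr \<Rightarrow> nat" where "ecost e = 60 * (esize e)\<^sup>2"

lemma runs_mono:
  assumes "runs s c k \<sigma> Q" "\<And>\<sigma>'. Q \<sigma>' \<Longrightarrow> Q' \<sigma>'" "k \<le> k'"
  shows "runs s c k' \<sigma> Q'"
  unfolding runs_def
proof (intro allI impI)
  fix M assume "view M = \<sigma>"
  then obtain u M' where "exec c M u M'" "Q (view M')" "u \<le> k * s" using assms(1) unfolding runs_def by blast
  moreover have "k * s \<le> k' * s" using assms(3) by simp
  ultimately show "\<exists>u M'. exec c M u M' \<and> Q' (view M') \<and> u \<le> k' * s" using assms(2) by (meson order_trans)
qed

lemma runs_Seq:
  assumes "runs s c k \<sigma> (\<lambda>\<sigma>'. runs s c' k' \<sigma>' Q)"
  shows "runs s (Seq c c') (k + k') \<sigma> Q"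
  unfolding runs_def
proof (intro allI impI)
  fix M assume "view M = \<sigma>"
  then obtain u M' where 1: "exec c M u M'" "runs s c' k' (view M') Q" "u \<le> k * s"
    using assms unfolding runs_def by blast
  then obtain u' M'' where 2: "exec c' M' u' M''" "Q (view M'')" "u' \<le> k' * s"
    unfolding runs_def by blast
  show "\<exists>u M'. exec (Seq c c') M u M' \<and> Q (view M') \<and> u \<le> (k + k') * s"
    using exec.Seq[OF 1(1) 2(1)] 1(3) 2(2,3)
    by (intro exI[of _ "u + u'"] exI[of _ M'']) (simp add: algebra_simps)
qed

lemma runs_asg:
  assumes "bounded s \<sigma>" "1 \<le> s" "safe s \<sigma> e" "esize e \<le> 64" "i \<notin> temp" "\<bar>i\<bar> \<le> 2 ^ s" "Q (\<sigma>(i := val e \<sigma>))"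
  shows "runs s (asg i e) (ecost e) \<sigma> Q"
  unfolding runs_def
proof (intro allI impI)
  fix M assume M: "view M = \<sigma>"
  obtain u M' where M': "exec (compile e 1) M u M'" "view M' = \<sigma>" "M' (- 1) = val e \<sigma>" "u \<le> 40 * s * (esize e)\<^sup>2"
    using compile_correct[OF assms(1-3) M, of 1] assms(4) by auto
  define u' where "u' = 1 + (int_len (-1) + int_len (val e \<sigma>)) + int_len 0 + int_len i + int_len (val e \<sigma>)"
  have ex: "exec (asg i e) M (u + u') (M'(i := val e \<sigma>))"
    unfolding asg_def
    by (rule exec.Seq[OF M'(1)])
      (use exec.Op[OF refl, of "Reg i" arith.Add "Load (Reg (-1))" "Lit 0" M'] in \<open>simp add: u'_def M'(3)\<close>)
  have "int_len (-1) \<le> 2" "int_len 0 \<le> 2" "int_len i \<le> s + 2" "int_len (val e \<sigma>) \<le> s * esize e + 2"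
    using int_len_le[of "-1" 0] int_len_le[of 0 0] int_len_le[OF assms(6)] int_len_le[OF val_le[OF assms(1-3)]] by auto
  then have "u' \<le> 11 + s + 2 * (s * esize e)" by (simp add: u'_def)
  moreover have "s \<le> s * esize e" "s * esize e \<le> s * (esize e)\<^sup>2" using esize_pos[of e] by (auto simp: power2_eq_square)
  ultimately have "u' \<le> 20 * (s * (esize e)\<^sup>2)" using assms(2) by linarith
  then have "u + u' \<le> ecost e * s" using M'(4) by (simp add: ecost_def algebra_simps)
  then show "\<exists>u M'. exec (asg i e) M u M' \<and> Q (view M') \<and> u \<le> ecost e * s"
    using ex assms(5,7) M'(2) by (intro exI[of _ "u + u'"] exI[of _ "M'(i := val e \<sigma>)"]) (simp add: view_upd)
qed

lemma runs_store:
  assumes "bounded s \<sigma>" "1 \<le> s" "safe s \<sigma> e" "esize e \<le> 63" "safe s \<sigma> f" "esize f \<le> 64"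
    "val f \<sigma> \<notin> temp" "Q (\<sigma>(val f \<sigma> := val e \<sigma>))"
  shows "runs s (store f e) (ecost e + ecost f) \<sigma> Q"
  unfolding runs_def
proof (intro allI impI)
  fix M assume M: "view M = \<sigma>"
  obtain u M' where M': "exec (compile f 1) M u M'" "view M' = \<sigma>" "M' (- 1) = val f \<sigma>" "u \<le> 40 * s * (esize f)\<^sup>2"
    using compile_correct[OF assms(1,2,5) M, of 1] assms(6) by auto
  obtain u2 M2 where M2: "exec (compile e 2) M' u2 M2" "view M2 = \<sigma>" "M2 (- 2) = val e \<sigma>"
     "\<forall>j<2. M2 (- int j) = M' (- int j)" "u2 \<le> 40 * s * (esize e)\<^sup>2"
    using compile_correct[OF assms(1,2,3) M'(2), of 2] assms(4) by auto
  have m1: "M2 (-1) = val f \<sigma>" using M2(4)[rule_format, of 1] M'(3) by simp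
  define u' where "u' = 1 + (int_len (-2) + int_len (val e \<sigma>)) + int_len 0 + (int_len (-1) + int_len (val f \<sigma>)) + int_len (val e \<sigma>)"
  have ex: "exec (store f e) M (u + (u2 + u')) (M2(val f \<sigma> := val e \<sigma>))"
    unfolding store_def
    by (rule exec.Seq[OF M'(1) exec.Seq[OF M2(1)]])
      (use exec.Op[OF refl, of "Ind (-1)" arith.Add "Load (Reg (-2))" "Lit 0" M2] in \<open>simp add: u'_def M2(3) m1\<close>)
  have "int_len (-1) \<le> 2" "int_len (-2) \<le> 3" "int_len 0 \<le> 2" "int_len (val e \<sigma>) \<le> s * esize e + 2" "int_len (val f \<sigma>) \<le> s * esize f + 2"
    using int_len_le[of "-1" 0] int_len_le[of "-2" 1] int_len_le[of 0 0] int_len_le[OF val_le[OF assms(1-3)]]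
      int_len_le[OF val_le[OF assms(1,2,5)]] by auto
  then have "u' \<le> 14 + s * esize f + 2 * (s * esize e)" by (simp add: u'_def)
  moreover have "s * esize f \<le> s * (esize f)\<^sup>2" "s \<le> s * esize e" "s * esize e \<le> s * (esize e)\<^sup>2"
    using esize_pos[of e] esize_pos[of f] by (auto simp: power2_eq_square)
  ultimately have "u' \<le> 20 * (s * (esize e)\<^sup>2) + 20 * (s * (esize f)\<^sup>2)" using assms(2) by linarith
  then have "u + (u2 + u') \<le> (ecost e + ecost f) * s" using M'(4) M2(5) by (simp add: ecost_def algebra_simps)
  then show "\<exists>u M'. exec (store f e) M u M' \<and> Q (view M') \<and> u \<le> (ecost e + ecost f) * s"
    using ex assms(7,8) M2(2) by (intro exI[of _ "u + (u2 + u')"] exI[of _ "M2(val f \<sigma> := val e \<sigma>)"]) (simp add: view_upd)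
qed

text \<open>The invariant is indexed by the number of completed rounds, so \<open>n\<close> is the
  exact number of rounds. The additional unit in \<open>Suc n\<close> pays for the first evaluation
  of the condition and the last test.\<close>

lemma runs_while:
  assumes s: "1 \<le> s" and e: "esize e \<le> 64"
    and I0: "I 0 \<sigma>"
    and step: "\<And>i \<sigma>. i < n \<Longrightarrow> I i \<sigma> \<Longrightarrow> 0 < val e \<sigma> \<and> runs s c k \<sigma> (I (Suc i))"
    and stop: "\<And>\<sigma>. I n \<sigma> \<Longrightarrow> val e \<sigma> \<le> 0 \<and> Q \<sigma>"
    and ok: "\<And>i \<sigma>. i \<le> n \<Longrightarrow> I i \<sigma> \<Longrightarrow> bounded s \<sigma> \<and> safe s \<sigma> e"
  shows "runs s (while_loop e c) (Suc n * (k + ecost e)) \<sigma> Q"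
proof -
  let ?w = "WhilePos (Load (Reg (-1))) (Seq c (compile e 1))"
  have test: "1 + opval_cost M (Load (Reg (-1))) \<le> 10 * s * (esize e)\<^sup>2"
    if "M (-1) = val e \<sigma>" "bounded s \<sigma>" "safe s \<sigma> e" for M \<sigma>
  proof -
    have "int_len (-1) \<le> 2" "int_len (val e \<sigma>) \<le> s * esize e + 2"
      using int_len_le[of "-1" 0] int_len_le[OF val_le[OF that(2) s that(3)]] by auto
    moreover have "s \<le> s * esize e" "s * esize e \<le> s * (esize e)\<^sup>2"
      using esize_pos[of e] by (auto simp: power2_eq_square)
    moreover have "opval_cost M (Load (Reg (-1))) = int_len (-1) + int_len (val e \<sigma>)" using that(1) by simp
    ultimately show ?thesis using s unfolding mult.assoc by linarith
  qed
  have loop: "\<exists>u M'. exec ?w M u M' \<and> Q (view M') \<and> u \<le> (j * (k + ecost e) + 10 * (esize e)\<^sup>2) * s"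
    if "I i (view M)" "i + j = n" "M (-1) = val e (view M)" for i j M
    using that
  proof (induction j arbitrary: i M)
    case 0
    then have "val e (view M) \<le> 0" "Q (view M)" "bounded s (view M)" "safe s (view M) e"
      using stop ok[of i] by auto
    moreover from this have "exec ?w M (1 + opval_cost M (Load (Reg (-1)))) M"
      by (intro exec.WhileFalse) (use 0(3) in simp)
    moreover have "1 + opval_cost M (Load (Reg (-1))) \<le> (0 * (k + ecost e) + 10 * (esize e)\<^sup>2) * s"
      using test[of M "view M"] 0(3) calculation by (simp only: mult_0 add_0) (simp add: mult_ac)
    ultimately show ?case by blast
  next
    case (Suc j)
    then have i: "i < n" and ok_i: "bounded s (view M)" "safe s (view M) e" using ok[of i] by auto
    from step[OF i Suc.prems(1)] obtain u1 M1 where 1: "exec c M u1 M1" "I (Suc i) (view M1)" "u1 \<le> k * s"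
      and pos: "0 < val e (view M)"
      unfolding runs_def by blast
    have ok1: "bounded s (view M1)" "safe s (view M1) e" using ok[of "Suc i"] 1(2) i by auto
    obtain u2 M2 where 2: "exec (compile e 1) M1 u2 M2" "view M2 = view M1" "M2 (-1) = val e (view M1)" "u2 \<le> 40 * s * (esize e)\<^sup>2"
      using compile_correct[OF ok1(1) s ok1(2) refl, of 1] e by auto
    obtain u3 M3 where 3: "exec ?w M2 u3 M3" "Q (view M3)" "u3 \<le> (j * (k + ecost e) + 10 * (esize e)\<^sup>2) * s"
      using Suc.IH[of "Suc i" M2] 1 2 Suc.prems by auto
    have "exec ?w M (1 + opval_cost M (Load (Reg (-1))) + (u1 + u2) + u3) M3"
      by (rule exec.WhileTrue[OF _ exec.Seq[OF 1(1) 2(1)] 3(1)]) (use pos Suc.prems(3) in simp)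
    moreover have "1 + opval_cost M (Load (Reg (-1))) + (u1 + u2) + u3 \<le> (Suc j * (k + ecost e) + 10 * (esize e)\<^sup>2) * s"
      using test[of M "view M", OF Suc.prems(3) ok_i] 1(3) 2(4) 3(3) by (simp add: ecost_def algebra_simps)
    ultimately show ?case using 3(2) by blast
  qed
  show ?thesis unfolding runs_def
  proof (intro allI impI)
    fix M assume M: "view M = \<sigma>"
    have ok0: "bounded s \<sigma>" "safe s \<sigma> e" using ok[OF _ I0] by auto
    obtain u M' where 1: "exec (compile e 1) M u M'" "view M' = \<sigma>" "M' (-1) = val e \<sigma>" "u \<le> 40 * s * (esize e)\<^sup>2"
      using compile_correct[OF ok0(1) s ok0(2) M, of 1] e by auto
    obtain u2 M2 where 2: "exec ?w M' u2 M2" "Q (view M2)" "u2 \<le> (n * (k + ecost e) + 10 * (esize e)\<^sup>2) * s"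
      using loop[of 0 M' n] 1 I0 by auto
    have "u + u2 \<le> (Suc n * (k + ecost e)) * s" using 1(4) 2(3) by (simp add: ecost_def algebra_simps)
    then show "\<exists>u M'. exec (while_loop e c) M u M' \<and> Q (view M') \<and> u \<le> Suc n * (k + ecost e) * s"
      unfolding while_loop_def using exec.Seq[OF 1(1) 2(1)] 2(2) by blast
  qed
qed

text \<open>The index of the invariant is the value of the counter and decreases. The overhead 300
  per round consists of 240 for the decrement and 60 for the condition.\<close>

lemma runs_for:
  assumes s: "1 \<le> s" and \<sigma>: "bounded s \<sigma>" "safe s \<sigma> e" "esize e \<le> 64" "val e \<sigma> = int n"
    and i: "i \<notin> temp" "\<bar>i\<bar> \<le> 2 ^ s"
    and I0: "I n (\<sigma>(i := int n))"
    and step: "\<And>j \<sigma>. j < n \<Longrightarrow> I (Suc j) \<sigma> \<Longrightarrow> runs s c k (\<sigma>(i := int j)) (I j)"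
    and stop: "\<And>\<sigma>. I 0 \<sigma> \<Longrightarrow> Q \<sigma>"
    and ok: "\<And>j \<sigma>. j \<le> n \<Longrightarrow> I j \<sigma> \<Longrightarrow> bounded s \<sigma> \<and> \<sigma> i = int j"
  shows "runs s (for_loop i e c) (ecost e + Suc n * (k + 300)) \<sigma> Q"
  unfolding for_loop_def
proof (intro runs_Seq runs_asg)
  let ?\<sigma> = "\<sigma>(i := val e \<sigma>)"
  let ?dec = "Pl (Vr i) (Cn (-1))"
  have "runs s (while_loop (Vr i) (Seq (asg i ?dec) c)) (Suc n * ((ecost ?dec + k) + ecost (Vr i))) ?\<sigma> Q"
  proof (rule runs_while[where I = "\<lambda>j \<sigma>. I (n - j) \<sigma>"])
    show "I (n - 0) ?\<sigma>" using I0 \<sigma>(4) by simp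
    fix j \<sigma>' assume j: "j < n" "I (n - j) \<sigma>'"
    then have o: "bounded s \<sigma>'" "\<sigma>' i = int (n - j)" using ok[of "n - j"] by auto
    have "runs s (asg i ?dec) (ecost ?dec) \<sigma>' (\<lambda>\<sigma>'. runs s c k \<sigma>' (I (n - Suc j)))"
    proof (rule runs_asg)
      have n: "n - j = Suc (n - Suc j)" using j by simp
      then have v: "val ?dec \<sigma>' = int (n - Suc j)" using o(2) by simp
      show "runs s c k (\<sigma>'(i := val ?dec \<sigma>')) (I (n - Suc j))"
        unfolding v by (rule step) (use j n in auto)
      have "(1 :: int) \<le> 2 ^ s" by simp
      then show "safe s \<sigma>' ?dec" using i by simp
    qed (use o s i in auto)
    then show "0 < val (Vr i) \<sigma>' \<and> runs s (Seq (asg i ?dec) c) (ecost ?dec + k) \<sigma>' (I (n - Suc j))"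
      using o j runs_Seq by auto
  next
    fix \<sigma>' assume "I (n - n) \<sigma>'"
    then show "val (Vr i) \<sigma>' \<le> 0 \<and> Q \<sigma>'" using ok[of 0 \<sigma>'] stop[of \<sigma>'] by simp
  next
    fix j \<sigma>' assume "j \<le> n" "I (n - j) \<sigma>'"
    then show "bounded s \<sigma>' \<and> safe s \<sigma>' (Vr i)" using ok[of "n - j"] i by auto
  qed (use s in auto)
  then show "runs s (while_loop (Vr i) (Seq (asg i ?dec) c)) (Suc n * (k + 300)) ?\<sigma> Q"
    by (rule runs_mono) (auto simp: ecost_def power2_eq_square algebra_simps)
qed (use \<sigma> s i in auto)

section \<open>Evaluation of all equations with controlled bit length\<close>

section \<open>Checking blocks of equations\<close>

text \<open>Registers: the dimensions in \<open>-105, \<dots>, -101\<close>, the number of matrix entries in \<open>-106\<close>, the loop counters, the accumulator of one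
  equation, and the sum of the squared errors of all equations. Item \<open>i\<close> of the parsed input occupies
  the cells \<open>-1000 - c - 5 i\<close>, \<open>c < 5\<close>.\<close>

abbreviation "rI \<equiv> -111 :: int"
abbreviation "rJ \<equiv> -112 :: int"
abbreviation "rL \<equiv> -113 :: int"
abbreviation "rAcc \<equiv> -114 :: int"
abbreviation "rBad \<equiv> -115 :: int"

definition dims :: "int set" where "dims = {-106..-101}"
definition idxs :: "int set" where "idxs = {-113..-111} \<union> dims"

text \<open>Constants are nonnegative, so over nonnegative registers the value is nonnegative, and a
  cell address computed from it stays at -1000 or below, away from the temporaries and the other
  registers.\<close>

fun index_expr :: "int set \<Rightarrow> expr \<Rightarrow> bool" where
  "index_expr A (Cn z) \<longleftrightarrow> 0 \<le> z \<and> z \<le> 2000"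
| "index_expr A (Vr i) \<longleftrightarrow> i \<in> A"
| "index_expr A (Pl e f) \<longleftrightarrow> index_expr A e \<and> index_expr A f"
| "index_expr A (Ti e f) \<longleftrightarrow> index_expr A e \<and> index_expr A f"
| "index_expr A (Rd e) \<longleftrightarrow> False"

definition cell :: "nat \<Rightarrow> expr \<Rightarrow> expr" where
  "cell c e = Rd (Pl (Cn (- 1000 - int c)) (Ti (Cn (-5)) e))"

inductive cell_expr :: "expr \<Rightarrow> bool" where
  "\<bar>z\<bar> \<le> 2000 \<Longrightarrow> cell_expr (Cn z)"
| "index_expr idxs e \<Longrightarrow> c < 5 \<Longrightarrow> cell_expr (cell c e)"
| "cell_expr e \<Longrightarrow> cell_expr f \<Longrightarrow> cell_expr (Pl e f)"
| "cell_expr e \<Longrightarrow> cell_expr f \<Longrightarrow> cell_expr (Ti e f)"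

text \<open>The two accumulators are exempt from the bound: they outgrow \<open>s\<close> bits while
  everything else stays small. This separates the input size \<open>s\<close> from the unit of cost
  \<open>s'\<close>.\<close>

definition base :: "nat \<Rightarrow> memory \<Rightarrow> bool" where
  "base s \<sigma> \<longleftrightarrow> (\<forall>i. i \<noteq> rAcc \<longrightarrow> i \<noteq> rBad \<longrightarrow> \<bar>\<sigma> i\<bar> \<le> 2 ^ s) \<and> (\<forall>i\<in>idxs. 0 \<le> \<sigma> i)"

lemma idxs_simps: "idxs = {-113, -112, -111, -106, -105, -104, -103, -102, -101}"
  "dims = {-106, -105, -104, -103, -102, -101}"
proof -
  show d: "dims = {-106, -105, -104, -103, -102, -101}" by (auto simp: dims_def)
  show "idxs = {-113, -112, -111, -106, -105, -104, -103, -102, -101}" unfolding idxs_def d by auto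
qed

lemma base_upd: "base s \<sigma> \<Longrightarrow> 0 \<le> v \<Longrightarrow> v \<le> 2 ^ s \<Longrightarrow> base s (\<sigma>(i := v))"
  by (auto simp: base_def)

lemma base_upd_work: "base s \<sigma> \<Longrightarrow> i = rAcc \<or> i = rBad \<Longrightarrow> base s (\<sigma>(i := v))"
  by (auto simp: base_def idxs_simps)

lemma base_bounded:
  "base s \<sigma> \<Longrightarrow> s \<le> s' \<Longrightarrow> \<bar>\<sigma> rAcc\<bar> \<le> 2 ^ s' \<Longrightarrow> \<bar>\<sigma> rBad\<bar> \<le> 2 ^ s' \<Longrightarrow> bounded s' \<sigma>"
  unfolding bounded_def base_def
proof
  fix i
  assume *: "(\<forall>i. i \<noteq> rAcc \<longrightarrow> i \<noteq> rBad \<longrightarrow> \<bar>\<sigma> i\<bar> \<le> 2 ^ s) \<and> (\<forall>i\<in>idxs. 0 \<le> \<sigma> i)" "s \<le> s'"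
    "\<bar>\<sigma> rAcc\<bar> \<le> 2 ^ s'" "\<bar>\<sigma> rBad\<bar> \<le> 2 ^ s'"
  have "(2 :: int) ^ s \<le> 2 ^ s'" using *(2) by (intro power_increasing) auto
  then show "\<bar>\<sigma> i\<bar> \<le> 2 ^ s'" using * by (metis order_trans)
qed

text \<open>The bound 11 comes from \<open>2 ^ 11 = 2048\<close>; 2000 exceeds every register number
  and constant of the program.\<close>

lemma const_le: "11 \<le> s \<Longrightarrow> \<bar>z\<bar> \<le> 2000 \<Longrightarrow> \<bar>z\<bar> \<le> (2 :: int) ^ s"
  using power_increasing[of 11 s "2 :: int"] by simp

lemma index_expr_mono: "index_expr A e \<Longrightarrow> A \<subseteq> B \<Longrightarrow> index_expr B e"
  by (induction e) auto

lemma index_expr_cong: "index_expr A e \<Longrightarrow> (\<And>i. i \<in> A \<Longrightarrow> \<sigma> i = \<sigma>' i) \<Longrightarrow> val e \<sigma> = val e \<sigma>'"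
  by (induction e) auto

lemma index_expr_nonneg: "index_expr A e \<Longrightarrow> (\<And>i. i \<in> A \<Longrightarrow> 0 \<le> \<sigma> i) \<Longrightarrow> 0 \<le> val e \<sigma>"
  by (induction e) auto

lemma index_expr_safe: "index_expr idxs e \<Longrightarrow> 11 \<le> s \<Longrightarrow> safe s \<sigma> e"
proof (induction e)
  case (Vr i)
  then have "\<bar>i\<bar> \<le> 2000" "i \<notin> temp" by (auto simp: idxs_simps temp_def)
  then show ?case using const_le[of s i] Vr by simp
next
  case (Cn z)
  then show ?case using const_le[of s z] by simp
qed auto

lemma cell_expr_safe:
  assumes "cell_expr e" "base s \<sigma>" "11 \<le> s'"
  shows "safe s' \<sigma> e"
  using assms(1)
proof (induction rule: cell_expr.induct)
  case (2 e c)
  have "0 \<le> val e \<sigma>" using 2 assms(2) by (intro index_expr_nonneg[OF 2(1)]) (auto simp: base_def)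
  then have "- 1000 - int c + - 5 * val e \<sigma> < - 64" by simp
  then show ?case using 2 assms(3) index_expr_safe[OF 2(1) assms(3)] const_le[of s' "-1000 - int c"] const_le[of s' "-5"]
    by (simp add: cell_def temp_def)
qed (use assms(3) in \<open>auto simp: const_le\<close>)

lemma cell_expr_cong:
  assumes "cell_expr e" "base s \<sigma>" "\<And>i. i \<noteq> rAcc \<Longrightarrow> i \<noteq> rBad \<Longrightarrow> \<sigma> i = \<sigma>' i"
  shows "val e \<sigma> = val e \<sigma>'"
  using assms(1)
proof (induction rule: cell_expr.induct)
  case (2 e c)
  have "0 \<le> val e \<sigma>" using 2 assms(2) by (intro index_expr_nonneg[OF 2(1)]) (auto simp: base_def)
  moreover have "val e \<sigma> = val e \<sigma>'" by (rule index_expr_cong[OF 2(1)]) (auto intro!: assms(3) simp: idxs_simps)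
  ultimately show ?case by (simp add: cell_def) (auto intro!: assms(3))
qed auto

lemma cell_expr_le:
  assumes "cell_expr e" "base s \<sigma>" "11 \<le> s"
  shows "\<bar>val e \<sigma>\<bar> \<le> 2 ^ (s * esize e)"
proof -
  \<comment> \<open>The accumulators may exceed \<open>s\<close> bits; since a cell expression does
    not read them, they can be cleared before \<open>val_le\<close> is applied.\<close>
  let ?\<sigma> = "\<sigma>(rAcc := 0, rBad := 0)"
  have b: "base s ?\<sigma>" using assms(2) by (intro base_upd_work) auto
  then have "\<bar>val e ?\<sigma>\<bar> \<le> 2 ^ (s * esize e)"
    using assms by (intro val_le cell_expr_safe[OF assms(1) b]) (auto intro: base_bounded)
  moreover have "val e \<sigma> = val e ?\<sigma>" by (rule cell_expr_cong[OF assms(1,2)]) auto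
  ultimately show ?thesis by simp
qed

text \<open>A triple \<open>(e, f, ts)\<close> is a family of equations indexed by
  \<open>i < e\<close> and \<open>j < f\<close>. Each pair in \<open>ts\<close> contributes a sum
  over \<open>l\<close> whose range is the first component and whose summand is the second; a range
  of 1 gives a single term.\<close>

type_synonym eqn_block = "expr \<times> expr \<times> (expr \<times> expr) list"

definition lsum :: "memory \<Rightarrow> expr \<times> expr \<Rightarrow> int" where
  "lsum \<sigma> t = (\<Sum>l<nat (val (fst t) \<sigma>). val (snd t) (\<sigma>(rL := int l)))"

definition sat :: "memory \<Rightarrow> eqn_block \<Rightarrow> bool" where
  "sat \<sigma> b \<longleftrightarrow> (case b of (e, f, ts) \<Rightarrow> \<forall>i<nat (val e \<sigma>). \<forall>j<nat (val f \<sigma>).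
     sum_list (map (lsum (\<sigma>(rI := int i, rJ := int j))) ts) = 0)"

definition sum_loop :: "expr \<times> expr \<Rightarrow> com" where
  "sum_loop t = for_loop rL (fst t) (asg rAcc (Pl (Vr rAcc) (snd t)))"

fun seq :: "com list \<Rightarrow> com" where
  "seq [] = Skip"
| "seq (c # cs) = Seq c (seq cs)"

definition block_com :: "eqn_block \<Rightarrow> com" where
  "block_com b = (case b of (e, f, ts) \<Rightarrow> for_loop rI e (for_loop rJ f
     (Seq (asg rAcc (Cn 0)) (Seq (seq (map sum_loop ts)) (asg rBad (Pl (Vr rBad) (Ti (Vr rAcc) (Vr rAcc))))))))"

definition ok_term :: "expr \<times> expr \<Rightarrow> bool" where
  "ok_term t \<longleftrightarrow> index_expr dims (fst t) \<and> esize (fst t) \<le> 60 \<and> cell_expr (snd t) \<and> esize (snd t) \<le> 60"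

definition ok_block :: "eqn_block \<Rightarrow> bool" where
  "ok_block b \<longleftrightarrow> (case b of (e, f, ts) \<Rightarrow> index_expr dims e \<and> esize e \<le> 60 \<and> index_expr dims f \<and> esize f \<le> 60 \<and>
     length ts \<le> 100 \<and> (\<forall>t\<in>set ts. ok_term t))"

definition ranges_le :: "nat \<Rightarrow> memory \<Rightarrow> eqn_block \<Rightarrow> bool" where
  "ranges_le K \<sigma> b \<longleftrightarrow> (case b of (e, f, ts) \<Rightarrow> val e \<sigma> \<le> int K \<and> val f \<sigma> \<le> int K \<and>
     (\<forall>t\<in>set ts. val (fst t) \<sigma> \<le> int K))"

lemma index_dims_idxs: "index_expr dims e \<Longrightarrow> index_expr idxs e"
  by (erule index_expr_mono) (auto simp: idxs_def)

lemma ecost_le: "esize e \<le> 62 \<Longrightarrow> ecost e \<le> 230640"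
  unfolding ecost_def using power_mono[of "esize e" 62 2] by simp

lemma sum_abs_le:
  assumes "\<And>l. l \<in> A \<Longrightarrow> \<bar>f l\<bar> \<le> (2 :: int) ^ a" "card A \<le> (2 :: nat) ^ b"
  shows "\<bar>sum f A\<bar> \<le> 2 ^ (a + b)"
proof -
  have "\<bar>sum f A\<bar> \<le> (\<Sum>l\<in>A. \<bar>f l\<bar>)" by (rule sum_abs)
  also have "\<dots> \<le> (\<Sum>l\<in>A. 2 ^ a)" using assms(1) by (rule sum_mono)
  also have "\<dots> = int (card A) * 2 ^ a" by simp
  also have "\<dots> \<le> 2 ^ b * 2 ^ a"
  proof (rule mult_right_mono)
    have "int (card A) \<le> int (2 ^ b)" using assms(2) by (simp only: of_nat_le_iff)
    then show "int (card A) \<le> 2 ^ b" by simp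
  qed simp
  finally show ?thesis by (simp add: power_add mult.commute)
qed

text \<open>Every summand has at most \<open>60 * s\<close> bits and there are at most
  \<open>2 ^ s\<close> of them, so each of the \<open>c\<close> terms added so far contributes at
  most \<open>2 ^ (61 * s)\<close>.\<close>

lemma runs_sum_loop:
  assumes t: "ok_term t" and \<sigma>: "base s \<sigma>" "\<sigma> rL = 0" "11 \<le> s" and s': "400 * s \<le> s'"
    and K: "val (fst t) \<sigma> \<le> int K" "K \<le> 2 ^ s" and bad: "\<bar>\<sigma> rBad\<bar> \<le> 2 ^ s'"
    and acc: "\<bar>\<sigma> rAcc\<bar> \<le> int c * 2 ^ (61 * s)" "c < 100"
  shows "runs s' (sum_loop t) (Suc (Suc K) * 231000) \<sigma> (\<lambda>\<sigma>'. \<sigma>' = \<sigma>(rAcc := \<sigma> rAcc + lsum \<sigma> t) \<and>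
    \<bar>\<sigma>' rAcc\<bar> \<le> int (Suc c) * 2 ^ (61 * s))"
proof -
  obtain e f where tt: "t = (e, f)" by fastforce
  from t have e: "index_expr dims e" "esize e \<le> 60" and f: "cell_expr f" "esize f \<le> 60"
    by (auto simp: ok_term_def tt)
  define n where "n = nat (val e \<sigma>)"
  have "0 \<le> val e \<sigma>" using \<sigma>(1) by (intro index_expr_nonneg[OF e(1)]) (auto simp: base_def idxs_def)
  then have n: "val e \<sigma> = int n" "n \<le> K" using K by (auto simp: n_def tt)
  have n2: "int j \<le> 2 ^ s" if "j \<le> n" for j
  proof -
    have "j \<le> 2 ^ s" using that n K by linarith
    then have "int j \<le> int (2 ^ s)" by (simp only: of_nat_le_iff)
    then show ?thesis by simp
  qed
  \<comment> \<open>The state in which the counter stands at \<open>j\<close>. As the loop counts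
    down, the summands from \<open>j\<close> to \<open>n - 1\<close> have already been
    added.\<close>
  define F where "F = (\<lambda>j. \<sigma>(rL := int j, rAcc := \<sigma> rAcc + (\<Sum>l = j..<n. val f (\<sigma>(rL := int l)))))"
  have vf: "\<bar>val f (\<sigma>(rL := int j))\<bar> \<le> 2 ^ (60 * s)" if "j \<le> n" for j
  proof -
    have "\<bar>val f (\<sigma>(rL := int j))\<bar> \<le> 2 ^ (s * esize f)"
      using \<sigma> n2[OF that] by (intro cell_expr_le[OF f(1)] base_upd) auto
    also have "\<dots> \<le> 2 ^ (60 * s)" using f(2) by (intro power_increasing) auto
    finally show ?thesis .
  qed
  have sumle: "\<bar>\<Sum>l = j..<n. val f (\<sigma>(rL := int l))\<bar> \<le> 2 ^ (61 * s)" for j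
  proof -
    have "\<bar>\<Sum>l = j..<n. val f (\<sigma>(rL := int l))\<bar> \<le> 2 ^ (60 * s + s)"
      by (rule sum_abs_le) (use vf n(2) K in auto)
    then show ?thesis by (simp add: algebra_simps)
  qed
  have accle: "\<bar>F j rAcc\<bar> \<le> int (Suc c) * 2 ^ (61 * s)" for j
    using sumle[of j] acc by (simp add: F_def algebra_simps)
  have big: "int (Suc c) * 2 ^ (61 * s) \<le> 2 ^ s'"
  proof -
    have "int (Suc c) \<le> 2 ^ s" using acc(2) const_le[OF \<sigma>(3), of "int (Suc c)"] by simp
    then have "int (Suc c) * 2 ^ (61 * s) \<le> 2 ^ s * 2 ^ (61 * s)" by (intro mult_right_mono) auto
    also have "\<dots> = 2 ^ (62 * s)" by (simp add: power_add[symmetric])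
    also have "\<dots> \<le> 2 ^ s'" using s' by (intro power_increasing) auto
    finally show ?thesis .
  qed
  have bF: "base s (F j)" if "j \<le> n" for j
    unfolding F_def using \<sigma>(1) n2[OF that] by (intro base_upd_work base_upd) auto
  have bdF: "bounded s' (F j)" if "j \<le> n" for j
    by (rule base_bounded[OF bF[OF that]]) (use s' accle[of j] big bad in \<open>auto simp: F_def\<close>)
  have bd\<sigma>: "bounded s' \<sigma>"
  proof (rule base_bounded[OF \<sigma>(1)])
    have "int c * 2 ^ (61 * s) \<le> int (Suc c) * 2 ^ (61 * s)" by (intro mult_right_mono) auto
    then show "\<bar>\<sigma> rAcc\<bar> \<le> 2 ^ s'" using acc(1) big by linarith
  qed (use s' bad in auto)
  have s11: "11 \<le> s'" using s' \<sigma>(3) by linarith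
  have regs: "\<bar>z\<bar> \<le> 2 ^ s'" if "\<bar>z\<bar> \<le> 2000" for z :: int using that const_le[OF s11] by blast
  have "runs s' (sum_loop t) (ecost e + Suc n * (ecost (Pl (Vr rAcc) f) + 300)) \<sigma> (\<lambda>\<sigma>'. \<sigma>' = F 0)"
    unfolding sum_loop_def tt fst_conv snd_conv
  proof (rule runs_for[where I = "\<lambda>j \<sigma>'. \<sigma>' = F j"])
    show "safe s' \<sigma> e" by (rule index_expr_safe[OF index_dims_idxs[OF e(1)] s11])
    fix j \<sigma>' assume j: "j < n" "\<sigma>' = F (Suc j)"
    have b: "base s (\<sigma>'(rL := int j))" unfolding j(2) using bF[of "Suc j"] j(1) n2[of j] by (intro base_upd) auto
    have v: "val f (\<sigma>'(rL := int j)) = val f (\<sigma>(rL := int j))"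
      by (rule cell_expr_cong[OF f(1) b]) (auto simp: j F_def)
    have bd: "bounded s' (\<sigma>'(rL := int j))"
      by (rule base_bounded[OF b]) (use s' accle[of "Suc j"] big bad j in \<open>auto simp: F_def\<close>)
    show "runs s' (asg rAcc (Pl (Vr rAcc) f)) (ecost (Pl (Vr rAcc) f)) (\<sigma>'(rL := int j)) (\<lambda>\<sigma>'. \<sigma>' = F j)"
    proof (rule runs_asg[OF bd])
      show "safe s' (\<sigma>'(rL := int j)) (Pl (Vr rAcc) f)"
        using cell_expr_safe[OF f(1) b s11] regs[of rAcc] by (simp add: temp_def)
      have "(\<Sum>l = j..<n. val f (\<sigma>(rL := int l))) = val f (\<sigma>(rL := int j)) + (\<Sum>l = Suc j..<n. val f (\<sigma>(rL := int l)))"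
        using j(1) by (rule sum.atLeast_Suc_lessThan)
      then show "(\<sigma>'(rL := int j))(rAcc := val (Pl (Vr rAcc) f) (\<sigma>'(rL := int j))) = F j"
        using v by (auto simp: j F_def fun_eq_iff)
    qed (use f s11 regs[of rAcc] in \<open>auto simp: temp_def\<close>)
  next
    show "\<sigma>(rL := int n) = F n" by (auto simp: F_def fun_eq_iff)
  next
    fix j \<sigma>' assume "j \<le> n" "\<sigma>' = F j"
    then show "bounded s' \<sigma>' \<and> \<sigma>' rL = int j" using bdF by (simp add: F_def)
  qed (use e n s11 bd\<sigma> regs[of rL] in \<open>auto simp: temp_def\<close>)
  then show ?thesis
  proof (rule runs_mono)
    fix \<sigma>' assume "\<sigma>' = F 0"
    moreover have "\<sigma>(rL := 0) = \<sigma>" using \<sigma>(2) by auto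
    ultimately show "\<sigma>' = \<sigma>(rAcc := \<sigma> rAcc + lsum \<sigma> t) \<and> \<bar>\<sigma>' rAcc\<bar> \<le> int (Suc c) * 2 ^ (61 * s)"
      using accle[of 0] by (simp add: F_def lsum_def tt n_def atLeast0LessThan)
  next
    \<comment> \<open>An expression of size at most 62 costs at most
      \<open>60 * 62 ^ 2 = 230640\<close>; 231000 leaves room for the loop overhead of 300.\<close>
    have "ecost e \<le> 230640" "ecost (Pl (Vr rAcc) f) \<le> 230640" using e f by (auto intro!: ecost_le)
    then have "ecost e + Suc n * (ecost (Pl (Vr rAcc) f) + 300) \<le> 231000 + Suc K * 231000"
      using n(2) by (intro add_mono mult_le_mono) auto
    then show "ecost e + Suc n * (ecost (Pl (Vr rAcc) f) + 300) \<le> Suc (Suc K) * 231000" by simp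
  qed
qed

lemma lsum_cong:
  assumes "ok_term t" "base s \<sigma>" "\<And>i. i \<noteq> rAcc \<Longrightarrow> i \<noteq> rBad \<Longrightarrow> \<sigma> i = \<sigma>' i" "val (fst t) \<sigma> \<le> 2 ^ s"
  shows "lsum \<sigma> t = lsum \<sigma>' t"
proof -
  from assms(1) have e: "index_expr dims (fst t)" and f: "cell_expr (snd t)" by (auto simp: ok_term_def)
  have eq: "val (fst t) \<sigma> = val (fst t) \<sigma>'"
    by (rule index_expr_cong[OF e]) (auto intro!: assms(3) simp: idxs_simps)
  show ?thesis unfolding lsum_def eq
  proof (rule sum.cong[OF refl])
    fix l assume "l \<in> {..<nat (val (fst t) \<sigma>')}"
    then have "int l < val (fst t) \<sigma>'" by (simp add: zless_nat_eq_int_zless)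
    then have "int l \<le> 2 ^ s" using assms(4) eq by linarith
    then show "val (snd t) (\<sigma>(rL := int l)) = val (snd t) (\<sigma>'(rL := int l))"
      using assms(2,3) by (intro cell_expr_cong[OF f, of s] base_upd) auto
  qed
qed

lemma runs_sum_loops:
  assumes s': "400 * s \<le> s'" "11 \<le> s" and K2: "K \<le> 2 ^ s"
  shows "\<lbrakk>\<forall>t\<in>set ts. ok_term t \<and> val (fst t) \<sigma> \<le> int K; base s \<sigma>; \<sigma> rL = 0; \<bar>\<sigma> rBad\<bar> \<le> 2 ^ s';
    \<bar>\<sigma> rAcc\<bar> \<le> int c * 2 ^ (61 * s); c + length ts \<le> 100\<rbrakk> \<Longrightarrow>
    runs s' (seq (map sum_loop ts)) (Suc (length ts) * (Suc (Suc K) * 231000)) \<sigma>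
      (\<lambda>\<sigma>'. \<sigma>' = \<sigma>(rAcc := \<sigma> rAcc + sum_list (map (lsum \<sigma>) ts)) \<and> \<bar>\<sigma>' rAcc\<bar> \<le> 100 * 2 ^ (61 * s))"
proof (induction ts arbitrary: \<sigma> c)
  case Nil
  have "int c * 2 ^ (61 * s) \<le> 100 * 2 ^ (61 * s)" using Nil by (intro mult_right_mono) auto
  then have "\<bar>\<sigma> rAcc\<bar> \<le> 100 * 2 ^ (61 * s)" using Nil by linarith
  moreover have "exec Skip M 1 M" for M by (rule exec.Skip)
  moreover have "1 \<le> Suc (Suc K) * 231000 * s'" using s' by (cases s') auto
  ultimately show ?case unfolding runs_def by (fastforce simp: fun_upd_idem)
next
  case (Cons t ts)
  have "runs s' (Seq (sum_loop t) (seq (map sum_loop ts)))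
     (Suc (Suc K) * 231000 + Suc (length ts) * (Suc (Suc K) * 231000)) \<sigma>
     (\<lambda>\<sigma>'. \<sigma>' = \<sigma>(rAcc := \<sigma> rAcc + sum_list (map (lsum \<sigma>) (t # ts))) \<and> \<bar>\<sigma>' rAcc\<bar> \<le> 100 * 2 ^ (61 * s))"
  proof (rule runs_Seq, rule runs_mono[OF runs_sum_loop[of t s \<sigma> s' K c]])
    fix \<sigma>' assume \<sigma>': "\<sigma>' = \<sigma>(rAcc := \<sigma> rAcc + lsum \<sigma> t) \<and> \<bar>\<sigma>' rAcc\<bar> \<le> int (Suc c) * 2 ^ (61 * s)"
    then have b: "base s \<sigma>'" using Cons.prems by (auto intro!: base_upd_work)
    have val: "val (fst u) \<sigma>' = val (fst u) \<sigma>" if "ok_term u" for u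
      by (rule index_expr_cong[of dims]) (use that \<sigma>' in \<open>auto simp: ok_term_def idxs_simps\<close>)
    have K3: "int K \<le> 2 ^ s"
    proof -
      have "int K \<le> int (2 ^ s)" using K2 by (simp only: of_nat_le_iff)
      then show ?thesis by simp
    qed
    have ls: "lsum \<sigma> u = lsum \<sigma>' u" if "u \<in> set ts" for u
    proof (rule lsum_cong)
      have "val (fst u) \<sigma> \<le> int K" using that Cons.prems(1) by auto
      then show "val (fst u) \<sigma> \<le> 2 ^ s" using K3 by linarith
    qed (use that Cons.prems \<sigma>' in auto)
    show "runs s' (seq (map sum_loop ts)) (Suc (length ts) * (Suc (Suc K) * 231000)) \<sigma>'
      (\<lambda>\<sigma>'. \<sigma>' = \<sigma>(rAcc := \<sigma> rAcc + sum_list (map (lsum \<sigma>) (t # ts))) \<and> \<bar>\<sigma>' rAcc\<bar> \<le> 100 * 2 ^ (61 * s))"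
    proof (rule runs_mono[OF Cons.IH[of \<sigma>' "Suc c"]])
      show "\<forall>t\<in>set ts. ok_term t \<and> val (fst t) \<sigma>' \<le> int K" using Cons.prems(1) val by simp
      show "base s \<sigma>'" by (rule b)
    next
      fix \<sigma>2 assume "\<sigma>2 = \<sigma>'(rAcc := \<sigma>' rAcc + sum_list (map (lsum \<sigma>') ts)) \<and> \<bar>\<sigma>2 rAcc\<bar> \<le> 100 * 2 ^ (61 * s)"
      moreover have "sum_list (map (lsum \<sigma>') ts) = sum_list (map (lsum \<sigma>) ts)"
        by (intro arg_cong[of _ _ sum_list] map_cong[OF refl]) (use ls in simp)
      ultimately show "\<sigma>2 = \<sigma>(rAcc := \<sigma> rAcc + sum_list (map (lsum \<sigma>) (t # ts))) \<and> \<bar>\<sigma>2 rAcc\<bar> \<le> 100 * 2 ^ (61 * s)"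
        using \<sigma>' by (auto simp: fun_eq_iff)
    qed (use Cons.prems \<sigma>' in auto)
  qed (use Cons.prems s' K2 in auto)
  then show ?case unfolding list.map seq.simps by (rule runs_mono) simp_all
qed

lemma lsum_le:
  assumes t: "ok_term t" and \<sigma>: "base s \<sigma>" "11 \<le> s" and K: "val (fst t) \<sigma> \<le> 2 ^ s"
  shows "\<bar>lsum \<sigma> t\<bar> \<le> 2 ^ (61 * s)"
proof -
  from t have f: "cell_expr (snd t)" "esize (snd t) \<le> 60" by (auto simp: ok_term_def)
  have "\<bar>lsum \<sigma> t\<bar> \<le> 2 ^ (60 * s + s)" unfolding lsum_def
  proof (rule sum_abs_le)
    fix l assume "l \<in> {..<nat (val (fst t) \<sigma>)}"
    then have "int l < val (fst t) \<sigma>" by (simp add: zless_nat_eq_int_zless)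
    then have "int l \<le> 2 ^ s" using K by linarith
    then have "\<bar>val (snd t) (\<sigma>(rL := int l))\<bar> \<le> 2 ^ (s * esize (snd t))"
      by (intro cell_expr_le[OF f(1)] base_upd \<sigma>) auto
    also have "\<dots> \<le> 2 ^ (60 * s)" using f(2) by (intro power_increasing) auto
    finally show "\<bar>val (snd t) (\<sigma>(rL := int l))\<bar> \<le> 2 ^ (60 * s)" .
  next
    show "card {..<nat (val (fst t) \<sigma>)} \<le> 2 ^ s" using K by (simp add: nat_le_iff)
  qed
  then show ?thesis by (simp add: algebra_simps)
qed

definition sqsum :: "memory \<Rightarrow> (expr \<times> expr) list \<Rightarrow> int \<Rightarrow> int \<Rightarrow> int" where
  "sqsum \<sigma> ts i j = (sum_list (map (lsum (\<sigma>(rI := i, rJ := j))) ts))\<^sup>2"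

text \<open>Squares cannot cancel, so the errors of all equations may be added into one register,
  which stays 0 exactly if all of them hold. A block adds at most \<open>2 ^ (150 * s)\<close>, and
  up to 100 blocks remain below \<open>2 ^ (151 * s)\<close>, which fits into \<open>s'\<close>
  bits.\<close>

lemma runs_block:
  assumes b: "ok_block b" "ranges_le K \<sigma> b" and \<sigma>: "base s \<sigma>" "\<sigma> rI = 0" "\<sigma> rJ = 0" "\<sigma> rL = 0" "11 \<le> s"
    and s': "400 * s \<le> s'" and K2: "K \<le> 2 ^ s"
    and acc: "\<bar>\<sigma> rAcc\<bar> \<le> 100 * 2 ^ (61 * s)" and bad: "0 \<le> \<sigma> rBad" "\<sigma> rBad \<le> int c * 2 ^ (150 * s)" "c < 100"
  shows "runs s' (block_com b) (Suc (Suc K) ^ 3 * 30000000) \<sigma> (\<lambda>\<sigma>'. \<exists>x y. \<sigma>' = \<sigma>(rAcc := x, rBad := y) \<and>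
    \<bar>x\<bar> \<le> 100 * 2 ^ (61 * s) \<and> 0 \<le> y \<and> y \<le> int (Suc c) * 2 ^ (150 * s) \<and> (y = 0 \<longleftrightarrow> \<sigma> rBad = 0 \<and> sat \<sigma> b))"
proof -
  obtain e f ts where bb: "b = (e, f, ts)" by (cases b)
  from b have e: "index_expr dims e" "esize e \<le> 60" "val e \<sigma> \<le> int K" and f: "index_expr dims f" "esize f \<le> 60" "val f \<sigma> \<le> int K"
    and ts: "length ts \<le> 100" "\<And>t. t \<in> set ts \<Longrightarrow> ok_term t \<and> val (fst t) \<sigma> \<le> int K"
    by (auto simp: ok_block_def ranges_le_def bb)
  define m where "m = nat (val e \<sigma>)"
  define n where "n = nat (val f \<sigma>)"
  have "0 \<le> val e \<sigma>" using \<sigma>(1) by (intro index_expr_nonneg[OF e(1)]) (auto simp: base_def idxs_def)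
  then have m: "val e \<sigma> = int m" "m \<le> K" using e by (auto simp: m_def)
  have "0 \<le> val f \<sigma>" using \<sigma>(1) by (intro index_expr_nonneg[OF f(1)]) (auto simp: base_def idxs_def)
  then have n: "val f \<sigma> = int n" "n \<le> K" using f by (auto simp: n_def)
  have K3: "int j \<le> 2 ^ s" if "j \<le> K" for j
  proof -
    have "int j \<le> int (2 ^ s)" using that K2 by (simp only: of_nat_le_iff)
    then show ?thesis by simp
  qed
  have s11: "11 \<le> s'" using s' \<sigma>(5) by linarith
  have regs: "\<bar>z\<bar> \<le> 2 ^ s'" if "\<bar>z\<bar> \<le> 2000" for z :: int using that const_le[OF s11] by blast
  have pw: "z \<le> 2 ^ s'" if "z \<le> int c' * 2 ^ (150 * s)" "c' \<le> 100" for z :: int and c'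
  proof -
    have "int c' \<le> 2 ^ s" using that(2) const_le[OF \<sigma>(5), of "int c'"] by simp
    then have "int c' * 2 ^ (150 * s) \<le> 2 ^ s * 2 ^ (150 * s)" by (intro mult_right_mono) auto
    also have "\<dots> = 2 ^ (151 * s)" by (simp add: power_add[symmetric])
    also have "\<dots> \<le> 2 ^ s'" using s' by (intro power_increasing) auto
    finally show ?thesis using that(1) by linarith
  qed
  have accpw: "\<bar>x\<bar> \<le> 2 ^ s'" if "\<bar>x\<bar> \<le> 100 * 2 ^ (61 * s)" for x :: int
  proof -
    have "(2 :: int) ^ (61 * s) \<le> 2 ^ (150 * s)" by (intro power_increasing) auto
    then have "\<bar>x\<bar> \<le> 100 * 2 ^ (150 * s)" using that by linarith
    then show ?thesis by (intro pw[of _ 100]) auto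
  qed
  define err where "err = sqsum \<sigma> ts"
  define A where "A = (\<lambda>x :: int. \<bar>x\<bar> \<le> 100 * 2 ^ (61 * s))"
  define row where "row = (\<lambda>i. \<Sum>j<n. err (int i) (int j))"
  \<comment> \<open>The state at loop counters \<open>i\<close> and \<open>j\<close> after errors of
    total size \<open>v\<close> have been added; \<open>rAcc\<close> is left over from the previous
    equation and is only known to be bounded.\<close>
  define st where "st = (\<lambda>i j v \<sigma>'. \<exists>x. A x \<and> \<sigma>' = \<sigma>(rI := int i, rJ := int j, rAcc := x, rBad := \<sigma> rBad + v))"
  have st_base: "base s \<sigma>'" if st: "st i j v \<sigma>'" and iK: "i \<le> K" and jK: "j \<le> K" for i j v \<sigma>'
  proof -
    obtain x where x: "\<sigma>' = \<sigma>(rI := int i, rJ := int j, rAcc := x, rBad := \<sigma> rBad + v)"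
      using st by (auto simp: st_def)
    have "base s (\<sigma>(rI := int i, rJ := int j))"
      by (rule base_upd[OF base_upd[OF \<sigma>(1)]]) (use K3[OF iK] K3[OF jK] in auto)
    then show ?thesis unfolding x by (rule base_upd_work[OF base_upd_work]) auto
  qed
  have err0: "0 \<le> err (int i) (int j)" for i j by (simp add: err_def sqsum_def)
  \<comment> \<open>At most 100 terms of \<open>61 * s\<close> bits give \<open>62 * s\<close> bits,
    and the square \<open>124 * s\<close>, generously estimated by \<open>148 * s\<close>. Each of
    the two loops adds another \<open>s\<close>, which leads to 149 and 150.\<close>
  have err_le: "err (int i) (int j) \<le> 2 ^ (148 * s)" if "i < m" "j < n" for i j
  proof -
    define \<tau> where "\<tau> = \<sigma>(rI := int i, rJ := int j)"
    have b: "base s \<tau>" unfolding \<tau>_def using \<sigma>(1) that m n K3[of i] K3[of j] by (intro base_upd) auto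
    have len: "length us \<le> 100 \<Longrightarrow> (\<And>t. t \<in> set us \<Longrightarrow> ok_term t \<and> val (fst t) \<sigma> \<le> int K) \<Longrightarrow>
      \<bar>sum_list (map (lsum \<tau>) us)\<bar> \<le> int (length us) * 2 ^ (61 * s)" for us
    proof (induction us)
      case (Cons t us)
      have "val (fst t) \<tau> = val (fst t) \<sigma>"
        by (rule index_expr_cong[of dims]) (use Cons.prems(2)[of t] in \<open>auto simp: ok_term_def idxs_simps \<tau>_def\<close>)
      moreover have "val (fst t) \<sigma> \<le> int K" using Cons.prems(2)[of t] by simp
      ultimately have "val (fst t) \<tau> \<le> 2 ^ s" using K3[of K] by linarith
      then have "\<bar>lsum \<tau> t\<bar> \<le> 2 ^ (61 * s)" using Cons.prems(2)[of t] b \<sigma>(5) by (intro lsum_le) auto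
      then show ?case using Cons by (auto simp: algebra_simps)
    qed simp
    have "(100 :: int) \<le> 2 ^ s" using const_le[OF \<sigma>(5), of 100] by simp
    then have "int (length ts) \<le> 2 ^ s" using ts(1) by linarith
    then have "int (length ts) * 2 ^ (61 * s) \<le> 2 ^ s * 2 ^ (61 * s)" by (intro mult_right_mono) auto
    also have "\<dots> = 2 ^ (62 * s)" by (simp add: power_add[symmetric])
    finally have "\<bar>sum_list (map (lsum \<tau>) ts)\<bar> \<le> 2 ^ (62 * s)" using len[of ts] ts by simp
    then have "\<bar>sum_list (map (lsum \<tau>) ts)\<bar>\<^sup>2 \<le> (2 ^ (62 * s))\<^sup>2" by (intro power_mono) auto
    also have "\<dots> = (2 :: int) ^ (124 * s)" by (simp add: power_mult[symmetric])
    also have "\<dots> \<le> 2 ^ (148 * s)" by (intro power_increasing) auto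
    finally show ?thesis by (simp add: err_def sqsum_def \<tau>_def)
  qed
  have K4: "j \<le> 2 ^ s" if "j \<le> K" for j using that K2 by linarith
  have row0: "0 \<le> row i" for i unfolding row_def using err0 by (intro sum_nonneg) auto
  have row_le: "row i \<le> 2 ^ (149 * s)" if "i < m" for i
  proof -
    have "\<bar>row i\<bar> \<le> 2 ^ (148 * s + s)" unfolding row_def
      by (rule sum_abs_le) (use err_le[OF that] err0 K4[OF n(2)] in \<open>auto simp: abs_of_nonneg\<close>)
    then show ?thesis by (simp add: algebra_simps)
  qed
  define tot where "tot = (\<Sum>i<m. row i)"
  have tot_le: "tot \<le> 2 ^ (150 * s)"
  proof -
    have "\<bar>tot\<bar> \<le> 2 ^ (149 * s + s)" unfolding tot_def
      by (rule sum_abs_le) (use row_le row0 K4[OF m(2)] in \<open>auto simp: abs_of_nonneg\<close>)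
    then show ?thesis by (simp add: algebra_simps)
  qed
  have part: "(\<Sum>i' = i..<m. row i') \<le> tot" for i
    unfolding tot_def atLeast0LessThan[symmetric] by (rule sum_mono2) (use row0 in auto)
  have part2: "(\<Sum>i' = Suc i..<m. row i') + (\<Sum>j' = j..<n. err (int i) (int j')) \<le> tot" if "i < m" for i j
  proof -
    have "(\<Sum>j' = j..<n. err (int i) (int j')) \<le> row i"
      unfolding row_def atLeast0LessThan[symmetric] by (rule sum_mono2) (use err0 in auto)
    then have "(\<Sum>i' = Suc i..<m. row i') + (\<Sum>j' = j..<n. err (int i) (int j')) \<le> (\<Sum>i' = i..<m. row i')"
      using that by (simp add: sum.atLeast_Suc_lessThan)
    then show ?thesis using part[of i] by linarith
  qed
  have pos: "0 \<le> (\<Sum>i' = i..<m. row i')" "0 \<le> (\<Sum>j' = j..<n. err i'' (int j'))" for i j i''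
    using row0 by (auto simp: err_def sqsum_def intro!: sum_nonneg)
  have badle: "\<sigma> rBad + v \<le> int (Suc c) * 2 ^ (150 * s)" "\<bar>\<sigma> rBad + v\<bar> \<le> 2 ^ s'" if "0 \<le> v" "v \<le> tot" for v
  proof -
    show 1: "\<sigma> rBad + v \<le> int (Suc c) * 2 ^ (150 * s)" using that bad tot_le by (simp add: algebra_simps)
    have "\<sigma> rBad + v \<le> 2 ^ s'" by (rule pw[OF 1]) (use bad in simp)
    then show "\<bar>\<sigma> rBad + v\<bar> \<le> 2 ^ s'" using that bad by simp
  qed
  have st_bd: "bounded s' \<sigma>'" if "st i j v \<sigma>'" "i \<le> K" "j \<le> K" "0 \<le> v" "v \<le> tot" for i j v \<sigma>'
    using st_base[OF that(1-3)] that(1) badle[OF that(4,5)] s' accpw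
    by (intro base_bounded[of s]) (auto simp: st_def A_def)
  have body: "runs s' (Seq (asg rAcc (Cn 0)) (Seq (seq (map sum_loop ts)) (asg rBad (Pl (Vr rBad) (Ti (Vr rAcc) (Vr rAcc))))))
      (60 + (101 * (Suc (Suc K) * 231000) + 540)) \<sigma>' (\<lambda>\<sigma>''. st i j (v + err (int i) (int j)) \<sigma>'')"
    if st: "st i j v \<sigma>'" and ij: "i < m" "j < n" and v: "\<bar>\<sigma> rBad + v\<bar> \<le> 2 ^ s'" for i j v \<sigma>'
  proof (rule runs_Seq, rule runs_mono)
    obtain x where x: "A x" "\<sigma>' = \<sigma>(rI := int i, rJ := int j, rAcc := x, rBad := \<sigma> rBad + v)"
      using st by (auto simp: st_def)
    have b: "base s \<sigma>'" using st_base[OF st] ij m n by auto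
    have bd: "bounded s' \<sigma>'"
      by (rule base_bounded[OF b]) (use s' x accpw v in \<open>auto simp: A_def\<close>)
    show "runs s' (asg rAcc (Cn 0)) (ecost (Cn 0)) \<sigma>' (\<lambda>\<sigma>2. \<sigma>2 = \<sigma>'(rAcc := 0))"
      by (rule runs_asg[OF bd]) (use s11 regs[of rAcc] in \<open>auto simp: temp_def\<close>)
    show "ecost (Cn 0) \<le> 60" by (simp add: ecost_def)
    fix \<sigma>2 assume s2: "\<sigma>2 = \<sigma>'(rAcc := 0)"
    have b2: "base s \<sigma>2" using b s2 by (auto intro: base_upd_work)
    have eq: "sum_list (map (lsum \<sigma>2) ts) = sum_list (map (lsum (\<sigma>(rI := int i, rJ := int j))) ts)"
    proof (intro arg_cong[of _ _ sum_list] map_cong[OF refl])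
      fix t assume t: "t \<in> set ts"
      have "val (fst t) \<sigma>2 = val (fst t) \<sigma>"
        by (rule index_expr_cong[of dims]) (use ts(2)[OF t] s2 x in \<open>auto simp: ok_term_def idxs_simps\<close>)
      then have "val (fst t) \<sigma>2 \<le> 2 ^ s" using ts(2)[OF t] K3[of K] by linarith
      then show "lsum \<sigma>2 t = lsum (\<sigma>(rI := int i, rJ := int j)) t"
        by (intro lsum_cong[OF _ b2]) (use ts(2)[OF t] s2 x in auto)
    qed
    have err: "err (int i) (int j) = (sum_list (map (lsum \<sigma>2) ts))\<^sup>2" by (simp add: err_def sqsum_def eq)
    show "runs s' (Seq (seq (map sum_loop ts)) (asg rBad (Pl (Vr rBad) (Ti (Vr rAcc) (Vr rAcc)))))
      (101 * (Suc (Suc K) * 231000) + 540) \<sigma>2 (\<lambda>\<sigma>''. st i j (v + err (int i) (int j)) \<sigma>'')"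
    proof (rule runs_Seq, rule runs_mono[OF runs_sum_loops[OF s' \<sigma>(5) K2, of ts \<sigma>2 0]])
      show "\<forall>t\<in>set ts. ok_term t \<and> val (fst t) \<sigma>2 \<le> int K"
      proof
        fix t assume t: "t \<in> set ts"
        have "val (fst t) \<sigma>2 = val (fst t) \<sigma>"
          by (rule index_expr_cong[of dims]) (use ts(2)[OF t] s2 x in \<open>auto simp: ok_term_def idxs_simps\<close>)
        then show "ok_term t \<and> val (fst t) \<sigma>2 \<le> int K" using ts(2)[OF t] by simp
      qed
      show "Suc (length ts) * (Suc (Suc K) * 231000) \<le> 101 * (Suc (Suc K) * 231000)" using ts(1) by (intro mult_le_mono1) simp
      fix \<sigma>3 assume s3: "\<sigma>3 = \<sigma>2(rAcc := \<sigma>2 rAcc + sum_list (map (lsum \<sigma>2) ts)) \<and> \<bar>\<sigma>3 rAcc\<bar> \<le> 100 * 2 ^ (61 * s)"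
      define z where "z = sum_list (map (lsum \<sigma>2) ts)"
      have "\<sigma>2 rAcc = 0" using s2 by simp
      then have z3: "\<sigma>3 = \<sigma>2(rAcc := z)" using s3 by (simp add: z_def)
      have z: "\<bar>z\<bar> \<le> 100 * 2 ^ (61 * s)" "\<sigma>3 = \<sigma>(rI := int i, rJ := int j, rAcc := z, rBad := \<sigma> rBad + v)"
      proof -
        have "\<sigma>3 rAcc = z" by (simp add: z3)
        moreover have "\<bar>\<sigma>3 rAcc\<bar> \<le> 100 * 2 ^ (61 * s)" using s3 by blast
        ultimately show "\<bar>z\<bar> \<le> 100 * 2 ^ (61 * s)" by (simp only:)
        show "\<sigma>3 = \<sigma>(rI := int i, rJ := int j, rAcc := z, rBad := \<sigma> rBad + v)"
          unfolding z3 s2 x(2) by (simp add: fun_eq_iff)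
      qed
      have b3: "base s \<sigma>3" using s3 b2 by (auto intro: base_upd_work)
      have bd3: "bounded s' \<sigma>3"
        by (rule base_bounded[OF b3]) (use s' z accpw v in auto)
      show "runs s' (asg rBad (Pl (Vr rBad) (Ti (Vr rAcc) (Vr rAcc)))) 540 \<sigma>3
         (\<lambda>\<sigma>''. st i j (v + err (int i) (int j)) \<sigma>'')"
      proof (rule runs_mono[OF runs_asg[OF bd3]])
        show "st i j (v + err (int i) (int j)) (\<sigma>3(rBad := val (Pl (Vr rBad) (Ti (Vr rAcc) (Vr rAcc))) \<sigma>3))"
          using z by (auto simp: st_def A_def err z_def power2_eq_square intro!: exI[of _ z])
      qed (use s11 regs[of rBad] regs[of rAcc] in \<open>auto simp: temp_def ecost_def power2_eq_square\<close>)
    qed (use b2 s2 x \<sigma> v ts in auto)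
  qed
  let ?KK = "Suc (Suc K)"
  let ?kb = "60 + (101 * (?KK * 231000) + 540)"
  let ?body = "Seq (asg rAcc (Cn 0)) (Seq (seq (map sum_loop ts)) (asg rBad (Pl (Vr rBad) (Ti (Vr rAcc) (Vr rAcc)))))"
  have inner: "runs s' (for_loop rJ f ?body) (ecost f + Suc n * (?kb + 300)) \<sigma>' (st i 0 (\<Sum>i' = i..<m. row i'))"
    if st: "st i 0 (\<Sum>i' = Suc i..<m. row i') \<sigma>'" and i: "i < m" for i \<sigma>'
  proof (rule runs_for[where I = "\<lambda>j. st i j ((\<Sum>i' = Suc i..<m. row i') + (\<Sum>j' = j..<n. err (int i) (int j')))"])
    have iK: "i \<le> K" using i m by simp
    show "bounded s' \<sigma>'" using st_bd[OF st iK] pos part by simp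
    show "safe s' \<sigma>' f" by (rule index_expr_safe[OF index_dims_idxs[OF f(1)] s11])
    have "val f \<sigma>' = val f \<sigma>"
      by (rule index_expr_cong[OF f(1)]) (use st in \<open>auto simp: st_def idxs_simps\<close>)
    then show "val f \<sigma>' = int n" using n by simp
    show "st i n ((\<Sum>i' = Suc i..<m. row i') + (\<Sum>j' = n..<n. err (int i) (int j'))) (\<sigma>'(rJ := int n))"
      using st by (auto simp: st_def fun_eq_iff)
    fix \<sigma>2
    show "runs s' ?body ?kb (\<sigma>2(rJ := int j)) (st i j ((\<Sum>i' = Suc i..<m. row i') + (\<Sum>j' = j..<n. err (int i) (int j'))))"
      if j: "j < n" and st2: "st i (Suc j) ((\<Sum>i' = Suc i..<m. row i') + (\<Sum>j' = Suc j..<n. err (int i) (int j'))) \<sigma>2" for j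
    proof (rule runs_mono[OF body])
      show "st i j ((\<Sum>i' = Suc i..<m. row i') + (\<Sum>j' = Suc j..<n. err (int i) (int j'))) (\<sigma>2(rJ := int j))"
        using st2 by (auto simp: st_def fun_eq_iff)
      show "\<bar>\<sigma> rBad + ((\<Sum>i' = Suc i..<m. row i') + (\<Sum>j' = Suc j..<n. err (int i) (int j')))\<bar> \<le> 2 ^ s'"
        by (rule badle(2)) (use pos part2[OF i] in auto)
      fix \<sigma>3
      assume "st i j ((\<Sum>i' = Suc i..<m. row i') + (\<Sum>j' = Suc j..<n. err (int i) (int j')) + err (int i) (int j)) \<sigma>3"
      then show "st i j ((\<Sum>i' = Suc i..<m. row i') + (\<Sum>j' = j..<n. err (int i) (int j'))) \<sigma>3"
        using j by (simp add: sum.atLeast_Suc_lessThan algebra_simps)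
    qed (use i j in auto)
    show "bounded s' \<sigma>2 \<and> \<sigma>2 rJ = int j"
      if "j \<le> n" "st i j ((\<Sum>i' = Suc i..<m. row i') + (\<Sum>j' = j..<n. err (int i) (int j'))) \<sigma>2" for j
      using st_bd[OF that(2) iK] that n part2[OF i, of j] pos by (auto simp: st_def)
    show "st i 0 (\<Sum>i' = i..<m. row i') \<sigma>2"
      if "st i 0 ((\<Sum>i' = Suc i..<m. row i') + (\<Sum>j' = 0..<n. err (int i) (int j'))) \<sigma>2"
      using that i by (simp add: sum.atLeast_Suc_lessThan row_def atLeast0LessThan add.commute)
  qed (use f s11 regs[of rJ] in \<open>auto simp: temp_def\<close>)
  have "runs s' (block_com b) (ecost e + Suc m * ((ecost f + Suc n * (?kb + 300)) + 300)) \<sigma> (st 0 0 tot)"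
    unfolding block_com_def bb prod.case
  proof (rule runs_for[where I = "\<lambda>i. st i 0 (\<Sum>i' = i..<m. row i')"])
    show "bounded s' \<sigma>" using badle(2)[of 0] part[of m] s' accpw[OF acc] by (intro base_bounded[OF \<sigma>(1)]) auto
    show "safe s' \<sigma> e" by (rule index_expr_safe[OF index_dims_idxs[OF e(1)] s11])
    show "st m 0 (\<Sum>i' = m..<m. row i') (\<sigma>(rI := int m))"
      using acc \<sigma>(3) by (auto simp: st_def A_def fun_eq_iff intro!: exI[of _ "\<sigma> rAcc"])
    fix \<sigma>2
    show "runs s' (for_loop rJ f ?body) (ecost f + Suc n * (?kb + 300)) (\<sigma>2(rI := int i)) (st i 0 (\<Sum>i' = i..<m. row i'))"
      if "i < m" "st (Suc i) 0 (\<Sum>i' = Suc i..<m. row i') \<sigma>2" for i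
      by (rule inner) (use that in \<open>auto simp: st_def fun_eq_iff\<close>)
    show "bounded s' \<sigma>2 \<and> \<sigma>2 rI = int i" if "i \<le> m" "st i 0 (\<Sum>i' = i..<m. row i') \<sigma>2" for i
      using st_bd[OF that(2)] that m part[of i] pos by (auto simp: st_def)
    show "st 0 0 tot \<sigma>2" if "st 0 0 (\<Sum>i' = 0..<m. row i') \<sigma>2"
      using that by (simp add: tot_def atLeast0LessThan)
  qed (use e m s11 regs[of rI] in \<open>auto simp: temp_def\<close>)
  then show ?thesis
  proof (rule runs_mono)
    fix \<sigma>' assume "st 0 0 tot \<sigma>'"
    then obtain x where x: "A x" "\<sigma>' = \<sigma>(rI := int 0, rJ := int 0, rAcc := x, rBad := \<sigma> rBad + tot)" by (auto simp: st_def)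
    moreover have "\<sigma>(rI := int 0, rJ := int 0, rAcc := x, rBad := \<sigma> rBad + tot) = \<sigma>(rAcc := x, rBad := \<sigma> rBad + tot)"
      using \<sigma> by (auto simp: fun_eq_iff)
    moreover have tot0: "0 \<le> tot" unfolding tot_def using row0 by (intro sum_nonneg) auto
    moreover have "tot = 0 \<longleftrightarrow> sat \<sigma> b"
    proof -
      have "tot = 0 \<longleftrightarrow> (\<forall>i<m. row i = 0)"
        unfolding tot_def using row0 by (subst sum_nonneg_eq_0_iff) auto
      also have "\<dots> \<longleftrightarrow> (\<forall>i<m. \<forall>j<n. err (int i) (int j) = 0)"
        unfolding row_def using err0 by (subst sum_nonneg_eq_0_iff) auto
      finally show ?thesis by (simp add: sat_def bb err_def sqsum_def m_def n_def)
    qed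
    ultimately show "\<exists>x y. \<sigma>' = \<sigma>(rAcc := x, rBad := y) \<and> \<bar>x\<bar> \<le> 100 * 2 ^ (61 * s) \<and> 0 \<le> y \<and>
        y \<le> int (Suc c) * 2 ^ (150 * s) \<and> (y = 0 \<longleftrightarrow> \<sigma> rBad = 0 \<and> sat \<sigma> b)"
      using badle(1)[OF tot0] bad by (intro exI[of _ x] exI[of _ "\<sigma> rBad + tot"]) (auto simp: A_def)
  next
    have c: "ecost e \<le> 230640" "ecost f \<le> 230640" using e f by (auto intro!: ecost_le)
    have "?kb + 300 \<le> 23331450 * ?KK" by simp
    then have "Suc n * (?kb + 300) \<le> ?KK * (23331450 * ?KK)"
      using n(2) by (intro mult_le_mono) auto
    moreover have "?KK * (23331450 * ?KK) = 23331450 * ?KK ^ 2" by (simp only: power2_eq_square mult_ac)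
    moreover have "1 \<le> ?KK ^ 2" by simp
    ultimately have "(ecost f + Suc n * (?kb + 300)) + 300 \<le> 24000000 * ?KK ^ 2" using c by linarith
    then have "ecost e + Suc m * ((ecost f + Suc n * (?kb + 300)) + 300) \<le> 230640 + ?KK * (24000000 * ?KK ^ 2)"
      using c m(2) by (intro add_mono mult_le_mono) auto
    also have "\<dots> = 230640 + 24000000 * ?KK ^ 3" by (simp only: power2_eq_square power3_eq_cube mult_ac)
    also have "\<dots> \<le> ?KK ^ 3 * 30000000"
    proof -
      have "1 \<le> ?KK ^ 3" by simp
      then show ?thesis by linarith
    qed
    finally show "ecost e + Suc m * ((ecost f + Suc n * (?kb + 300)) + 300) \<le> ?KK ^ 3 * 30000000" .
  qed
qed

lemma runs_blocks:
  assumes s: "11 \<le> s" "400 * s \<le> s'" "K \<le> 2 ^ s"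
  shows "\<lbrakk>\<forall>b\<in>set bs. ok_block b \<and> ranges_le K \<sigma> b; base s \<sigma>; \<sigma> rI = 0; \<sigma> rJ = 0; \<sigma> rL = 0;
    \<bar>\<sigma> rAcc\<bar> \<le> 100 * 2 ^ (61 * s); 0 \<le> \<sigma> rBad; \<sigma> rBad \<le> int c * 2 ^ (150 * s); c + length bs \<le> 100\<rbrakk> \<Longrightarrow>
    runs s' (seq (map block_com bs)) (Suc (length bs) * (Suc (Suc K) ^ 3 * 30000000)) \<sigma>
      (\<lambda>\<sigma>'. 0 \<le> \<sigma>' rBad \<and> bounded s' \<sigma>' \<and> (\<sigma>' rBad = 0 \<longleftrightarrow> \<sigma> rBad = 0 \<and> (\<forall>b\<in>set bs. sat \<sigma> b)))"
proof (induction bs arbitrary: \<sigma> c)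
  case Nil
  have le: "100 * 2 ^ (150 * s) \<le> (2 :: int) ^ s'"
  proof -
    have "(100 :: int) \<le> 2 ^ s" using const_le[OF s(1), of 100] by simp
    then have "(100 :: int) * 2 ^ (150 * s) \<le> 2 ^ s * 2 ^ (150 * s)" by (intro mult_right_mono) auto
    also have "\<dots> = 2 ^ (151 * s)" by (simp add: power_add[symmetric])
    also have "\<dots> \<le> 2 ^ s'" using s by (intro power_increasing) auto
    finally show ?thesis .
  qed
  have "\<bar>\<sigma> rAcc\<bar> \<le> 2 ^ s'"
  proof -
    have "(2 :: int) ^ (61 * s) \<le> 2 ^ (150 * s)" by (intro power_increasing) auto
    then show ?thesis using Nil le by linarith
  qed
  moreover have "\<bar>\<sigma> rBad\<bar> \<le> 2 ^ s'"
  proof -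
    have "int c * 2 ^ (150 * s) \<le> 100 * 2 ^ (150 * s)" using Nil by (intro mult_right_mono) auto
    then show ?thesis using Nil le by linarith
  qed
  ultimately have "bounded s' \<sigma>" using Nil s by (intro base_bounded[of s]) auto
  moreover have "exec Skip M 1 M" for M by (rule exec.Skip)
  moreover have "1 \<le> Suc 0 * (Suc (Suc K) ^ 3 * 30000000) * s'"
  proof -
    have "0 < Suc 0 * (Suc (Suc K) ^ 3 * 30000000) * s'" using s by simp
    then show ?thesis by linarith
  qed
  ultimately show ?case unfolding runs_def using Nil by fastforce
next
  case (Cons b bs)
  have "runs s' (Seq (block_com b) (seq (map block_com bs)))
     (Suc (Suc K) ^ 3 * 30000000 + Suc (length bs) * (Suc (Suc K) ^ 3 * 30000000)) \<sigma>
      (\<lambda>\<sigma>'. 0 \<le> \<sigma>' rBad \<and> bounded s' \<sigma>' \<and> (\<sigma>' rBad = 0 \<longleftrightarrow> \<sigma> rBad = 0 \<and> (\<forall>b\<in>set (b # bs). sat \<sigma> b)))"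
  proof (rule runs_Seq, rule runs_mono[OF runs_block[of b K \<sigma> s s' c]])
    fix \<sigma>' assume "\<exists>x y. \<sigma>' = \<sigma>(rAcc := x, rBad := y) \<and> \<bar>x\<bar> \<le> 100 * 2 ^ (61 * s) \<and> 0 \<le> y \<and>
        y \<le> int (Suc c) * 2 ^ (150 * s) \<and> (y = 0 \<longleftrightarrow> \<sigma> rBad = 0 \<and> sat \<sigma> b)"
    then obtain x y where xy: "\<sigma>' = \<sigma>(rAcc := x, rBad := y)" "\<bar>x\<bar> \<le> 100 * 2 ^ (61 * s)" "0 \<le> y"
        "y \<le> int (Suc c) * 2 ^ (150 * s)" "y = 0 \<longleftrightarrow> \<sigma> rBad = 0 \<and> sat \<sigma> b" by blast
    have b: "base s \<sigma>'" using Cons.prems xy(1) by (auto intro!: base_upd_work)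
    have val: "val e \<sigma>' = val e \<sigma>" if "index_expr dims e" for e
      by (rule index_expr_cong[OF that]) (auto simp: xy idxs_simps)
    have rg: "ranges_le K \<sigma>' b'" if "b' \<in> set bs" for b'
    proof -
      have "ok_block b'" "ranges_le K \<sigma> b'" using Cons.prems(1) that by auto
      then show ?thesis by (fastforce simp: ranges_le_def ok_block_def ok_term_def val)
    qed
    have K3: "int K \<le> 2 ^ s"
    proof -
      have "int K \<le> int (2 ^ s)" using s(3) by (simp only: of_nat_le_iff)
      then show ?thesis by simp
    qed
    have sat: "sat \<sigma>' b' = sat \<sigma> b'" if b': "b' \<in> set bs" for b'
    proof -
      obtain e f ts where bb: "b' = (e, f, ts)" by (cases b')
      have o: "index_expr dims e" "index_expr dims f" "\<And>t. t \<in> set ts \<Longrightarrow> ok_term t \<and> val (fst t) \<sigma> \<le> int K"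
        "val e \<sigma> \<le> int K" "val f \<sigma> \<le> int K"
        using Cons.prems(1) b' by (auto simp: bb ok_block_def ranges_le_def)
      have eq: "sum_list (map (lsum (\<sigma>'(rI := int i, rJ := int j))) ts) = sum_list (map (lsum (\<sigma>(rI := int i, rJ := int j))) ts)"
        if "i < nat (val e \<sigma>)" "j < nat (val f \<sigma>)" for i j
      proof (intro arg_cong[of _ _ sum_list] map_cong[OF refl])
        fix t assume t: "t \<in> set ts"
        have "int i \<le> 2 ^ s" "int j \<le> 2 ^ s" using that o(4,5) K3 by linarith+
        then have b2: "base s (\<sigma>'(rI := int i, rJ := int j))" using b by (intro base_upd) auto
        have "val (fst t) (\<sigma>'(rI := int i, rJ := int j)) = val (fst t) \<sigma>"
          by (rule index_expr_cong[of dims]) (use o(3)[OF t] in \<open>auto simp: ok_term_def idxs_simps xy\<close>)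
        then have "val (fst t) (\<sigma>'(rI := int i, rJ := int j)) \<le> 2 ^ s" using o(3)[OF t] K3 by linarith
        then show "lsum (\<sigma>'(rI := int i, rJ := int j)) t = lsum (\<sigma>(rI := int i, rJ := int j)) t"
          by (intro lsum_cong[OF _ b2]) (use o(3)[OF t] xy in auto)
      qed
      show ?thesis using eq by (auto simp: sat_def bb val o(1,2))
    qed
    show "runs s' (seq (map block_com bs)) (Suc (length bs) * (Suc (Suc K) ^ 3 * 30000000)) \<sigma>'
      (\<lambda>\<sigma>'. 0 \<le> \<sigma>' rBad \<and> bounded s' \<sigma>' \<and> (\<sigma>' rBad = 0 \<longleftrightarrow> \<sigma> rBad = 0 \<and> (\<forall>b\<in>set (b # bs). sat \<sigma> b)))"
    proof (rule runs_mono[OF Cons.IH[of \<sigma>' "Suc c"]])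
      show "\<forall>b\<in>set bs. ok_block b \<and> ranges_le K \<sigma>' b" using Cons.prems(1) rg by auto
      show "base s \<sigma>'" by (rule b)
    next
      fix \<sigma>2 assume "0 \<le> \<sigma>2 rBad \<and> bounded s' \<sigma>2 \<and> (\<sigma>2 rBad = 0 \<longleftrightarrow> \<sigma>' rBad = 0 \<and> (\<forall>b\<in>set bs. sat \<sigma>' b))"
      moreover have "(\<forall>b\<in>set bs. sat \<sigma>' b) \<longleftrightarrow> (\<forall>b\<in>set bs. sat \<sigma> b)" using sat by blast
      ultimately show "0 \<le> \<sigma>2 rBad \<and> bounded s' \<sigma>2 \<and> (\<sigma>2 rBad = 0 \<longleftrightarrow> \<sigma> rBad = 0 \<and> (\<forall>b\<in>set (b # bs). sat \<sigma> b))"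
        using xy(1,5) by auto
    qed (use Cons.prems b xy in auto)
  qed (use Cons.prems s in auto)
  then show ?case unfolding list.map seq.simps by (rule runs_mono) simp_all
qed

section \<open>A total parser for arbitrary words\<close>

section \<open>Parsing\<close>

text \<open>Reading past the end of the word yields 0, as in memory, where the registers behind the
  input are 0. Unary numbers and runs of digits therefore end there at the latest.\<close>

definition hd0 :: "int list \<Rightarrow> int" where "hd0 xs = (case xs of [] \<Rightarrow> 0 | x # _ \<Rightarrow> x)"

lemma hd0_simps [simp]: "hd0 [] = 0" "hd0 (x # xs) = x"
  by (simp_all add: hd0_def)

text \<open>Defined on arbitrary words: every positive marker, even the separator 2, announces a
  digit, and the digit itself may be 2. A malformed number may run across the separator.\<close>

function digs :: "int list \<Rightarrow> int list" where
  "digs xs = (if hd0 xs > 0 then hd0 (drop 1 xs) # digs (drop 2 xs) else [])"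
  by pat_completeness auto
termination
  by (relation "measure length") (auto simp: hd0_def split: list.splits)

declare digs.simps [simp del]

definition dval :: "int list \<Rightarrow> int" where "dval ds = horner_sum (\<lambda>x. x) 2 ds"

text \<open>The most significant digit, since digits come with the least significant one first. With
  the default 1 for the empty list, the value 1 on bit lists characterizes the canonical
  representations, that of 0 included.\<close>

definition dlast :: "int list \<Rightarrow> int" where "dlast ds = last (1 # ds)"

definition nat_rest :: "int list \<Rightarrow> int list" where "nat_rest xs = drop (2 * length (digs xs) + 1) xs"

text \<open>An item has the shape of \<open>enc_rat\<close>, one sign symbol and two numbers.
  Entries of the input and cells of the certificate are parsed alike.\<close>

definition item_rest :: "int list \<Rightarrow> int list" where "item_rest xs = nat_rest (nat_rest (drop 1 xs))"

definition cellv :: "nat \<Rightarrow> int list \<Rightarrow> int" where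
  "cellv c xs = [hd0 xs, dval (digs (drop 1 xs)), dlast (digs (drop 1 xs)),
     dval (digs (nat_rest (drop 1 xs))), dlast (digs (nat_rest (drop 1 xs)))] ! c"

definition dimv :: "int list \<Rightarrow> nat" where "dimv xs = length (takeWhile (\<lambda>x. x > 0) xs)"

definition dim_rest :: "int list \<Rightarrow> int list" where "dim_rest xs = drop (Suc (dimv xs)) xs"

lemma digs_nth:
  "i < length (digs xs) \<Longrightarrow> 0 < hd0 (drop (2 * i) xs) \<and> digs xs ! i = hd0 (drop (2 * i + 1) xs)"
proof (induction xs arbitrary: i rule: digs.induct)
  case (1 xs)
  then have pos: "0 < hd0 xs" by (subst (asm) (2) digs.simps) (auto split: if_splits)
  have d: "digs xs = hd0 (drop 1 xs) # digs (drop 2 xs)" by (subst digs.simps) (simp add: pos)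
  show ?case
  proof (cases i)
    case (Suc j)
    then have "j < length (digs (drop 2 xs))" using 1(2) d by simp
    from 1(1)[OF pos this] show ?thesis by (simp add: d Suc)
  qed (use pos d in simp)
qed

lemma digs_end: "hd0 (drop (2 * length (digs xs)) xs) \<le> 0"
proof (induction xs rule: digs.induct)
  case (1 xs)
  show ?case
  proof (cases "0 < hd0 xs")
    case True
    have d: "digs xs = hd0 (drop 1 xs) # digs (drop 2 xs)" by (subst digs.simps) (simp add: True)
    show ?thesis using 1[OF True] by (simp add: d)
  next
    case False
    then have "digs xs = []" by (subst digs.simps) simp
    then show ?thesis using False by simp
  qed
qed

lemma digs_length: "length (digs xs) \<le> length xs"
proof (rule ccontr)
  assume "\<not> length (digs xs) \<le> length xs"
  then show False using digs_nth[of "length xs" xs] by simp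
qed

lemma dimv_nth: "i < dimv xs \<Longrightarrow> 0 < hd0 (drop i xs)"
  unfolding dimv_def
proof (induction xs arbitrary: i)
  case (Cons x xs)
  then show ?case by (cases i) (auto split: if_splits)
qed simp

lemma dimv_end: "hd0 (drop (dimv xs) xs) \<le> 0"
  unfolding dimv_def by (induction xs) auto

lemma dimv_length: "dimv xs \<le> length xs"
  by (simp add: dimv_def length_takeWhile_le)

definition digit_word :: "int list \<Rightarrow> bool" where "digit_word u \<longleftrightarrow> set u \<subseteq> {0, 1, 2}"

lemma hd0_digit: "digit_word u \<Longrightarrow> 0 \<le> hd0 (drop i u) \<and> hd0 (drop i u) \<le> 2"
proof (cases "drop i u")
  case (Cons a xs)
  assume "digit_word u"
  moreover have "a \<in> set u" using in_set_dropD[of a i u] Cons by simp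
  ultimately have "a \<in> {0, 1, 2}" unfolding digit_word_def by blast
  then show ?thesis using Cons by auto
qed simp

lemma digit_word_drop: "digit_word u \<Longrightarrow> digit_word (drop i u)"
  using set_drop_subset[of i u] by (auto simp: digit_word_def)

text \<open>Malformed words may contain the digit 2, so the bound is twice the usual
  \<open>2 ^ length ds - 1\<close>.\<close>

lemma dval_bounds:
  "(\<And>d. d \<in> set ds \<Longrightarrow> 0 \<le> d \<and> d \<le> 2) \<Longrightarrow> 0 \<le> dval ds \<and> dval ds \<le> 2 ^ Suc (length ds) - 2"
proof (induction ds)
  case (Cons d ds)
  then have "0 \<le> dval ds \<and> dval ds \<le> 2 ^ Suc (length ds) - 2" "0 \<le> d \<and> d \<le> 2" by auto
  then show ?case by (auto simp: dval_def)
qed (simp add: dval_def)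

lemma dval_snoc: "dval (ds @ [d]) = dval ds + 2 ^ length ds * d"
  by (simp add: dval_def horner_sum_append)

lemma digs_digit:
  assumes "digit_word xs" "d \<in> set (digs xs)"
  shows "0 \<le> d \<and> d \<le> 2"
proof -
  obtain i where "i < length (digs xs)" "digs xs ! i = d" using assms(2) by (auto simp: in_set_conv_nth)
  then show ?thesis using digs_nth[of i xs] hd0_digit[OF assms(1)] by metis
qed

abbreviation "rPtr \<equiv> -116 :: int"
abbreviation "rVal \<equiv> -117 :: int"
abbreviation "rPow \<equiv> -118 :: int"
abbreviation "rDig \<equiv> -119 :: int"
abbreviation "rIdx \<equiv> -120 :: int"
abbreviation "rCnt \<equiv> -121 :: int"

definition inc :: "int \<Rightarrow> int \<Rightarrow> com" where "inc i z = asg i (Pl (Vr i) (Cn z))"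

text \<open>\<open>rDig\<close> keeps the last digit that was read, so its initial value 1 agrees
  with the default of \<open>dlast\<close>.\<close>

definition nat_com :: com where
  "nat_com = Seq (asg rVal (Cn 0)) (Seq (asg rPow (Cn 1)) (Seq (asg rDig (Cn 1)) (Seq
     (while_loop (Rd (Vr rPtr)) (Seq (asg rDig (Rd (Pl (Vr rPtr) (Cn 1))))
        (Seq (asg rVal (Pl (Vr rVal) (Ti (Vr rPow) (Vr rDig))))
        (Seq (asg rPow (Ti (Cn 2) (Vr rPow))) (inc rPtr 2)))))
     (inc rPtr 1))))"

definition dim_com :: "int \<Rightarrow> com" where
  "dim_com i = Seq (while_loop (Rd (Vr rPtr)) (Seq (inc i 1) (inc rPtr 1))) (inc rPtr 1)"

definition adr :: "int \<Rightarrow> expr" where "adr c = Pl (Cn (- 1000 - c)) (Ti (Cn (-5)) (Vr rIdx))"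

definition item_com :: com where
  "item_com = Seq (store (adr 0) (Rd (Vr rPtr))) (Seq (inc rPtr 1) (Seq nat_com (Seq (store (adr 1) (Vr rVal))
     (Seq (store (adr 2) (Vr rDig)) (Seq nat_com (Seq (store (adr 3) (Vr rVal)) (Seq (store (adr 4) (Vr rDig)) (inc rIdx 1))))))))"

definition inp :: "int list \<Rightarrow> memory \<Rightarrow> bool" where
  "inp u \<sigma> \<longleftrightarrow> (\<forall>i. \<sigma> (int i + 1) = hd0 (drop i u))"

lemma inp_upd: "inp u \<sigma> \<Longrightarrow> i \<le> 0 \<Longrightarrow> inp u (\<sigma>(i := v))"
  by (auto simp: inp_def)

lemma bounded_upd: "bounded s \<sigma> \<Longrightarrow> \<bar>v\<bar> \<le> 2 ^ s \<Longrightarrow> bounded s (\<sigma>(i := v))"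
  by (auto simp: bounded_def)

lemma runs_inc:
  assumes "bounded s \<sigma>" "11 \<le> s" "i \<in> {-1000..-65}" "\<bar>z\<bar> \<le> 2000" "Q (\<sigma>(i := \<sigma> i + z))"
  shows "runs s (inc i z) 240 \<sigma> Q"
proof -
  have "runs s (inc i z) (ecost (Pl (Vr i) (Cn z))) \<sigma> Q"
    unfolding inc_def
    by (rule runs_asg[OF assms(1)]) (use assms const_le[of s i] const_le[of s z] in \<open>auto simp: temp_def\<close>)
  then show ?thesis by (rule runs_mono) (auto simp: ecost_def power2_eq_square)
qed

definition nat_state :: "memory \<Rightarrow> int list \<Rightarrow> nat \<Rightarrow> memory" where
  "nat_state \<sigma> ds i = \<sigma>(rVal := dval (take i ds), rPow := 2 ^ i, rDig := dlast (take i ds), rPtr := \<sigma> rPtr + 2 * int i)"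

text \<open>\<open>q\<close> counts the symbols read so far; the next one lies in register
  \<open>q + 1\<close>.\<close>

lemma runs_nat_com:
  assumes \<sigma>: "inp u \<sigma>" "\<sigma> rPtr = int q + 1" "bounded s \<sigma>" and u: "digit_word u"
    and s: "length u + 11 \<le> s" "int q + 2 * int (length u) + 10 \<le> 2 ^ s"
    and ds: "ds = digs (drop q u)"
  shows "runs s nat_com (5000 * (length u + 2)) \<sigma> (\<lambda>\<sigma>'.
    \<sigma>' = (nat_state \<sigma> ds (length ds))(rPtr := \<sigma> rPtr + 2 * int (length ds) + 1))"
proof -
  have s11: "11 \<le> s" "1 \<le> s" using s by auto
  have len: "length ds \<le> length u" using digs_length[of "drop q u"] by (simp add: ds)
  have regs: "\<bar>z\<bar> \<le> 2 ^ s" if "\<bar>z\<bar> \<le> 2000" for z :: int using that const_le[OF s11(1)] by blast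
  have pw: "(2 :: int) ^ i \<le> 2 ^ s" if "i \<le> length u + 11" for i using that s by (intro power_increasing) auto
  have dig: "0 \<le> d \<and> d \<le> 2" if "d \<in> set ds" for d
    using digs_digit[OF digit_word_drop[OF u]] that by (simp add: ds)
  have val: "\<bar>dval (take i ds)\<bar> \<le> 2 ^ s" if "i \<le> length ds" for i
  proof -
    have "0 \<le> dval (take i ds) \<and> dval (take i ds) \<le> 2 ^ Suc (length (take i ds)) - 2"
      by (rule dval_bounds) (use dig set_take_subset[of i ds] in auto)
    moreover have "(2 :: int) ^ Suc (length (take i ds)) \<le> 2 ^ s" using that len by (intro pw) simp
    ultimately show ?thesis by linarith
  qed
  have lst: "0 \<le> dlast (take i ds) \<and> dlast (take i ds) \<le> 2" for i
  proof (cases "take i ds = []")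
    case False
    then have "last (take i ds) \<in> set ds" using last_in_set in_set_takeD by fast
    then show ?thesis using dig False by (simp add: dlast_def)
  qed (simp add: dlast_def)
  have bd: "bounded s (nat_state \<sigma> ds i)" if "i \<le> length ds" for i
  proof -
    have "\<bar>\<sigma> rPtr + 2 * int i\<bar> \<le> 2 ^ s" using that len s \<sigma>(2) by simp
    moreover have "\<bar>2 ^ i\<bar> \<le> (2 :: int) ^ s" using pw[of i] that len by simp
    moreover have "\<bar>dlast (take i ds)\<bar> \<le> 2 ^ s" using lst[of i] regs[of "dlast (take i ds)"] by simp
    ultimately show ?thesis unfolding nat_state_def using val[OF that] by (intro bounded_upd \<sigma>(3))
  qed
  have nin: "inp u (nat_state \<sigma> ds i)" for i
    unfolding nat_state_def using \<sigma>(1) by (intro inp_upd) auto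
  have rd: "nat_state \<sigma> ds i (\<sigma> rPtr + 2 * int i + int j) = hd0 (drop (q + 2 * i + j) u)" for i j
  proof -
    have "nat_state \<sigma> ds i (int (q + 2 * i + j) + 1) = hd0 (drop (q + 2 * i + j) u)"
      using nin by (simp add: inp_def del: of_nat_add)
    moreover have "int (q + 2 * i + j) + 1 = \<sigma> rPtr + 2 * int i + int j" using \<sigma>(2) by simp
    ultimately show ?thesis by metis
  qed
  have ptr: "nat_state \<sigma> ds i rPtr = \<sigma> rPtr + 2 * int i" for i by (simp add: nat_state_def)
  have step: "runs s (Seq (asg rDig (Rd (Pl (Vr rPtr) (Cn 1))))
        (Seq (asg rVal (Pl (Vr rVal) (Ti (Vr rPow) (Vr rDig))))
        (Seq (asg rPow (Ti (Cn 2) (Vr rPow))) (inc rPtr 2)))) (540 + (540 + (240 + 240)))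
        (nat_state \<sigma> ds i) (\<lambda>\<sigma>'. \<sigma>' = nat_state \<sigma> ds (Suc i))" if i: "i < length ds" for i
  proof -
    let ?n = "nat_state \<sigma> ds i"
    have d: "ds ! i = hd0 (drop (q + 2 * i + 1) u)"
      using digs_nth[of i "drop q u"] i by (simp add: ds add.commute add.left_commute)
    then have v1: "val (Rd (Pl (Vr rPtr) (Cn 1))) ?n = ds ! i"
      using rd[of i 1] by (simp add: ptr)
    have dd: "0 \<le> ds ! i" "ds ! i \<le> 2" using dig[of "ds ! i"] i by auto
    have tk: "take (Suc i) ds = take i ds @ [ds ! i]" using i by (rule take_Suc_conv_app_nth)
    have v2: "dval (take i ds) + 2 ^ i * ds ! i = dval (take (Suc i) ds)"
      using i by (simp add: tk dval_snoc)
    let ?n1 = "?n(rDig := ds ! i)"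
    let ?n2 = "?n1(rVal := dval (take (Suc i) ds))"
    let ?n3 = "?n2(rPow := 2 ^ Suc i)"
    have b: "bounded s ?n" "bounded s ?n1" "bounded s ?n2" "bounded s ?n3"
    proof -
      show 0: "bounded s ?n" using bd i by simp
      show 1: "bounded s ?n1" using dd regs[of "ds ! i"] by (intro bounded_upd 0) auto
      show 2: "bounded s ?n2" using val[of "Suc i"] i by (intro bounded_upd 1) auto
      show "bounded s ?n3" using pw[of "Suc i"] i len by (intro bounded_upd 2) simp
    qed
    show ?thesis
    proof (intro runs_Seq)
      have q2: "\<sigma> rPtr + 2 * int i + 1 \<notin> temp" using \<sigma>(2) by (simp add: temp_def)
      have e: "ecost (Rd (Pl (Vr rPtr) (Cn 1))) = 540" "ecost (Pl (Vr rVal) (Ti (Vr rPow) (Vr rDig))) = 540"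
        "ecost (Ti (Cn 2) (Vr rPow)) = 240" by (simp_all add: ecost_def power2_eq_square)
      have r4: "runs s (inc rPtr 2) 240 ?n3 (\<lambda>\<sigma>'. \<sigma>' = nat_state \<sigma> ds (Suc i))"
        by (rule runs_inc[OF b(4) s11(1)]) (use tk in \<open>auto simp: nat_state_def dlast_def fun_eq_iff\<close>)
      have r3: "runs s (asg rPow (Ti (Cn 2) (Vr rPow))) 240 ?n2 (\<lambda>\<sigma>'. runs s (inc rPtr 2) 240 \<sigma>' (\<lambda>\<sigma>'. \<sigma>' = nat_state \<sigma> ds (Suc i)))"
      proof -
        have "val (Ti (Cn 2) (Vr rPow)) ?n2 = 2 ^ Suc i" by (simp add: nat_state_def)
        then show ?thesis unfolding e(3)[symmetric]
          by (intro runs_asg[OF b(3) s11(2)]) (use r4 regs[of rPow] regs[of 2] in \<open>auto simp: temp_def e simp del: fun_upd_apply val.simps\<close>)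
      qed
      have r2: "runs s (asg rVal (Pl (Vr rVal) (Ti (Vr rPow) (Vr rDig)))) 540 ?n1 (\<lambda>\<sigma>'. runs s (Seq (asg rPow (Ti (Cn 2) (Vr rPow))) (inc rPtr 2)) (240 + 240) \<sigma>' (\<lambda>\<sigma>'. \<sigma>' = nat_state \<sigma> ds (Suc i)))"
      proof -
        have "val (Pl (Vr rVal) (Ti (Vr rPow) (Vr rDig))) ?n1 = dval (take (Suc i) ds)"
          using v2 by (simp add: nat_state_def)
        then show ?thesis unfolding e(2)[symmetric]
          by (intro runs_asg[OF b(2) s11(2)]) (use runs_Seq[OF r3] regs[of rPow] regs[of rVal] regs[of rDig] in \<open>auto simp: temp_def e simp del: fun_upd_apply val.simps\<close>)
      qed
      show "runs s (asg rDig (Rd (Pl (Vr rPtr) (Cn 1)))) 540 ?n (\<lambda>\<sigma>'. runs s (Seq (asg rVal (Pl (Vr rVal) (Ti (Vr rPow) (Vr rDig)))) (Seq (asg rPow (Ti (Cn 2) (Vr rPow))) (inc rPtr 2))) (540 + (240 + 240)) \<sigma>' (\<lambda>\<sigma>'. \<sigma>' = nat_state \<sigma> ds (Suc i)))"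
        unfolding e(1)[symmetric]
      proof (intro runs_asg[OF b(1) s11(2)])
        show "safe s ?n (Rd (Pl (Vr rPtr) (Cn 1)))" using q2 regs[of rPtr] regs[of 1] by (simp add: temp_def ptr)
      qed (use runs_Seq[OF r2] regs[of rDig] v1 in \<open>auto simp: temp_def e simp del: fun_upd_apply val.simps\<close>)
    qed
  qed
  let ?w = "while_loop (Rd (Vr rPtr)) (Seq (asg rDig (Rd (Pl (Vr rPtr) (Cn 1))))
        (Seq (asg rVal (Pl (Vr rVal) (Ti (Vr rPow) (Vr rDig))))
        (Seq (asg rPow (Ti (Cn 2) (Vr rPow))) (inc rPtr 2))))"
  let ?Q = "\<lambda>\<sigma>'. \<sigma>' = (nat_state \<sigma> ds (length ds))(rPtr := \<sigma> rPtr + 2 * int (length ds) + 1)"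
  have w: "runs s ?w (Suc (length ds) * (540 + (540 + (240 + 240)) + ecost (Rd (Vr rPtr)))) (nat_state \<sigma> ds 0)
     (\<lambda>\<sigma>'. runs s (inc rPtr 1) 240 \<sigma>' ?Q)"
  proof (rule runs_while[where I = "\<lambda>i \<sigma>'. \<sigma>' = nat_state \<sigma> ds i"])
    fix i \<sigma>' assume i: "i < length ds" "\<sigma>' = nat_state \<sigma> ds i"
    have "0 < hd0 (drop (q + 2 * i) u)" using digs_nth[of i "drop q u"] i by (simp add: ds add.commute)
    then show "0 < val (Rd (Vr rPtr)) \<sigma>' \<and> runs s (Seq (asg rDig (Rd (Pl (Vr rPtr) (Cn 1))))
        (Seq (asg rVal (Pl (Vr rVal) (Ti (Vr rPow) (Vr rDig))))
        (Seq (asg rPow (Ti (Cn 2) (Vr rPow))) (inc rPtr 2)))) (540 + (540 + (240 + 240))) \<sigma>' (\<lambda>\<sigma>'. \<sigma>' = nat_state \<sigma> ds (Suc i))"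
      using step[OF i(1)] rd[of i 0] by (simp add: i(2) ptr)
  next
    fix \<sigma>' assume "\<sigma>' = nat_state \<sigma> ds (length ds)"
    moreover have "runs s (inc rPtr 1) 240 (nat_state \<sigma> ds (length ds)) ?Q"
      by (rule runs_inc[OF bd s11(1)]) (auto simp: ptr)
    moreover have "hd0 (drop (q + 2 * length ds) u) \<le> 0" using digs_end[of "drop q u"] by (simp add: ds add.commute)
    ultimately show "val (Rd (Vr rPtr)) \<sigma>' \<le> 0 \<and> runs s (inc rPtr 1) 240 \<sigma>' ?Q"
      using rd[of "length ds" 0] by (simp add: ptr)
  next
    fix i \<sigma>' assume "i \<le> length ds" "\<sigma>' = nat_state \<sigma> ds i"
    moreover have "\<sigma> rPtr + 2 * int i \<notin> temp" using \<sigma>(2) by (simp add: temp_def)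
    ultimately show "bounded s \<sigma>' \<and> safe s \<sigma>' (Rd (Vr rPtr))" using bd regs[of rPtr] by (simp add: temp_def ptr)
  qed (use s11 in auto)
  let ?kw = "Suc (length ds) * (540 + (540 + (240 + 240)) + ecost (Rd (Vr rPtr)))"
  let ?s1 = "\<sigma>(rVal := 0)"
  let ?s2 = "?s1(rPow := 1)"
  have b1: "bounded s ?s1" using \<sigma>(3) by (intro bounded_upd) auto
  have b2: "bounded s ?s2" using regs[of 1] by (intro bounded_upd b1) auto
  have e1: "ecost (Cn z) = 60" for z by (simp add: ecost_def)
  have n0: "?s2(rDig := 1) = nat_state \<sigma> ds 0" by (auto simp: nat_state_def dval_def dlast_def fun_eq_iff)
  have r3: "runs s (asg rDig (Cn 1)) 60 ?s2 (\<lambda>\<sigma>'. runs s (Seq ?w (inc rPtr 1)) (?kw + 240) \<sigma>' ?Q)"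
    unfolding e1[of 1, symmetric]
    by (intro runs_asg[OF b2 s11(2)]) (use runs_Seq[OF w] n0 regs[of rDig] regs[of 1] in \<open>auto simp: temp_def e1 simp del: fun_upd_apply\<close>)
  have r2: "runs s (asg rPow (Cn 1)) 60 ?s1 (\<lambda>\<sigma>'. runs s (Seq (asg rDig (Cn 1)) (Seq ?w (inc rPtr 1))) (60 + (?kw + 240)) \<sigma>' ?Q)"
    unfolding e1[of 1, symmetric]
    by (intro runs_asg[OF b1 s11(2)]) (use runs_Seq[OF r3] regs[of rPow] regs[of 1] in \<open>auto simp: temp_def e1 simp del: fun_upd_apply\<close>)
  have r1: "runs s (asg rVal (Cn 0)) 60 \<sigma> (\<lambda>\<sigma>'. runs s (Seq (asg rPow (Cn 1)) (Seq (asg rDig (Cn 1)) (Seq ?w (inc rPtr 1)))) (60 + (60 + (?kw + 240))) \<sigma>' ?Q)"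
    unfolding e1[of 0, symmetric]
    by (intro runs_asg[OF \<sigma>(3) s11(2)]) (use runs_Seq[OF r2] regs[of rVal] regs[of 0] in \<open>auto simp: temp_def e1 simp del: fun_upd_apply\<close>)
  show ?thesis unfolding nat_com_def
  proof (rule runs_mono[OF runs_Seq[OF r1]])
    have "?kw \<le> Suc (length u) * 2000" using len by (intro mult_le_mono) (auto simp: ecost_def power2_eq_square)
    then show "60 + (60 + (60 + (?kw + 240))) \<le> 5000 * (length u + 2)" by simp
  qed
qed

lemma runs_dim_com:
  assumes \<sigma>: "inp u \<sigma>" "\<sigma> rPtr = int q + 1" "\<sigma> i = 0" "bounded s \<sigma>"
    and i: "i \<in> {-105..-101}"
    and s: "length u + 11 \<le> s" "int q + 2 * int (length u) + 10 \<le> 2 ^ s"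
    and d: "d = dimv (drop q u)"
  shows "runs s (dim_com i) (5000 * (length u + 2)) \<sigma> (\<lambda>\<sigma>'.
    \<sigma>' = \<sigma>(i := int d, rPtr := int (q + d + 1) + 1))"
proof -
  have s11: "11 \<le> s" "1 \<le> s" using s by auto
  have len: "d \<le> length u" using dimv_length[of "drop q u"] by (simp add: d)
  have regs: "\<bar>z\<bar> \<le> 2 ^ s" if "\<bar>z\<bar> \<le> 2000" for z :: int using that const_le[OF s11(1)] by blast
  have jle: "int j \<le> 2 ^ s" "int (q + j) + 1 \<le> 2 ^ s" if "j \<le> length u" for j
    using that s(2) by linarith+
  define st where "st = (\<lambda>j. \<sigma>(i := int j, rPtr := int (q + j) + 1))"
  have bd: "bounded s (st j)" if "j \<le> d" for j
    unfolding st_def by (intro bounded_upd \<sigma>(4)) (use jle[of j] that len in auto)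
  have bd': "bounded s ((st j)(i := int (Suc j)))" if "j < d" for j
    by (rule bounded_upd[OF bd]) (use jle[of "Suc j"] that len in auto)
  have nin: "inp u (st j)" for j
    unfolding st_def using \<sigma>(1) i by (intro inp_upd) (auto simp: inp_def)
  have rd: "val (Rd (Vr rPtr)) (st j) = hd0 (drop (q + j) u)" for j
  proof -
    have "st j (int (q + j) + 1) = hd0 (drop (q + j) u)" using \<sigma>(1) i by (auto simp: st_def inp_def simp del: of_nat_add)
    then show ?thesis by (simp add: st_def)
  qed
  have "runs s (while_loop (Rd (Vr rPtr)) (Seq (inc i 1) (inc rPtr 1))) (Suc d * ((240 + 240) + ecost (Rd (Vr rPtr)))) (st 0)
     (\<lambda>\<sigma>'. runs s (inc rPtr 1) 240 \<sigma>' (\<lambda>\<sigma>'. \<sigma>' = \<sigma>(i := int d, rPtr := int (q + d + 1) + 1)))"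
  proof (rule runs_while[where I = "\<lambda>j \<sigma>'. \<sigma>' = st j"])
    fix j \<sigma>' assume j: "j < d" "\<sigma>' = st j"
    have "0 < hd0 (drop (q + j) u)" using dimv_nth[of j "drop q u"] j by (simp add: d add.commute)
    moreover have "runs s (Seq (inc i 1) (inc rPtr 1)) (240 + 240) \<sigma>' (\<lambda>\<sigma>'. \<sigma>' = st (Suc j))"
    proof (rule runs_Seq, rule runs_inc)
      have "\<sigma>'(i := \<sigma>' i + 1) = (st j)(i := int (Suc j))" using i by (auto simp: j st_def)
      moreover have "runs s (inc rPtr 1) 240 ((st j)(i := int (Suc j))) (\<lambda>\<sigma>'. \<sigma>' = st (Suc j))"
        by (rule runs_inc[OF bd'[OF j(1)]]) (use s11 i in \<open>auto simp: st_def fun_eq_iff\<close>)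
      ultimately show "runs s (inc rPtr 1) 240 (\<sigma>'(i := \<sigma>' i + 1)) (\<lambda>\<sigma>'. \<sigma>' = st (Suc j))" by simp
    qed (use bd j s11 i in auto)
    ultimately show "0 < val (Rd (Vr rPtr)) \<sigma>' \<and> runs s (Seq (inc i 1) (inc rPtr 1)) (240 + 240) \<sigma>' (\<lambda>\<sigma>'. \<sigma>' = st (Suc j))"
      using rd[of j] j by simp
  next
    fix \<sigma>' assume "\<sigma>' = st d"
    moreover have "hd0 (drop (q + d) u) \<le> 0" using dimv_end[of "drop q u"] by (simp add: d add.commute)
    moreover have "runs s (inc rPtr 1) 240 (st d) (\<lambda>\<sigma>'. \<sigma>' = \<sigma>(i := int d, rPtr := int (q + d + 1) + 1))"
      by (rule runs_inc[OF bd]) (use s11 in \<open>auto simp: st_def\<close>)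
    ultimately show "val (Rd (Vr rPtr)) \<sigma>' \<le> 0 \<and> runs s (inc rPtr 1) 240 \<sigma>' (\<lambda>\<sigma>'. \<sigma>' = \<sigma>(i := int d, rPtr := int (q + d + 1) + 1))"
      using rd[of d] by simp
  next
    fix j \<sigma>' assume "j \<le> d" "\<sigma>' = st j"
    then show "bounded s \<sigma>' \<and> safe s \<sigma>' (Rd (Vr rPtr))" using bd regs[of rPtr] by (simp add: temp_def st_def)
  qed (use s11 in auto)
  moreover have "st 0 = \<sigma>" using \<sigma>(2,3) by (auto simp: st_def fun_eq_iff)
  ultimately show ?thesis unfolding dim_com_def
  proof (intro runs_mono[OF runs_Seq])
    have "Suc d * ((240 + 240) + ecost (Rd (Vr rPtr))) \<le> Suc (length u) * 2000"
      using len by (intro mult_le_mono) (auto simp: ecost_def power2_eq_square)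
    then show "Suc d * ((240 + 240) + ecost (Rd (Vr rPtr))) + 240 \<le> 5000 * (length u + 2)" by simp
  qed auto
qed

text \<open>The position \<open>q\<close> is kept in addition to the remaining list because the
  pointer may run past the end of the word, where the list no longer determines it.\<close>

definition parsed :: "int list \<Rightarrow> int list \<Rightarrow> memory \<Rightarrow> nat \<Rightarrow> nat \<Rightarrow> memory \<Rightarrow> bool" where
  "parsed u xs \<tau> n q \<sigma> \<longleftrightarrow> inp u \<sigma> \<and> \<sigma> rPtr = int q + 1 \<and> drop q u = (item_rest ^^ n) xs \<and> \<sigma> rIdx = int n \<and>
     (\<forall>i<n. \<forall>c<5. \<sigma> (- 1000 - int c - 5 * int i) = cellv c ((item_rest ^^ i) xs)) \<and>
     (\<forall>i\<in>{-115..-101}. \<sigma> i = \<tau> i)"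

lemma drop_rest:
  "nat_rest (drop q u) = drop (q + (2 * length (digs (drop q u)) + 1)) u"
  by (simp add: nat_rest_def add.commute)

lemma runs_store_cell:
  assumes "bounded s \<sigma>" "11 \<le> s" "\<sigma> rIdx = int n" and c: "0 \<le> c" "c < 5" and e: "safe s \<sigma> e" "esize e \<le> 2"
    and \<sigma>': "\<sigma>' = \<sigma>(- 1000 - c - 5 * int n := v)" "val e \<sigma> = v"
  shows "runs s (store (adr c) e) 780 \<sigma> (\<lambda>\<tau>. \<tau> = \<sigma>')"
proof -
  have v: "val (adr c) \<sigma> = - 1000 - c - 5 * int n" using assms(3) by (simp add: adr_def)
  have "\<bar>- 1000 - c\<bar> \<le> 2 ^ s" "\<bar>-5 :: int\<bar> \<le> 2 ^ s" "\<bar>rIdx\<bar> \<le> 2 ^ s"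
    by (intro const_le[OF assms(2)]; use c in simp)+
  then have safe: "safe s \<sigma> (adr c)" by (simp add: adr_def temp_def)
  have "runs s (store (adr c) e) (ecost e + ecost (adr c)) \<sigma> (\<lambda>\<tau>. \<tau> = \<sigma>')"
  proof (rule runs_store[OF assms(1) _ e(1) _ safe])
    show "val (adr c) \<sigma> \<notin> temp" unfolding v using c by (simp add: temp_def)
    show "\<sigma>(val (adr c) \<sigma> := val e \<sigma>) = \<sigma>'" unfolding v \<sigma>'(2) \<sigma>'(1)[symmetric] by (rule refl)
  qed (use assms(2) e(2) in \<open>auto simp: adr_def\<close>)
  moreover have "ecost e \<le> 240" using power_mono[OF e(2), of 2] by (simp add: ecost_def)
  moreover have "ecost (adr c) = 540" by (simp add: ecost_def adr_def power2_eq_square)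
  ultimately show ?thesis by (elim runs_mono) auto
qed

lemma runs_Seq_det:
  assumes "runs s c k \<sigma> (\<lambda>\<sigma>'. \<sigma>' = \<tau>)" "runs s c' k' \<tau> Q"
  shows "runs s (Seq c c') (k + k') \<sigma> Q"
  by (rule runs_Seq, rule runs_mono[OF assms(1)]) (use assms(2) in auto)

text \<open>Even in a malformed word a number has at most \<open>length u\<close> digits, so one
  item advances the pointer by at most \<open>4 * length u + 3\<close>. This keeps all addresses and
  the time polynomial on every input.\<close>

lemma runs_item_com:
  assumes p: "parsed u xs \<tau> n q \<sigma>" and b: "bounded s \<sigma>" and u: "digit_word u"
    and s: "length u + 11 \<le> s" "int q + int n + 8 * int (length u) + 40 \<le> 2 ^ s"
  shows "runs s item_com (20000 * (length u + 2)) \<sigma> (\<lambda>\<sigma>'. bounded s \<sigma>' \<and> \<sigma>' rCnt = \<sigma> rCnt \<and>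
    (\<exists>q'\<le>q + 4 * length u + 3. parsed u xs \<tau> (Suc n) q' \<sigma>'))"
proof -
  let ?N = "length u"
  have s11: "11 \<le> s" "1 \<le> s" using s by auto
  have regs: "\<bar>z\<bar> \<le> 2 ^ s" if "\<bar>z\<bar> \<le> 2000" for z :: int using that const_le[OF s11(1)] by blast
  from p have in0: "inp u \<sigma>" and ptr: "\<sigma> rPtr = int q + 1" and dq: "drop q u = (item_rest ^^ n) xs"
    and idx: "\<sigma> rIdx = int n" by (auto simp: parsed_def)
  define A where "A = (\<lambda>c. - 1000 - c - 5 * int n)"
  define d1 where "d1 = digs (drop (q + 1) u)"
  define q1 where "q1 = q + 1 + (2 * length d1 + 1)"
  define d2 where "d2 = digs (drop q1 u)"
  define q2 where "q2 = q1 + (2 * length d2 + 1)"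
  have l: "length d1 \<le> ?N" "length d2 \<le> ?N"
    using digs_length[of "drop (q + 1) u"] digs_length[of "drop q1 u"] by (auto simp: d1_def d2_def)
  have q1: "int q1 \<le> int q + 2 * int ?N + 2" and q2: "int q2 \<le> int q + 4 * int ?N + 3" using l by (auto simp: q1_def q2_def)
  have r1: "nat_rest (drop 1 (drop q u)) = drop q1 u"
    using drop_rest[of "q + 1" u] by (simp add: q1_def d1_def)
  have r2: "item_rest (drop q u) = drop q2 u"
    using drop_rest[of q1 u] by (simp add: item_rest_def r1[simplified] q2_def d2_def)
  have dd: "cellv 0 (drop q u) = hd0 (drop q u)" "cellv 1 (drop q u) = dval d1" "cellv 2 (drop q u) = dlast d1"
    "cellv 3 (drop q u) = dval d2" "cellv 4 (drop q u) = dlast d2"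
    using r1 by (simp_all add: cellv_def d1_def d2_def numeral_eq_Suc)
  define t1 where "t1 = \<sigma>(A 0 := hd0 (drop q u))"
  define t2 where "t2 = t1(rPtr := int (q + 1) + 1)"
  define t3 where "t3 = (nat_state t2 d1 (length d1))(rPtr := int q1 + 1)"
  define t4 where "t4 = t3(A 1 := dval d1)"
  define t5 where "t5 = t4(A 2 := dlast d1)"
  define t6 where "t6 = (nat_state t5 d2 (length d2))(rPtr := int q2 + 1)"
  define t7 where "t7 = t6(A 3 := dval d2)"
  define t8 where "t8 = t7(A 4 := dlast d2)"
  define t9 where "t9 = t8(rIdx := int (Suc n))"
  note ts = t1_def t2_def t3_def t4_def t5_def t6_def t7_def t8_def t9_def
  have digl: "\<bar>dval ds\<bar> \<le> 2 ^ s \<and> \<bar>dlast ds\<bar> \<le> 2 ^ s \<and> \<bar>2 ^ length ds\<bar> \<le> (2 :: int) ^ s"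
    if ds: "ds = digs (drop i u)" for ds i
  proof -
    have le: "length ds \<le> ?N" using digs_length[of "drop i u"] by (simp add: ds)
    have dig: "0 \<le> d \<and> d \<le> 2" if "d \<in> set ds" for d
      using digs_digit[OF digit_word_drop[OF u]] that by (simp add: ds)
    have "(2 :: int) ^ Suc (length ds) \<le> 2 ^ s" using le s by (intro power_increasing) auto
    moreover have "0 \<le> dval ds \<and> dval ds \<le> 2 ^ Suc (length ds) - 2" by (rule dval_bounds) (use dig in auto)
    moreover have "\<bar>dlast ds\<bar> \<le> 2" using dig by (cases "ds = []") (auto simp: dlast_def abs_of_nonneg)
    moreover have "(2 :: int) \<le> 2 ^ s" using regs[of 2] by simp
    moreover have "\<bar>2 ^ length ds\<bar> \<le> (2 :: int) ^ s" using le s by (auto intro: power_increasing)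
    ultimately show ?thesis by linarith
  qed
  have qs: "\<bar>int (q + 1) + 1\<bar> \<le> 2 ^ s" "\<bar>int q1 + 1\<bar> \<le> 2 ^ s" "\<bar>int q2 + 1\<bar> \<le> 2 ^ s" "\<bar>int (Suc n)\<bar> \<le> 2 ^ s"
    using s(2) q1 q2 by linarith+
  have bn: "bounded s ((nat_state t ds (length ds))(rPtr := z))" if "bounded s t" "ds = digs (drop i u)" "\<bar>z\<bar> \<le> 2 ^ s" for t ds i z
  proof -
    have "(nat_state t ds (length ds))(rPtr := z) = t(rVal := dval ds, rPow := 2 ^ length ds, rDig := dlast ds, rPtr := z)"
      by (simp add: nat_state_def)
    then show ?thesis using digl[OF that(2)] that(1,3) by (simp only:) (intro bounded_upd; blast)
  qed
  have hd: "\<bar>hd0 (drop q u)\<bar> \<le> 2 ^ s" using hd0_digit[OF u, of q] regs[of "hd0 (drop q u)"] by simp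
  have b1: "bounded s t1" unfolding t1_def using b hd by (rule bounded_upd)
  have b2: "bounded s t2" unfolding t2_def using b1 qs(1) by (rule bounded_upd)
  have b3: "bounded s t3" unfolding t3_def by (rule bn[OF b2 d1_def qs(2)])
  have b4: "bounded s t4" unfolding t4_def using b3 digl[OF d1_def] by (intro bounded_upd) auto
  have b5: "bounded s t5" unfolding t5_def using b4 digl[OF d1_def] by (intro bounded_upd) auto
  have b6: "bounded s t6" unfolding t6_def by (rule bn[OF b5 d2_def qs(3)])
  have b7: "bounded s t7" unfolding t7_def using b6 digl[OF d2_def] by (intro bounded_upd) auto
  have b8: "bounded s t8" unfolding t8_def using b7 digl[OF d2_def] by (intro bounded_upd) auto
  have b9: "bounded s t9" unfolding t9_def using b8 qs(4) by (rule bounded_upd)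
  have An: "A 0 \<le> -1000" "A 1 \<le> -1000" "A 2 \<le> -1000" "A 3 \<le> -1000" "A 4 \<le> -1000" by (simp_all add: A_def)
  have Aneq: "A 0 \<noteq> z" "A 1 \<noteq> z" "A 2 \<noteq> z" "A 3 \<noteq> z" "A 4 \<noteq> z" if "-1000 < z" for z using An that by linarith+
  have idxs: "t1 rIdx = int n" "t3 rIdx = int n" "t4 rIdx = int n" "t6 rIdx = int n" "t7 rIdx = int n" "t8 rIdx = int n"
    using idx Aneq by (auto simp: ts nat_state_def)
  have in2: "inp u t2" unfolding t2_def t1_def using in0 An by (intro inp_upd) auto
  have in5: "inp u t5" unfolding t5_def t4_def t3_def nat_state_def using in2 An by (intro inp_upd) auto
  have in9: "inp u t9" unfolding t9_def t8_def t7_def t6_def nat_state_def using in5 An by (intro inp_upd) auto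
  have ptr2: "t2 rPtr = int (q + 1) + 1" by (simp add: t2_def)
  have ptr5: "t5 rPtr = int q1 + 1" using Aneq by (simp add: t5_def t4_def t3_def)
  have vt4: "val (Vr rVal) t3 = dval d1" by (simp add: t3_def nat_state_def)
  have vt5: "val (Vr rDig) t4 = dlast d1" using Aneq by (simp add: t4_def t3_def nat_state_def)
  have vt7: "val (Vr rVal) t6 = dval d2" by (simp add: t6_def nat_state_def)
  have vt8: "val (Vr rDig) t7 = dlast d2" using Aneq by (simp add: t7_def t6_def nat_state_def)
  let ?kn = "5000 * (?N + 2)"
  have c9: "runs s (inc rIdx 1) 240 t8 (\<lambda>\<sigma>'. \<sigma>' = t9)"
    by (rule runs_inc[OF b8 s11(1)]) (auto simp: t9_def idxs)
  have c8: "runs s (store (adr 4) (Vr rDig)) 780 t7 (\<lambda>\<sigma>'. \<sigma>' = t8)"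
    by (rule runs_store_cell[OF b7 s11(1) idxs(5) _ _ _ _ t8_def[unfolded A_def] vt8]) (use regs[of rDig] in \<open>auto simp: temp_def\<close>)
  have c7: "runs s (store (adr 3) (Vr rVal)) 780 t6 (\<lambda>\<sigma>'. \<sigma>' = t7)"
    by (rule runs_store_cell[OF b6 s11(1) idxs(4) _ _ _ _ t7_def[unfolded A_def] vt7]) (use regs[of rVal] in \<open>auto simp: temp_def\<close>)
  have c6: "runs s nat_com ?kn t5 (\<lambda>\<sigma>'. \<sigma>' = t6)"
  proof (rule runs_mono[OF runs_nat_com[OF in5 ptr5 b5 u s(1) _ d2_def]])
    show "int q1 + 2 * int ?N + 10 \<le> 2 ^ s" using q1 s(2) by linarith
    show "\<sigma>' = t6" if "\<sigma>' = (nat_state t5 d2 (length d2))(rPtr := t5 rPtr + 2 * int (length d2) + 1)" for \<sigma>'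
      using that by (simp add: t6_def ptr5 q2_def)
  qed simp
  have c5: "runs s (store (adr 2) (Vr rDig)) 780 t4 (\<lambda>\<sigma>'. \<sigma>' = t5)"
    by (rule runs_store_cell[OF b4 s11(1) idxs(3) _ _ _ _ t5_def[unfolded A_def] vt5]) (use regs[of rDig] in \<open>auto simp: temp_def\<close>)
  have c4: "runs s (store (adr 1) (Vr rVal)) 780 t3 (\<lambda>\<sigma>'. \<sigma>' = t4)"
    by (rule runs_store_cell[OF b3 s11(1) idxs(2) _ _ _ _ t4_def[unfolded A_def] vt4]) (use regs[of rVal] in \<open>auto simp: temp_def\<close>)
  have c3: "runs s nat_com ?kn t2 (\<lambda>\<sigma>'. \<sigma>' = t3)"
  proof (rule runs_mono[OF runs_nat_com[OF in2 ptr2 b2 u s(1) _ d1_def]])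
    show "int (q + 1) + 2 * int ?N + 10 \<le> 2 ^ s" using s(2) by linarith
    show "\<sigma>' = t3" if "\<sigma>' = (nat_state t2 d1 (length d1))(rPtr := t2 rPtr + 2 * int (length d1) + 1)" for \<sigma>'
      using that by (simp add: t3_def ptr2 q1_def)
  qed simp
  have t1p: "t1 rPtr = int q + 1" using ptr Aneq by (simp add: t1_def)
  have c2: "runs s (inc rPtr 1) 240 t1 (\<lambda>\<sigma>'. \<sigma>' = t2)"
    by (rule runs_inc[OF b1 s11(1)]) (auto simp: t2_def t1p)
  have v0: "val (Rd (Vr rPtr)) \<sigma> = hd0 (drop q u)" using in0 ptr by (simp add: inp_def)
  have "safe s \<sigma> (Rd (Vr rPtr))" using regs[of rPtr] ptr by (simp add: temp_def)
  then have c1: "runs s (store (adr 0) (Rd (Vr rPtr))) 780 \<sigma> (\<lambda>\<sigma>'. \<sigma>' = t1)"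
    by (intro runs_store_cell[OF b s11(1) idx _ _ _ _ t1_def[unfolded A_def] v0]) auto
  have "runs s item_com (780 + (240 + (?kn + (780 + (780 + (?kn + (780 + (780 + 240)))))))) \<sigma> (\<lambda>\<sigma>'. \<sigma>' = t9)"
    unfolding item_com_def
    by (rule runs_Seq_det[OF c1 runs_Seq_det[OF c2 runs_Seq_det[OF c3 runs_Seq_det[OF c4
      runs_Seq_det[OF c5 runs_Seq_det[OF c6 runs_Seq_det[OF c7 runs_Seq_det[OF c8 c9]]]]]]]])
  then show ?thesis
  proof (rule runs_mono)
    fix \<sigma>' assume s9: "\<sigma>' = t9"
    have cell_old: "t9 z = \<sigma> z" if "z \<notin> {A 0, A 1, A 2, A 3, A 4}" "z \<notin> {rPtr, rVal, rPow, rDig, rIdx}" for z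
      using that by (auto simp: ts nat_state_def)
    have Ainj: "A c \<noteq> A c'" if "c \<noteq> c'" for c c' using that by (simp add: A_def)
    have cells_new: "t9 (A 0) = hd0 (drop q u)" "t9 (A 1) = dval d1" "t9 (A 2) = dlast d1" "t9 (A 3) = dval d2" "t9 (A 4) = dlast d2"
      using Aneq Ainj by (auto simp: ts nat_state_def)
    have "parsed u xs \<tau> (Suc n) q2 t9" unfolding parsed_def
    proof (intro conjI allI impI ballI)
      show "t9 rPtr = int q2 + 1" using Aneq by (simp add: t9_def t8_def t7_def t6_def)
      show "drop q2 u = (item_rest ^^ Suc n) xs" using r2 dq by simp
      show "t9 i = \<tau> i" if "i \<in> {-115..-101}" for i
        using cell_old[of i] that p An Aneq by (auto simp: parsed_def)
      fix i c assume i: "i < Suc n" and c: "c < (5 :: nat)"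
      show "t9 (- 1000 - int c - 5 * int i) = cellv c ((item_rest ^^ i) xs)"
      proof (cases "i = n")
        case True
        have "c = 0 \<or> c = 1 \<or> c = 2 \<or> c = 3 \<or> c = 4" using c by auto
        then show ?thesis using cells_new dd True unfolding A_def dq[symmetric] True by auto
      next
        case False
        then have "i < n" using i by simp
        moreover have "- 1000 - int c - 5 * int i \<notin> {A 0, A 1, A 2, A 3, A 4}"
          using c \<open>i < n\<close> by (simp add: A_def)
        ultimately show ?thesis using cell_old p c by (simp add: parsed_def)
      qed
    qed (use in9 in \<open>auto simp: t9_def\<close>)
    moreover have "q2 \<le> q + 4 * ?N + 3" using q2 by linarith
    moreover have "t9 rCnt = \<sigma> rCnt" using cell_old[of rCnt] An by auto
    ultimately show "bounded s \<sigma>' \<and> \<sigma>' rCnt = \<sigma> rCnt \<and> (\<exists>q'\<le>q + 4 * length u + 3. parsed u xs \<tau> (Suc n) q' \<sigma>')"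
      using b9 s9 by blast
  qed simp
qed

section \<open>Assembly of the verifier, its verdict and its cost\<close>

section \<open>The verifier program\<close>

text \<open>\<open>accepts\<close> asks for some halting run. Determinism is what turns the single
  constructed run into a proof of rejection as well.\<close>

lemma exec_deterministic: "exec c M s M' \<Longrightarrow> exec c M s2 M2 \<Longrightarrow> s2 = s \<and> M2 = M'"
proof (induction arbitrary: s2 M2 rule: exec.induct)
  case (Skip M)
  then show ?case by (auto elim: exec.cases)
next
  case (Op v f M a b l)
  from Op.prems show ?case by (cases rule: exec.cases) (auto simp: Op)
next
  case (Seq c M s M' c' s' M'')
  from Seq.prems obtain t t' N where "exec c M t N" "exec c' N t' M2" "s2 = t + t'"
    by (cases rule: exec.cases) auto
  then show ?case using Seq.IH by blast
next
  case (IfTrue M a c s M' c')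
  from IfTrue.prems IfTrue.hyps(1) obtain t where "exec c M t M2" "s2 = 1 + opval_cost M a + t"
    by (cases rule: exec.cases) auto
  then show ?case using IfTrue.IH by blast
next
  case (IfFalse M a c' s M' c)
  from IfFalse.prems IfFalse.hyps(1) obtain t where "exec c' M t M2" "s2 = 1 + opval_cost M a + t"
    by (cases rule: exec.cases) auto
  then show ?case using IfFalse.IH by blast
next
  case (WhileFalse M a c)
  from WhileFalse.prems WhileFalse.hyps show ?case by (cases rule: exec.cases) auto
next
  case (WhileTrue M a c s M' s' M'')
  from WhileTrue.prems WhileTrue.hyps(1) obtain t t' N where "exec c M t N" "exec (WhilePos a c) N t' M2"
      "s2 = 1 + opval_cost M a + t + t'"
    by (cases rule: exec.cases) auto
  then show ?case using WhileTrue.IH by blast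
qed

text \<open>The argument counts the dimensions still to be read, so the registers -101 to -105 are
  filled in this order; \<open>c\<close> is the continuation.\<close>

fun dims_com :: "nat \<Rightarrow> com \<Rightarrow> com" where
  "dims_com 0 c = c"
| "dims_com (Suc n) c = Seq (dim_com (-105 + int n)) (dims_com n c)"

text \<open>The first product counts the entries of \<open>A\<close>, \<open>B\<close>,
  \<open>b\<close>, the second those of \<open>C\<close>, \<open>c\<close>, \<open>D\<close>,
  \<open>d\<close>, the third those of \<open>S\<close>, \<open>t\<close>.\<close>

definition entries :: "nat \<Rightarrow> nat \<Rightarrow> nat \<Rightarrow> nat \<Rightarrow> nat \<Rightarrow> nat" where
  "entries m n k g r = m * (n + k + 1) + (n + g) * (k + 1) + r * (n + 1)"

definition entries_expr :: expr where
  "entries_expr = Pl (Pl (Ti (Vr (-101)) (Pl (Pl (Vr (-102)) (Vr (-103))) (Cn 1)))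
     (Ti (Pl (Vr (-102)) (Vr (-104))) (Pl (Vr (-103)) (Cn 1)))) (Ti (Vr (-105)) (Pl (Vr (-102)) (Cn 1)))"

definition parse_com :: "expr \<Rightarrow> com" where
  "parse_com tot = Seq (asg rPtr (Cn 1)) (dims_com 5 (Seq (asg (-106) entries_expr) (for_loop rCnt tot item_com)))"

definition verifier :: "expr \<Rightarrow> eqn_block list \<Rightarrow> com" where
  "verifier tot bs = Seq (parse_com tot) (Seq (seq (map block_com bs))
     (asg 0 (Pl (Cn 1) (Ti (Cn (-1)) (Vr rBad)))))"

definition dim_at :: "int list \<Rightarrow> nat \<Rightarrow> nat" where "dim_at u i = dimv ((dim_rest ^^ i) u)"

definition entries_at :: "int list \<Rightarrow> nat" where
  "entries_at u = entries (dim_at u 0) (dim_at u 1) (dim_at u 2) (dim_at u 3) (dim_at u 4)"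

definition items_at :: "int list \<Rightarrow> int list" where "items_at u = (dim_rest ^^ 5) u"

definition loaded :: "int list \<Rightarrow> nat \<Rightarrow> memory \<Rightarrow> bool" where
  "loaded u n \<sigma> \<longleftrightarrow> \<sigma> (-101) = int (dim_at u 0) \<and> \<sigma> (-102) = int (dim_at u 1) \<and> \<sigma> (-103) = int (dim_at u 2) \<and>
     \<sigma> (-104) = int (dim_at u 3) \<and> \<sigma> (-105) = int (dim_at u 4) \<and> \<sigma> (-106) = int (entries_at u) \<and>
     (\<forall>i<n. \<forall>c<5. \<sigma> (- 1000 - int c - 5 * int i) = cellv c ((item_rest ^^ i) (items_at u))) \<and>
     (\<forall>i\<in>{-115..-107}. \<sigma> i = 0)"

lemma inp_init: "inp u (init_memory u)"
proof -
  have "init_memory u (int i + 1) = hd0 (drop i u)" for i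
  proof (cases "i < length u")
    case True
    then have "drop i u = u ! i # drop (Suc i) u" by (rule Cons_nth_drop_Suc[symmetric])
    then show ?thesis using True by (simp add: init_memory_def)
  qed (simp add: init_memory_def)
  then show ?thesis by (simp add: inp_def)
qed

lemma dim_drop: "dim_rest (drop q u) = drop (q + dimv (drop q u) + 1) u"
  by (simp add: dim_rest_def add.commute)

definition pstate :: "int list \<Rightarrow> nat \<Rightarrow> nat \<Rightarrow> memory" where
  "pstate u i q = (\<lambda>a. if a = rPtr then int q + 1 else if - 100 - int i \<le> a \<and> a \<le> -101 then int (dim_at u (nat (-101 - a)))
     else init_memory u a)"

lemma runs_parse_dim:
  assumes q: "drop q u = (dim_rest ^^ i) u" "q \<le> i * (length u + 1)" and i: "i < 5" and u: "digit_word u"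
    and b: "bounded s (pstate u i q)" and s: "length u + 11 \<le> s" "10 * int (length u) + 50 \<le> 2 ^ s"
  shows "\<exists>q'. drop q' u = (dim_rest ^^ Suc i) u \<and> q' \<le> Suc i * (length u + 1) \<and> bounded s (pstate u (Suc i) q') \<and>
    runs s (dim_com (-101 - int i)) (5000 * (length u + 2)) (pstate u i q) (\<lambda>\<sigma>. \<sigma> = pstate u (Suc i) q')"
proof (intro exI conjI)
  let ?d = "dimv (drop q u)"
  let ?q = "q + ?d + 1"
  have d: "?d = dim_at u i" by (simp add: dim_at_def q)
  have len: "?d \<le> length u" using dimv_length[of "drop q u"] by simp
  have "i * (length u + 1) \<le> 4 * (length u + 1)" using i by (intro mult_le_mono1) simp
  then have q5: "q \<le> 4 * (length u + 1)" using q(2) by linarith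
  show "drop ?q u = (dim_rest ^^ Suc i) u" using dim_drop[of q u] q by simp
  show "?q \<le> Suc i * (length u + 1)" using q(2) len by simp
  have eq: "(pstate u i q)(-101 - int i := int ?d, rPtr := int ?q + 1) = pstate u (Suc i) ?q"
    unfolding d using i by (auto simp: pstate_def fun_eq_iff)
  show "bounded s (pstate u (Suc i) ?q)" unfolding eq[symmetric]
  proof (intro bounded_upd b)
    have "q + d + 2 \<le> 10 * N + 50" if "q \<le> 4 * (N + 1)" "d \<le> N" for q d N :: nat using that by simp
    from this[OF q5 len] have "q + ?d + 2 \<le> 10 * length u + 50" .
    then have "int (q + ?d + 2) \<le> int (10 * length u + 50)" by (simp only: of_nat_le_iff)
    then have "int q + int ?d + 2 \<le> 10 * int (length u) + 50" by simp
    then have "int ?d \<le> 2 ^ s" "int q + int ?d + 2 \<le> 2 ^ s" using s(2) by linarith+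
    then show "\<bar>int ?d\<bar> \<le> 2 ^ s" "\<bar>int ?q + 1\<bar> \<le> 2 ^ s" by (simp_all add: algebra_simps)
  qed
  have "runs s (dim_com (-101 - int i)) (5000 * (length u + 2)) (pstate u i q)
     (\<lambda>\<sigma>. \<sigma> = (pstate u i q)(-101 - int i := int ?d, rPtr := int ?q + 1))"
  proof (rule runs_dim_com)
    show "inp u (pstate u i q)" using inp_init[of u] by (auto simp: inp_def pstate_def)
    have "int q \<le> int (4 * (length u + 1))" using q5 by (simp only: of_nat_le_iff)
    then have "int q \<le> 4 * int (length u) + 4" by simp
    then show "int q + 2 * int (length u) + 10 \<le> 2 ^ s" using s(2) by linarith
  qed (use b i s in \<open>auto simp: pstate_def init_memory_def\<close>)
  then show "runs s (dim_com (-101 - int i)) (5000 * (length u + 2)) (pstate u i q) (\<lambda>\<sigma>. \<sigma> = pstate u (Suc i) ?q)"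
    unfolding eq .
qed

lemma runs_dims_com:
  assumes u: "digit_word u" and s: "length u + 11 \<le> s" "10 * int (length u) + 50 \<le> 2 ^ s"
    and c: "\<And>q. drop q u = (dim_rest ^^ 5) u \<Longrightarrow> q \<le> 5 * (length u + 1) \<Longrightarrow> bounded s (pstate u 5 q) \<Longrightarrow>
      runs s c k (pstate u 5 q) Q"
  shows "\<lbrakk>n \<le> 5; drop q u = (dim_rest ^^ (5 - n)) u; q \<le> (5 - n) * (length u + 1); bounded s (pstate u (5 - n) q)\<rbrakk> \<Longrightarrow>
    runs s (dims_com n c) (n * (5000 * (length u + 2)) + k) (pstate u (5 - n) q) Q"
proof (induction n arbitrary: q)
  case 0
  then show ?case using c by simp
next
  case (Suc n)
  define i where "i = 5 - Suc n"
  have i: "i < 5" "Suc i = 5 - n" "-105 + int n = -101 - int i" using Suc.prems(1) by (auto simp: i_def)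
  obtain q' where q': "drop q' u = (dim_rest ^^ Suc i) u" "q' \<le> Suc i * (length u + 1)" "bounded s (pstate u (Suc i) q')"
    "runs s (dim_com (-101 - int i)) (5000 * (length u + 2)) (pstate u i q) (\<lambda>\<sigma>. \<sigma> = pstate u (Suc i) q')"
    using runs_parse_dim[OF _ _ i(1) u _ s, of q] Suc.prems(2-4)[folded i_def] by blast
  have "runs s (dims_com n c) (n * (5000 * (length u + 2)) + k) (pstate u (Suc i) q') Q"
    using Suc.IH[of q'] q'(1-3) Suc.prems(1) unfolding i(2) by simp
  from runs_Seq_det[OF q'(4) this] show ?case
    unfolding dims_com.simps i(3) i_def[symmetric] by (rule runs_mono) simp_all
qed

text \<open>The number of items \<open>tot\<close> may depend on the dimensions and on the number of
  entries, because both are in memory before the loop over the items starts.\<close>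

lemma runs_parse:
  assumes u: "digit_word u" and tot: "index_expr dims tot" "esize tot \<le> 60"
    and n: "\<And>\<sigma>. loaded u 0 \<sigma> \<Longrightarrow> val tot \<sigma> = int n" "n \<le> K" "entries_at u \<le> K"
    and s: "length u + 11 \<le> s" "13 * int (length u) + 50 + int K * (4 * int (length u) + 4) \<le> 2 ^ s"
  shows "runs s (parse_com tot) ((K + 20) * (20000 * (length u + 20))) (init_memory u)
    (\<lambda>\<sigma>. bounded s \<sigma> \<and> loaded u n \<sigma>)"
proof -
  let ?N = "length u"
  let ?kd = "5000 * (?N + 2)"
  have s11: "11 \<le> s" "1 \<le> s" using s by auto
  have regs: "\<bar>z\<bar> \<le> 2 ^ s" if "\<bar>z\<bar> \<le> 2000" for z :: int using that const_le[OF s11(1)] by blast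
  have K0: "0 \<le> int K * (4 * int ?N + 4)" by simp
  have s2: "10 * int ?N + 50 \<le> 2 ^ s" using s(2) K0 by linarith
  have b0: "bounded s (init_memory u)"
    unfolding bounded_def
  proof
    fix i
    have "\<bar>u ! j\<bar> \<le> 2 ^ s" if "j < ?N" for j
    proof -
      have "u ! j \<in> {0, 1, 2}" using u that unfolding digit_word_def by (meson nth_mem subsetD)
      then show ?thesis using regs[of 1] regs[of 2] by auto
    qed
    moreover have "int ?N \<le> 2 ^ s" using s2 by linarith
    ultimately show "\<bar>init_memory u i\<bar> \<le> 2 ^ s" by (auto simp: init_memory_def)
  qed
  have p0: "(init_memory u)(rPtr := 1) = pstate u 0 0" by (auto simp: pstate_def fun_eq_iff)
  have bp0: "bounded s (pstate u 0 0)" unfolding p0[symmetric] using regs[of 1] by (intro bounded_upd b0) auto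
  have r0: "runs s (asg rPtr (Cn 1)) 60 (init_memory u) (\<lambda>\<sigma>. \<sigma> = pstate u 0 0)"
    by (rule runs_mono[OF runs_asg[OF b0 s11(2), of "Cn 1" rPtr "\<lambda>\<sigma>. \<sigma> = pstate u 0 0"]])
      (use regs[of 1] regs[of rPtr] p0 in \<open>auto simp: temp_def ecost_def\<close>)
  have L0: "loaded u 0 ((pstate u 5 q)(-106 := int (entries_at u)))" for q
    by (auto simp: loaded_def pstate_def init_memory_def)
  let ?kl = "ecost tot + Suc n * (20000 * (?N + 2) + 300)"
  have K2: "int K \<le> 2 ^ s"
  proof -
    have "int K * 1 \<le> int K * (4 * int ?N + 4)" by (intro mult_left_mono) auto
    then show ?thesis using s(2) by linarith
  qed
  then have n2: "int n \<le> 2 ^ s" "\<bar>int (entries_at u)\<bar> \<le> 2 ^ s" using n(2,3) by linarith+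
  have loop: "runs s (Seq (asg (-106) entries_expr) (for_loop rCnt tot item_com)) (ecost entries_expr + ?kl) (pstate u 5 q5) (\<lambda>\<sigma>. bounded s \<sigma> \<and> loaded u n \<sigma>)"
    if q5: "drop q5 u = (dim_rest ^^ 5) u" "q5 \<le> 5 * (?N + 1)" "bounded s (pstate u 5 q5)" for q5
  proof -
  define \<tau> where "\<tau> = (pstate u 5 q5)(-106 := int (entries_at u))"
  have asg: "runs s (asg (-106) entries_expr) (ecost entries_expr) (pstate u 5 q5) (\<lambda>\<sigma>. \<sigma> = \<tau>)"
  proof (rule runs_asg[OF q5(3) s11(2)])
    show "safe s (pstate u 5 q5) entries_expr"
      by (rule index_expr_safe[OF _ s11(1)]) (simp add: entries_expr_def idxs_simps)
    have "val entries_expr (pstate u 5 q5) = int (entries_at u)"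
      by (simp add: entries_expr_def entries_at_def entries_def pstate_def algebra_simps)
    then show "(pstate u 5 q5)(- 106 := val entries_expr (pstate u 5 q5)) = \<tau>" by (simp add: \<tau>_def)
  qed (use regs[of "-106"] in \<open>auto simp: temp_def entries_expr_def\<close>)
  have vt: "val tot \<tau> = int n" unfolding \<tau>_def by (rule n(1)[OF L0])
  have it: "items_at u = drop q5 u" using q5(1) by (simp add: items_at_def)
  have bt: "bounded s \<tau>" unfolding \<tau>_def using q5(3) n2(2) by (rule bounded_upd)
  define I where "I = (\<lambda>j \<sigma>. (\<exists>q \<le> 5 * (?N + 1) + (n - j) * (4 * ?N + 3). parsed u (items_at u) \<tau> (n - j) q \<sigma>) \<and> bounded s \<sigma> \<and> \<sigma> rCnt = int j)"
  show ?thesis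
  proof (rule runs_Seq_det[OF asg], rule runs_for[where I = I])
    show "safe s \<tau> tot" by (rule index_expr_safe[OF index_dims_idxs[OF tot(1)] s11(1)])
    have "parsed u (items_at u) \<tau> 0 q5 (\<tau>(rCnt := int n))"
      using inp_init[of u] it by (auto simp: parsed_def \<tau>_def pstate_def inp_def init_memory_def)
    then show "I n (\<tau>(rCnt := int n))" unfolding I_def
      using bounded_upd[OF bt, of "int n" rCnt] n2 q5(2) by (auto intro!: exI[of _ q5])
    fix j \<sigma> assume j: "j < n" "I (Suc j) \<sigma>"
    then obtain q where q: "q \<le> 5 * (?N + 1) + (n - Suc j) * (4 * ?N + 3)" "parsed u (items_at u) \<tau> (n - Suc j) q \<sigma>"
      and bs: "bounded s \<sigma>" by (auto simp: I_def)
    have nj: "Suc (n - Suc j) = n - j" using j by simp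
    have "parsed u (items_at u) \<tau> (n - Suc j) q (\<sigma>(rCnt := int j))"
      using q(2) by (auto simp: parsed_def inp_def)
    moreover have "bounded s (\<sigma>(rCnt := int j))" using bs n2 j(1) by (intro bounded_upd) auto
    moreover have "int q + int (n - Suc j) + 8 * int ?N + 40 \<le> 2 ^ s"
    proof -
      have "q + (n - Suc j) \<le> 5 * (?N + 1) + (n - Suc j) * (4 * ?N + 4)" using q(1) by (simp add: algebra_simps)
      also have "\<dots> \<le> 5 * (?N + 1) + K * (4 * ?N + 4)" using n(2) by (intro add_left_mono mult_le_mono1) simp
      finally have "int (q + (n - Suc j)) \<le> int (5 * (?N + 1) + K * (4 * ?N + 4))" by (simp only: of_nat_le_iff)
      then have "int q + int (n - Suc j) \<le> 5 * (int ?N + 1) + int K * (4 * int ?N + 4)"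
        by (simp only: of_nat_add of_nat_mult of_nat_numeral of_nat_1)
      then have "int q + int (n - Suc j) + 8 * int ?N + 40 \<le> 5 * (int ?N + 1) + int K * (4 * int ?N + 4) + 8 * int ?N + 40"
        by simp
      also have "\<dots> \<le> 13 * int ?N + 50 + int K * (4 * int ?N + 4)" by simp
      finally show ?thesis using s(2) by (rule order_trans)
    qed
    ultimately have "runs s item_com (20000 * (?N + 2)) (\<sigma>(rCnt := int j)) (\<lambda>\<sigma>'. bounded s \<sigma>' \<and> \<sigma>' rCnt = (\<sigma>(rCnt := int j)) rCnt \<and>
      (\<exists>q'\<le>q + 4 * ?N + 3. parsed u (items_at u) \<tau> (Suc (n - Suc j)) q' \<sigma>'))"
      by (intro runs_item_com u s(1))
    then show "runs s item_com (20000 * (?N + 2)) (\<sigma>(rCnt := int j)) (I j)"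
    proof (rule runs_mono)
      fix \<sigma>' assume *: "bounded s \<sigma>' \<and> \<sigma>' rCnt = (\<sigma>(rCnt := int j)) rCnt \<and>
        (\<exists>q'\<le>q + 4 * ?N + 3. parsed u (items_at u) \<tau> (Suc (n - Suc j)) q' \<sigma>')"
      then obtain q' where q': "q' \<le> q + 4 * ?N + 3" "parsed u (items_at u) \<tau> (n - j) q' \<sigma>'" unfolding nj by blast
      have "q' \<le> 5 * (?N + 1) + Suc (n - Suc j) * (4 * ?N + 3)" using q'(1) q(1) by simp
      then show "I j \<sigma>'" using q'(2) * unfolding I_def nj by auto
    qed simp
  next
    fix \<sigma> assume "I 0 \<sigma>"
    then obtain q where "parsed u (items_at u) \<tau> n q \<sigma>" and bs: "bounded s \<sigma>" by (auto simp: I_def)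
    then show "bounded s \<sigma> \<and> loaded u n \<sigma>" using L0[of q5] by (auto simp: loaded_def parsed_def \<tau>_def)
  next
    fix j \<sigma> assume "I j \<sigma>"
    then show "bounded s \<sigma> \<and> \<sigma> rCnt = int j" by (simp add: I_def)
  qed (use tot s11 vt regs[of rCnt] bt in \<open>auto simp: temp_def\<close>)
  qed
  have "runs s (dims_com 5 (Seq (asg (-106) entries_expr) (for_loop rCnt tot item_com))) (5 * ?kd + (ecost entries_expr + ?kl)) (pstate u 0 0) (\<lambda>\<sigma>. bounded s \<sigma> \<and> loaded u n \<sigma>)"
    using runs_dims_com[OF u s(1) s2 loop, of 5 0] bp0 by simp
  from runs_Seq_det[OF r0 this] have "runs s (parse_com tot) (60 + (5 * ?kd + (ecost entries_expr + ?kl))) (init_memory u) (\<lambda>\<sigma>. bounded s \<sigma> \<and> loaded u n \<sigma>)"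
    unfolding parse_com_def .
  then show ?thesis
  proof (rule runs_mono)
    have "ecost tot \<le> 230640" using tot(2) by (intro ecost_le) simp
    moreover have "ecost entries_expr \<le> 7260" by (simp add: entries_expr_def ecost_def power2_eq_square)
    moreover have "Suc n * (20000 * (?N + 2) + 300) \<le> Suc K * (20000 * (?N + 3))" using n(2) by (intro mult_le_mono) auto
    ultimately show "60 + (5 * ?kd + (ecost entries_expr + ?kl)) \<le> (K + 20) * (20000 * (?N + 20))"
      by (simp add: algebra_simps)
  qed
qed

text \<open>Parsing is analysed with the unit \<open>s\<close>, the equations with
  \<open>400 * s\<close>; this brings both phases to the same unit.\<close>

lemma runs_mono_bits:
  assumes "runs s c k \<sigma> Q" "s \<le> s'"
  shows "runs s' c k \<sigma> Q"
  unfolding runs_def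
proof (intro allI impI)
  fix M assume "view M = \<sigma>"
  then obtain u M' where "exec c M u M'" "Q (view M')" "u \<le> k * s" using assms(1) unfolding runs_def by blast
  moreover have "k * s \<le> k * s'" using assms(2) by simp
  ultimately show "\<exists>u M'. exec c M u M' \<and> Q (view M') \<and> u \<le> k * s'" by (meson order_trans)
qed

lemma verifier_correct:
  assumes u: "digit_word u" and tot: "index_expr dims tot" "esize tot \<le> 60"
    and bs: "\<And>b. b \<in> set bs \<Longrightarrow> ok_block b" "length bs \<le> 100"
    and n: "\<And>\<sigma>. loaded u 0 \<sigma> \<Longrightarrow> val tot \<sigma> = int n" "n \<le> K" "entries_at u \<le> K"
    and K: "\<And>\<sigma> b. loaded u 0 \<sigma> \<Longrightarrow> b \<in> set bs \<Longrightarrow> ranges_le K \<sigma> b"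
    and s: "length u + 11 \<le> s" "13 * int (length u) + 50 + int K * (4 * int (length u) + 4) \<le> 2 ^ s"
  shows "\<exists>\<sigma>. loaded u n \<sigma> \<and> (accepts (verifier tot bs) u \<longleftrightarrow> (\<forall>b\<in>set bs. sat \<sigma> b)) \<and>
    halts_within (verifier tot bs) u
      (((K + 20) * (20000 * (length u + 20)) + (101 * ((K + 2) ^ 3 * 30000000) + 540)) * (400 * s))"
proof -
  let ?s = "400 * s"
  let ?kb = "101 * (Suc (Suc K) ^ 3 * 30000000)"
  have s11: "11 \<le> s" "11 \<le> ?s" "1 \<le> ?s" using s by auto
  have K2: "K \<le> 2 ^ s"
  proof -
    have "int K * 1 \<le> int K * (4 * int (length u) + 4)" by (intro mult_left_mono) auto
    then have "int K \<le> 2 ^ s" using s(2) by linarith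
    then show ?thesis by simp
  qed
  define M0 where "M0 = init_memory u"
  have view0: "view M0 = M0" by (auto simp: M0_def view_def temp_def init_memory_def fun_eq_iff)
  have "runs s (parse_com tot) ((K + 20) * (20000 * (length u + 20))) M0 (\<lambda>\<sigma>. bounded s \<sigma> \<and> loaded u n \<sigma>)"
    unfolding M0_def by (rule runs_parse[OF u tot n s])
  then have "runs ?s (parse_com tot) ((K + 20) * (20000 * (length u + 20))) M0 (\<lambda>\<sigma>. bounded s \<sigma> \<and> loaded u n \<sigma>)"
    by (rule runs_mono_bits) simp
  then obtain t M where M: "exec (parse_com tot) M0 t M" "bounded s (view M)" "loaded u n (view M)"
    "t \<le> (K + 20) * (20000 * (length u + 20)) * ?s"
    using view0 unfolding runs_def by blast
  define \<sigma> where "\<sigma> = view M"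
  have L: "loaded u n \<sigma>" and b: "bounded s \<sigma>" using M by (auto simp: \<sigma>_def)
  then have L0: "loaded u 0 \<sigma>" by (simp add: loaded_def)
  have zero: "\<sigma> rI = 0" "\<sigma> rJ = 0" "\<sigma> rL = 0" "\<sigma> rAcc = 0" "\<sigma> rBad = 0" using L by (auto simp: loaded_def)
  have base: "base s \<sigma>" using b L zero by (auto simp: base_def bounded_def loaded_def idxs_simps)
  have "runs ?s (seq (map block_com bs)) (Suc (length bs) * (Suc (Suc K) ^ 3 * 30000000)) \<sigma>
      (\<lambda>\<sigma>'. 0 \<le> \<sigma>' rBad \<and> bounded ?s \<sigma>' \<and> (\<sigma>' rBad = 0 \<longleftrightarrow> \<sigma> rBad = 0 \<and> (\<forall>b\<in>set bs. sat \<sigma> b)))"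
    by (rule runs_blocks[OF s11(1) _ K2, where c = 0]) (use bs K[OF L0] base zero in auto)
  then have "runs ?s (seq (map block_com bs)) ?kb \<sigma>
      (\<lambda>\<sigma>'. bounded ?s \<sigma>' \<and> (\<sigma>' rBad = 0 \<longleftrightarrow> (\<forall>b\<in>set bs. sat \<sigma> b)))"
  proof (rule runs_mono)
    show "Suc (length bs) * (Suc (Suc K) ^ 3 * 30000000) \<le> ?kb" using bs(2) by (intro mult_le_mono1) simp
  qed (use zero in auto)
  then obtain t2 M2 where M2: "exec (seq (map block_com bs)) M t2 M2" "bounded ?s (view M2)"
    "view M2 rBad = 0 \<longleftrightarrow> (\<forall>b\<in>set bs. sat \<sigma> b)" "t2 \<le> ?kb * ?s"
    unfolding runs_def \<sigma>_def by blast
  let ?e = "Pl (Cn 1) (Ti (Cn (-1)) (Vr rBad))"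
  have regs: "\<bar>z\<bar> \<le> 2 ^ ?s" if "\<bar>z\<bar> \<le> 2000" for z :: int using that const_le[OF s11(2)] by blast
  have "runs ?s (asg 0 ?e) (ecost ?e) (view M2) (\<lambda>\<sigma>'. \<sigma>' 0 = 1 - view M2 rBad)"
    by (rule runs_asg[OF M2(2) s11(3)]) (use regs[of 1] regs[of "-1"] regs[of rBad] in \<open>auto simp: temp_def\<close>)
  then obtain t3 M3 where M3: "exec (asg 0 ?e) M2 t3 M3" "view M3 0 = 1 - view M2 rBad" "t3 \<le> ecost ?e * ?s"
    unfolding runs_def by blast
  have ex: "exec (verifier tot bs) M0 (t + (t2 + t3)) M3"
    unfolding verifier_def by (rule exec.Seq[OF M(1) exec.Seq[OF M2(1) M3(1)]])
  have "M3 0 = view M3 0" by (simp add: view_def temp_def)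
  then have acc: "M3 0 = 1 \<longleftrightarrow> (\<forall>b\<in>set bs. sat \<sigma> b)" using M3(2) M2(3) by simp
  have "accepts (verifier tot bs) u \<longleftrightarrow> (\<forall>b\<in>set bs. sat \<sigma> b)"
    unfolding accepts_def using ex exec_deterministic[OF ex] acc unfolding M0_def by metis
  moreover have "t + (t2 + t3) \<le> ((K + 20) * (20000 * (length u + 20)) + (101 * ((K + 2) ^ 3 * 30000000) + 540)) * ?s"
    using M(4) M2(4) M3(3) by (simp add: ecost_def power2_eq_square distrib_right)
  then have "halts_within (verifier tot bs) u
      (((K + 20) * (20000 * (length u + 20)) + (101 * ((K + 2) ^ 3 * 30000000) + 540)) * ?s)"
    unfolding halts_within_def using ex unfolding M0_def by blast
  ultimately show ?thesis using L by blast
qed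

section \<open>Canonical binary words and inversion of the parser\<close>

section \<open>Encodings\<close>

abbreviation bits :: "bool list \<Rightarrow> int list" where "bits \<equiv> map of_bool"

definition nat_bits :: "bool list \<Rightarrow> bool list" where
  "nat_bits bs = concat (map (\<lambda>\<beta>. [True, \<beta>]) bs) @ [False]"

definition bval :: "bool list \<Rightarrow> nat" where "bval bs = horner_sum of_bool 2 bs"

lemma enc_nat_bits: "enc_nat a = nat_bits (bin a)"
  by (simp add: enc_nat_def nat_bits_def)

lemma dval_bits: "dval (bits bs) = int (bval bs)"
  by (induction bs) (simp_all add: dval_def bval_def)

lemma bval_bin: "bval (bin a) = a"
proof -
  have "a < 2 ^ floorlog 2 a"
    using floorlog_bounds[of a 2] by (cases "a = 0") (auto simp: floorlog_def)
  then show ?thesis by (simp add: bval_def bin_def horner_sum_bit_eq_take_bit take_bit_nat_eq_self)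
qed

lemma dlast_bin: "dlast (bits (bin a)) = 1"
proof (cases "a = 0")
  case True
  then show ?thesis by (simp add: bin_def floorlog_def dlast_def)
next
  case False
  then obtain l where l: "floorlog 2 a = Suc l" by (cases "floorlog 2 a") (auto simp: floorlog_def)
  have "2 ^ l \<le> a" "a < 2 ^ Suc l" using floorlog_bounds[of a 2] False l by auto
  then have "a div 2 ^ l = 1" by (intro div_nat_eqI) auto
  then have "bit a l" by (simp add: bit_iff_odd)
  then show ?thesis by (simp add: bin_def l dlast_def last_map)
qed

text \<open>A leading digit 1 at position \<open>k\<close> puts the value between
  \<open>2 ^ k\<close> and \<open>2 ^ Suc k\<close>, which fixes the number of digits. This shows
  that a parsed number was written exactly as \<open>enc_nat\<close> writes it.\<close>

lemma bin_bval:
  assumes "dlast (bits bs) = 1"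
  shows "bin (bval bs) = bs"
proof (cases "bs = []")
  case True
  then show ?thesis by (simp add: bin_def bval_def floorlog_def)
next
  case False
  then have l: "last bs" using assms by (simp add: dlast_def last_map)
  define k where "k = length bs - 1"
  have bs: "bs = butlast bs @ [True]" using append_butlast_last_id[OF False] l by simp
  have len_k: "length (butlast bs) = k" unfolding k_def by (rule length_butlast)
  have "bval bs = horner_sum of_bool 2 (butlast bs) + 2 ^ k"
    unfolding bval_def by (subst bs) (simp only: horner_sum_append len_k, simp)
  moreover have "horner_sum of_bool 2 cs < (2 :: nat) ^ length cs" for cs
    by (induction cs) auto
  from this[of "butlast bs"] have "horner_sum of_bool 2 (butlast bs) < (2 :: nat) ^ k" by (simp only: len_k)
  ultimately have b: "2 ^ k \<le> bval bs" "bval bs < 2 ^ Suc k" by auto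
  have len: "length bs = Suc k" using False by (simp add: k_def)
  have "floorlog 2 (bval bs) = Suc k"
  proof (rule antisym)
    show "floorlog 2 (bval bs) \<le> Suc k" using b by (intro floorlog_leI) auto
    show "Suc k \<le> floorlog 2 (bval bs)" using b by (intro floorlog_geI) auto
  qed
  then have "bin (bval bs) = map (bit (bval bs)) [0..<length bs]" by (simp add: bin_def len)
  also have "\<dots> = map (\<lambda>i. bs ! i) [0..<length bs]"
    by (rule map_cong[OF refl]) (simp add: bval_def bit_horner_sum_bit_iff)
  finally show ?thesis by (simp add: map_nth)
qed

lemma digs_nat_bits: "digs (bits (nat_bits bs) @ ys) = bits bs"
  by (induction bs) (subst digs.simps; simp add: nat_bits_def numeral_2_eq_2)+

lemma nat_rest_nat_bits: "nat_rest (bits (nat_bits bs) @ ys) = ys"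
proof -
  have "length (nat_bits bs) = 2 * length bs + 1" by (induction bs) (auto simp: nat_bits_def)
  then show ?thesis by (simp add: nat_rest_def digs_nat_bits)
qed

text \<open>The length condition says that the number ends inside \<open>x\<close>, before the
  separator. All its markers and digits are then genuine bits.\<close>

lemma nat_rest_sound:
  assumes "xs = bits x @ ys" "2 * length (digs xs) + 1 \<le> length x"
  shows "\<exists>bs x'. x = nat_bits bs @ x' \<and> digs xs = bits bs \<and> nat_rest xs = bits x' @ ys"
proof -
  have "\<exists>bs x'. x = nat_bits bs @ x' \<and> digs xs = bits bs"
    using assms
  proof (induction xs arbitrary: x rule: digs.induct)
    case (1 xs)
    show ?case
    proof (cases "0 < hd0 xs")
      case True
      have d: "digs xs = hd0 (drop 1 xs) # digs (drop 2 xs)" by (subst digs.simps) (simp add: True)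
      then obtain \<alpha> \<beta> x2 where x: "x = \<alpha> # \<beta> # x2" using 1(3) by (cases x; cases "tl x") auto
      have \<alpha>: "\<alpha>" using True by (cases \<alpha>) (auto simp: 1(2) x)
      have "drop 2 xs = bits x2 @ ys" "2 * length (digs (drop 2 xs)) + 1 \<le> length x2"
        using 1(2,3) d by (auto simp: x)
      from 1(1)[OF True this] obtain bs x' where "x2 = nat_bits bs @ x'" "digs (drop 2 xs) = bits bs" by blast
      then have "x = nat_bits (\<beta> # bs) @ x' \<and> digs xs = bits (\<beta> # bs)"
        using d by (simp add: x \<alpha> nat_bits_def 1(2))
      then show ?thesis by blast
    next
      case False
      then have d: "digs xs = []" by (subst digs.simps) simp
      obtain \<alpha> x2 where x: "x = \<alpha> # x2" using 1(3) by (cases x) auto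
      then have "\<not> \<alpha>" using False 1(2) by auto
      then have "x = nat_bits [] @ x2 \<and> digs xs = bits []" using d by (simp add: x nat_bits_def)
      then show ?thesis by blast
    qed
  qed
  then obtain bs x' where *: "x = nat_bits bs @ x'" "digs xs = bits bs" by blast
  moreover have "nat_rest xs = bits x' @ ys"
    unfolding assms(1) *(1) using nat_rest_nat_bits[of bs "bits x' @ ys"] by simp
  ultimately show ?thesis by blast
qed

lemma dimv_enc: "dimv (bits (enc_dim a) @ ys) = a" "dim_rest (bits (enc_dim a) @ ys) = ys"
proof -
  show d: "dimv (bits (enc_dim a) @ ys) = a" by (induction a) (auto simp: dimv_def enc_dim_def)
  have "length (enc_dim a) = Suc a" by (simp add: enc_dim_def)
  then show "dim_rest (bits (enc_dim a) @ ys) = ys" unfolding dim_rest_def d by simp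
qed

lemma dim_rest_sound:
  assumes "xs = bits x @ ys" "Suc (dimv xs) \<le> length x"
  shows "\<exists>x'. x = enc_dim (dimv xs) @ x' \<and> dim_rest xs = bits x' @ ys"
proof -
  have "\<exists>x'. x = enc_dim (dimv xs) @ x'"
    using assms
  proof (induction x arbitrary: xs)
    case (Cons \<alpha> x)
    show ?case
    proof (cases \<alpha>)
      case True
      have "dimv xs = Suc (dimv (bits x @ ys))" using True Cons(2) by (simp add: dimv_def)
      then show ?thesis using Cons(1)[OF refl] Cons(3) True by (auto simp: enc_dim_def)
    next
      case False
      then show ?thesis using Cons(2) by (simp add: dimv_def enc_dim_def)
    qed
  qed simp
  then obtain x' where x: "x = enc_dim (dimv xs) @ x'" by blast
  then have "dim_rest xs = bits x' @ ys"
    using dimv_enc(2)[of "dimv xs" "bits x' @ ys"] assms(1) by (metis append_assoc map_append)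
  then show ?thesis using x by blast
qed

text \<open>The sign symbol is an integer rather than a bit because the separator 2 is itself parsed
  as the sign of an item.\<close>

definition item_bits :: "int \<times> bool list \<times> bool list \<Rightarrow> int list" where
  "item_bits i = (case i of (s, as, bs) \<Rightarrow> s # bits (nat_bits as) @ bits (nat_bits bs))"

definition item_cell :: "nat \<Rightarrow> int \<times> bool list \<times> bool list \<Rightarrow> int" where
  "item_cell c i = (case i of (s, as, bs) \<Rightarrow>
     [s, int (bval as), dlast (bits as), int (bval bs), dlast (bits bs)] ! c)"

lemma item_rest_item_bits: "item_rest (item_bits i @ ys) = ys"
  by (cases i) (simp add: item_bits_def item_rest_def nat_rest_nat_bits)

lemma cellv_item_bits: "cellv c (item_bits i @ ys) = item_cell c i"
  by (cases i) (simp add: item_bits_def cellv_def item_cell_def nat_rest_nat_bits digs_nat_bits dval_bits)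

lemma cellv_items:
  "i < length its \<Longrightarrow> cellv c ((item_rest ^^ i) (concat (map item_bits its) @ ys)) = item_cell c (its ! i)"
proof (induction its arbitrary: i)
  case (Cons a its)
  show ?case
  proof (cases i)
    case 0
    then show ?thesis by (simp add: cellv_item_bits)
  next
    case (Suc j)
    then show ?thesis using Cons by (simp add: funpow_swap1 item_rest_item_bits del: funpow.simps) (simp add: funpow_Suc_right item_rest_item_bits del: funpow.simps)
  qed
qed simp

text \<open>At least \<open>length ys\<close> symbols remain after the item, so the item lies inside
  \<open>x\<close>. As \<open>ys\<close> is nonempty, the length left after dropping is positive and
  determines how much was consumed.\<close>

lemma item_rest_sound:
  assumes xs: "xs = bits x @ ys" and len: "length ys \<le> length (item_rest xs)" "ys \<noteq> []"
  shows "\<exists>s as bs x'. bits x = item_bits (of_bool s, as, bs) @ bits x' \<and> x = s # nat_bits as @ nat_bits bs @ x' \<and>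
    item_rest xs = bits x' @ ys"
proof -
  have l: "length (nat_rest zs) = length zs - (2 * length (digs zs) + 1)" for zs by (simp add: nat_rest_def)
  obtain k where k: "length ys = Suc k" using len(2) by (cases ys) auto
  have "length (drop 1 xs) \<ge> length ys + 1" using len(1) l[of "drop 1 xs"] l[of "nat_rest (drop 1 xs)"] by (simp add: item_rest_def k)
  then obtain s x1 where x: "x = s # x1" using xs by (cases x) auto
  then have d: "drop 1 xs = bits x1 @ ys" using xs by simp
  have "2 * length (digs (drop 1 xs)) + 1 \<le> length x1"
    using len(1) l[of "drop 1 xs"] l[of "nat_rest (drop 1 xs)"] unfolding item_rest_def d by (simp add: k)
  from nat_rest_sound[OF d this] obtain as x2 where 1: "x1 = nat_bits as @ x2" "nat_rest (drop 1 xs) = bits x2 @ ys" by blast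
  have "2 * length (digs (nat_rest (drop 1 xs))) + 1 \<le> length x2"
    using len(1) l[of "nat_rest (drop 1 xs)"] unfolding item_rest_def 1(2) by (simp add: k)
  from nat_rest_sound[OF 1(2) this] obtain bs x3 where 2: "x2 = nat_bits bs @ x3" "nat_rest (nat_rest (drop 1 xs)) = bits x3 @ ys" by blast
  show ?thesis
    by (rule exI[of _ s], rule exI[of _ as], rule exI[of _ bs], rule exI[of _ x3])
      (simp add: x 1(1) 2(1) 2(2)[unfolded One_nat_def] item_bits_def item_rest_def)
qed

lemma item_rest_length: "length (item_rest xs) \<le> length xs"
  by (simp add: item_rest_def nat_rest_def)

text \<open>Remaining lengths never increase, so the condition on the final rest covers every
  intermediate one.\<close>

lemma items_sound:
  assumes "xs = bits x @ ys" "length ys \<le> length ((item_rest ^^ n) xs)" "ys \<noteq> []"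
  shows "\<exists>its x'. length its = n \<and> x = concat (map (\<lambda>(s, as, bs). s # nat_bits as @ nat_bits bs) its) @ x' \<and>
    (item_rest ^^ n) xs = bits x' @ ys \<and>
    (\<forall>i<n. \<forall>c. cellv c ((item_rest ^^ i) xs) = item_cell c (case its ! i of (s, as, bs) \<Rightarrow> (of_bool s, as, bs)))"
  using assms
proof (induction n arbitrary: xs x)
  case (Suc n)
  have step: "(item_rest ^^ Suc n) xs = (item_rest ^^ n) (item_rest xs)" by (simp add: funpow_Suc_right del: funpow.simps)
  have mono: "length ((item_rest ^^ m) zs) \<le> length zs" for m zs
    by (induction m) (auto intro: order_trans[OF item_rest_length])
  have "length ys \<le> length (item_rest xs)" using Suc.prems(2) mono[of n "item_rest xs"] unfolding step by linarith
  from item_rest_sound[OF Suc.prems(1) this Suc.prems(3)] obtain s as bs x1 where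
    1: "bits x = item_bits (of_bool s, as, bs) @ bits x1" "x = s # nat_bits as @ nat_bits bs @ x1" "item_rest xs = bits x1 @ ys"
    by blast
  have len: "length ys \<le> length ((item_rest ^^ n) (item_rest xs))" using Suc.prems(2) step by simp
  from Suc.IH[OF 1(3) len Suc.prems(3)] obtain its x' where
    2: "length its = n" "x1 = concat (map (\<lambda>(s, as, bs). s # nat_bits as @ nat_bits bs) its) @ x'"
      "(item_rest ^^ n) (item_rest xs) = bits x' @ ys"
      "\<And>i c. i < n \<Longrightarrow> cellv c ((item_rest ^^ i) (item_rest xs)) = item_cell c (case its ! i of (s, as, bs) \<Rightarrow> (of_bool s, as, bs))"
    by blast
  have "cellv c ((item_rest ^^ i) xs) = item_cell c (case ((s, as, bs) # its) ! i of (s, as, bs) \<Rightarrow> (of_bool s, as, bs))"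
    if "i < Suc n" for i c
  proof (cases i)
    case 0
    have "xs = item_bits (of_bool s, as, bs) @ (bits x1 @ ys)" using 1(1) Suc.prems(1) by simp
    then show ?thesis using cellv_item_bits[of c "(of_bool s, as, bs)"] by (simp add: 0)
  next
    case (Suc j)
    then show ?thesis using 2(4)[of j c] that by (simp add: funpow_Suc_right del: funpow.simps)
  qed
  then show ?case using 1(2) 2(1-3) step
    by (intro exI[of _ "(s, as, bs) # its"] exI[of _ x']) simp
qed auto

lemma dims_sound:
  assumes "xs = bits x @ ys" "length ys \<le> length ((dim_rest ^^ n) xs)" "ys \<noteq> []"
  shows "\<exists>x'. x = concat (map (\<lambda>i. enc_dim (dimv ((dim_rest ^^ i) xs))) [0..<n]) @ x' \<and> (dim_rest ^^ n) xs = bits x' @ ys"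
  using assms
proof (induction n)
  case (Suc n)
  have l: "length (dim_rest zs) = length zs - Suc (dimv zs)" for zs by (simp add: dim_rest_def)
  have "length ys \<le> length ((dim_rest ^^ n) xs)" using Suc.prems(2) l[of "(dim_rest ^^ n) xs"] by simp
  then obtain x' where 1: "x = concat (map (\<lambda>i. enc_dim (dimv ((dim_rest ^^ i) xs))) [0..<n]) @ x'" "(dim_rest ^^ n) xs = bits x' @ ys"
    using Suc.IH Suc.prems by blast
  obtain k where k: "length ys = Suc k" using Suc.prems(3) by (cases ys) auto
  have "Suc (dimv ((dim_rest ^^ n) xs)) \<le> length x'"
    using Suc.prems(2) l[of "(dim_rest ^^ n) xs"] unfolding funpow.simps comp_def 1(2) by (simp add: k)
  from dim_rest_sound[OF 1(2) this] show ?case using 1(1) by auto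
qed simp

section \<open>The polynomial equations as program blocks and as mathematical statements\<close>

section \<open>The equations of the certificate\<close>

text \<open>Together with \<open>cv\<close>, this evaluates the blocks over natural indices and a
  table \<open>H\<close> of item components instead of a memory, so that the simplifier can unfold
  them into ordinary equations.\<close>

fun ix :: "expr \<Rightarrow> (int \<Rightarrow> nat) \<Rightarrow> nat" where
  "ix (Cn z) \<rho> = nat z"
| "ix (Vr i) \<rho> = \<rho> i"
| "ix (Pl e f) \<rho> = ix e \<rho> + ix f \<rho>"
| "ix (Ti e f) \<rho> = ix e \<rho> * ix f \<rho>"
| "ix (Rd e) \<rho> = 0"

definition cells :: "memory \<Rightarrow> nat \<Rightarrow> nat \<Rightarrow> int" where
  "cells \<sigma> c i = \<sigma> (- 1000 - int c - 5 * int i)"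

fun cv :: "expr \<Rightarrow> (nat \<Rightarrow> nat \<Rightarrow> int) \<Rightarrow> (int \<Rightarrow> nat) \<Rightarrow> int" where
  "cv (Cn z) H \<rho> = z"
| "cv (Vr i) H \<rho> = 0"
| "cv (Pl e f) H \<rho> = cv e H \<rho> + cv f H \<rho>"
| "cv (Ti e f) H \<rho> = cv e H \<rho> * cv f H \<rho>"
| "cv (Rd (Pl (Cn z) (Ti w e))) H \<rho> = H (nat (- 1000 - z)) (ix e \<rho>)"
| "cv (Rd _) H \<rho> = 0"

lemma cv_cell [simp]: "cv (cell c e) H \<rho> = H c (ix e \<rho>)"
  by (simp add: cell_def)

definition nsat :: "(nat \<Rightarrow> nat \<Rightarrow> int) \<Rightarrow> (int \<Rightarrow> nat) \<Rightarrow> eqn_block \<Rightarrow> bool" where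
  "nsat H \<rho> b \<longleftrightarrow> (case b of (e, f, ts) \<Rightarrow> \<forall>i<ix e \<rho>. \<forall>j<ix f \<rho>.
     sum_list (map (\<lambda>t. \<Sum>l<ix (fst t) \<rho>. cv (snd t) H (\<rho>(rI := i, rJ := j, rL := l))) ts) = 0)"

lemma val_ix: "index_expr A e \<Longrightarrow> (\<And>i. i \<in> A \<Longrightarrow> \<sigma> i = int (\<rho> i)) \<Longrightarrow> val e \<sigma> = int (ix e \<rho>)"
  by (induction e) auto

lemma val_cv:
  assumes "cell_expr e" "\<And>i. i \<in> idxs \<Longrightarrow> \<sigma> i = int (\<rho> i)"
  shows "val e \<sigma> = cv e (cells \<sigma>) \<rho>"
  using assms(1)
proof (induction rule: cell_expr.induct)
  case (2 e c)
  then show ?case using val_ix[OF 2(1) assms(2)] by (simp add: cell_def cells_def)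
qed auto

lemma sat_iff_nsat:
  assumes b: "ok_block b" and \<rho>: "\<And>i. i \<in> dims \<Longrightarrow> \<sigma> i = int (\<rho> i)"
    and z: "\<sigma> rI = 0" "\<sigma> rJ = 0" "\<sigma> rL = 0"
  shows "sat \<sigma> b \<longleftrightarrow> nsat (cells \<sigma>) \<rho> b"
proof -
  obtain e f ts where bb: "b = (e, f, ts)" by (cases b)
  have ok: "index_expr dims e" "index_expr dims f" "\<And>t. t \<in> set ts \<Longrightarrow> ok_term t"
    using b by (auto simp: ok_block_def bb)
  have v: "val e' \<sigma> = int (ix e' \<rho>)" if "index_expr dims e'" for e' by (rule val_ix[OF that \<rho>])
  have "lsum (\<sigma>(rI := int i, rJ := int j)) t = (\<Sum>l<ix (fst t) \<rho>. cv (snd t) (cells \<sigma>) (\<rho>(rI := i, rJ := j, rL := l)))"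
    if t: "t \<in> set ts" for i j t
  proof -
    have t': "index_expr dims (fst t)" "cell_expr (snd t)" using ok(3)[OF t] by (auto simp: ok_term_def)
    have "val (fst t) (\<sigma>(rI := int i, rJ := int j)) = int (ix (fst t) \<rho>)"
      unfolding v[OF t'(1), symmetric] by (rule index_expr_cong[OF t'(1)]) (auto simp: idxs_simps)
    moreover have "val (snd t) (\<sigma>(rI := int i, rJ := int j, rL := int l)) = cv (snd t) (cells \<sigma>) (\<rho>(rI := i, rJ := j, rL := l))" for l
    proof -
      have "cells (\<sigma>(rI := int i, rJ := int j, rL := int l)) = cells \<sigma>" by (auto simp: cells_def fun_eq_iff)
      moreover have "val (snd t) (\<sigma>(rI := int i, rJ := int j, rL := int l)) =
        cv (snd t) (cells (\<sigma>(rI := int i, rJ := int j, rL := int l))) (\<rho>(rI := i, rJ := j, rL := l))"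
        by (rule val_cv[OF t'(2)]) (use \<rho> in \<open>auto simp: idxs_simps\<close>)
      ultimately show ?thesis by simp
    qed
    ultimately show ?thesis by (simp add: lsum_def)
  qed
  then have eq: "map (lsum (\<sigma>(rI := int i, rJ := int j))) ts =
    map (\<lambda>t. \<Sum>l<ix (fst t) \<rho>. cv (snd t) (cells \<sigma>) (\<rho>(rI := i, rJ := j, rL := l))) ts" for i j by simp
  show ?thesis by (simp add: sat_def nsat_def bb v ok eq)
qed

abbreviation "eM \<equiv> Vr (-101)"
abbreviation "eN \<equiv> Vr (-102)"
abbreviation "eK \<equiv> Vr (-103)"
abbreviation "eG \<equiv> Vr (-104)"
abbreviation "eR \<equiv> Vr (-105)"
abbreviation "eT \<equiv> Vr (-106)"
abbreviation "eI \<equiv> Vr rI"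
abbreviation "eJ \<equiv> Vr rJ"
abbreviation "eL \<equiv> Vr rL"

text \<open>The certificate consists of 17 arrays, interleaved with stride 20. An item stands for the
  difference of its two numbers, and also serves as a nonnegative unknown through its first number alone.
  Array 0 holds \<open>\<Delta> - 1\<close>, \<open>q - 1\<close>, \<open>\<delta> - 1\<close>, where \<open>\<Delta>\<close> is a common denominator of the input; 1: the input times \<open>\<Delta>\<close>;
  2, 3: Bezout coefficients of numerator and denominator; 4: the numerator minus 1, if negative (there is no \<open>-0\<close>);
  5, 6, 7: parameter, primal and dual solution; 8, 9: right-hand side and objective; 10, 11, 12: slacks of the
  constraints, of the reduced costs and of the parameter set; 13: slacks of the target; 14, 15, 16: multipliers of the
  constraints, of the objective and of \<open>y \<ge> 0\<close> that derive the rows of the target.\<close>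

definition crt :: "nat \<Rightarrow> expr \<Rightarrow> expr" where
  "crt a i = Pl (Pl eT (Cn (1 + int a))) (Ti (Cn 20) i)"

definition neg :: "expr \<Rightarrow> expr" where "neg e = Ti (Cn (-1)) e"

definition cpos :: "nat \<Rightarrow> expr \<Rightarrow> expr" where "cpos a i = cell 1 (crt a i)"
definition cneg :: "nat \<Rightarrow> expr \<Rightarrow> expr" where "cneg a i = cell 3 (crt a i)"
definition cnum :: "nat \<Rightarrow> expr \<Rightarrow> expr" where "cnum a i = Pl (cpos a i) (neg (cneg a i))"

abbreviation "eDelta \<equiv> Pl (Cn 1) (cpos 0 (Cn 0))"
abbreviation "eQ \<equiv> Pl (Cn 1) (cpos 0 (Cn 1))"
abbreviation "eDel \<equiv> Pl (Cn 1) (cpos 0 (Cn 2))"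

text \<open>The position of the first entry of \<open>C\<close>: the matrices \<open>A\<close>,
  \<open>B\<close> and the vector \<open>b\<close> precede it.\<close>

definition offC :: expr where "offC = Ti eM (Pl (Pl eN eK) (Cn 1))"

abbreviation "eA i j \<equiv> cnum 1 (Pl (Ti i eN) j)"
abbreviation "eB i j \<equiv> cnum 1 (Pl (Ti eM eN) (Pl (Ti i eK) j))"
abbreviation "eb i \<equiv> cnum 1 (Pl (Ti eM (Pl eN eK)) i)"
abbreviation "eC i j \<equiv> cnum 1 (Pl offC (Pl (Ti i eK) j))"
abbreviation "ec i \<equiv> cnum 1 (Pl offC (Pl (Ti eN eK) i))"
abbreviation "eD i j \<equiv> cnum 1 (Pl (Pl offC (Ti eN (Pl eK (Cn 1)))) (Pl (Ti i eK) j))"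
abbreviation "ed i \<equiv> cnum 1 (Pl (Pl offC (Ti eN (Pl eK (Cn 1)))) (Pl (Ti eG eK) i))"
abbreviation "eS i j \<equiv> cnum 1 (Pl (Pl offC (Ti (Pl eN eG) (Pl eK (Cn 1)))) (Pl (Ti i eN) j))"
abbreviation "et i \<equiv> cnum 1 (Pl (Pl offC (Ti (Pl eN eG) (Pl eK (Cn 1)))) (Pl (Ti eR eN) i))"

text \<open>In this order: the digits of numerator and denominator are canonical, the two numbers
  are coprime, a negative entry has a nonzero numerator, array 1 holds the entry times the common
  denominator, and the item after the last entry starts with the separator. Together they say that
  the input word is an encoding.\<close>

definition input_blocks :: "eqn_block list" where
  "input_blocks =
    [(eT, Cn 1, [(Cn 1, Pl (cell 2 eI) (Cn (-1)))]),
     (eT, Cn 1, [(Cn 1, Pl (cell 4 eI) (Cn (-1)))]),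
     (eT, Cn 1, [(Cn 1, Pl (Pl (Ti (cell 1 eI) (cnum 2 eI)) (Ti (cell 3 eI) (cnum 3 eI))) (Cn (-1)))]),
     (eT, Cn 1, [(Cn 1, Ti (cell 0 eI) (Pl (Pl (cell 1 eI) (Cn (-1))) (neg (cpos 4 eI))))]),
     (eT, Cn 1, [(Cn 1, Pl (Ti (cnum 1 eI) (cell 3 eI))
        (neg (Ti (Pl (Cn 1) (Ti (Cn (-2)) (cell 0 eI))) (Ti (cell 1 eI) eDelta))))]),
     (Cn 1, Cn 1, [(Cn 1, Pl (cell 0 eT) (Cn (-2)))])]"

text \<open>Slack variables turn the inequalities into equations. The last block, of degree 2 in the
  unknowns, is complementary slackness; with the others it expresses the equality of primal and dual
  objective.\<close>

definition lp_blocks :: "eqn_block list" where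
  "lp_blocks =
    [(eG, Cn 1, [(eK, Ti (eD eI eL) (cnum 5 eL)), (Cn 1, Pl (cpos 12 eI) (neg (Ti (ed eI) eQ)))]),
     (eM, Cn 1, [(eK, neg (Ti (eB eI eL) (cnum 5 eL))), (Cn 1, Pl (cnum 8 eI) (neg (Ti (eb eI) eQ)))]),
     (eN, Cn 1, [(eK, neg (Ti (eC eI eL) (cnum 5 eL))), (Cn 1, Pl (cnum 9 eI) (neg (Ti (ec eI) eQ)))]),
     (eM, Cn 1, [(eN, Ti (eA eI eL) (cnum 6 eL)), (Cn 1, Pl (cpos 10 eI) (neg (cnum 8 eI)))]),
     (eN, Cn 1, [(eM, neg (Ti (eA eL eI) (cnum 7 eL))), (Cn 1, Pl (cpos 11 eI) (neg (cnum 9 eI)))]),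
     (Cn 1, Cn 1, [(eM, Ti (cnum 7 eL) (cpos 10 eL)), (eN, Ti (cpos 11 eL) (cnum 6 eL))])]"

text \<open>In the natural form \<open>y\<close> is free, so the reduced costs vanish and the
  multipliers of the constraints are nonnegative. In the standard form the roles are exchanged: no
  slack in the constraints, free multipliers, and nonnegative \<open>y\<close>.\<close>

fun form_blocks :: "lp_form \<Rightarrow> eqn_block list" where
  "form_blocks Natural =
    [(eN, Cn 1, [(Cn 1, cpos 11 eI)]), (eM, Cn 1, [(Cn 1, cneg 7 eI)])]"
| "form_blocks Standard =
    [(eM, Cn 1, [(Cn 1, cpos 10 eI)]), (eN, Cn 1, [(Cn 1, cneg 6 eI)])]"

definition opt_blocks :: "eqn_block list" where
  "opt_blocks = [(eR, Cn 1, [(eN, Ti (eS eI eL) (cnum 6 eL)), (Cn 1, Pl (cpos 13 eI) (neg (Ti (et eI) eQ)))])]"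

abbreviation "eMu i j \<equiv> cnum 14 (Pl (Ti i eM) j)"
abbreviation "eRho i j \<equiv> cpos 16 (Pl (Ti i eN) j)"

text \<open>The first block reads \<open>S * \<delta> = A\<^sup>T \<mu> - \<rho> + K * w\<close>,
  where \<open>w\<close> is the scaled objective and \<open>\<rho>\<close> belongs to
  \<open>y \<ge> 0\<close>; the second compares the right-hand sides.\<close>

definition pess_blocks :: "eqn_block list" where
  "pess_blocks =
    [(eR, eN, [(eM, neg (Ti (eA eL eJ) (eMu eI eL))),
       (Cn 1, Pl (eRho eI eJ) (Ti (eS eI eJ) eDel)), (Cn 1, neg (Ti (cpos 15 eI) (cnum 9 eJ)))]),
     (eR, Cn 1, [(eM, Ti (eMu eI eL) (cnum 8 eL)), (eN, Ti (cpos 15 eI) (Ti (cnum 9 eL) (cnum 6 eL))),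
       (Cn 1, Pl (cpos 13 eI) (neg (Ti (et eI) (Ti eDel eQ))))])]"

text \<open>In the standard form the multipliers of the equations are free, and those of
  \<open>y \<ge> 0\<close> are nonnegative as first numbers of their items, so there is nothing left
  to check.\<close>

fun pess_form_blocks :: "lp_form \<Rightarrow> eqn_block list" where
  "pess_form_blocks Natural =
    [(eR, eM, [(Cn 1, cneg 14 (Pl (Ti eI eM) eJ))]), (eR, eN, [(Cn 1, eRho eI eJ)])]"
| "pess_form_blocks Standard = []"

definition blocks :: "bool \<Rightarrow> lp_form \<Rightarrow> eqn_block list" where
  "blocks pess F = input_blocks @ lp_blocks @ form_blocks F @
     (if pess then pess_blocks @ pess_form_blocks F else opt_blocks)"

text \<open>Entries, separator and 20 interleaved arrays of one common length. That length is a sum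
  that dominates every array, as expressions offer no maximum.\<close>

definition tot_expr :: expr where
  "tot_expr = Pl (Pl eT (Cn 1)) (Ti (Cn 20) (Pl (Pl (Pl eT (Ti eR eM)) (Pl (Pl eM eN) (Pl eK eG))) (Pl eR (Cn 3))))"

text \<open>A recursive test that the simplifier can evaluate on concrete blocks, in place of the
  inductive \<open>cell_expr\<close>.\<close>

fun cell_check :: "expr \<Rightarrow> bool" where
  "cell_check (Cn z) \<longleftrightarrow> \<bar>z\<bar> \<le> 2000"
| "cell_check (Vr i) \<longleftrightarrow> False"
| "cell_check (Pl e f) \<longleftrightarrow> cell_check e \<and> cell_check f"
| "cell_check (Ti e f) \<longleftrightarrow> cell_check e \<and> cell_check f"
| "cell_check (Rd (Pl (Cn z) (Ti (Cn w) e))) \<longleftrightarrow> w = -5 \<and> z \<le> -1000 \<and> -1005 < z \<and> index_expr idxs e"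
| "cell_check (Rd _) \<longleftrightarrow> False"

lemma cell_expr_check: "cell_check e \<Longrightarrow> cell_expr e"
proof (induction e rule: cell_check.induct)
  case (5 z w e)
  then have "cell (nat (- 1000 - z)) e = Rd (Pl (Cn z) (Ti (Cn w) e))" by (simp add: cell_def)
  moreover have "cell_expr (cell (nat (- 1000 - z)) e)" using 5 by (intro cell_expr.intros(2)) auto
  ultimately show ?case by (simp only:)
qed (auto intro: cell_expr.intros)

lemma cell_check_cell [simp]: "cell_check (cell c e) \<longleftrightarrow> c < 5 \<and> index_expr idxs e"
  by (auto simp: cell_def)

lemma esize_cell [simp]: "esize (cell c e) = 3 + esize e"
  by (simp add: cell_def)

lemma ok_blockI:
  assumes "index_expr dims e" "esize e \<le> 60" "index_expr dims f" "esize f \<le> 60" "length ts \<le> 100"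
    "list_all (\<lambda>t. index_expr dims (fst t) \<and> esize (fst t) \<le> 60 \<and> cell_check (snd t) \<and> esize (snd t) \<le> 60) ts"
  shows "ok_block (e, f, ts)"
  using assms by (auto simp: ok_block_def ok_term_def list_all_iff cell_expr_check)

lemmas crt_defs = cnum_def cpos_def cneg_def neg_def crt_def offC_def

lemma ok_input: "list_all ok_block input_blocks"
  unfolding input_blocks_def list.pred_inject
  by (intro conjI ok_blockI TrueI) (simp_all add: crt_defs idxs_simps)

lemma ok_lp: "list_all ok_block lp_blocks"
  unfolding lp_blocks_def list.pred_inject
  by (intro conjI ok_blockI TrueI) (simp_all add: crt_defs idxs_simps)

lemma ok_opt: "list_all ok_block opt_blocks"
  unfolding opt_blocks_def list.pred_inject
  by (intro conjI ok_blockI TrueI) (simp_all add: crt_defs idxs_simps)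

lemma ok_pess: "list_all ok_block pess_blocks"
  unfolding pess_blocks_def list.pred_inject
  by (intro conjI ok_blockI TrueI) (simp_all add: crt_defs idxs_simps)

lemma ok_form: "list_all ok_block (form_blocks F)" "list_all ok_block (pess_form_blocks F)"
  by (cases F; simp only: form_blocks.simps pess_form_blocks.simps list.pred_inject;
      (intro conjI ok_blockI TrueI)?; simp add: crt_defs idxs_simps)+

lemma ok_blocks: "b \<in> set (blocks pess F) \<Longrightarrow> ok_block b"
  using ok_input ok_lp ok_opt ok_pess ok_form by (auto simp: blocks_def list_all_iff split: if_splits)

lemma length_blocks: "length (blocks pess F) \<le> 100"
  by (cases F) (auto simp: blocks_def input_blocks_def lp_blocks_def opt_blocks_def pess_blocks_def)

definition nenv :: "nat \<Rightarrow> nat \<Rightarrow> nat \<Rightarrow> nat \<Rightarrow> nat \<Rightarrow> nat \<Rightarrow> int \<Rightarrow> nat" where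
  "nenv m n k g r T = (\<lambda>_. 0)(-101 := m, -102 := n, -103 := k, -104 := g, -105 := r, -106 := T)"

lemma nenv_simps [simp]:
  "nenv m n k g r T (-101) = m" "nenv m n k g r T (-102) = n" "nenv m n k g r T (-103) = k"
  "nenv m n k g r T (-104) = g" "nenv m n k g r T (-105) = r" "nenv m n k g r T (-106) = T"
  by (simp_all add: nenv_def)

text \<open>Item \<open>T\<close> holds the separator, so the arrays start at item
  \<open>T + 1\<close>.\<close>

definition num_at :: "(nat \<Rightarrow> nat \<Rightarrow> int) \<Rightarrow> nat \<Rightarrow> nat \<Rightarrow> nat \<Rightarrow> int" where
  "num_at H T a i = H 1 (T + (1 + a) + 20 * i) - H 3 (T + (1 + a) + 20 * i)"

definition pos_at :: "(nat \<Rightarrow> nat \<Rightarrow> int) \<Rightarrow> nat \<Rightarrow> nat \<Rightarrow> nat \<Rightarrow> int" where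
  "pos_at H T a i = H 1 (T + (1 + a) + 20 * i)"

definition neg_at :: "(nat \<Rightarrow> nat \<Rightarrow> int) \<Rightarrow> nat \<Rightarrow> nat \<Rightarrow> nat \<Rightarrow> int" where
  "neg_at H T a i = H 3 (T + (1 + a) + 20 * i)"

definition input_ok :: "nat \<Rightarrow> (nat \<Rightarrow> nat \<Rightarrow> int) \<Rightarrow> bool" where
  "input_ok T H \<longleftrightarrow> H 0 T = 2 \<and> (\<forall>i<T. H 2 i = 1 \<and> H 4 i = 1 \<and>
     H 1 i * num_at H T 2 i + H 3 i * num_at H T 3 i = 1 \<and> H 0 i * (H 1 i - 1 - pos_at H T 4 i) = 0 \<and>
     num_at H T 1 i * H 3 i = (1 - 2 * H 0 i) * (H 1 i * (1 + pos_at H T 0 0)))"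

text \<open>The bracketing of the equations mirrors the term lists of the blocks, so that unfolding
  alone identifies the two.\<close>

definition lp_eqs :: "lp_form \<Rightarrow> nat \<Rightarrow> nat \<Rightarrow> nat \<Rightarrow> nat \<Rightarrow> (nat \<Rightarrow> nat \<Rightarrow> int) \<Rightarrow> (nat \<Rightarrow> nat \<Rightarrow> int) \<Rightarrow> (nat \<Rightarrow> int) \<Rightarrow> (nat \<Rightarrow> nat \<Rightarrow> int) \<Rightarrow> (nat \<Rightarrow> int) \<Rightarrow> (nat \<Rightarrow> nat \<Rightarrow> int) \<Rightarrow> (nat \<Rightarrow> int) \<Rightarrow> int \<Rightarrow> (nat \<Rightarrow> int) \<Rightarrow> (nat \<Rightarrow> int) \<Rightarrow> (nat \<Rightarrow> int) \<Rightarrow> 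
  (nat \<Rightarrow> int) \<Rightarrow> (nat \<Rightarrow> int) \<Rightarrow> (nat \<Rightarrow> int) \<Rightarrow> (nat \<Rightarrow> int) \<Rightarrow> (nat \<Rightarrow> int) \<Rightarrow> bool" where
  "lp_eqs F m n k g A B b C c D d q x y lam h w s nu sg \<longleftrightarrow>
     (\<forall>i<g. (\<Sum>l<k. D i l * x l) + (sg i - d i * q) = (0 :: int)) \<and>
     (\<forall>i<m. - (\<Sum>l<k. B i l * x l) + (h i - b i * q) = 0) \<and>
     (\<forall>j<n. - (\<Sum>l<k. C j l * x l) + (w j - c j * q) = 0) \<and>
     (\<forall>i<m. (\<Sum>j<n. A i j * y j) + (s i - h i) = 0) \<and>
     (\<forall>j<n. - (\<Sum>i<m. A i j * lam i) + (nu j - w j) = 0) \<and>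
     (\<Sum>i<m. lam i * s i) + (\<Sum>j<n. nu j * y j) = 0 \<and>
     (case F of Natural \<Rightarrow> (\<forall>j<n. nu j = 0) | Standard \<Rightarrow> (\<forall>i<m. s i = 0))"

definition opt_eqs :: "nat \<Rightarrow> nat \<Rightarrow> (nat \<Rightarrow> nat \<Rightarrow> int) \<Rightarrow> (nat \<Rightarrow> int) \<Rightarrow> int \<Rightarrow> (nat \<Rightarrow> int) \<Rightarrow> (nat \<Rightarrow> int) \<Rightarrow> bool" where
  "opt_eqs n r S t q y th \<longleftrightarrow> (\<forall>i<r. (\<Sum>j<n. S i j * y j) + (th i - t i * q) = (0 :: int))"

definition pess_eqs :: "lp_form \<Rightarrow> nat \<Rightarrow> nat \<Rightarrow> nat \<Rightarrow> (nat \<Rightarrow> nat \<Rightarrow> int) \<Rightarrow> (nat \<Rightarrow> nat \<Rightarrow> int) \<Rightarrow> (nat \<Rightarrow> int) \<Rightarrow> int \<Rightarrow> (nat \<Rightarrow> int) \<Rightarrow> (nat \<Rightarrow> int) \<Rightarrow> (nat \<Rightarrow> int) \<Rightarrow> 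
  int \<Rightarrow> (nat \<Rightarrow> nat \<Rightarrow> int) \<Rightarrow> (nat \<Rightarrow> int) \<Rightarrow> (nat \<Rightarrow> nat \<Rightarrow> int) \<Rightarrow> (nat \<Rightarrow> int) \<Rightarrow> bool" where
  "pess_eqs F m n r A S t q y h w del mu K rho th \<longleftrightarrow>
     (\<forall>i<r. \<forall>j<n. - (\<Sum>l<m. A l j * mu i l) + (rho i j + S i j * del + - (K i * w j)) = (0 :: int)) \<and>
     (\<forall>i<r. (\<Sum>l<m. mu i l * h l) + ((\<Sum>l<n. K i * (w l * y l)) + (th i - t i * (del * q))) = 0) \<and>
     (F = Natural \<longrightarrow> (\<forall>i<r. \<forall>j<n. rho i j = 0))"

definition equations :: "bool \<Rightarrow> lp_form \<Rightarrow> nat \<Rightarrow> nat \<Rightarrow> nat \<Rightarrow> nat \<Rightarrow> nat \<Rightarrow> nat \<Rightarrow> (nat \<Rightarrow> nat \<Rightarrow> int) \<Rightarrow> bool" where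
  "equations pess F m n k g r T H \<longleftrightarrow> (let E = num_at H T 1; oC = m * (n + k + 1); oD = oC + n * (k + 1);
       oS = oC + (n + g) * (k + 1); q = 1 + pos_at H T 0 1; del = 1 + pos_at H T 0 2;
       A = (\<lambda>i j. E (i * n + j)); S = (\<lambda>i j. E (oS + (i * n + j))); t = (\<lambda>i. E (oS + (r * n + i)));
       y = num_at H T 6; h = num_at H T 8; w = num_at H T 9; th = pos_at H T 13
     in input_ok T H \<and>
       lp_eqs F m n k g A (\<lambda>i l. E (m * n + (i * k + l))) (\<lambda>i. E (m * (n + k) + i))
         (\<lambda>i l. E (oC + (i * k + l))) (\<lambda>i. E (oC + (n * k + i))) (\<lambda>i l. E (oD + (i * k + l))) (\<lambda>i. E (oD + (g * k + i)))
         q (num_at H T 5) y (num_at H T 7) h w (pos_at H T 10) (pos_at H T 11) (pos_at H T 12) \<and>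
       (case F of Natural \<Rightarrow> (\<forall>i<m. neg_at H T 7 i = 0) | Standard \<Rightarrow> (\<forall>j<n. neg_at H T 6 j = 0)) \<and>
       (if pess then pess_eqs F m n r A S t q y h w del (\<lambda>i l. num_at H T 14 (i * m + l)) (pos_at H T 15)
           (\<lambda>i j. pos_at H T 16 (i * n + j)) th \<and> (F = Natural \<longrightarrow> (\<forall>i<r. \<forall>l<m. neg_at H T 14 (i * m + l) = 0))
        else opt_eqs n r S t q y th))"

lemma cv_crt [simp]:
  "cv (cpos a e) H \<rho> = pos_at H (\<rho> (-106)) a (ix e \<rho>)"
  "cv (cneg a e) H \<rho> = neg_at H (\<rho> (-106)) a (ix e \<rho>)"
  "cv (cnum a e) H \<rho> = num_at H (\<rho> (-106)) a (ix e \<rho>)"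
  "cv (neg e) H \<rho> = - cv e H \<rho>"
proof -
  have n: "nat (1 + int a) = 1 + a" by simp
  show "cv (cpos a e) H \<rho> = pos_at H (\<rho> (-106)) a (ix e \<rho>)"
    unfolding cpos_def crt_def pos_at_def cv_cell ix.simps n by simp
  show "cv (cneg a e) H \<rho> = neg_at H (\<rho> (-106)) a (ix e \<rho>)"
    unfolding cneg_def crt_def neg_at_def cv_cell ix.simps n by simp
  show "cv (cnum a e) H \<rho> = num_at H (\<rho> (-106)) a (ix e \<rho>)"
    unfolding cnum_def neg_def cpos_def cneg_def crt_def num_at_def cv.simps cv_cell ix.simps n by simp
qed (simp add: neg_def)

lemma ix_offC [simp]: "ix offC \<rho> = \<rho> (-101) * (\<rho> (-102) + \<rho> (-103) + 1)"
  by (simp add: offC_def)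

lemma nsat_input: "(\<forall>b\<in>set input_blocks. nsat H (nenv m n k g r T) b) \<longleftrightarrow> input_ok T H"
proof -
  have "(\<forall>b\<in>set input_blocks. nsat H (nenv m n k g r T) b) \<longleftrightarrow>
    (\<forall>i<T. H 2 i + - 1 = 0) \<and> (\<forall>i<T. H 4 i + - 1 = 0) \<and>
    (\<forall>i<T. H 1 i * num_at H T 2 i + H 3 i * num_at H T 3 i + - 1 = 0) \<and>
    (\<forall>i<T. H 0 i * (H 1 i + - 1 + - pos_at H T 4 i) = 0) \<and>
    (\<forall>i<T. num_at H T 1 i * H 3 i + - ((1 + - 2 * H 0 i) * (H 1 i * (1 + pos_at H T 0 0))) = 0) \<and> H 0 T + - 2 = 0"
    by (simp add: input_blocks_def nsat_def)
  also have "\<dots> \<longleftrightarrow> input_ok T H"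
    unfolding input_ok_def by (auto simp: algebra_simps)
  finally show ?thesis .
qed

lemma nsat_lp: "(\<forall>b\<in>set (lp_blocks @ form_blocks F). nsat H (nenv m n k g r T) b) \<longleftrightarrow>
   (let E = num_at H T 1; oC = m * (n + k + 1); oD = oC + n * (k + 1) in
       lp_eqs F m n k g (\<lambda>i j. E (i * n + j)) (\<lambda>i l. E (m * n + (i * k + l))) (\<lambda>i. E (m * (n + k) + i))
         (\<lambda>i l. E (oC + (i * k + l))) (\<lambda>i. E (oC + (n * k + i))) (\<lambda>i l. E (oD + (i * k + l))) (\<lambda>i. E (oD + (g * k + i)))
         (1 + pos_at H T 0 1) (num_at H T 5) (num_at H T 6) (num_at H T 7) (num_at H T 8) (num_at H T 9)
         (pos_at H T 10) (pos_at H T 11) (pos_at H T 12) \<and>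
       (case F of Natural \<Rightarrow> (\<forall>i<m. neg_at H T 7 i = 0) | Standard \<Rightarrow> (\<forall>j<n. neg_at H T 6 j = 0)))"
  by (cases F) (simp_all add: lp_blocks_def nsat_def lp_eqs_def Let_def sum_negf conj_ac)

lemma nsat_opt: "(\<forall>b\<in>set opt_blocks. nsat H (nenv m n k g r T) b) \<longleftrightarrow>
   (let E = num_at H T 1; oS = m * (n + k + 1) + (n + g) * (k + 1) in
     opt_eqs n r (\<lambda>i j. E (oS + (i * n + j))) (\<lambda>i. E (oS + (r * n + i))) (1 + pos_at H T 0 1) (num_at H T 6) (pos_at H T 13))"
  by (simp add: opt_blocks_def nsat_def opt_eqs_def Let_def)

lemma nsat_pess: "(\<forall>b\<in>set (pess_blocks @ pess_form_blocks F). nsat H (nenv m n k g r T) b) \<longleftrightarrow>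
   (let E = num_at H T 1; oS = m * (n + k + 1) + (n + g) * (k + 1) in
     pess_eqs F m n r (\<lambda>i j. E (i * n + j)) (\<lambda>i j. E (oS + (i * n + j))) (\<lambda>i. E (oS + (r * n + i)))
       (1 + pos_at H T 0 1) (num_at H T 6) (num_at H T 8) (num_at H T 9) (1 + pos_at H T 0 2)
       (\<lambda>i l. num_at H T 14 (i * m + l)) (pos_at H T 15) (\<lambda>i j. pos_at H T 16 (i * n + j)) (pos_at H T 13) \<and>
     (F = Natural \<longrightarrow> (\<forall>i<r. \<forall>l<m. neg_at H T 14 (i * m + l) = 0)))"
  by (cases F) (simp_all add: pess_blocks_def nsat_def pess_eqs_def Let_def sum_negf conj_ac)

lemma nsat_blocks:
  "(\<forall>b\<in>set (blocks pess F). nsat H (nenv m n k g r T) b) \<longleftrightarrow> equations pess F m n k g r T H"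
proof -
  have "(\<forall>b\<in>set (blocks pess F). nsat H (nenv m n k g r T) b) \<longleftrightarrow>
    (\<forall>b\<in>set input_blocks. nsat H (nenv m n k g r T) b) \<and>
    (\<forall>b\<in>set (lp_blocks @ form_blocks F). nsat H (nenv m n k g r T) b) \<and>
    (if pess then (\<forall>b\<in>set (pess_blocks @ pess_form_blocks F). nsat H (nenv m n k g r T) b)
     else (\<forall>b\<in>set opt_blocks. nsat H (nenv m n k g r T) b))"
    by (auto simp: blocks_def)
  then show ?thesis unfolding nsat_input nsat_lp nsat_opt nsat_pess equations_def Let_def by auto
qed

section \<open>Equations and sign conditions as rows of one inequality system\<close>

section \<open>Both forms as systems of inequalities\<close>

text \<open>\<open>Up\<close> is a constraint as given, \<open>Lo\<close> its reverse, present for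
  equations only, and \<open>Nn\<close> the row \<open>- y \<le> 0\<close> of a sign
  condition.\<close>

datatype lp_row = Up nat | Lo nat | Nn nat

definition rows :: "lp_form \<Rightarrow> nat \<Rightarrow> nat \<Rightarrow> lp_row set" where
  "rows F m n = Up ` {..<m} \<union> (case F of Natural \<Rightarrow> {} | Standard \<Rightarrow> Lo ` {..<m} \<union> Nn ` {..<n})"

fun row_A :: "(nat \<Rightarrow> nat \<Rightarrow> int) \<Rightarrow> lp_row \<Rightarrow> nat \<Rightarrow> int" where
  "row_A A (Up i) = A i"
| "row_A A (Lo i) = (\<lambda>j. - A i j)"
| "row_A A (Nn i) = (\<lambda>j. if j = i then -1 else 0)"

fun row_B :: "(nat \<Rightarrow> nat \<Rightarrow> int) \<Rightarrow> lp_row \<Rightarrow> nat \<Rightarrow> int" where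
  "row_B B (Up i) = B i"
| "row_B B (Lo i) = (\<lambda>j. - B i j)"
| "row_B B (Nn i) = (\<lambda>j. 0)"

fun row_b :: "(nat \<Rightarrow> int) \<Rightarrow> lp_row \<Rightarrow> int" where
  "row_b b (Up i) = b i"
| "row_b b (Lo i) = - b i"
| "row_b b (Nn i) = 0"

text \<open>A free multiplier of an equation is distributed as positive and negative part over the
  two opposite inequalities.\<close>

fun row_mult :: "lp_form \<Rightarrow> (nat \<Rightarrow> int) \<Rightarrow> (nat \<Rightarrow> int) \<Rightarrow> lp_row \<Rightarrow> int" where
  "row_mult F lam nu (Up i) = (case F of Natural \<Rightarrow> lam i | Standard \<Rightarrow> max (lam i) 0)"
| "row_mult F lam nu (Lo i) = max (- lam i) 0"
| "row_mult F lam nu (Nn i) = nu i"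

lemma finite_rows: "finite (rows F m n)"
  by (cases F) (auto simp: rows_def)

lemma card_rows: "card (rows F m n) \<le> 2 * m + n"
proof -
  have "rows F m n \<subseteq> Up ` {..<m} \<union> (Lo ` {..<m} \<union> Nn ` {..<n})" by (cases F) (auto simp: rows_def)
  then have "card (rows F m n) \<le> card (Up ` {..<m} \<union> (Lo ` {..<m} \<union> Nn ` {..<n}))" by (intro card_mono) auto
  also have "\<dots> \<le> card (Up ` {..<m}) + (card (Lo ` {..<m}) + card (Nn ` {..<n}))"
    by (intro order.trans[OF card_Un_le] add_left_mono order.refl)
  also have "\<dots> \<le> m + (m + n)"
    using card_image_le[of "{..<m}" Up] card_image_le[of "{..<m}" Lo] card_image_le[of "{..<n}" Nn] by simp
  finally show ?thesis by simp
qed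

lemma sum_rows:
  "sum f (rows F m n) = (\<Sum>i<m. f (Up i)) + (case F of Natural \<Rightarrow> 0 | Standard \<Rightarrow> (\<Sum>i<m. f (Lo i)) + (\<Sum>j<n. f (Nn j)))"
  for f :: "lp_row \<Rightarrow> 'z :: comm_monoid_add"
proof -
  have inj: "inj_on Up S" "inj_on Lo S" "inj_on Nn S" for S by (auto simp: inj_on_def)
  have d: "Up ` X \<inter> (Lo ` Y \<union> Nn ` Z) = {}" "Lo ` Y \<inter> Nn ` Z = {}" for X Y Z by auto
  show ?thesis
    by (cases F) (simp_all add: rows_def sum.reindex inj sum.union_disjoint d)
qed

lemma ball_rows:
  "(\<forall>i\<in>rows F m n. P i) \<longleftrightarrow> (\<forall>i<m. P (Up i)) \<and> (F = Standard \<longrightarrow> (\<forall>i<m. P (Lo i)) \<and> (\<forall>j<n. P (Nn j)))"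
  by (cases F) (auto simp: rows_def)

lemma sum_row_mult:
  assumes "j < n"
  shows "(\<Sum>i\<in>rows F m n. row_A A i j * row_mult F lam nu i) =
    (\<Sum>i<m. A i j * lam i) - (case F of Natural \<Rightarrow> 0 | Standard \<Rightarrow> nu j)"
proof (cases F)
  case Standard
  have "(\<Sum>i<m. A i j * max (lam i) 0) + (\<Sum>i<m. - A i j * max (- lam i) 0) = (\<Sum>i<m. A i j * lam i)"
    unfolding sum.distrib[symmetric] by (rule sum.cong) (auto simp: max_def)
  moreover have "(\<Sum>l<n. (if j = l then -1 else 0) * nu l) = - nu j"
    using assms by (simp add: if_distrib[of "\<lambda>x. x * _"] cong: if_cong)
  ultimately show ?thesis using Standard by (simp add: sum_rows add.assoc[symmetric])
qed (simp add: sum_rows)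

lemma sum_row_mult_rhs:
  assumes "\<And>i. i < m \<Longrightarrow> h (Lo i) = - h (Up i)" "\<And>j. j < n \<Longrightarrow> h (Nn j) = (0 :: int)"
  shows "(\<Sum>i\<in>rows F m n. row_mult F lam nu i * h i) = (\<Sum>i<m. lam i * h (Up i))"
proof (cases F)
  case Standard
  have "(\<Sum>i<m. max (lam i) 0 * h (Up i)) + (\<Sum>i<m. max (- lam i) 0 * h (Lo i)) = (\<Sum>i<m. lam i * h (Up i))"
    unfolding sum.distrib[symmetric] using assms(1) by (intro sum.cong) (auto simp: max_def)
  then show ?thesis using Standard assms(2) by (simp add: sum_rows)
qed (simp add: sum_rows)

lemma lp_eqsD:
  assumes "lp_eqs F m n k g A B b C c D d q x y lam h w s nu sg"
  shows "\<And>i. i < g \<Longrightarrow> (\<Sum>l<k. D i l * x l) + sg i = d i * q"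
    "\<And>i. i < m \<Longrightarrow> h i = (\<Sum>l<k. B i l * x l) + b i * q"
    "\<And>j. j < n \<Longrightarrow> w j = (\<Sum>l<k. C j l * x l) + c j * q"
    "\<And>i. i < m \<Longrightarrow> (\<Sum>j<n. A i j * y j) + s i = h i"
    "\<And>j. j < n \<Longrightarrow> nu j = (\<Sum>i<m. A i j * lam i) + w j"
    "(\<Sum>i<m. lam i * s i) + (\<Sum>j<n. nu j * y j) = 0"
    "F = Natural \<Longrightarrow> j < n \<Longrightarrow> nu j = 0" "F = Standard \<Longrightarrow> i < m \<Longrightarrow> s i = 0"
proof -
  note e = assms[unfolded lp_eqs_def]
  fix i
  show "i < g \<Longrightarrow> (\<Sum>l<k. D i l * x l) + sg i = d i * q"
    using e[THEN conjunct1, rule_format, of i] by linarith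
  show "i < m \<Longrightarrow> h i = (\<Sum>l<k. B i l * x l) + b i * q"
    using e[THEN conjunct2, THEN conjunct1, rule_format, of i] by linarith
  show "i < n \<Longrightarrow> w i = (\<Sum>l<k. C i l * x l) + c i * q"
    using e[THEN conjunct2, THEN conjunct2, THEN conjunct1, rule_format, of i] by linarith
  show "i < m \<Longrightarrow> (\<Sum>j<n. A i j * y j) + s i = h i"
    using e[THEN conjunct2, THEN conjunct2, THEN conjunct2, THEN conjunct1, rule_format, of i] by linarith
  show "i < n \<Longrightarrow> nu i = (\<Sum>j<m. A j i * lam j) + w i"
    using e[THEN conjunct2, THEN conjunct2, THEN conjunct2, THEN conjunct2, THEN conjunct1, rule_format, of i] by linarith
qed (use assms in \<open>simp_all add: lp_eqs_def\<close>)

locale lp_data =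
  fixes F :: lp_form and m n k g r :: nat and A B :: "nat \<Rightarrow> nat \<Rightarrow> int" and b :: "nat \<Rightarrow> int"
    and C :: "nat \<Rightarrow> nat \<Rightarrow> int" and c :: "nat \<Rightarrow> int" and D :: "nat \<Rightarrow> nat \<Rightarrow> int" and d :: "nat \<Rightarrow> int"
    and S :: "nat \<Rightarrow> nat \<Rightarrow> int" and t :: "nat \<Rightarrow> int"
begin

sublocale param_lp "rows F m n" n k g r "row_A A" "row_B B" "row_b b" C c D d S t
  by unfold_locales (rule finite_rows)

lemma irhs_rows: "irhs (Lo i) q x = - irhs (Up i) q x" "irhs (Nn i) q x = 0"
  by (simp_all add: irhs_def sum_negf)

context
  fixes q x y lam h w s nu sg
  assumes eqs: "lp_eqs F m n k g A B b C c D d q x y lam h w s nu sg"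
begin

lemma eqs_h: "i < m \<Longrightarrow> h i = irhs (Up i) q x" and eqs_w: "j < n \<Longrightarrow> w j = iobj j q x"
  using lp_eqsD(2,3)[OF eqs] by (auto simp: irhs_def iobj_def)

text \<open>Substituting the slacks \<open>s\<close> and the reduced costs \<open>nu\<close> into
  complementary slackness makes the two terms with \<open>A\<close> cancel; what remains is the
  equality of the objectives.\<close>

lemma eqs_primal_dual:
  assumes "1 \<le> q" "\<And>i. i < m \<Longrightarrow> 0 \<le> s i" "\<And>j. j < n \<Longrightarrow> 0 \<le> nu j" "\<And>i. i < g \<Longrightarrow> 0 \<le> sg i"
    and nn: "case F of Natural \<Rightarrow> \<forall>i<m. 0 \<le> lam i | Standard \<Rightarrow> \<forall>j<n. 0 \<le> y j"
  shows "primal_dual q x y (row_mult F lam nu)"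
proof -
  note eD = lp_eqsD(1)[OF eqs] and form = lp_eqsD(7,8)[OF eqs]
  have es: "(\<Sum>j<n. A i j * y j) + s i = irhs (Up i) q x" if "i < m" for i
    using lp_eqsD(4)[OF eqs that] eqs_h[OF that] by simp
  have enu: "nu j = (\<Sum>i<m. A i j * lam i) + iobj j q x" if "j < n" for j
    using lp_eqsD(5)[OF eqs that] eqs_w[OF that] by simp
  have X: "\<forall>i<g. (\<Sum>l<k. D i l * x l) \<le> d i * q"
  proof (intro allI impI)
    fix i assume "i < g"
    then show "(\<Sum>l<k. D i l * x l) \<le> d i * q" using eD[of i] assms(4)[of i] by linarith
  qed
  have feas: "\<forall>i\<in>rows F m n. (\<Sum>j<n. row_A A i j * y j) \<le> irhs i q x"
    unfolding ball_rows
  proof (intro conjI allI impI)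
    fix i assume i: "i < m"
    show "(\<Sum>j<n. row_A A (Up i) j * y j) \<le> irhs (Up i) q x" using es[OF i] assms(2)[OF i] by simp
    assume "F = Standard"
    then have "s i = 0" using form i by simp
    then show "(\<Sum>j<n. row_A A (Lo i) j * y j) \<le> irhs (Lo i) q x" using es[OF i] by (simp add: irhs_rows sum_negf)
  next
    fix j assume "F = Standard" and j: "j < n"
    then have "0 \<le> y j" using nn by simp
    moreover have "(\<Sum>l<n. (if l = j then -1 else 0) * y l) = - y j"
      using j by (simp add: if_distrib[of "\<lambda>x. x * _"] cong: if_cong)
    ultimately show "(\<Sum>l<n. row_A A (Nn j) l * y l) \<le> irhs (Nn j) q x" by (simp add: irhs_rows)
  qed
  have pnn: "\<forall>i\<in>rows F m n. 0 \<le> row_mult F lam nu i"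
    using nn assms(3) by (cases F) (auto simp: ball_rows)
  have dual: "\<forall>j<n. (\<Sum>i\<in>rows F m n. row_A A i j * row_mult F lam nu i) + iobj j q x = 0"
  proof (intro allI impI)
    fix j assume "j < n"
    then show "(\<Sum>i\<in>rows F m n. row_A A i j * row_mult F lam nu i) + iobj j q x = 0"
      using enu[of j] form(1)[of j] by (cases F) (simp_all add: sum_row_mult)
  qed
  have "(\<Sum>i<m. lam i * s i) + (\<Sum>j<n. nu j * y j) = 0" by (rule lp_eqsD(6)[OF eqs])
  moreover have "(\<Sum>i<m. lam i * s i) = (\<Sum>i<m. lam i * irhs (Up i) q x) - (\<Sum>i<m. lam i * (\<Sum>j<n. A i j * y j))"
    unfolding sum_subtractf[symmetric]
    by (rule sum.cong[OF refl]) (simp add: right_diff_distrib[symmetric] es[symmetric])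
  moreover have "(\<Sum>j<n. nu j * y j) = (\<Sum>j<n. (\<Sum>i<m. A i j * lam i) * y j) + (\<Sum>j<n. iobj j q x * y j)"
    unfolding sum.distrib[symmetric] by (rule sum.cong) (use enu in \<open>auto simp: algebra_simps\<close>)
  moreover have "(\<Sum>j<n. (\<Sum>i<m. A i j * lam i) * y j) = (\<Sum>i<m. lam i * (\<Sum>j<n. A i j * y j))"
    unfolding sum_distrib_left sum_distrib_right by (subst sum.swap) (simp add: mult_ac)
  ultimately have "(\<Sum>i<m. lam i * irhs (Up i) q x) + (\<Sum>j<n. iobj j q x * y j) = 0" by linarith
  then have "(\<Sum>i\<in>rows F m n. row_mult F lam nu i * irhs i q x) + (\<Sum>j<n. iobj j q x * y j) = 0"
    by (subst sum_row_mult_rhs) (auto simp: irhs_rows)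
  then show ?thesis unfolding primal_dual_def using assms(1) X feas pnn dual by blast
qed

lemma eqs_farkas_cert:
  assumes p: "pess_eqs F m n r A S t q y h w del mu K rho th"
    and "1 \<le> del" "\<And>i. i < r \<Longrightarrow> 0 \<le> K i" "\<And>i j. i < r \<Longrightarrow> j < n \<Longrightarrow> 0 \<le> rho i j" "\<And>i. i < r \<Longrightarrow> 0 \<le> th i"
    and mu: "F = Natural \<Longrightarrow> \<forall>i<r. \<forall>l<m. 0 \<le> mu i l"
  shows "farkas_cert q x y del (\<lambda>i. row_mult F (mu i) (rho i)) K"
  unfolding farkas_cert_def
proof (intro conjI allI impI ballI)
  fix i assume i: "i < r"
  show "0 \<le> row_mult F (mu i) (rho i) l" if "l \<in> rows F m n" for l
    using that mu i assms(4) by (cases F; cases l) (auto simp: rows_def)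
  show "(\<Sum>l\<in>rows F m n. row_A A l j * row_mult F (mu i) (rho i) l) + K i * iobj j q x = S i j * del" if j: "j < n" for j
  proof -
    have "- (\<Sum>l<m. A l j * mu i l) + (rho i j + S i j * del + - (K i * w j)) = 0"
      "F = Natural \<Longrightarrow> rho i j = 0"
      using p i j by (auto simp: pess_eqs_def)
    then show ?thesis using eqs_w[OF j] j by (cases F) (simp_all add: sum_row_mult)
  qed
  have "(\<Sum>l\<in>rows F m n. row_mult F (mu i) (rho i) l * irhs l q x) = (\<Sum>l<m. mu i l * h l)"
    using eqs_h by (subst sum_row_mult_rhs) (auto simp: irhs_rows)
  moreover have "K i * (\<Sum>j<n. iobj j q x * y j) = (\<Sum>l<n. K i * (w l * y l))"
    unfolding sum_distrib_left by (rule sum.cong) (auto simp: eqs_w)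
  moreover have "(\<Sum>l<m. mu i l * h l) + ((\<Sum>l<n. K i * (w l * y l)) + (th i - t i * (del * q))) = 0"
    using p i by (simp add: pess_eqs_def)
  ultimately show "(\<Sum>l\<in>rows F m n. row_mult F (mu i) (rho i) l * irhs l q x) + K i * (\<Sum>j<n. iobj j q x * y j) \<le> t i * (del * q)"
    using assms(5)[OF i] by linarith
qed (use assms in auto)

end

lemma opt_eqs_target_cert:
  assumes "opt_eqs n r S t q y th" "\<And>i. i < r \<Longrightarrow> 0 \<le> th i"
  shows "target_cert q y"
  unfolding target_cert_def
proof (intro allI impI)
  fix i assume i: "i < r"
  then have "(\<Sum>j<n. S i j * y j) + (th i - t i * q) = 0" using assms by (simp add: opt_eqs_def)
  then show "(\<Sum>j<n. S i j * y j) \<le> t i * q" using assms(2)[OF i] by linarith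
qed

text \<open>The net multiplier of a constraint. In the standard form it recombines the two opposite
  rows, as a counterpart of \<open>row_mult\<close>.\<close>

definition signed :: "(lp_row \<Rightarrow> int) \<Rightarrow> nat \<Rightarrow> int" where
  "signed p i = p (Up i) - (case F of Natural \<Rightarrow> 0 | Standard \<Rightarrow> p (Lo i))"

definition slackness :: "(lp_row \<Rightarrow> int) \<Rightarrow> nat \<Rightarrow> int" where
  "slackness p j = (case F of Natural \<Rightarrow> 0 | Standard \<Rightarrow> p (Nn j))"

lemma sum_signed:
  assumes "j < n"
  shows "(\<Sum>i\<in>rows F m n. row_A A i j * p i) = (\<Sum>i<m. A i j * signed p i) - slackness p j"
  unfolding signed_def slackness_def
proof (cases F)
  case Standard
  have "(\<Sum>l<n. (if j = l then -1 else 0) * p (Nn l)) = - p (Nn j)"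
    using assms by (simp add: if_distrib[of "\<lambda>x. x * _"] cong: if_cong)
  then show "(\<Sum>i\<in>rows F m n. row_A A i j * p i) = (\<Sum>i<m. A i j * (p (Up i) - (case F of Natural \<Rightarrow> 0 | Standard \<Rightarrow> p (Lo i)))) -
      (case F of Natural \<Rightarrow> 0 | Standard \<Rightarrow> p (Nn j))"
    using Standard by (simp add: sum_rows right_diff_distrib sum_subtractf sum_negf)
qed (simp add: sum_rows)

lemma sum_signed_rhs: "(\<Sum>i\<in>rows F m n. p i * irhs i q x) = (\<Sum>i<m. signed p i * irhs (Up i) q x)"
  unfolding signed_def
  by (cases F) (simp_all add: sum_rows irhs_rows left_diff_distrib sum_subtractf sum_negf)

text \<open>Slacks are defined as differences, so most equations hold by construction. In the
  standard form the rows \<open>Up\<close> and \<open>Lo\<close> force the slack of a constraint to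
  be 0.\<close>

lemma primal_dual_eqs:
  assumes pd: "primal_dual q x y p"
  shows "lp_eqs F m n k g A B b C c D d q x y (signed p) (\<lambda>i. irhs (Up i) q x) (\<lambda>j. iobj j q x)
    (\<lambda>i. irhs (Up i) q x - (\<Sum>j<n. A i j * y j)) (slackness p) (\<lambda>i. d i * q - (\<Sum>l<k. D i l * x l))"
    "\<forall>i<m. 0 \<le> irhs (Up i) q x - (\<Sum>j<n. A i j * y j)" "\<forall>j<n. 0 \<le> slackness p j"
    "\<forall>i<g. 0 \<le> d i * q - (\<Sum>l<k. D i l * x l)"
    "case F of Natural \<Rightarrow> \<forall>i<m. 0 \<le> signed p i | Standard \<Rightarrow> \<forall>j<n. 0 \<le> y j"
proof -
  have feas: "\<forall>i\<in>rows F m n. (\<Sum>j<n. row_A A i j * y j) \<le> irhs i q x" and pnn: "\<forall>i\<in>rows F m n. 0 \<le> p i"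
    using pd by (auto simp: primal_dual_def)
  have dual: "(\<Sum>i<m. A i j * signed p i) - slackness p j + iobj j q x = 0" if "j < n" for j
  proof -
    have "(\<Sum>i\<in>rows F m n. row_A A i j * p i) + iobj j q x = 0" using pd that unfolding primal_dual_def by blast
    then show ?thesis unfolding sum_signed[OF that] .
  qed
  have compl: "(\<Sum>i<m. signed p i * irhs (Up i) q x) + (\<Sum>j<n. iobj j q x * y j) = 0"
    using pd unfolding primal_dual_def sum_signed_rhs by blast
  have "(\<Sum>j<n. slackness p j * y j) = (\<Sum>j<n. (\<Sum>i<m. A i j * signed p i) * y j) + (\<Sum>j<n. iobj j q x * y j)"
    unfolding sum.distrib[symmetric]
  proof (rule sum.cong[OF refl])
    fix j assume "j \<in> {..<n}"
    then have "slackness p j = (\<Sum>i<m. A i j * signed p i) + iobj j q x" using dual[of j] by simp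
    then show "slackness p j * y j = (\<Sum>i<m. A i j * signed p i) * y j + iobj j q x * y j" by (simp add: distrib_right)
  qed
  moreover have "(\<Sum>j<n. (\<Sum>i<m. A i j * signed p i) * y j) = (\<Sum>i<m. signed p i * (\<Sum>j<n. A i j * y j))"
    unfolding sum_distrib_left sum_distrib_right by (subst sum.swap) (simp add: mult_ac)
  ultimately have compl': "(\<Sum>i<m. signed p i * (irhs (Up i) q x - (\<Sum>j<n. A i j * y j))) + (\<Sum>j<n. slackness p j * y j) = 0"
    using compl by (simp add: right_diff_distrib sum_subtractf)
  have std: "irhs (Up i) q x = (\<Sum>j<n. A i j * y j)" if "F = Standard" "i < m" for i
  proof -
    have "(\<Sum>j<n. row_A A (Up i) j * y j) \<le> irhs (Up i) q x" "(\<Sum>j<n. row_A A (Lo i) j * y j) \<le> irhs (Lo i) q x"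
      using feas that unfolding ball_rows by blast+
    then show ?thesis by (simp add: irhs_rows sum_negf)
  qed
  show "lp_eqs F m n k g A B b C c D d q x y (signed p) (\<lambda>i. irhs (Up i) q x) (\<lambda>j. iobj j q x)
    (\<lambda>i. irhs (Up i) q x - (\<Sum>j<n. A i j * y j)) (slackness p) (\<lambda>i. d i * q - (\<Sum>l<k. D i l * x l))"
    unfolding lp_eqs_def
  proof (intro conjI allI impI)
    show "- (\<Sum>i<m. A i j * signed p i) + (slackness p j - iobj j q x) = 0" if "j < n" for j
      using dual[OF that] by simp
    show "case F of Natural \<Rightarrow> \<forall>j<n. slackness p j = 0 | Standard \<Rightarrow> \<forall>i<m. irhs (Up i) q x - (\<Sum>j<n. A i j * y j) = 0"
      using std unfolding slackness_def by (cases F) auto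
  qed (use compl' in \<open>auto simp: irhs_def iobj_def\<close>)
  show "\<forall>i<m. 0 \<le> irhs (Up i) q x - (\<Sum>j<n. A i j * y j)" using feas unfolding ball_rows by simp
  show "\<forall>j<n. 0 \<le> slackness p j" using pnn unfolding ball_rows slackness_def by (cases F) auto
  show "\<forall>i<g. 0 \<le> d i * q - (\<Sum>l<k. D i l * x l)" using pd by (simp add: primal_dual_def)
  show "case F of Natural \<Rightarrow> \<forall>i<m. 0 \<le> signed p i | Standard \<Rightarrow> \<forall>j<n. 0 \<le> y j"
  proof (cases F)
    case Natural
    then show ?thesis using pnn unfolding ball_rows signed_def by simp
  next
    case Standard
    have "(\<Sum>l<n. (if l = j then -1 else 0) * y l) = - y j" if "j < n" for j
      using that by (simp add: if_distrib[of "\<lambda>x. x * _"] cong: if_cong)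
    moreover have "(\<Sum>l<n. row_A A (Nn j) l * y l) \<le> irhs (Nn j) q x" if "j < n" for j
      using feas Standard that unfolding ball_rows by blast
    ultimately show ?thesis using Standard by (simp add: irhs_rows)
  qed
qed

lemma farkas_cert_eqs:
  assumes fc: "farkas_cert q x y del mu K"
  shows "pess_eqs F m n r A S t q y (\<lambda>i. irhs (Up i) q x) (\<lambda>j. iobj j q x) del (\<lambda>i. signed (mu i)) K (\<lambda>i. slackness (mu i))
      (\<lambda>i. t i * (del * q) - ((\<Sum>l<m. signed (mu i) l * irhs (Up l) q x) + K i * (\<Sum>j<n. iobj j q x * y j)))"
    "1 \<le> del" "\<forall>i<r. 0 \<le> K i" "\<forall>i<r. \<forall>j<n. 0 \<le> slackness (mu i) j"
    "\<forall>i<r. 0 \<le> t i * (del * q) - ((\<Sum>l<m. signed (mu i) l * irhs (Up l) q x) + K i * (\<Sum>j<n. iobj j q x * y j))"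
    "F = Natural \<longrightarrow> (\<forall>i<r. \<forall>l<m. 0 \<le> signed (mu i) l)"
proof -
  have nn: "\<forall>h\<in>rows F m n. 0 \<le> mu i h" if "i < r" for i using fc that by (simp add: farkas_cert_def)
  have row: "(\<Sum>l<m. A l j * signed (mu i) l) - slackness (mu i) j + K i * iobj j q x = S i j * del" if "i < r" "j < n" for i j
  proof -
    have "(\<Sum>l\<in>rows F m n. row_A A l j * mu i l) + K i * iobj j q x = S i j * del"
      using fc that unfolding farkas_cert_def by blast
    then show ?thesis unfolding sum_signed[OF that(2)] .
  qed
  have le: "(\<Sum>l<m. signed (mu i) l * irhs (Up l) q x) + K i * (\<Sum>j<n. iobj j q x * y j) \<le> t i * (del * q)" if "i < r" for i
    using fc that unfolding farkas_cert_def sum_signed_rhs by blast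
  show "pess_eqs F m n r A S t q y (\<lambda>i. irhs (Up i) q x) (\<lambda>j. iobj j q x) del (\<lambda>i. signed (mu i)) K (\<lambda>i. slackness (mu i))
      (\<lambda>i. t i * (del * q) - ((\<Sum>l<m. signed (mu i) l * irhs (Up l) q x) + K i * (\<Sum>j<n. iobj j q x * y j)))"
    unfolding pess_eqs_def
  proof (intro conjI allI impI)
    fix i j assume ij: "i < r" "j < n"
    show "- (\<Sum>l<m. A l j * signed (mu i) l) + (slackness (mu i) j + S i j * del + - (K i * iobj j q x)) = 0"
      using row[OF ij] by simp
  next
    fix i j assume "F = Natural" "i < r" "j < n"
    then show "slackness (mu i) j = 0" unfolding slackness_def by simp
  qed (auto simp: sum_distrib_left)
  show "1 \<le> del" "\<forall>i<r. 0 \<le> K i" using fc by (auto simp: farkas_cert_def)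
  show "\<forall>i<r. \<forall>j<n. 0 \<le> slackness (mu i) j" using nn unfolding ball_rows slackness_def by (cases F) auto
  show "\<forall>i<r. 0 \<le> t i * (del * q) - ((\<Sum>l<m. signed (mu i) l * irhs (Up l) q x) + K i * (\<Sum>j<n. iobj j q x * y j))"
    using le by simp
  show "F = Natural \<longrightarrow> (\<forall>i<r. \<forall>l<m. 0 \<le> signed (mu i) l)" using nn unfolding ball_rows signed_def by simp
qed

lemma target_cert_eqs:
  assumes "target_cert q y"
  shows "opt_eqs n r S t q y (\<lambda>i. t i * q - (\<Sum>j<n. S i j * y j))" "\<forall>i<r. 0 \<le> t i * q - (\<Sum>j<n. S i j * y j)"
  using assms by (auto simp: opt_eqs_def target_cert_def)

end

section \<open>Instances flattened to one sequence of rationals\<close>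

section \<open>Instances as sequences of entries\<close>

text \<open>The nine components are cut out of one sequence in the order of \<open>encode\<close>,
  row by row. The offsets are those used by the verifier, so index arithmetic is shared between both
  sides.\<close>

definition inst :: "nat \<Rightarrow> nat \<Rightarrow> nat \<Rightarrow> nat \<Rightarrow> nat \<Rightarrow> (nat \<Rightarrow> rat) \<Rightarrow> ilfp" where
  "inst m n k g r E = (let oC = m * (n + k + 1); oD = oC + n * (k + 1); oS = oC + (n + g) * (k + 1) in
    \<lparr> lhs_A = mat m n (\<lambda>(i, j). E (i * n + j)),
      rhs_B = mat m k (\<lambda>(i, l). E (m * n + (i * k + l))),
      rhs_b = vec m (\<lambda>i. E (m * (n + k) + i)),
      obj_C = mat n k (\<lambda>(i, l). E (oC + (i * k + l))),
      obj_c = vec n (\<lambda>i. E (oC + (n * k + i))),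
      par_D = mat g k (\<lambda>(i, l). E (oD + (i * k + l))),
      par_d = vec g (\<lambda>i. E (oD + (g * k + i))),
      tgt_S = mat r n (\<lambda>(i, j). E (oS + (i * n + j))),
      tgt_t = vec r (\<lambda>i. E (oS + (r * n + i))) \<rparr>)"

lemma mult_add_less: "i < a \<Longrightarrow> j < b \<Longrightarrow> i * b + j < a * (b :: nat)"
proof -
  assume "i < a" "j < b"
  then have "i * b + j < Suc i * b" by simp
  also have "\<dots> \<le> a * b" using \<open>i < a\<close> by (intro mult_le_mono1) simp
  finally show ?thesis .
qed

lemma entry_bounds:
  "i < m \<Longrightarrow> j < n \<Longrightarrow> i * n + j < entries m n k g r"
  "i < m \<Longrightarrow> l < k \<Longrightarrow> m * n + (i * k + l) < entries m n k g r"
  "i < m \<Longrightarrow> m * (n + k) + i < entries m n k g r"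
  "j < n \<Longrightarrow> l < k \<Longrightarrow> m * (n + k + 1) + (j * k + l) < entries m n k g r"
  "j < n \<Longrightarrow> m * (n + k + 1) + (n * k + j) < entries m n k g r"
  "h < g \<Longrightarrow> l < k \<Longrightarrow> m * (n + k + 1) + n * (k + 1) + (h * k + l) < entries m n k g r"
  "h < g \<Longrightarrow> m * (n + k + 1) + n * (k + 1) + (g * k + h) < entries m n k g r"
  "h < r \<Longrightarrow> j < n \<Longrightarrow> m * (n + k + 1) + (n + g) * (k + 1) + (h * n + j) < entries m n k g r"
  "h < r \<Longrightarrow> m * (n + k + 1) + (n + g) * (k + 1) + (r * n + h) < entries m n k g r"
proof -
  assume "i < m" "j < n"
  from mult_add_less[OF this] show "i * n + j < entries m n k g r" by (simp add: entries_def algebra_simps)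
next
  assume "i < m" "l < k"
  from mult_add_less[OF this] show "m * n + (i * k + l) < entries m n k g r" by (simp add: entries_def algebra_simps)
next
  assume "j < n" "l < k"
  from mult_add_less[OF this] show "m * (n + k + 1) + (j * k + l) < entries m n k g r" by (simp add: entries_def algebra_simps)
next
  assume "h < g" "l < k"
  from mult_add_less[OF this] show "m * (n + k + 1) + n * (k + 1) + (h * k + l) < entries m n k g r" by (simp add: entries_def algebra_simps)
next
  assume "h < r" "j < n"
  from mult_add_less[OF this] show "m * (n + k + 1) + (n + g) * (k + 1) + (h * n + j) < entries m n k g r" by (simp add: entries_def algebra_simps)
qed (simp_all add: entries_def algebra_simps)

lemma dims_inst [simp]:
  "dim_m (inst m n k g r E) = m" "dim_n (inst m n k g r E) = n" "dim_k (inst m n k g r E) = k"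
  "dim_g (inst m n k g r E) = g" "dim_r (inst m n k g r E) = r"
  by (simp_all add: inst_def Let_def)

lemma inst_sel:
  "lhs_A (inst m n k g r E) = mat m n (\<lambda>(i, j). E (i * n + j))"
  "rhs_B (inst m n k g r E) = mat m k (\<lambda>(i, l). E (m * n + (i * k + l)))"
  "rhs_b (inst m n k g r E) = vec m (\<lambda>i. E (m * (n + k) + i))"
  "obj_C (inst m n k g r E) = mat n k (\<lambda>(i, l). E (m * (n + k + 1) + (i * k + l)))"
  "obj_c (inst m n k g r E) = vec n (\<lambda>i. E (m * (n + k + 1) + (n * k + i)))"
  "par_D (inst m n k g r E) = mat g k (\<lambda>(i, l). E (m * (n + k + 1) + n * (k + 1) + (i * k + l)))"
  "par_d (inst m n k g r E) = vec g (\<lambda>i. E (m * (n + k + 1) + n * (k + 1) + (g * k + i)))"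
  "tgt_S (inst m n k g r E) = mat r n (\<lambda>(i, j). E (m * (n + k + 1) + (n + g) * (k + 1) + (i * n + j)))"
  "tgt_t (inst m n k g r E) = vec r (\<lambda>i. E (m * (n + k + 1) + (n + g) * (k + 1) + (r * n + i)))"
  unfolding inst_def Let_def by (simp_all only: ilfp.simps)

lemma wf_inst: "wf_ilfp (inst m n k g r E)"
  unfolding wf_ilfp_def dims_inst unfolding inst_sel by simp

lemma enc_vec_seq: "enc_vec (vec a (\<lambda>i. E (z + i))) = concat (map (enc_rat \<circ> E) [z..<z + a])"
proof -
  have "map (\<lambda>i. enc_rat (vec a (\<lambda>i. E (z + i)) $ i)) [0..<a] = map (enc_rat \<circ> E) (map (\<lambda>i. i + z) [0..<a])"
    by (simp add: add.commute)
  then show ?thesis unfolding enc_vec_def map_add_upt by (simp add: add.commute)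
qed

lemma enc_mat_seq: "enc_mat (mat a b (\<lambda>(i, j). E (z + (i * b + j)))) = concat (map (enc_rat \<circ> E) [z..<z + a * b])"
proof -
  have row: "enc_vec (row (mat a b (\<lambda>(i, j). E (z + (i * b + j)))) i) = concat (map (enc_rat \<circ> E) [z + i * b..<z + i * b + b])"
    if "i < a" for i
  proof -
    have "row (mat a b (\<lambda>(i, j). E (z + (i * b + j)))) i = vec b (\<lambda>j. E (z + i * b + j))"
      using that by (intro eq_vecI) (auto simp: add.assoc)
    then show ?thesis by (simp add: enc_vec_seq)
  qed
  have "concat (map (\<lambda>i. concat (map f [z + i * b..<z + i * b + b])) [0..<a']) = concat (map f [z..<z + a' * b])"
    for f :: "nat \<Rightarrow> bool list" and a'
  proof (induction a')
    case (Suc a')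
    have "[z..<z + Suc a' * b] = [z..<z + a' * b] @ [z + a' * b..<z + a' * b + b]"
      using upt_add_eq_append[of z "z + a' * b" b] by (simp add: ac_simps)
    then show ?case using Suc by simp
  qed simp
  moreover have "map (\<lambda>i. enc_vec (row (mat a b (\<lambda>(i, j). E (z + (i * b + j)))) i)) [0..<a] =
      map (\<lambda>i. concat (map (enc_rat \<circ> E) [z + i * b..<z + i * b + b])) [0..<a]"
    by (rule map_cong[OF refl]) (rule row, simp)
  ultimately show ?thesis by (simp only: enc_mat_def dim_row_mat)
qed

lemma encode_inst:
  "encode (inst m n k g r E) = enc_dim m @ enc_dim n @ enc_dim k @ enc_dim g @ enc_dim r @
     concat (map (enc_rat \<circ> E) [0..<entries m n k g r])"
proof -
  define f where "f = enc_rat \<circ> E"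
  have app: "concat (map f [x..<y]) @ concat (map f [y..<z]) @ ys = concat (map f [x..<z]) @ ys"
    if "x \<le> y" "y \<le> z" for x y z ys
  proof -
    have "[x..<z] = [x..<y] @ [y..<z]" using upt_add_eq_append[of x y "z - y"] that by simp
    then show ?thesis by simp
  qed
  define oC where "oC = m * (n + k + 1)"
  define oD where "oD = oC + n * (k + 1)"
  define oS where "oS = oC + (n + g) * (k + 1)"
  have A: "enc_mat (mat m n (\<lambda>(i, j). E (i * n + j))) = concat (map f [0..<m * n])"
    using enc_mat_seq[of m n E 0] by (simp add: f_def)
  have B: "enc_mat (mat m k (\<lambda>(i, l). E (m * n + (i * k + l)))) = concat (map f [m * n..<m * (n + k)])"
    using enc_mat_seq[of m k E "m * n"] by (simp add: f_def distrib_left)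
  have b: "enc_vec (vec m (\<lambda>i. E (m * (n + k) + i))) = concat (map f [m * (n + k)..<oC])"
    using enc_vec_seq[of m E "m * (n + k)"] by (simp add: f_def oC_def distrib_left add.commute)
  have C: "enc_mat (mat n k (\<lambda>(i, l). E (oC + (i * k + l)))) = concat (map f [oC..<oC + n * k])"
    by (simp add: enc_mat_seq f_def)
  have c: "enc_vec (vec n (\<lambda>i. E (oC + (n * k + i)))) = concat (map f [oC + n * k..<oD])"
    using enc_vec_seq[of n E "oC + n * k"] by (simp add: f_def oD_def add.assoc add.commute[of n])
  have D: "enc_mat (mat g k (\<lambda>(i, l). E (oD + (i * k + l)))) = concat (map f [oD..<oD + g * k])"
    by (simp add: enc_mat_seq f_def)
  have oS: "oS = oD + g * k + g" by (simp add: oS_def oD_def oC_def algebra_simps)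
  have d: "enc_vec (vec g (\<lambda>i. E (oD + (g * k + i)))) = concat (map f [oD + g * k..<oS])"
    using enc_vec_seq[of g E "oD + g * k"] by (simp add: f_def oS add.assoc)
  have S: "enc_mat (mat r n (\<lambda>(i, j). E (oS + (i * n + j)))) = concat (map f [oS..<oS + r * n])"
    by (simp add: enc_mat_seq f_def)
  have t: "enc_vec (vec r (\<lambda>i. E (oS + (r * n + i)))) = concat (map f [oS + r * n..<entries m n k g r])"
    using enc_vec_seq[of r E "oS + r * n"] by (simp add: f_def oS_def oC_def entries_def add.assoc add.commute[of r])
  have le: "m * n \<le> m * (n + k)" "m * (n + k) \<le> oC" "oC \<le> oC + n * k" "oC + n * k \<le> oD" "oD \<le> oD + g * k"
    "oD + g * k \<le> oS" "oS \<le> oS + r * n" "oS + r * n \<le> entries m n k g r"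
    by (simp_all add: oC_def oD_def oS) (simp add: entries_def oD_def oC_def algebra_simps)
  have "concat (map f [0..<m * n]) @ concat (map f [m * n..<m * (n + k)]) @ concat (map f [m * (n + k)..<oC]) @
    concat (map f [oC..<oC + n * k]) @ concat (map f [oC + n * k..<oD]) @ concat (map f [oD..<oD + g * k]) @
    concat (map f [oD + g * k..<oS]) @ concat (map f [oS..<oS + r * n]) @ concat (map f [oS + r * n..<entries m n k g r]) @ [] =
    concat (map f [0..<entries m n k g r]) @ []"
    by (simp only: app[OF le0 le(1)] app[OF le0 le(2)] app[OF le0 le(3)] app[OF le0 le(4)] app[OF le0 le(5)]
      app[OF le0 le(6)] app[OF le0 le(7)] app[OF le0 le(8)])
  then show ?thesis
    unfolding encode_def dims_inst unfolding inst_sel oC_def[symmetric] unfolding oD_def[symmetric] oS_def[symmetric]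
    unfolding A B b C c D d S t f_def[symmetric] 
    by (simp only: append_Nil2)
qed

definition glue :: "nat \<Rightarrow> (nat \<Rightarrow> 'a) \<Rightarrow> (nat \<Rightarrow> 'a) \<Rightarrow> nat \<Rightarrow> 'a" where
  "glue a f h x = (if x < a then f x else h (x - a))"

lemma glue_simps: "x < a \<Longrightarrow> glue a f h x = f x" "glue a f h (a + x) = h x"
  by (simp_all add: glue_def)

text \<open>The sequence is glued from the nine components in their order; a matrix of width
  \<open>b\<close> is read back through quotient and remainder by \<open>b\<close>.\<close>

lemma wf_imp_inst:
  assumes "wf_ilfp I"
  shows "\<exists>E. I = inst (dim_m I) (dim_n I) (dim_k I) (dim_g I) (dim_r I) E"
proof -
  define m n k g r where dims: "m = dim_m I" "n = dim_n I" "k = dim_k I" "g = dim_g I" "r = dim_r I"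
  define fm :: "rat mat \<Rightarrow> nat \<Rightarrow> nat \<Rightarrow> rat" where "fm = (\<lambda>P b x. P $$ (x div b, x mod b))"
  have fm: "fm P b (i * b + j) = P $$ (i, j)" if "j < b" for P b i j using that by (simp add: fm_def)
  define E where "E = glue (m * n) (fm (lhs_A I) n) (glue (m * k) (fm (rhs_B I) k) (glue m (($) (rhs_b I))
    (glue (n * k) (fm (obj_C I) k) (glue n (($) (obj_c I)) (glue (g * k) (fm (par_D I) k) (glue g (($) (par_d I))
    (glue (r * n) (fm (tgt_S I) n) (($) (tgt_t I)))))))))"
  have w: "lhs_A I \<in> carrier_mat m n" "rhs_B I \<in> carrier_mat m k" "rhs_b I \<in> carrier_vec m" "obj_C I \<in> carrier_mat n k"
     "obj_c I \<in> carrier_vec n" "par_D I \<in> carrier_mat g k" "par_d I \<in> carrier_vec g" "tgt_S I \<in> carrier_mat r n" "tgt_t I \<in> carrier_vec r"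
    using assms by (auto simp: wf_ilfp_def dims)
  have o: "m * (n + k) + x = m * n + (m * k + x)" "m * (n + k + 1) + x = m * n + (m * k + (m + x))"
    "m * (n + k + 1) + n * (k + 1) + x = m * n + (m * k + (m + (n * k + (n + x))))"
    "m * (n + k + 1) + (n + g) * (k + 1) + x = m * n + (m * k + (m + (n * k + (n + (g * k + (g + x))))))" for x
    by (simp_all add: algebra_simps)
  have matI: "P = mat a b (\<lambda>(i, j). h (i * b + j))"
    if "P \<in> carrier_mat a b" "\<And>i j. i < a \<Longrightarrow> j < b \<Longrightarrow> h (i * b + j) = P $$ (i, j)" for P :: "rat mat" and a b h
    using that by (intro eq_matI) auto
  have vecI: "p = vec a h" if "p \<in> carrier_vec a" "\<And>i. i < a \<Longrightarrow> h i = p $ i" for p :: "rat vec" and a h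
    using that by (intro eq_vecI) auto
  note sm = E_def glue_simps mult_add_less fm
  have "lhs_A I = mat m n (\<lambda>(i, j). E (i * n + j))"
    by (rule matI[OF w(1), of E]) (simp only: sm)
  moreover have "rhs_B I = mat m k (\<lambda>(i, l). E (m * n + (i * k + l)))"
    by (rule matI[OF w(2), of "\<lambda>x. E (m * n + x)"]) (simp only: sm)
  moreover have "obj_C I = mat n k (\<lambda>(i, l). E (m * (n + k + 1) + (i * k + l)))"
    by (rule matI[OF w(4), of "\<lambda>x. E (m * (n + k + 1) + x)"]) (simp only: o(2) sm)
  moreover have "par_D I = mat g k (\<lambda>(i, l). E (m * (n + k + 1) + n * (k + 1) + (i * k + l)))"
    by (rule matI[OF w(6), of "\<lambda>x. E (m * (n + k + 1) + n * (k + 1) + x)"]) (unfold o(3), simp only: sm)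
  moreover have "tgt_S I = mat r n (\<lambda>(i, j). E (m * (n + k + 1) + (n + g) * (k + 1) + (i * n + j)))"
    by (rule matI[OF w(8), of "\<lambda>x. E (m * (n + k + 1) + (n + g) * (k + 1) + x)"]) (unfold o(4), simp only: sm)
  moreover have "rhs_b I = vec m (\<lambda>i. E (m * (n + k) + i))"
    by (rule vecI[OF w(3)]) (simp only: o(1) sm)
  moreover have "obj_c I = vec n (\<lambda>i. E (m * (n + k + 1) + (n * k + i)))"
    by (rule vecI[OF w(5)]) (simp only: o(2) sm)
  moreover have "par_d I = vec g (\<lambda>i. E (m * (n + k + 1) + n * (k + 1) + (g * k + i)))"
    by (rule vecI[OF w(7)]) (unfold o(3), simp only: sm)
  moreover have "tgt_t I = vec r (\<lambda>i. E (m * (n + k + 1) + (n + g) * (k + 1) + (r * n + i)))"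
    by (rule vecI[OF w(9)]) (unfold o(4), simp only: sm)
  ultimately have "I = inst m n k g r E" by (cases I) (simp only: inst_def Let_def ilfp.simps)
  then show ?thesis unfolding dims by blast
qed

section \<open>Clearing denominators, and the passage from vectors to functions\<close>

section \<open>Optimal solutions of an instance\<close>

text \<open>All data are multiplied by one positive \<open>\<Delta>\<close>, while \<open>x\<close>
  and \<open>y\<close> are not rescaled: every constraint and the objective merely get the factor
  \<open>\<Delta>\<close>, so the sets of solutions agree exactly.\<close>

locale lp_inst =
  fixes F :: lp_form and m n k g r :: nat and E :: "nat \<Rightarrow> rat" and Ei :: "nat \<Rightarrow> int" and \<Delta> :: int
  assumes \<Delta>: "0 < \<Delta>"
    and E: "\<And>i. i < entries m n k g r \<Longrightarrow> real_of_rat (E i) = real_of_int (Ei i) / real_of_int \<Delta>"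
begin

sublocale lp_data F m n k g r "\<lambda>i j. Ei (i * n + j)" "\<lambda>i l. Ei (m * n + (i * k + l))" "\<lambda>i. Ei (m * (n + k) + i)"
  "\<lambda>i l. Ei (m * (n + k + 1) + (i * k + l))" "\<lambda>i. Ei (m * (n + k + 1) + (n * k + i))"
  "\<lambda>i l. Ei (m * (n + k + 1) + n * (k + 1) + (i * k + l))" "\<lambda>i. Ei (m * (n + k + 1) + n * (k + 1) + (g * k + i))"
  "\<lambda>i j. Ei (m * (n + k + 1) + (n + g) * (k + 1) + (i * n + j))" "\<lambda>i. Ei (m * (n + k + 1) + (n + g) * (k + 1) + (r * n + i))" .

abbreviation "I \<equiv> inst m n k g r E"

lemma sum_E:
  assumes "\<And>l. l < b \<Longrightarrow> f l < entries m n k g r"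
  shows "(\<Sum>l<b. real_of_rat (E (f l)) * v l) = (\<Sum>l<b. real_of_int (Ei (f l)) * v l) / real_of_int \<Delta>"
  unfolding sum_divide_distrib using E assms by (intro sum.cong) auto

lemma mult_mat_vec_sum:
  "v \<in> carrier_vec b \<Longrightarrow> i < a \<Longrightarrow> (real_mat (mat a b f) *\<^sub>v v) $ i = (\<Sum>l<b. real_of_rat (f (i, l)) * v $ l)"
  by (simp add: scalar_prod_def atLeast0LessThan)

lemma le_scaled: "x / real_of_int \<Delta> \<le> y / real_of_int \<Delta> \<longleftrightarrow> x \<le> y" "x / real_of_int \<Delta> = y / real_of_int \<Delta> \<longleftrightarrow> x = y"
  using \<Delta> by (simp_all add: divide_le_cancel)

lemma row_le:
  assumes "\<And>l. l < b \<Longrightarrow> f l < entries m n k g r" "e < entries m n k g r"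
  shows "(\<Sum>l<b. real_of_rat (E (f l)) * v l) \<le> real_of_rat (E e) \<longleftrightarrow> (\<Sum>l<b. real_of_int (Ei (f l)) * v l) \<le> real_of_int (Ei e)"
proof -
  have "(\<Sum>l<b. real_of_rat (E (f l)) * v l) = (\<Sum>l<b. real_of_int (Ei (f l)) * v l) / real_of_int \<Delta>"
    by (rule sum_E) (rule assms(1))
  then show ?thesis by (simp only: E[OF assms(2)] le_scaled)
qed

lemma in_param_set: "x \<in> param_set I \<longleftrightarrow> x \<in> carrier_vec k \<and> inX (($) x)"
proof -
  have "x \<in> param_set I \<longleftrightarrow> x \<in> carrier_vec k \<and> (\<forall>i<g.
      (\<Sum>l<k. real_of_rat (E (m * (n + k + 1) + n * (k + 1) + (i * k + l))) * x $ l)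
        \<le> real_of_rat (E (m * (n + k + 1) + n * (k + 1) + (g * k + i))))"
    by (auto simp: param_set_def polyhedron_def inst_def Let_def less_eq_vec_def mult_mat_vec_sum simp del: index_mult_mat_vec)
  also have "\<dots> \<longleftrightarrow> x \<in> carrier_vec k \<and> inX (($) x)"
    unfolding inX_def by (rule conj_cong[OF refl], rule all_cong, rule row_le, (rule entry_bounds, assumption+)+)
  finally show ?thesis .
qed

lemma in_target_set: "y \<in> target_set I \<longleftrightarrow> y \<in> carrier_vec n \<and> inY (($) y)"
proof -
  have "y \<in> target_set I \<longleftrightarrow> y \<in> carrier_vec n \<and> (\<forall>i<r.
      (\<Sum>j<n. real_of_rat (E (m * (n + k + 1) + (n + g) * (k + 1) + (i * n + j))) * y $ j)
        \<le> real_of_rat (E (m * (n + k + 1) + (n + g) * (k + 1) + (r * n + i))))"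
    by (auto simp: target_set_def polyhedron_def inst_def Let_def less_eq_vec_def mult_mat_vec_sum simp del: index_mult_mat_vec)
  also have "\<dots> \<longleftrightarrow> y \<in> carrier_vec n \<and> inY (($) y)"
    unfolding inY_def by (rule conj_cong[OF refl], rule all_cong, rule row_le, (rule entry_bounds, assumption+)+)
  finally show ?thesis .
qed

lemma lp_rhs_inst:
  assumes "x \<in> carrier_vec k" "i < m"
  shows "lp_rhs I x $ i = rhs (Up i) (($) x) / real_of_int \<Delta>"
proof -
  have "lp_rhs I x $ i = (\<Sum>l<k. real_of_rat (E (m * n + (i * k + l))) * x $ l) + real_of_rat (E (m * (n + k) + i))"
    using assms by (simp add: lp_rhs_def inst_def Let_def scalar_prod_def atLeast0LessThan)
  also have "(\<Sum>l<k. real_of_rat (E (m * n + (i * k + l))) * x $ l) = (\<Sum>l<k. real_of_int (Ei (m * n + (i * k + l))) * x $ l) / real_of_int \<Delta>"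
    by (rule sum_E) (rule entry_bounds(2)[OF assms(2)])
  finally show ?thesis
    unfolding rhs_def row_B.simps row_b.simps E[OF entry_bounds(3)[OF assms(2)]] add_divide_distrib .
qed

lemma lp_obj_inst:
  assumes "x \<in> carrier_vec k" "j < n"
  shows "lp_obj I x $ j = obj j (($) x) / real_of_int \<Delta>"
proof -
  have "lp_obj I x $ j = (\<Sum>l<k. real_of_rat (E (m * (n + k + 1) + (j * k + l))) * x $ l) + real_of_rat (E (m * (n + k + 1) + (n * k + j)))"
    using assms by (simp add: lp_obj_def inst_def Let_def scalar_prod_def atLeast0LessThan)
  also have "(\<Sum>l<k. real_of_rat (E (m * (n + k + 1) + (j * k + l))) * x $ l) = (\<Sum>l<k. real_of_int (Ei (m * (n + k + 1) + (j * k + l))) * x $ l) / real_of_int \<Delta>"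
    by (rule sum_E) (rule entry_bounds(4)[OF assms(2)])
  finally show ?thesis
    unfolding obj_def E[OF entry_bounds(5)[OF assms(2)]] add_divide_distrib .
qed

lemma feas_rows:
  "feas x y \<longleftrightarrow> (\<forall>i<m. (\<Sum>j<n. real_of_int (Ei (i * n + j)) * y j) \<le> rhs (Up i) x) \<and>
    (F = Standard \<longrightarrow> (\<forall>i<m. (\<Sum>j<n. real_of_int (Ei (i * n + j)) * y j) = rhs (Up i) x) \<and> (\<forall>j<n. 0 \<le> y j))"
proof -
  have "rhs (Lo i) x = - rhs (Up i) x" "rhs (Nn i) x = 0" for i by (simp_all add: rhs_def sum_negf)
  moreover have "(\<Sum>l<n. real_of_int (if l = j then -1 else 0) * y l) = - y j" if "j < n" for j
    using that by (simp add: if_distrib[of "\<lambda>x. real_of_int x * _"] cong: if_cong)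
  ultimately show ?thesis unfolding feas_def ball_rows by (auto simp: sum_negf intro: antisym)
qed

lemma in_lp_feasible:
  assumes x: "x \<in> carrier_vec k"
  shows "y \<in> lp_feasible F I x \<longleftrightarrow> y \<in> carrier_vec n \<and> feas (($) x) (($) y)"
proof -
  have row: "(real_mat (lhs_A I) *\<^sub>v y) $ i = (\<Sum>j<n. real_of_int (Ei (i * n + j)) * y $ j) / real_of_int \<Delta>"
    if "y \<in> carrier_vec n" "i < m" for i
  proof -
    have "(real_mat (lhs_A I) *\<^sub>v y) $ i = (\<Sum>j<n. real_of_rat (E (i * n + j)) * y $ j)"
      using that mult_mat_vec_sum[OF that, of "\<lambda>(i, j). E (i * n + j)"] by (simp add: inst_def Let_def del: index_mult_mat_vec)
    also have "\<dots> = (\<Sum>j<n. real_of_int (Ei (i * n + j)) * y $ j) / real_of_int \<Delta>"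
      by (rule sum_E) (rule entry_bounds(1)[OF that(2)])
    finally show ?thesis .
  qed
  have dim: "dim_vec (real_mat (lhs_A I) *\<^sub>v y) = m" "dim_vec (lp_rhs I x) = m"
    by (simp_all add: lp_rhs_def inst_def Let_def)
  have le: "real_mat (lhs_A I) *\<^sub>v y \<le> lp_rhs I x \<longleftrightarrow> (\<forall>i<m. (\<Sum>j<n. real_of_int (Ei (i * n + j)) * y $ j) \<le> rhs (Up i) (($) x))"
    if "y \<in> carrier_vec n"
    unfolding less_eq_vec_def dim using row[OF that] lp_rhs_inst[OF x] by (auto simp: le_scaled simp del: index_mult_mat_vec)
  have eq: "real_mat (lhs_A I) *\<^sub>v y = lp_rhs I x \<longleftrightarrow> (\<forall>i<m. (\<Sum>j<n. real_of_int (Ei (i * n + j)) * y $ j) = rhs (Up i) (($) x))"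
    if "y \<in> carrier_vec n"
    unfolding vec_eq_iff dim using row[OF that] lp_rhs_inst[OF x] \<Delta> by (auto simp: le_scaled simp del: index_mult_mat_vec)
  show ?thesis
  proof (cases F)
    case Natural
    then show ?thesis using le feas_rows[of "($) x" "($) y"] by auto
  next
    case Standard
    have "0\<^sub>v n \<le> y \<longleftrightarrow> (\<forall>j<n. 0 \<le> y $ j)" if "y \<in> carrier_vec n" using that by (auto simp: less_eq_vec_def)
    then show ?thesis using Standard eq feas_rows[of "($) x" "($) y"] by auto
  qed
qed

lemma in_Opt:
  assumes x: "x \<in> carrier_vec k"
  shows "y \<in> Opt F I x \<longleftrightarrow> y \<in> carrier_vec n \<and> isopt (($) x) (($) y)"
proof -
  have val: "lp_obj I x \<bullet> z = (\<Sum>j<n. obj j (($) x) * z $ j) / real_of_int \<Delta>" if "z \<in> carrier_vec n" for z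
    using that lp_obj_inst[OF x] unfolding scalar_prod_def sum_divide_distrib
    by (auto simp: atLeast0LessThan intro!: sum.cong)
  \<comment> \<open>\<open>isopt\<close> quantifies over functions on all naturals,
    \<open>Opt\<close> over vectors; truncation to the first \<open>n\<close> values changes neither
    feasibility nor the objective.\<close>
  have vec: "feas (($) x) z \<longleftrightarrow> feas (($) x) (($) (vec n z))" "(\<Sum>j<n. obj j (($) x) * z j) = (\<Sum>j<n. obj j (($) x) * vec n z $ j)" for z
  proof -
    show "feas (($) x) z \<longleftrightarrow> feas (($) x) (($) (vec n z))"
      unfolding feas_def by (intro ball_cong refl arg_cong2[where f = "(\<le>)"] sum.cong) auto
  qed simp
  show ?thesis
  proof
    assume y: "y \<in> Opt F I x"
    then have yc: "y \<in> carrier_vec n" "feas (($) x) (($) y)" using in_lp_feasible[OF x] by (auto simp: Opt_def)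
    have "(\<Sum>j<n. obj j (($) x) * y $ j) \<le> (\<Sum>j<n. obj j (($) x) * z j)" if "feas (($) x) z" for z
    proof -
      have "vec n z \<in> lp_feasible F I x" using that vec(1)[of z] in_lp_feasible[OF x] by simp
      then have "lp_obj I x \<bullet> y \<le> lp_obj I x \<bullet> vec n z" using y by (simp add: Opt_def)
      then show ?thesis unfolding vec(2)[of z] using val[OF yc(1)] val[of "vec n z"] by (simp add: le_scaled del: index_vec)
    qed
    then show "y \<in> carrier_vec n \<and> isopt (($) x) (($) y)" unfolding isopt_def using yc by blast
  next
    assume y: "y \<in> carrier_vec n \<and> isopt (($) x) (($) y)"
    then have yc: "y \<in> lp_feasible F I x" using in_lp_feasible[OF x] unfolding isopt_def by blast
    have "lp_obj I x \<bullet> y \<le> lp_obj I x \<bullet> z" if "z \<in> lp_feasible F I x" for z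
    proof -
      have z: "z \<in> carrier_vec n" "feas (($) x) (($) z)" using that in_lp_feasible[OF x] by blast+
      then show ?thesis using y unfolding val[OF z(1)] val[OF conjunct1[OF y]] le_scaled isopt_def by blast
    qed
    then show "y \<in> Opt F I x" unfolding Opt_def using yc by blast
  qed
qed

lemma cong_vec:
  "inX (($) (vec k x)) \<longleftrightarrow> inX x" "inY (($) (vec n y)) \<longleftrightarrow> inY y" "isopt (($) (vec k x)) z \<longleftrightarrow> isopt x z"
  "isopt x (($) (vec n y)) \<longleftrightarrow> isopt x y"
proof -
  show "inX (($) (vec k x)) \<longleftrightarrow> inX x" unfolding inX_def by simp
  show "inY (($) (vec n y)) \<longleftrightarrow> inY y" unfolding inY_def by simp
  have "rhs i (($) (vec k x)) = rhs i x" "obj j (($) (vec k x)) = obj j x" for i j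
    unfolding rhs_def obj_def by simp_all
  then show "isopt (($) (vec k x)) z \<longleftrightarrow> isopt x z" unfolding isopt_def feas_def by (simp only:)
  have "feas x (($) (vec n y)) \<longleftrightarrow> feas x y" unfolding feas_def by simp
  then show "isopt x (($) (vec n y)) \<longleftrightarrow> isopt x y" unfolding isopt_def by simp
qed

lemma optimistic_iff: "optimistic F I \<longleftrightarrow> (\<exists>x y. inX x \<and> isopt x y \<and> inY y)"
proof
  assume "optimistic F I"
  then obtain x y where "x \<in> param_set I" "y \<in> Opt F I x" "y \<in> target_set I" by (auto simp: optimistic_def)
  then show "\<exists>x y. inX x \<and> isopt x y \<and> inY y" using in_param_set in_Opt in_target_set by blast
next
  assume "\<exists>x y. inX x \<and> isopt x y \<and> inY y"
  then obtain x y where "inX x" "isopt x y" "inY y" by blast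
  then have "vec k x \<in> param_set I" "vec n y \<in> Opt F I (vec k x)" "vec n y \<in> target_set I"
    unfolding in_param_set in_target_set in_Opt[OF vec_carrier] cong_vec by (simp_all only: vec_carrier simp_thms)
  then show "optimistic F I" by (auto simp: optimistic_def)
qed

lemma pessimistic_iff:
  "pessimistic F I \<longleftrightarrow> (\<exists>x. inX x \<and> (\<exists>y. isopt x y) \<and> (\<forall>y. isopt x y \<longrightarrow> inY y))"
proof
  assume "pessimistic F I"
  then obtain x y where x: "x \<in> param_set I" "y \<in> Opt F I x" "Opt F I x \<subseteq> target_set I" by (auto simp: pessimistic_def)
  then have xc: "x \<in> carrier_vec k" using in_param_set by blast
  have "inY z" if "isopt (($) x) z" for z
  proof -
    have "vec n z \<in> Opt F I x" using that unfolding in_Opt[OF xc] cong_vec by (simp only: vec_carrier simp_thms)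
    then show ?thesis using x(3) in_target_set cong_vec(2) by blast
  qed
  then show "\<exists>x. inX x \<and> (\<exists>y. isopt x y) \<and> (\<forall>y. isopt x y \<longrightarrow> inY y)"
    using x xc in_param_set in_Opt by blast
next
  assume "\<exists>x. inX x \<and> (\<exists>y. isopt x y) \<and> (\<forall>y. isopt x y \<longrightarrow> inY y)"
  then obtain x y where x: "inX x" "isopt x y" "\<And>y. isopt x y \<Longrightarrow> inY y" by blast
  have "vec n y \<in> Opt F I (vec k x)" using x(2) unfolding in_Opt[OF vec_carrier] cong_vec by (simp only: vec_carrier simp_thms)
  moreover have "Opt F I (vec k x) \<subseteq> target_set I"
  proof
    fix z assume "z \<in> Opt F I (vec k x)"
    then have "z \<in> carrier_vec n" "isopt x (($) z)" unfolding in_Opt[OF vec_carrier] cong_vec by blast+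
    then show "z \<in> target_set I" using x(3) unfolding in_target_set by blast
  qed
  moreover have "vec k x \<in> param_set I" using x(1) unfolding in_param_set cong_vec by (simp only: vec_carrier simp_thms)
  ultimately show "pessimistic F I" by (auto simp: pessimistic_def)
qed

end

section \<open>Polynomial running time and the verdict on every word\<close>

section \<open>Running the verifier on a word\<close>

lemma dim_rest_iter: "\<exists>P. (dim_rest ^^ i) u = drop P u"
proof (induction i)
  case 0
  show ?case by (rule exI[of _ 0]) simp
next
  case (Suc i)
  then show ?case by (auto simp: dim_drop)
qed

lemma item_rest_drop: "\<exists>P. item_rest (drop q u) = drop P u"
proof -
  have "item_rest (drop q u) = nat_rest (nat_rest (drop (q + 1) u))" by (simp add: item_rest_def add.commute)
  then show ?thesis unfolding drop_rest by blast
qed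

lemma item_rest_iter: "\<exists>P. (item_rest ^^ i) (items_at u) = drop P u"
proof (induction i)
  case 0
  show ?case using dim_rest_iter[of 5 u] by (simp add: items_at_def)
next
  case (Suc i)
  then obtain P where "(item_rest ^^ i) (items_at u) = drop P u" by blast
  then show ?case using item_rest_drop[of P u] by simp
qed

lemma dim_at_le: "dim_at u i \<le> length u"
proof -
  obtain P where "(dim_rest ^^ i) u = drop P u" using dim_rest_iter by blast
  then show ?thesis using dimv_length[of "drop P u"] by (simp add: dim_at_def)
qed

definition tot_size :: "nat \<Rightarrow> nat \<Rightarrow> nat \<Rightarrow> nat \<Rightarrow> nat \<Rightarrow> nat" where
  "tot_size m n k g r = entries m n k g r + r * m + m + n + k + g + r + 3"

definition tot_at :: "int list \<Rightarrow> nat" where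
  "tot_at u = entries_at u + 1 + 20 * tot_size (dim_at u 0) (dim_at u 1) (dim_at u 2) (dim_at u 3) (dim_at u 4)"

lemma val_tot_expr: "loaded u 0 \<sigma> \<Longrightarrow> val tot_expr \<sigma> = int (tot_at u)"
  by (simp add: tot_expr_def loaded_def tot_at_def tot_size_def entries_at_def)

lemma entries_at_le: "entries_at u \<le> 5 * (length u + 1) ^ 2"
proof -
  note d = dim_at_le[of u]
  let ?N = "length u"
  have "entries_at u \<le> ?N * (?N + ?N + 1) + (?N + ?N) * (?N + 1) + ?N * (?N + 1)"
    unfolding entries_at_def entries_def by (intro add_mono mult_le_mono order.refl d)
  also have "\<dots> \<le> 5 * (?N + 1) ^ 2" by (simp add: power2_eq_square algebra_simps)
  finally show ?thesis .
qed

lemma tot_at_le: "tot_at u \<le> 300 * (length u + 1) ^ 2"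
proof -
  note d = dim_at_le[of u]
  let ?N = "length u"
  have "tot_at u \<le> 5 * (?N + 1) ^ 2 + 1 + 20 * (5 * (?N + 1) ^ 2 + ?N * ?N + ?N + ?N + ?N + ?N + ?N + 3)"
    unfolding tot_at_def tot_size_def entries_at_def[symmetric] by (intro add_mono mult_le_mono order.refl d entries_at_le)
  also have "\<dots> \<le> 300 * (?N + 1) ^ 2" by (simp add: power2_eq_square algebra_simps)
  finally show ?thesis .
qed

text \<open>With \<open>a = N + 1\<close> the left side is at most \<open>1263 * a ^ 3\<close>. The
  exponent is explained by \<open>a \<le> 2 ^ N\<close> and \<open>2 ^ 11 = 2048\<close>.\<close>

lemma cell_bound: "13 * int N + 50 + int (300 * (N + 1) ^ 2) * (4 * int N + 4) \<le> 2 ^ (3 * N + 11)"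
proof -
  define a where "a = int N + 1"
  have "int (N + 1) \<le> int (2 ^ N)" unfolding of_nat_le_iff Suc_eq_plus1[symmetric] by (rule Suc_leI[OF less_exp])
  then have a: "1 \<le> a" "a \<le> 2 ^ N" by (auto simp: a_def)
  have "a * 1 \<le> a * (a * a)" using a mult_mono[of 1 a 1 a] by (intro mult_left_mono) auto
  then have a3: "a \<le> a ^ 3" by (simp add: power3_eq_cube mult.assoc)
  have "a ^ 3 \<le> (2 ^ N) ^ 3" using a by (intro power_mono) auto
  also have "(2 ^ N) ^ 3 = (2 :: int) ^ (3 * N)" by (simp add: power_mult[symmetric] mult.commute)
  finally have p: "a ^ 3 \<le> 2 ^ (3 * N)" .
  have "int (300 * (N + 1) ^ 2) * (4 * int N + 4) = 1200 * a ^ 3"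
    by (simp add: a_def power2_eq_square power3_eq_cube algebra_simps)
  moreover have "13 * int N + 50 \<le> 63 * a" by (simp add: a_def)
  moreover have "(2 :: int) ^ (3 * N + 11) = 2048 * 2 ^ (3 * N)" by (simp add: power_add)
  ultimately show ?thesis using a3 p a(1) by linarith
qed

text \<open>The bound of \<open>verifier_correct\<close> at \<open>K = 300 * (N + 1) ^ 2\<close>,
  which dominates the number of items and all loop ranges, and
  \<open>s = 3 * N + 11\<close>.\<close>

definition run_time :: "nat poly" where
  "run_time = (let X = [:0, 1:]; K = 300 * (X + 1) ^ 2 in
     ((K + 20) * (20000 * (X + 20)) + (101 * ((K + 2) ^ 3 * 30000000) + 540)) * (400 * (3 * X + 11)))"

lemma poly_run_time: "poly run_time N = (let K = 300 * (N + 1) ^ 2 in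
     ((K + 20) * (20000 * (N + 20)) + (101 * ((K + 2) ^ 3 * 30000000) + 540)) * (400 * (3 * N + 11)))"
  unfolding run_time_def Let_def by (simp only: poly_add poly_mult poly_power poly_numeral poly_1 poly_pCons poly_0 mult_1_right add_0_left mult_zero_right add_0_right)

lemma block_ranges:
  "(e, f, ts) \<in> set (blocks pess F) \<Longrightarrow> insert e (insert f (fst ` set ts)) \<subseteq> {Cn 1, eT, eM, eN, eK, eG, eR}"
  by (cases F; cases pess) (auto simp: blocks_def input_blocks_def lp_blocks_def opt_blocks_def pess_blocks_def)

text \<open>Stated for every word over 0, 1, 2, since the definition of \<open>NP\<close> demands
  halting in polynomial time on all pairs. The equations then speak about whatever was
  parsed.\<close>

lemma verifier_spec:
  fixes pess :: bool and F :: lp_form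
  assumes u: "digit_word u"
  defines "V \<equiv> verifier tot_expr (blocks pess F)"
  shows "\<exists>H. (\<forall>i<tot_at u. \<forall>c<5. H c i = cellv c ((item_rest ^^ i) (items_at u))) \<and>
      (accepts V u \<longleftrightarrow> equations pess F (dim_at u 0) (dim_at u 1) (dim_at u 2) (dim_at u 3) (dim_at u 4) (entries_at u) H) \<and>
      halts_within V u (poly run_time (length u))"
proof -
  define N where "N = length u"
  define K where "K = 300 * (N + 1) ^ 2"
  define s where "s = 3 * N + 11"
  have TK: "entries_at u \<le> K" "tot_at u \<le> K" using entries_at_le[of u] tot_at_le[of u] by (auto simp: K_def N_def)
  have "N * 1 \<le> (N + 1) * (N + 1)" by (intro mult_le_mono) auto
  then have NK: "N \<le> K" "1 \<le> K" by (auto simp: K_def power2_eq_square)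
  have rg: "ranges_le K \<sigma> b" if \<sigma>: "loaded u 0 \<sigma>" and b: "b \<in> set (blocks pess F)" for \<sigma> b
  proof -
    obtain e f ts where bb: "b = (e, f, ts)" by (cases b)
    have le: "val e' \<sigma> \<le> int K" if "e' \<in> {Cn 1, eT, eM, eN, eK, eG, eR}" for e'
    proof -
      have "dim_at u i \<le> K" for i using dim_at_le[of u i] NK by (simp add: N_def)
      then show ?thesis using that \<sigma> TK NK by (auto simp: loaded_def)
    qed
    have "insert e (insert f (fst ` set ts)) \<subseteq> {Cn 1, eT, eM, eN, eK, eG, eR}" using b unfolding bb by (rule block_ranges)
    then have "val e \<sigma> \<le> int K" "val f \<sigma> \<le> int K" "\<forall>t\<in>set ts. val (fst t) \<sigma> \<le> int K" using le by blast+
    then show ?thesis by (simp add: ranges_le_def bb)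
  qed
  have tot: "index_expr dims tot_expr" "esize tot_expr \<le> 60" by (simp_all add: tot_expr_def idxs_simps)
  have s: "length u + 11 \<le> s" "13 * int (length u) + 50 + int K * (4 * int (length u) + 4) \<le> 2 ^ s"
    using cell_bound[of N] by (simp_all add: s_def N_def K_def)
  obtain \<sigma> where \<sigma>: "loaded u (tot_at u) \<sigma>" "accepts V u \<longleftrightarrow> (\<forall>b\<in>set (blocks pess F). sat \<sigma> b)"
    and time: "halts_within V u (((K + 20) * (20000 * (length u + 20)) + (101 * ((K + 2) ^ 3 * 30000000) + 540)) * (400 * s))"
    using verifier_correct[OF u tot ok_blocks[of _ pess F] length_blocks[of pess F] val_tot_expr[of u] TK(2,1) rg s]
    unfolding V_def by blast
  have "sat \<sigma> b \<longleftrightarrow> nsat (cells \<sigma>) (nenv (dim_at u 0) (dim_at u 1) (dim_at u 2) (dim_at u 3) (dim_at u 4) (entries_at u)) b"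
    if "b \<in> set (blocks pess F)" for b
    using that \<sigma>(1) by (intro sat_iff_nsat ok_blocks) (auto simp: loaded_def idxs_simps)
  then have "accepts V u \<longleftrightarrow> equations pess F (dim_at u 0) (dim_at u 1) (dim_at u 2) (dim_at u 3) (dim_at u 4) (entries_at u) (cells \<sigma>)"
    unfolding \<sigma>(2) nsat_blocks[symmetric] by blast
  moreover have "cells \<sigma> c i = cellv c ((item_rest ^^ i) (items_at u))" if "i < tot_at u" "c < 5" for c i
    using that \<sigma>(1) by (simp add: loaded_def cells_def)
  moreover have "halts_within V u (poly run_time (length u))"
    using time unfolding poly_run_time Let_def by (simp only: K_def s_def N_def)
  ultimately show ?thesis by blast
qed

lemma digit_word_pair: "digit_word (pair_word x w)"
  by (auto simp: digit_word_def pair_word_def of_bool_def)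

text \<open>A number written in digits cannot be negative. This is how the certificate expresses
  nonnegative unknowns without further equations.\<close>

lemma cellv_nonneg:
  assumes u: "digit_word u" and c: "c = 1 \<or> c = 3"
  shows "0 \<le> cellv c ((item_rest ^^ i) (items_at u))"
proof -
  obtain P where P: "(item_rest ^^ i) (items_at u) = drop P u" using item_rest_iter by blast
  have d: "0 \<le> dval (digs (drop q u))" for q
    using dval_bounds[of "digs (drop q u)"] digs_digit[OF digit_word_drop[OF u]] by blast
  have "nat_rest (drop 1 (drop P u)) = drop (P + 1 + (2 * length (digs (drop (P + 1) u)) + 1)) u"
    using drop_rest[of "P + 1" u] by (simp add: add.commute)
  then show ?thesis unfolding P using c d[of "1 + P"] d by (auto simp: cellv_def simp del: One_nat_def)
qed

lemma at_index_less:
  assumes "a < 20" "i < L"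
  shows "T + (1 + a) + 20 * i < T + 1 + 20 * (L :: nat)"
  using assms by linarith

section \<open>Accepted words encode yes-instances\<close>

section \<open>Soundness\<close>

text \<open>The symbol 2 occurs exactly once in a paired word, so meeting it reveals the
  position.\<close>

lemma separator_position:
  assumes "hd0 (drop P (pair_word x w)) = 2"
  shows "drop P (pair_word x w) = 2 # bits w"
proof -
  let ?l = "bits x @ 2 # bits w"
  have l: "pair_word x w = ?l" by (simp add: pair_word_def)
  have "P < length ?l" using assms unfolding l by (cases "P < length ?l") (auto simp: hd0_def)
  then have d: "drop P ?l = ?l ! P # drop (Suc P) ?l" by (rule Cons_nth_drop_Suc[symmetric])
  have "?l ! P = 2" using assms unfolding l arg_cong[OF d, of hd0] by (simp only: hd0_simps)
  moreover have "?l ! P \<noteq> 2" if "P < length x" using that by (cases "x ! P") (simp_all add: nth_append)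
  moreover have "?l ! P \<noteq> 2" if "length x < P"
  proof -
    define j where "j = P - Suc (length x)"
    then have j: "P = length x + Suc j" using that by simp
    then have "j < length w" using \<open>P < length ?l\<close> by simp
    then show ?thesis by (cases "w ! j") (simp_all add: nth_append j)
  qed
  ultimately have "P = length x" by (meson linorder_neqE_nat)
  then show ?thesis unfolding l by simp
qed

lemma quotient_of_reduced: "0 < b \<Longrightarrow> coprime a b \<Longrightarrow> quotient_of (Rat.Fract a b) = (a, b)"
  by (simp add: quotient_of_Fract normalize_stable)

text \<open>The condition on \<open>s\<close> excludes a negative sign on the numerator 0, which
  \<open>enc_rat\<close> never produces.\<close>

lemma enc_rat_reduced:
  assumes "0 < q" "coprime p q" "s \<Longrightarrow> 0 < p"
  shows "enc_rat (Rat.Fract (if s then - int p else int p) (int q)) = s # enc_nat p @ enc_nat q"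
proof -
  have "coprime (if s then - int p else int p) (int q)" using assms(2) by (auto simp: coprime_int_iff)
  then show ?thesis using assms by (simp add: enc_rat_def quotient_of_reduced enc_int_def)
qed

lemma length_iter_mono:
  fixes f :: "int list \<Rightarrow> int list"
  assumes "\<And>ys. length (f ys) \<le> length ys"
  shows "length ((f ^^ n) xs) \<le> length xs"
proof (induction n)
  case (Suc n)
  then show ?case using assms[of "(f ^^ n) xs"] by simp
qed simp

text \<open>If item \<open>T\<close> starts with the separator, the dimensions and the
  \<open>T\<close> items before it consume exactly \<open>x\<close>, so none of them reaches into
  the certificate.\<close>

lemma parse_sound:
  assumes u: "u = pair_word x w" and sep: "cellv 0 ((item_rest ^^ T) (items_at u)) = 2"
  shows "\<exists>its. length its = T \<and>
    x = enc_dim (dim_at u 0) @ enc_dim (dim_at u 1) @ enc_dim (dim_at u 2) @ enc_dim (dim_at u 3) @ enc_dim (dim_at u 4) @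
      concat (map (\<lambda>(s, as, bs). s # nat_bits as @ nat_bits bs) its) \<and>
    (\<forall>i<T. \<forall>c. cellv c ((item_rest ^^ i) (items_at u)) = item_cell c (case its ! i of (s, as, bs) \<Rightarrow> (of_bool s, as, bs)))"
proof -
  let ?ys = "2 # bits w"
  obtain P where P: "(item_rest ^^ T) (items_at u) = drop P u" using item_rest_iter by blast
  then have ys: "(item_rest ^^ T) (items_at u) = ?ys"
    using sep separator_position[of P x w] by (simp add: cellv_def u)
  have len: "length ?ys \<le> length ((dim_rest ^^ 5) u)"
    using length_iter_mono[of item_rest T "items_at u", OF item_rest_length] unfolding ys unfolding items_at_def .
  have uu: "u = bits x @ ?ys" by (simp add: u pair_word_def)
  obtain x' where x': "x = concat (map (\<lambda>i. enc_dim (dimv ((dim_rest ^^ i) u))) [0..<5]) @ x'" "items_at u = bits x' @ ?ys"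
    using dims_sound[OF uu len] unfolding items_at_def by auto
  have "length ?ys \<le> length ((item_rest ^^ T) (items_at u))" unfolding ys ..
  then obtain its x'' where its: "length its = T" "x' = concat (map (\<lambda>(s, as, bs). s # nat_bits as @ nat_bits bs) its) @ x''"
    "(item_rest ^^ T) (items_at u) = bits x'' @ ?ys"
    "\<forall>i<T. \<forall>c. cellv c ((item_rest ^^ i) (items_at u)) = item_cell c (case its ! i of (s, as, bs) \<Rightarrow> (of_bool s, as, bs))"
    using items_sound[OF x'(2)] by blast
  have "x'' = []" using its(3) unfolding ys by simp
  moreover have "[0..<5] = [0, 1, 2, 3, 4]" by (simp add: upt_rec)
  ultimately have "x = enc_dim (dim_at u 0) @ enc_dim (dim_at u 1) @ enc_dim (dim_at u 2) @ enc_dim (dim_at u 3) @ enc_dim (dim_at u 4) @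
      concat (map (\<lambda>(s, as, bs). s # nat_bits as @ nat_bits bs) its)"
    using x'(1) its(2) by (simp add: dim_at_def)
  then show ?thesis using its(1,4) by blast
qed

context lp_inst begin

lemma equations_sound:
  assumes eqs: "equations pess F m n k g r (entries m n k g r) H"
    and nn: "\<And>a i. a < 20 \<Longrightarrow> i < tot_size m n k g r \<Longrightarrow> 0 \<le> pos_at H (entries m n k g r) a i"
    and Ei: "Ei = num_at H (entries m n k g r) 1"
  shows "if pess then pessimistic F I else optimistic F I"
proof -
  let ?T = "entries m n k g r"
  define q where "q = 1 + pos_at H ?T 0 1"
  define del where "del = 1 + pos_at H ?T 0 2"
  note e = eqs[unfolded equations_def Let_def, folded Ei, folded q_def del_def]
  have lp: "lp_eqs F m n k g (\<lambda>i j. Ei (i * n + j)) (\<lambda>i l. Ei (m * n + (i * k + l))) (\<lambda>i. Ei (m * (n + k) + i))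
     (\<lambda>i l. Ei (m * (n + k + 1) + (i * k + l))) (\<lambda>i. Ei (m * (n + k + 1) + (n * k + i)))
     (\<lambda>i l. Ei (m * (n + k + 1) + n * (k + 1) + (i * k + l))) (\<lambda>i. Ei (m * (n + k + 1) + n * (k + 1) + (g * k + i)))
     q (num_at H ?T 5) (num_at H ?T 6) (num_at H ?T 7) (num_at H ?T 8) (num_at H ?T 9) (pos_at H ?T 10) (pos_at H ?T 11) (pos_at H ?T 12)"
    and form: "case F of Natural \<Rightarrow> (\<forall>i<m. neg_at H ?T 7 i = 0) | Standard \<Rightarrow> (\<forall>j<n. neg_at H ?T 6 j = 0)"
    using e by blast+
  have num: "num_at H ?T a i = pos_at H ?T a i - neg_at H ?T a i" for a i by (simp add: num_at_def pos_at_def neg_at_def)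
  have L: "i < tot_size m n k g r" if "i < m \<or> i < n \<or> i < g \<or> i < r \<or> i < 3" for i using that by (auto simp: tot_size_def)
  have pn: "0 \<le> pos_at H ?T a i" if "a < 20" "i < m \<or> i < n \<or> i < g \<or> i < r \<or> i < 3" for a i using nn[OF that(1) L[OF that(2)]] .
  have q1: "1 \<le> q" "1 \<le> del" using pn[of 0 1] pn[of 0 2] by (auto simp: q_def del_def)
  have "case F of Natural \<Rightarrow> \<forall>i<m. 0 \<le> num_at H ?T 7 i | Standard \<Rightarrow> \<forall>j<n. 0 \<le> num_at H ?T 6 j"
    using form pn unfolding num by (cases F) auto
  then have pd: "primal_dual q (num_at H ?T 5) (num_at H ?T 6) (row_mult F (num_at H ?T 7) (pos_at H ?T 11))"
    by (intro eqs_primal_dual[OF lp q1(1)] pn) auto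
  show ?thesis
  proof (cases pess)
    case True
    let ?S = "\<lambda>i j. Ei (m * (n + k + 1) + (n + g) * (k + 1) + (i * n + j))"
    have p: "pess_eqs F m n r (\<lambda>i j. Ei (i * n + j)) ?S (\<lambda>i. Ei (m * (n + k + 1) + (n + g) * (k + 1) + (r * n + i))) q
        (num_at H ?T 6) (num_at H ?T 8) (num_at H ?T 9) del (\<lambda>i l. num_at H ?T 14 (i * m + l)) (pos_at H ?T 15)
        (\<lambda>i j. pos_at H ?T 16 (i * n + j)) (pos_at H ?T 13)"
      and nat: "F = Natural \<longrightarrow> (\<forall>i<r. \<forall>l<m. neg_at H ?T 14 (i * m + l) = 0)"
      using e[THEN conjunct2, THEN conjunct2, THEN conjunct2, unfolded if_P[OF True]] by blast+
    have mu: "i * m + l < tot_size m n k g r" if "i < r" "l < m" for i l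
      using mult_add_less[OF that] by (simp add: tot_size_def)
    have rho: "i * n + j < tot_size m n k g r" if "i < r" "j < n" for i j
      using mult_add_less[OF that] by (simp add: tot_size_def entries_def)
    have "farkas_cert q (num_at H ?T 5) (num_at H ?T 6) del
        (\<lambda>i. row_mult F (\<lambda>l. num_at H ?T 14 (i * m + l)) (\<lambda>j. pos_at H ?T 16 (i * n + j))) (pos_at H ?T 15)"
    proof (rule eqs_farkas_cert[OF lp p q1(2)])
      fix i assume "i < r"
      then show "0 \<le> pos_at H ?T 15 i" "0 \<le> pos_at H ?T 13 i" by (auto intro: pn)
    next
      fix i j assume "i < r" "j < n"
      then show "0 \<le> pos_at H ?T 16 (i * n + j)" by (intro nn rho) auto
    next
      assume "F = Natural"
      then show "\<forall>i<r. \<forall>l<m. 0 \<le> num_at H ?T 14 (i * m + l)" using nat nn mu unfolding num by simp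
    qed
    then show ?thesis using farkas_cert_sound[OF pd] pessimistic_iff True by simp
  next
    case False
    let ?S = "\<lambda>i j. Ei (m * (n + k + 1) + (n + g) * (k + 1) + (i * n + j))"
    have "opt_eqs n r ?S (\<lambda>i. Ei (m * (n + k + 1) + (n + g) * (k + 1) + (r * n + i))) q (num_at H ?T 6) (pos_at H ?T 13)"
      using e[THEN conjunct2, THEN conjunct2, THEN conjunct2, unfolded if_not_P[OF False]] .
    then have "target_cert q (num_at H ?T 6)" by (rule opt_eqs_target_cert) (auto intro: pn)
    then show ?thesis using target_cert_sound[OF pd] optimistic_iff False by simp
  qed
qed

end

text \<open>The word must be shown to be the encoding itself, not merely to parse like one.
  Canonical digits, coprimality and the absence of \<open>-0\<close> identify each item with
  \<open>enc_rat (E i)\<close>.\<close>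

lemma verifier_sound:
  assumes u: "u = pair_word x w"
    and H: "\<forall>i<tot_at u. \<forall>c<5. H c i = cellv c ((item_rest ^^ i) (items_at u))"
    and eqs: "equations pess F (dim_at u 0) (dim_at u 1) (dim_at u 2) (dim_at u 3) (dim_at u 4) (entries_at u) H"
  shows "x \<in> (if pess then pessimistic_ILFP F else optimistic_ILFP F)"
proof -
  define T where "T = entries_at u"
  let ?m = "dim_at u 0" and ?n = "dim_at u 1" and ?k = "dim_at u 2" and ?g = "dim_at u 3" and ?r = "dim_at u 4"
  have T: "T = entries ?m ?n ?k ?g ?r" by (simp add: T_def entries_at_def)
  have TL: "T < tot_at u" "\<And>a i. a < 20 \<Longrightarrow> i < tot_size ?m ?n ?k ?g ?r \<Longrightarrow> T + (1 + a) + 20 * i < tot_at u"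
    using at_index_less[of _ _ _ T] by (auto simp: tot_at_def T_def)
  have io: "input_ok T H" using eqs by (simp add: equations_def Let_def T_def)
  have dw: "digit_word u" unfolding u by (rule digit_word_pair)
  have nn: "0 \<le> H c i" if "c = 1 \<or> c = 3" "i < tot_at u" for c i
    using cellv_nonneg[OF dw that(1)] H that by auto
  have pn: "0 \<le> pos_at H T a i" if "a < 20" "i < tot_size ?m ?n ?k ?g ?r" for a i
    unfolding pos_at_def using TL(2)[OF that] by (intro nn) auto
  have "H 0 T = 2" using io by (simp add: input_ok_def)
  then have "cellv 0 ((item_rest ^^ T) (items_at u)) = 2" using H TL(1) by auto
  then obtain its where its: "length its = T"
    "x = enc_dim ?m @ enc_dim ?n @ enc_dim ?k @ enc_dim ?g @ enc_dim ?r @ concat (map (\<lambda>(s, as, bs). s # nat_bits as @ nat_bits bs) its)"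
    "\<And>i c. i < T \<Longrightarrow> cellv c ((item_rest ^^ i) (items_at u)) = item_cell c (case its ! i of (s, as, bs) \<Rightarrow> (of_bool s, as, bs))"
    using parse_sound[OF u] by blast
  define sg as bs where sg: "sg i = fst (its ! i)" and as: "as i = fst (snd (its ! i))" and bs: "bs i = snd (snd (its ! i))" for i
  define p q where p: "p i = bval (as i)" and q: "q i = bval (bs i)" for i
  define z where "z i = (if sg i then - int (p i) else int (p i))" for i
  define E where "E i = Rat.Fract (z i) (int (q i))" for i
  define \<Delta> where "\<Delta> = 1 + pos_at H T 0 0"
  have \<Delta>: "0 < \<Delta>" using pn[of 0 0] by (simp add: \<Delta>_def tot_size_def)
  have entry: "enc_rat (E i) = (\<lambda>(s, as, bs). s # nat_bits as @ nat_bits bs) (its ! i) \<and> num_at H T 1 i * int (q i) = z i * \<Delta> \<and> 0 < q i"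
    if i: "i < T" for i
  proof -
    have itsi: "its ! i = (sg i, as i, bs i)" by (simp add: sg as bs)
    have "H c i = item_cell c (of_bool (sg i), as i, bs i)" if "c < 5" for c
      using H its(3)[OF i, of c] i TL(1) that by (simp add: itsi)
    from this[of 0] this[of 1] this[of 2] this[of 3] this[of 4]
    have h: "H 0 i = of_bool (sg i)" "H 1 i = int (p i)" "H 2 i = dlast (bits (as i))" "H 3 i = int (q i)" "H 4 i = dlast (bits (bs i))"
      by (simp_all add: item_cell_def p q numeral_eq_Suc)
    have oi: "H 2 i = 1 \<and> H 4 i = 1 \<and> H 1 i * num_at H T 2 i + H 3 i * num_at H T 3 i = 1 \<and>
        H 0 i * (H 1 i - 1 - pos_at H T 4 i) = 0 \<and> num_at H T 1 i * H 3 i = (1 - 2 * H 0 i) * (H 1 i * \<Delta>)"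
      using io i unfolding input_ok_def \<Delta>_def by blast
    have o: "dlast (bits (as i)) = 1" "dlast (bits (bs i)) = 1" "int (p i) * num_at H T 2 i + int (q i) * num_at H T 3 i = 1"
      "of_bool (sg i) * (int (p i) - 1 - pos_at H T 4 i) = 0"
      "num_at H T 1 i * int (q i) = (1 - 2 * of_bool (sg i)) * (int (p i) * \<Delta>)"
      using oi unfolding h by blast+
    have b: "bin (p i) = as i" "bin (q i) = bs i" unfolding p q using o(1,2) by (auto intro: bin_bval)
    have zz: "num_at H T 1 i * int (q i) = z i * \<Delta>" using o(5) by (simp add: z_def)
    \<comment> \<open>A common divisor divides the Bezout combination, which is 1.\<close>
    have "coprime (int (p i)) (int (q i))"
    proof (rule coprimeI)
      fix c assume "c dvd int (p i)" "c dvd int (q i)"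
      then have "c dvd int (p i) * num_at H T 2 i + int (q i) * num_at H T 3 i" by simp
      then show "is_unit c" unfolding o(3) .
    qed
    then have cop: "coprime (p i) (q i)" by simp
    \<comment> \<open>Positivity of the denominator has no equation of its own. If it were 0, the
      scaling equation would make the numerator 0, and the Bezout combination would be 0 as
      well.\<close>
    have q0: "0 < q i"
    proof (rule ccontr)
      assume "\<not> 0 < q i"
      then have "q i = 0" by simp
      then have "p i = 0" using zz \<Delta> by (simp add: z_def split: if_splits)
      then show False using o(3) \<open>q i = 0\<close> by simp
    qed
    have "i < tot_size ?m ?n ?k ?g ?r" using i by (simp add: tot_size_def T)
    \<comment> \<open>For a negative entry, \<open>p i - 1\<close> equals a first number of the
      certificate and is therefore nonnegative.\<close>
    then have "0 < p i" if "sg i" using o(4) pn[of 4 i] that by simp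
    then have "enc_rat (E i) = sg i # enc_nat (p i) @ enc_nat (q i)"
      unfolding E_def z_def using q0 cop by (intro enc_rat_reduced)
    then show ?thesis using zz q0 by (simp add: itsi enc_nat_bits b)
  qed
  have "lp_inst ?m ?n ?k ?g ?r E (num_at H T 1) \<Delta>"
  proof
    fix i assume "i < entries ?m ?n ?k ?g ?r"
    then have i: "num_at H T 1 i * int (q i) = z i * \<Delta>" "0 < q i" using entry T by auto
    then have "real_of_int (num_at H T 1 i * int (q i)) = real_of_int (z i * \<Delta>)" by (simp only:)
    then have "real_of_int (z i) / real (q i) = real_of_int (num_at H T 1 i) / real_of_int \<Delta>"
      using i(2) \<Delta> by (simp add: field_simps)
    then show "real_of_rat (E i) = real_of_int (num_at H T 1 i) / real_of_int \<Delta>"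
      using i(2) by (simp add: E_def of_rat_rat)
  qed (rule \<Delta>)
  then interpret lp_inst F ?m ?n ?k ?g ?r E "num_at H T 1" \<Delta> .
  have "if pess then pessimistic F I else optimistic F I"
    using eqs pn by (intro equations_sound) (auto simp: T entries_at_def)
  moreover have "map (enc_rat \<circ> E) [0..<T] = map (\<lambda>(s, as, bs). s # nat_bits as @ nat_bits bs) its"
    using entry its(1) by (intro nth_equalityI) auto
  then have "x = encode I" unfolding encode_inst T[symmetric] its(2) by simp
  ultimately show ?thesis using wf_inst by (auto simp: pessimistic_ILFP_def optimistic_ILFP_def split: if_splits)
qed

section \<open>Bit lengths of the certificate entries\<close>

section \<open>Completeness\<close>

definition fits :: "nat \<Rightarrow> int \<Rightarrow> bool" where "fits e z \<longleftrightarrow> \<bar>z\<bar> \<le> 2 ^ e"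

lemma fits_mono: "fits e z \<Longrightarrow> e \<le> e' \<Longrightarrow> fits e' z"
  unfolding fits_def using power_increasing[of e e' "2 :: int"] by linarith

lemma fits_mult: "fits i x \<Longrightarrow> fits j y \<Longrightarrow> fits (i + j) (x * y)"
  unfolding fits_def abs_mult power_add by (intro mult_mono) auto

lemma fits_add: "fits i x \<Longrightarrow> fits i y \<Longrightarrow> fits (Suc i) (x + y)"
  unfolding fits_def by simp

lemma fits_diff: "fits i x \<Longrightarrow> fits i y \<Longrightarrow> fits (Suc i) (x - y)"
  unfolding fits_def by simp

lemma fits_sum:
  fixes a :: nat
  assumes "\<And>l. l < a \<Longrightarrow> fits i (f l)" "a \<le> 2 ^ j"
  shows "fits (i + j) (\<Sum>l<a. f l)"
proof -
  have "\<bar>\<Sum>l<a. f l\<bar> \<le> (\<Sum>l<a. \<bar>f l\<bar>)" by (rule sum_abs)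
  also have "\<dots> \<le> (\<Sum>l<a. 2 ^ i)" using assms(1) by (intro sum_mono) (simp add: fits_def)
  also have "\<dots> = int a * 2 ^ i" by simp
  also have "\<dots> \<le> 2 ^ j * 2 ^ i"
  proof (intro mult_right_mono)
    have "int a \<le> int (2 ^ j)" using assms(2) by (simp only: of_nat_le_iff)
    then show "int a \<le> 2 ^ j" by simp
  qed simp
  finally show ?thesis by (simp add: fits_def power_add mult.commute)
qed

text \<open>Arrays read back from the certificate agree with the intended functions only on their
  index ranges.\<close>

lemma lp_eqs_cong:
  assumes "lp_eqs F m n k g A B b C c D d q x y lam h w s nu sg"
    "\<And>i j. i < m \<Longrightarrow> j < n \<Longrightarrow> A' i j = A i j" "\<And>i l. i < m \<Longrightarrow> l < k \<Longrightarrow> B' i l = B i l" "\<And>i. i < m \<Longrightarrow> b' i = b i"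
    "\<And>i l. i < n \<Longrightarrow> l < k \<Longrightarrow> C' i l = C i l" "\<And>i. i < n \<Longrightarrow> c' i = c i"
    "\<And>i l. i < g \<Longrightarrow> l < k \<Longrightarrow> D' i l = D i l" "\<And>i. i < g \<Longrightarrow> d' i = d i"
    "\<And>l. l < k \<Longrightarrow> x' l = x l" "\<And>j. j < n \<Longrightarrow> y' j = y j" "\<And>i. i < m \<Longrightarrow> lam' i = lam i"
    "\<And>i. i < m \<Longrightarrow> h' i = h i" "\<And>j. j < n \<Longrightarrow> w' j = w j" "\<And>i. i < m \<Longrightarrow> s' i = s i"
    "\<And>j. j < n \<Longrightarrow> nu' j = nu j" "\<And>i. i < g \<Longrightarrow> sg' i = sg i"
  shows "lp_eqs F m n k g A' B' b' C' c' D' d' q x' y' lam' h' w' s' nu' sg'"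
proof -
  have "lp_eqs F m n k g A' B' b' C' c' D' d' q x' y' lam' h' w' s' nu' sg' = lp_eqs F m n k g A B b C c D d q x y lam h w s nu sg"
    by (cases F) (simp_all add: lp_eqs_def assms(2-))
  then show ?thesis using assms(1) by simp
qed

lemma opt_eqs_cong:
  assumes "opt_eqs n r S t q y th"
    "\<And>i j. i < r \<Longrightarrow> j < n \<Longrightarrow> S' i j = S i j" "\<And>i. i < r \<Longrightarrow> t' i = t i"
    "\<And>j. j < n \<Longrightarrow> y' j = y j" "\<And>i. i < r \<Longrightarrow> th' i = th i"
  shows "opt_eqs n r S' t' q y' th'"
  using assms(1) by (simp add: opt_eqs_def assms(2-))

lemma pess_eqs_cong:
  assumes "pess_eqs F m n r A S t q y h w del mu K rho th"
    "\<And>i j. i < m \<Longrightarrow> j < n \<Longrightarrow> A' i j = A i j" "\<And>i j. i < r \<Longrightarrow> j < n \<Longrightarrow> S' i j = S i j" "\<And>i. i < r \<Longrightarrow> t' i = t i"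
    "\<And>j. j < n \<Longrightarrow> y' j = y j" "\<And>i. i < m \<Longrightarrow> h' i = h i" "\<And>j. j < n \<Longrightarrow> w' j = w j"
    "\<And>i l. i < r \<Longrightarrow> l < m \<Longrightarrow> mu' i l = mu i l" "\<And>i. i < r \<Longrightarrow> K' i = K i" "\<And>i j. i < r \<Longrightarrow> j < n \<Longrightarrow> rho' i j = rho i j"
    "\<And>i. i < r \<Longrightarrow> th' i = th i"
  shows "pess_eqs F m n r A' S' t' q y' h' w' del mu' K' rho' th'"
  using assms(1) by (simp add: pess_eqs_def assms(2-))

definition array_sizes :: "nat \<Rightarrow> nat \<Rightarrow> nat \<Rightarrow> nat \<Rightarrow> nat \<Rightarrow> nat list" where
  "array_sizes m n k g r = (let T = entries m n k g r in
     [3, T, T, T, T, k, n, m, m, n, m, n, g, r, r * m, r, r * n])"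

lemma array_sizes_le: "a < 17 \<Longrightarrow> array_sizes m n k g r ! a \<le> tot_size m n k g r"
proof -
  assume "a < 17"
  then have "array_sizes m n k g r ! a \<in> set (array_sizes m n k g r)" by (intro nth_mem) (simp add: array_sizes_def Let_def)
  then show ?thesis by (auto simp: array_sizes_def Let_def tot_size_def entries_def)
qed

context lp_inst begin

definition target_slack :: "bool \<Rightarrow> int \<Rightarrow> (nat \<Rightarrow> int) \<Rightarrow> (nat \<Rightarrow> int) \<Rightarrow> int \<Rightarrow> (nat \<Rightarrow> lp_row \<Rightarrow> int) \<Rightarrow> (nat \<Rightarrow> int) \<Rightarrow> nat \<Rightarrow> int" where
  "target_slack pess q x y del mu K i =
    (if pess then Ei (m * (n + k + 1) + (n + g) * (k + 1) + (r * n + i)) * (del * q) -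
        ((\<Sum>l<m. signed (mu i) l * irhs (Up l) q x) + K i * (\<Sum>j<n. iobj j q x * y j))
     else Ei (m * (n + k + 1) + (n + g) * (k + 1) + (r * n + i)) * q -
        (\<Sum>j<n. Ei (m * (n + k + 1) + (n + g) * (k + 1) + (i * n + j)) * y j))"

definition arrays :: "bool \<Rightarrow> int \<Rightarrow> (nat \<Rightarrow> int) \<Rightarrow> (nat \<Rightarrow> int) \<Rightarrow> (lp_row \<Rightarrow> int) \<Rightarrow> int \<Rightarrow> (nat \<Rightarrow> lp_row \<Rightarrow> int) \<Rightarrow> (nat \<Rightarrow> int) \<Rightarrow>
    (nat \<Rightarrow> int) \<Rightarrow> (nat \<Rightarrow> int) \<Rightarrow> (nat \<Rightarrow> int) \<Rightarrow> (nat \<Rightarrow> int) list" where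
  "arrays pess q x y p del mu K uu vv zz =
    [\<lambda>i. if i = 0 then \<Delta> - 1 else if i = 1 then q - 1 else del - 1, Ei, uu, vv, zz, x, y, signed p,
     \<lambda>i. irhs (Up i) q x, \<lambda>j. iobj j q x, \<lambda>i. irhs (Up i) q x - (\<Sum>j<n. Ei (i * n + j) * y j), slackness p,
     \<lambda>i. Ei (m * (n + k + 1) + n * (k + 1) + (g * k + i)) * q - (\<Sum>l<k. Ei (m * (n + k + 1) + n * (k + 1) + (i * k + l)) * x l),
     target_slack pess q x y del mu K, \<lambda>i. signed (mu (i div m)) (i mod m), K, \<lambda>i. slackness (mu (i div n)) (i mod n)]"

text \<open>Every value is stored as positive and negative part. The difference recovers the value,
  and a nonnegative value equals its first number while the second one is 0, which is what the sign
  equations test.\<close>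

lemma equations_complete:
  assumes pd: "primal_dual q x y p"
    and cert: "if pess then farkas_cert q x y del mu K else target_cert q y"
    and del: "1 \<le> del"
    and inp: "input_ok (entries m n k g r) H"
    and H: "\<And>a i. a < 17 \<Longrightarrow> i < array_sizes m n k g r ! a \<Longrightarrow>
      pos_at H (entries m n k g r) a i = max ((arrays pess q x y p del mu K uu vv zz ! a) i) 0 \<and>
      neg_at H (entries m n k g r) a i = max (- (arrays pess q x y p del mu K uu vv zz ! a) i) 0"
  shows "equations pess F m n k g r (entries m n k g r) H"
proof -
  let ?T = "entries m n k g r"
  let ?vs = "arrays pess q x y p del mu K uu vv zz"
  note sz = array_sizes_def Let_def
  note base = primal_dual_eqs[OF pd]
  have num: "num_at H ?T a i = pos_at H ?T a i - neg_at H ?T a i" for a i by (simp add: num_at_def pos_at_def neg_at_def)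
  have nm: "num_at H ?T a i = (?vs ! a) i" if "a < 17" "i < array_sizes m n k g r ! a" for a i
    unfolding num using H[OF that] by auto
  have ps: "pos_at H ?T a i = (?vs ! a) i" "neg_at H ?T a i = 0" if "a < 17" "i < array_sizes m n k g r ! a" "0 \<le> (?vs ! a) i" for a i
    using H[OF that(1,2)] that(3) by auto
  have "1 \<le> q" using pd unfolding primal_dual_def by blast
  then have q: "1 + pos_at H ?T 0 1 = q" using ps(1)[of 0 1] by (simp add: sz arrays_def)
  have dl: "1 + pos_at H ?T 0 2 = del" using ps(1)[of 0 2] del by (simp add: sz arrays_def)
  have E: "num_at H ?T 1 i = Ei i" if "i < ?T" for i using nm[of 1 i] that by (simp add: sz arrays_def)
  have X: "l < k \<Longrightarrow> num_at H ?T 5 l = x l" "j < n \<Longrightarrow> num_at H ?T 6 j = y j" "i < m \<Longrightarrow> num_at H ?T 7 i = signed p i"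
    "i < m \<Longrightarrow> num_at H ?T 8 i = irhs (Up i) q x" "j < n \<Longrightarrow> num_at H ?T 9 j = iobj j q x" for i j l
    using nm[of 5 l] nm[of 6 j] nm[of 7 i] nm[of 8 i] nm[of 9 j] by (simp_all add: sz arrays_def)
  have Y: "i < m \<Longrightarrow> pos_at H ?T 10 i = irhs (Up i) q x - (\<Sum>j<n. Ei (i * n + j) * y j)"
    "j < n \<Longrightarrow> pos_at H ?T 11 j = slackness p j"
    "h < g \<Longrightarrow> pos_at H ?T 12 h = Ei (m * (n + k + 1) + n * (k + 1) + (g * k + h)) * q - (\<Sum>l<k. Ei (m * (n + k + 1) + n * (k + 1) + (h * k + l)) * x l)"
    for i j h
    using ps(1)[of 10 i] ps(1)[of 11 j] ps(1)[of 12 h] base(2-4) by (simp_all add: sz arrays_def)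
  have lp: "lp_eqs F m n k g (\<lambda>i j. num_at H ?T 1 (i * n + j)) (\<lambda>i l. num_at H ?T 1 (m * n + (i * k + l))) (\<lambda>i. num_at H ?T 1 (m * (n + k) + i))
     (\<lambda>i l. num_at H ?T 1 (m * (n + k + 1) + (i * k + l))) (\<lambda>i. num_at H ?T 1 (m * (n + k + 1) + (n * k + i)))
     (\<lambda>i l. num_at H ?T 1 (m * (n + k + 1) + n * (k + 1) + (i * k + l))) (\<lambda>i. num_at H ?T 1 (m * (n + k + 1) + n * (k + 1) + (g * k + i)))
     q (num_at H ?T 5) (num_at H ?T 6) (num_at H ?T 7) (num_at H ?T 8) (num_at H ?T 9) (pos_at H ?T 10) (pos_at H ?T 11) (pos_at H ?T 12)"
    by (rule lp_eqs_cong[OF base(1)]; ((rule E, rule entry_bounds, assumption+)[1] | (erule X)[1] | (erule Y)[1]))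
  have form: "case F of Natural \<Rightarrow> (\<forall>i<m. neg_at H ?T 7 i = 0) | Standard \<Rightarrow> (\<forall>j<n. neg_at H ?T 6 j = 0)"
  proof -
    have "\<forall>i<m. neg_at H ?T 7 i = 0" if "\<forall>i<m. 0 \<le> signed p i" using ps(2)[of 7] that by (simp add: sz arrays_def)
    moreover have "\<forall>j<n. neg_at H ?T 6 j = 0" if "\<forall>j<n. 0 \<le> y j" using ps(2)[of 6] that by (simp add: sz arrays_def)
    ultimately show ?thesis using base(5) by (auto split: lp_form.splits)
  qed
  have last: "if pess then pess_eqs F m n r (\<lambda>i j. num_at H ?T 1 (i * n + j))
         (\<lambda>i j. num_at H ?T 1 (m * (n + k + 1) + (n + g) * (k + 1) + (i * n + j)))
         (\<lambda>i. num_at H ?T 1 (m * (n + k + 1) + (n + g) * (k + 1) + (r * n + i))) q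
        (num_at H ?T 6) (num_at H ?T 8) (num_at H ?T 9) del (\<lambda>i l. num_at H ?T 14 (i * m + l)) (pos_at H ?T 15)
        (\<lambda>i j. pos_at H ?T 16 (i * n + j)) (pos_at H ?T 13) \<and> (F = Natural \<longrightarrow> (\<forall>i<r. \<forall>l<m. neg_at H ?T 14 (i * m + l) = 0))
     else opt_eqs n r (\<lambda>i j. num_at H ?T 1 (m * (n + k + 1) + (n + g) * (k + 1) + (i * n + j)))
         (\<lambda>i. num_at H ?T 1 (m * (n + k + 1) + (n + g) * (k + 1) + (r * n + i))) q (num_at H ?T 6) (pos_at H ?T 13)"
  proof (cases pess)
    case True
    have fc: "farkas_cert q x y del mu K" using cert True by simp
    note pe = farkas_cert_eqs[OF fc]
    have Z: "l < m \<Longrightarrow> num_at H ?T 14 (i * m + l) = signed (mu i) l" "pos_at H ?T 15 i = K i"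
      "j < n \<Longrightarrow> pos_at H ?T 16 (i * n + j) = slackness (mu i) j"
      "pos_at H ?T 13 i = Ei (m * (n + k + 1) + (n + g) * (k + 1) + (r * n + i)) * (del * q) -
        ((\<Sum>l<m. signed (mu i) l * irhs (Up l) q x) + K i * (\<Sum>j<n. iobj j q x * y j))" if "i < r" for i j l
    proof -
      show "num_at H ?T 14 (i * m + l) = signed (mu i) l" if "l < m"
        using nm[of 14 "i * m + l"] mult_add_less[OF \<open>i < r\<close> that] that by (simp add: sz arrays_def)
      show "pos_at H ?T 15 i = K i" using ps(1)[of 15 i] \<open>i < r\<close> pe(3) by (simp add: sz arrays_def)
      show "pos_at H ?T 16 (i * n + j) = slackness (mu i) j" if "j < n"
        using ps(1)[of 16 "i * n + j"] mult_add_less[OF \<open>i < r\<close> that] that pe(4) \<open>i < r\<close> by (simp add: sz arrays_def)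
      show "pos_at H ?T 13 i = Ei (m * (n + k + 1) + (n + g) * (k + 1) + (r * n + i)) * (del * q) -
        ((\<Sum>l<m. signed (mu i) l * irhs (Up l) q x) + K i * (\<Sum>j<n. iobj j q x * y j))"
        using ps(1)[of 13 i] pe(5) \<open>i < r\<close> True by (simp add: sz arrays_def target_slack_def)
    qed
    have "neg_at H ?T 14 (i * m + l) = 0" if "F = Natural" "i < r" "l < m" for i l
    proof -
      have "0 \<le> signed (mu i) l" using pe(6) that by blast
      then show ?thesis using ps(2)[of 14 "i * m + l"] mult_add_less[OF that(2,3)] that(3) by (simp add: sz arrays_def)
    qed
    moreover have "pess_eqs F m n r (\<lambda>i j. num_at H ?T 1 (i * n + j))
         (\<lambda>i j. num_at H ?T 1 (m * (n + k + 1) + (n + g) * (k + 1) + (i * n + j)))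
         (\<lambda>i. num_at H ?T 1 (m * (n + k + 1) + (n + g) * (k + 1) + (r * n + i))) q
        (num_at H ?T 6) (num_at H ?T 8) (num_at H ?T 9) del (\<lambda>i l. num_at H ?T 14 (i * m + l)) (pos_at H ?T 15)
        (\<lambda>i j. pos_at H ?T 16 (i * n + j)) (pos_at H ?T 13)"
      by (rule pess_eqs_cong[OF pe(1)]; ((rule E, rule entry_bounds, assumption+)[1] | (erule X)[1] | (erule (1) Z | erule Z)[1]))
    ultimately show ?thesis using True by simp
  next
    case False
    have tc: "target_cert q y" using cert False by simp
    note te = target_cert_eqs[OF tc]
    have Z: "pos_at H ?T 13 i = Ei (m * (n + k + 1) + (n + g) * (k + 1) + (r * n + i)) * q -
        (\<Sum>j<n. Ei (m * (n + k + 1) + (n + g) * (k + 1) + (i * n + j)) * y j)" if "i < r" for i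
      using ps(1)[of 13 i] te(2) that False by (simp add: sz arrays_def target_slack_def)
    have "opt_eqs n r (\<lambda>i j. num_at H ?T 1 (m * (n + k + 1) + (n + g) * (k + 1) + (i * n + j)))
         (\<lambda>i. num_at H ?T 1 (m * (n + k + 1) + (n + g) * (k + 1) + (r * n + i))) q (num_at H ?T 6) (pos_at H ?T 13)"
      by (rule opt_eqs_cong[OF te(1)]; ((rule E, rule entry_bounds, assumption+)[1] | (erule X)[1] | (erule Z)[1]))
    then show ?thesis using False by simp
  qed
  show ?thesis unfolding equations_def Let_def q dl using inp lp form last by blast
qed

end

text \<open>The coefficients of \<open>m\<close> and \<open>n\<close> come from
  \<open>card (rows F m n) \<le> 2 * m + n\<close>, which turns \<open>3 * n + 4 * card R\<close>
  into \<open>7 * n + 8 * m\<close>.\<close>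

locale small_lp_inst = lp_inst +
  fixes N :: nat
  assumes small_N: "entries m n k g r + 2 * k + 7 * n + 8 * m + g + r + 3 \<le> N"
    and small_E: "\<And>i. i < entries m n k g r \<Longrightarrow> \<bar>Ei i\<bar> \<le> 2 ^ N" and small_\<Delta>: "\<Delta> \<le> 2 ^ N"
begin

sublocale bounded_param_lp "rows F m n" n k g r "row_A (\<lambda>i j. Ei (i * n + j))" "row_B (\<lambda>i l. Ei (m * n + (i * k + l)))"
  "row_b (\<lambda>i. Ei (m * (n + k) + i))"
  "\<lambda>i l. Ei (m * (n + k + 1) + (i * k + l))" "\<lambda>i. Ei (m * (n + k + 1) + (n * k + i))"
  "\<lambda>i l. Ei (m * (n + k + 1) + n * (k + 1) + (i * k + l))" "\<lambda>i. Ei (m * (n + k + 1) + n * (k + 1) + (g * k + i))"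
  "\<lambda>i j. Ei (m * (n + k + 1) + (n + g) * (k + 1) + (i * n + j))" "\<lambda>i. Ei (m * (n + k + 1) + (n + g) * (k + 1) + (r * n + i))"
  N "2 ^ N"
proof
  have one: "(1 :: int) \<le> 2 ^ N" by simp
  have R: "i \<in> rows F m n \<Longrightarrow> (\<exists>i'<m. i = Up i' \<or> i = Lo i') \<or> (\<exists>i'<n. i = Nn i')" for i
    by (cases F) (auto simp: rows_def)
  fix i j assume i: "i \<in> rows F m n"
  show "\<bar>row_A (\<lambda>i j. Ei (i * n + j)) i j\<bar> \<le> 2 ^ N" if "j < n"
    using R[OF i] small_E[OF entry_bounds(1)] that one by auto
  show "\<bar>row_B (\<lambda>i l. Ei (m * n + (i * k + l))) i j\<bar> \<le> 2 ^ N" if "j < k"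
    using R[OF i] small_E[OF entry_bounds(2)] that one by auto
  show "\<bar>row_b (\<lambda>i. Ei (m * (n + k) + i)) i\<bar> \<le> 2 ^ N"
    using R[OF i] small_E[OF entry_bounds(3)] one by auto
next
  show "2 * k + 3 * n + 4 * card (rows F m n) + g + r + 3 \<le> N" using small_N card_rows[of F m n] by linarith
qed ((rule small_E, rule entry_bounds, assumption+) | simp)+

text \<open>With entries of \<open>N\<close> bits, \<open>bd1\<close> has at most
  \<open>4 * N ^ 2\<close> bits and \<open>bd2\<close> at most \<open>16 * N ^ 3\<close>. Hence
  \<open>bd\<close> has at most \<open>1 + 4 * N ^ 2 * (N + 1) + 16 * N ^ 3\<close>, which is below
  \<open>25 * N ^ 3\<close>.\<close>

definition "e0 = 25 * N ^ 3"

lemma N3: "3 \<le> N" using small_N by simp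

lemma bd_le: "bd \<le> 2 ^ e0"
proof -
  have f: "fits i z \<Longrightarrow> fits (i * a) (z ^ a)" for i z a
    unfolding fits_def power_abs power_mult by (intro power_mono) auto
  have "int N \<le> int (2 ^ N)" by (simp only: of_nat_le_iff) simp
  then have N: "fits N (int N)" by (simp add: fits_def)
  have w: "fits N (2 ^ N)" "fits 1 2" by (simp_all add: fits_def)
  have "fits ((N + N) * (2 * N)) bd1" unfolding bd1_def by (intro f fits_mult N w)
  moreover have "(N + N) * (2 * N) = 4 * N ^ 2" by (simp add: power2_eq_square)
  ultimately have 1: "fits (4 * N ^ 2) bd1" by (simp only:)
  have "fits ((N + (1 + N + N + 4 * N ^ 2)) * (2 * N)) bd2" unfolding bd2_def by (intro f fits_mult N w 1)
  then have 2: "fits (16 * N ^ 3) bd2"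
  proof (rule fits_mono)
    have "N * 3 \<le> N * N" using N3 by (rule mult_le_mono2)
    then have "N + (1 + N + N + 4 * N ^ 2) \<le> 8 * N ^ 2" using N3 unfolding power2_eq_square by linarith
    then have "(N + (1 + N + N + 4 * N ^ 2)) * (2 * N) \<le> 8 * N ^ 2 * (2 * N)" by (rule mult_le_mono1)
    then show "(N + (1 + N + N + 4 * N ^ 2)) * (2 * N) \<le> 16 * N ^ 3" by (simp add: power2_eq_square power3_eq_cube)
  qed
  have "fits (1 + 4 * N ^ 2 * (N + 1) + 16 * N ^ 3) bd" unfolding bd_def by (intro f fits_mult w 1 2)
  then have "fits e0 bd"
  proof (rule fits_mono)
    have "N ^ 2 * 1 \<le> N ^ 2 * N" using N3 by (intro mult_le_mono2) simp
    then have "N ^ 2 \<le> N ^ 3" by (simp add: power2_eq_square power3_eq_cube)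
    moreover have "1 \<le> N ^ 3" using N3 by simp
    moreover have "4 * N ^ 2 * (N + 1) = 4 * N ^ 3 + 4 * N ^ 2" by (simp add: power2_eq_square power3_eq_cube algebra_simps)
    ultimately show "1 + 4 * N ^ 2 * (N + 1) + 16 * N ^ 3 \<le> e0" unfolding e0_def by linarith
  qed
  then show ?thesis by (simp add: fits_def)
qed

lemma N_le_e0: "N \<le> e0" "25 \<le> e0"
proof -
  have "N * 1 \<le> N * (N * N)" "1 \<le> N * (N * N)" using N3 by simp_all
  then show "N \<le> e0" "25 \<le> e0" unfolding e0_def power3_eq_cube mult.assoc by linarith+
qed

text \<open>The largest entry is the slack of a target row in the pessimistic scenario:
  \<open>K\<close> times a sum of products \<open>iobj * y\<close> takes \<open>6 * e0 + 1\<close>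
  bits, and adding up the three parts takes two more. This is at most \<open>7 * e0\<close>.\<close>

lemma arrays_fit:
  assumes pd: "primal_dual q x y p"
    and cert: "if pess then farkas_cert q x y del mu K else target_cert q y"
    and del: "1 \<le> del"
    and small: "q \<le> bd" "\<And>l. l < k \<Longrightarrow> \<bar>x l\<bar> \<le> bd" "\<And>j. j < n \<Longrightarrow> \<bar>y j\<bar> \<le> bd" "\<And>i. i \<in> rows F m n \<Longrightarrow> p i \<le> bd"
      "del \<le> bd" "\<And>i. i < r \<Longrightarrow> 0 \<le> K i \<and> K i \<le> bd" "\<And>i h. i < r \<Longrightarrow> h \<in> rows F m n \<Longrightarrow> 0 \<le> mu i h \<and> mu i h \<le> bd"
    and inp: "\<And>i. i < entries m n k g r \<Longrightarrow> fits N (uu i)" "\<And>i. i < entries m n k g r \<Longrightarrow> fits N (vv i)"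
      "\<And>i. i < entries m n k g r \<Longrightarrow> fits N (zz i)"
  shows "list_all2 (\<lambda>f b. \<forall>i<b. fits (7 * e0) (f i)) (arrays pess q x y p del mu K uu vv zz) (array_sizes m n k g r)"
proof -
  have fb: "fits e0 z" if "\<bar>z\<bar> \<le> bd" for z using that bd_le by (simp add: fits_def)
  have q: "1 \<le> q" and pnn: "\<forall>i\<in>rows F m n. 0 \<le> p i" using pd unfolding primal_dual_def by blast+
  have up: "fits (7 * e0) z" if "fits e z" "e \<le> 6 * e0 + 3" for e z using fits_mono[OF that(1)] that(2) N_le_e0 by simp
  have e: "fits e0 z" if "fits N z" for z using fits_mono[OF that] N_le_e0 by simp
  have fE: "fits e0 (Ei i)" if "i < entries m n k g r" for i using small_E[OF that] by (intro e) (simp add: fits_def)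
  have fq: "fits e0 q" "fits e0 del" "fits e0 (q - 1)" "fits e0 (del - 1)" using q del small(1,5) by (auto intro!: fb)
  have f\<Delta>: "fits e0 (\<Delta> - 1)" using \<Delta> small_\<Delta> by (intro e) (simp add: fits_def)
  have fx: "fits e0 (x l)" if "l < k" for l using small(2)[OF that] by (rule fb)
  have fy: "fits e0 (y j)" if "j < n" for j using small(3)[OF that] by (rule fb)
  have fsigned: "fits e0 (signed p i)" if pb: "\<And>h. h \<in> rows F m n \<Longrightarrow> 0 \<le> p h \<and> p h \<le> bd" and i: "i < m" for p i
  proof -
    have "0 \<le> p (Up i) \<and> p (Up i) \<le> bd" using i by (intro pb) (auto simp: rows_def)
    moreover have "0 \<le> p (Lo i) \<and> p (Lo i) \<le> bd" if "F = Standard" using that i by (intro pb) (auto simp: rows_def)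
    ultimately have "\<bar>signed p i\<bar> \<le> bd" unfolding signed_def by (auto split: lp_form.splits)
    then show ?thesis by (rule fb)
  qed
  have fslackness: "fits e0 (slackness p j)" if pb: "\<And>h. h \<in> rows F m n \<Longrightarrow> 0 \<le> p h \<and> p h \<le> bd" and j: "j < n" for p j
  proof -
    have "0 \<le> p (Nn j) \<and> p (Nn j) \<le> bd" if "F = Standard" using that j by (intro pb) (auto simp: rows_def)
    then have "\<bar>slackness p j\<bar> \<le> bd" unfolding slackness_def using q small(1) by (auto split: lp_form.splits)
    then show ?thesis by (rule fb)
  qed
  have pb: "0 \<le> p h \<and> p h \<le> bd" if "h \<in> rows F m n" for h using pnn small(4) that by auto
  have dim: "a \<le> 2 ^ e0" if "a \<le> N" for a :: nat
    using that N_le_e0(1) less_exp[of e0] by linarith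
  have dims: "k \<le> 2 ^ e0" "n \<le> 2 ^ e0" "m \<le> 2 ^ e0" using small_N by (auto intro: dim)
  have dot: "fits (e0 + i + e0) (\<Sum>l<a. f l * h l)"
    if "\<And>l. l < a \<Longrightarrow> fits e0 (f l)" "\<And>l. l < a \<Longrightarrow> fits i (h l)" "a \<le> 2 ^ e0" for a :: nat and f h i
    using that by (intro fits_sum fits_mult) auto
  have tq: "fits (e0 + e0 + e0) (a * q)" if "fits e0 a" for a
    by (rule fits_mono[OF fits_mult[OF that fq(1)]]) simp
  have frhs: "fits (Suc (e0 + e0 + e0)) (irhs (Up i) q x)" if "i < m" for i
    unfolding irhs_def row_B.simps row_b.simps using that
    by (intro fits_add dot tq fE entry_bounds fx dims)
  have fobj: "fits (Suc (e0 + e0 + e0)) (iobj j q x)" if "j < n" for j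
    unfolding iobj_def using that by (intro fits_add dot tq fE entry_bounds fx dims)
  have G0: "fits (7 * e0) (if i = 0 then \<Delta> - 1 else if i = 1 then q - 1 else del - 1)" for i :: nat
    using fq f\<Delta> by (auto intro: up)
  have G1: "fits (7 * e0) (irhs (Up i) q x - (\<Sum>j<n. Ei (i * n + j) * y j))" if "i < m" for i
  proof (rule up[OF fits_diff])
    show "fits (Suc (e0 + e0 + e0)) (irhs (Up i) q x)" by (rule frhs[OF that])
    have "fits (e0 + e0 + e0) (\<Sum>j<n. Ei (i * n + j) * y j)" using that by (intro dot fE entry_bounds fy dims)
    then show "fits (Suc (e0 + e0 + e0)) (\<Sum>j<n. Ei (i * n + j) * y j)" by (rule fits_mono) simp
  qed (use N_le_e0 in simp)
  have G2: "fits (7 * e0) (Ei (m * (n + k + 1) + n * (k + 1) + (g * k + i)) * q - (\<Sum>l<k. Ei (m * (n + k + 1) + n * (k + 1) + (i * k + l)) * x l))"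
    if "i < g" for i
  proof (rule up)
    show "fits (Suc (e0 + e0 + e0)) (Ei (m * (n + k + 1) + n * (k + 1) + (g * k + i)) * q - (\<Sum>l<k. Ei (m * (n + k + 1) + n * (k + 1) + (i * k + l)) * x l))"
      using that by (intro fits_diff dot tq fE entry_bounds fx dims)
  qed (use N_le_e0 in simp)
  have fmu: "0 \<le> mu i h \<and> mu i h \<le> bd" if "i < r" "h \<in> rows F m n" for i h using small(7) that by auto
  have fK: "fits e0 (K i)" if "i < r" for i using small(6)[OF that] by (intro fb) auto
  have G3: "fits (7 * e0) (target_slack pess q x y del mu K i)" if i: "i < r" for i
  proof (cases pess)
    case True
    have "fits (e0 + Suc (e0 + e0 + e0) + e0) (\<Sum>l<m. signed (mu i) l * irhs (Up l) q x)"
      by (intro dot fsigned fmu i frhs dims)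
    then have 1: "fits (6 * e0 + 1) (\<Sum>l<m. signed (mu i) l * irhs (Up l) q x)" by (rule fits_mono) simp
    have "fits (Suc (e0 + e0 + e0) + e0 + e0) (\<Sum>j<n. iobj j q x * y j)"
      by (intro fits_sum fits_mult fobj fy dims)
    then have "fits (e0 + (Suc (e0 + e0 + e0) + e0 + e0)) (K i * (\<Sum>j<n. iobj j q x * y j))"
      by (intro fits_mult fK i)
    then have 2: "fits (6 * e0 + 1) (K i * (\<Sum>j<n. iobj j q x * y j))" by (rule fits_mono) simp
    have "fits (e0 + (e0 + e0)) (Ei (m * (n + k + 1) + (n + g) * (k + 1) + (r * n + i)) * (del * q))"
      using i by (intro fits_mult fE entry_bounds fq)
    then have 3: "fits (Suc (6 * e0 + 1)) (Ei (m * (n + k + 1) + (n + g) * (k + 1) + (r * n + i)) * (del * q))" by (rule fits_mono) simp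
    show ?thesis unfolding target_slack_def if_P[OF True] by (rule up[OF fits_diff[OF 3 fits_add[OF 1 2]]]) simp
  next
    case False
    show ?thesis unfolding target_slack_def if_not_P[OF False]
    proof (rule up)
      show "fits (Suc (e0 + e0 + e0)) (Ei (m * (n + k + 1) + (n + g) * (k + 1) + (r * n + i)) * q -
        (\<Sum>j<n. Ei (m * (n + k + 1) + (n + g) * (k + 1) + (i * n + j)) * y j))"
        using i by (intro fits_diff dot tq fE entry_bounds fy dims)
    qed (use N_le_e0 in simp)
  qed
  have dm: "i div a < r" "i mod a < a" if "i < r * a" for i a :: nat
  proof -
    have "0 < a" using that by (cases a) auto
    then show "i div a < r" "i mod a < a" using that by (auto simp: less_mult_imp_div_less)
  qed
  have G4: "fits (7 * e0) (signed (mu (i div m)) (i mod m))" if "i < r * m" for i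
    using dm[OF that] by (intro up[OF fsigned] fmu) auto
  have G5: "fits (7 * e0) (slackness (mu (i div n)) (i mod n))" if "i < r * n" for i
    using dm[OF that] by (intro up[OF fslackness] fmu) auto
  have le: "e0 \<le> 6 * e0 + 3" "Suc (e0 + e0 + e0) \<le> 6 * e0 + 3" using N_le_e0 by auto
  note G = G0 up[OF fE le(1)] up[OF e[OF inp(1)] le(1)] up[OF e[OF inp(2)] le(1)] up[OF e[OF inp(3)] le(1)] up[OF fx le(1)]
    up[OF fy le(1)] up[OF fsigned[OF pb] le(1)] up[OF frhs le(2)] up[OF fobj le(2)] G1 up[OF fslackness[OF pb] le(1)] G2 G3 G4
    up[OF fK le(1)] G5
  show ?thesis
    unfolding arrays_def array_sizes_def Let_def list_all2_Cons list_all2_Nil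
    by (intro conjI allI impI refl; (rule G; assumption))
qed

end

section \<open>Writing down the certificate and bounding its length\<close>

section \<open>The certificate as a word\<close>

lemma length_nat_bits: "length (nat_bits bs) = 2 * length bs + 1"
  by (induction bs) (simp_all add: nat_bits_def)

lemma less_exp_bin: "a < 2 ^ length (bin a)"
  using floorlog_bounds[of a 2] by (cases "a = 0") (auto simp: bin_def)

lemma length_bin_le: "a < 2 ^ e \<Longrightarrow> length (bin a) \<le> e"
proof (cases "a = 0")
  case False
  assume "a < 2 ^ e"
  moreover have "2 ^ (floorlog 2 a - 1) \<le> a" using floorlog_bounds[of a 2] False by simp
  ultimately have "(2 :: nat) ^ (floorlog 2 a - 1) < 2 ^ e" by linarith
  then have "floorlog 2 a - 1 < e" by (rule power_less_imp_less_exp[rotated]) simp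
  then show ?thesis by (simp add: bin_def)
qed (simp add: bin_def floorlog_def)

lemma enc_rat_bits:
  "enc_rat \<rho> = (fst (quotient_of \<rho>) < 0) # nat_bits (bin (nat \<bar>fst (quotient_of \<rho>)\<bar>)) @ nat_bits (bin (nat (snd (quotient_of \<rho>))))"
  by (simp add: enc_rat_def enc_int_def enc_nat_bits case_prod_beta)

lemma enc_rat_bounds:
  "nat \<bar>fst (quotient_of \<rho>)\<bar> < 2 ^ (length (enc_rat \<rho>) - 1)" "nat (snd (quotient_of \<rho>)) \<le> 2 ^ length (enc_rat \<rho>)"
  "1 \<le> length (enc_rat \<rho>)"
proof -
  have l: "length (bin (nat \<bar>fst (quotient_of \<rho>)\<bar>)) \<le> length (enc_rat \<rho>) - 1" "length (bin (nat (snd (quotient_of \<rho>)))) \<le> length (enc_rat \<rho>)"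
    by (simp_all add: enc_rat_bits length_nat_bits)
  show "nat \<bar>fst (quotient_of \<rho>)\<bar> < 2 ^ (length (enc_rat \<rho>) - 1)"
    by (rule less_le_trans[OF less_exp_bin power_increasing[OF l(1)]]) simp
  show "nat (snd (quotient_of \<rho>)) \<le> 2 ^ length (enc_rat \<rho>)"
    by (rule less_imp_le[OF less_le_trans[OF less_exp_bin power_increasing[OF l(2)]]]) simp
  show "1 \<le> length (enc_rat \<rho>)" by (simp add: enc_rat_bits)
qed

text \<open>The first coefficient is reduced modulo \<open>b\<close> and the quotient is moved into
  the second one, whose size then follows from the equation.\<close>

lemma small_bezout:
  assumes "coprime a b" "0 < b"
  shows "\<exists>u v. int a * u + int b * v = 1 \<and> \<bar>u\<bar> \<le> int b \<and> \<bar>v\<bar> \<le> int a + 1"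
proof -
  obtain u v where "u * int a + v * int b = gcd (int a) (int b)" using bezout_int by blast
  then have uv: "u * int a + v * int b = 1" using assms(1) by (simp add: coprime_int_iff[symmetric] coprime_iff_gcd_eq_1)
  define u' where "u' = u mod int b"
  define v' where "v' = v + (u div int b) * int a"
  have u: "0 \<le> u'" "u' < int b" using assms(2) by (auto simp: u'_def)
  have "u = u' + int b * (u div int b)" by (simp add: u'_def)
  from arg_cong[OF this, of "\<lambda>t. t * int a"] have "int a * u' + int b * v' = u * int a + v * int b"
    by (simp add: v'_def algebra_simps)
  then have e: "int a * u' + int b * v' = 1" using uv by simp
  have "0 \<le> int a * u'" "int a * u' \<le> int a * int b" using u by (auto intro: mult_left_mono)
  then have "int b * v' \<le> 1" "1 - int a * int b \<le> int b * v'" using e by linarith+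
  have "v' \<le> 1"
  proof (rule ccontr)
    assume "\<not> v' \<le> 1"
    then have "1 * 2 \<le> int b * v'" using assms(2) by (intro mult_mono) auto
    then show False using \<open>int b * v' \<le> 1\<close> by simp
  qed
  moreover have "- int a - 1 \<le> v'"
  proof (rule ccontr)
    assume "\<not> - int a - 1 \<le> v'"
    then have "int b * v' \<le> int b * (- int a - 2)" by (intro mult_left_mono) auto
    then have "1 - int a * int b \<le> - (int a * int b) - 2 * int b" using \<open>1 - int a * int b \<le> int b * v'\<close> by (simp add: algebra_simps)
    then show False using assms(2) by simp
  qed
  moreover have "v' \<le> int a + 1" using \<open>v' \<le> 1\<close> by simp
  ultimately show ?thesis using e u by (intro exI[of _ u'] exI[of _ v']) auto
qed

lemma dims_enc:
  assumes "u = bits (enc_dim m) @ bits (enc_dim n) @ bits (enc_dim k) @ bits (enc_dim g) @ bits (enc_dim r) @ ys"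
  shows "dim_at u 0 = m" "dim_at u 1 = n" "dim_at u 2 = k" "dim_at u 3 = g" "dim_at u 4 = r" "items_at u = ys"
  unfolding dim_at_def items_at_def assms by (simp_all add: numeral_eq_Suc dimv_enc)

lemma length_concat_upt: "length (concat (map f [0..<a])) = (\<Sum>i<a. length (f i))"
  by (induction a) simp_all

lemma item_cell_simps:
  "item_cell 0 (s, as, bs) = s" "item_cell 1 (s, as, bs) = int (bval as)" "item_cell 2 (s, as, bs) = dlast (bits as)"
  "item_cell 3 (s, as, bs) = int (bval bs)" "item_cell 4 (s, as, bs) = dlast (bits bs)"
  by (simp_all add: item_cell_def numeral_eq_Suc)

lemma (in small_lp_inst) certificate:
  assumes "if pess then pessimistic F I else optimistic F I"
  shows "\<exists>q x y p del mu K. primal_dual q x y p \<and> (if pess then farkas_cert q x y del mu K else target_cert q y) \<and>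
    1 \<le> del \<and> q \<le> bd \<and> (\<forall>l<k. \<bar>x l\<bar> \<le> bd) \<and> (\<forall>j<n. \<bar>y j\<bar> \<le> bd) \<and> (\<forall>i\<in>rows F m n. p i \<le> bd) \<and> del \<le> bd \<and>
    (\<forall>i<r. 0 \<le> K i \<and> K i \<le> bd) \<and> (\<forall>i<r. \<forall>h\<in>rows F m n. 0 \<le> mu i h \<and> mu i h \<le> bd)"
proof (cases pess)
  case True
  then obtain X Y where "inX X" "isopt X Y" "\<And>y. isopt X y \<Longrightarrow> inY y" using assms pessimistic_iff by auto
  from farkas_cert_complete[OF this] obtain q x y p del mu K where c: "primal_dual q x y p" "farkas_cert q x y del mu K"
      "q \<le> bd" "\<forall>l<k. \<bar>x l\<bar> \<le> bd" "\<forall>j<n. \<bar>y j\<bar> \<le> bd" "\<forall>i\<in>rows F m n. p i \<le> bd" "del \<le> bd"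
      "\<forall>i<r. K i \<le> bd \<and> (\<forall>h\<in>rows F m n. mu i h \<le> bd)" by blast
  moreover have "1 \<le> del" "\<forall>i<r. 0 \<le> K i \<and> (\<forall>h\<in>rows F m n. 0 \<le> mu i h)" using c(2) unfolding farkas_cert_def by blast+
  ultimately show ?thesis unfolding if_P[OF True] by blast
next
  case False
  then obtain X Y where "inX X" "isopt X Y" "inY Y" using assms optimistic_iff by auto
  from target_cert_complete[OF this] obtain q x y p where c: "primal_dual q x y p" "target_cert q y"
      "q \<le> bd" "\<forall>l<k. \<bar>x l\<bar> \<le> bd" "\<forall>j<n. \<bar>y j\<bar> \<le> bd" "\<forall>i\<in>rows F m n. p i \<le> bd" by blast
  have "1 \<le> q" using c(1) unfolding primal_dual_def by blast
  then have "1 \<le> bd" using c(3) by linarith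
  \<comment> \<open>The optimistic scenario fills the arrays of the Farkas certificate with dummies
    that satisfy the same bounds.\<close>
  then show ?thesis using c unfolding if_not_P[OF False]
    by (intro exI[of _ q] exI[of _ x] exI[of _ y] exI[of _ p] exI[of _ 1] exI[of _ "\<lambda>_ _. 0"] exI[of _ "\<lambda>_. 0"]) simp
qed

text \<open>The two empty numbers after the separator take 2 bits. They are followed by at most
  \<open>20 * N ^ 2\<close> items of at most \<open>7 + 4 * e\<close> bits each, where
  \<open>e = 7 * e0 = 175 * N ^ 3\<close>.\<close>

definition cert_length :: "nat poly" where
  "cert_length = (let N = 20 * ([:0, 1:] + 1) in 2 + 20 * N ^ 2 * (7 + 700 * N ^ 3))"

lemma poly_cert_length: "poly cert_length a = (let N = 20 * (a + 1) in 2 + 20 * N ^ 2 * (7 + 700 * N ^ 3))"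
  unfolding cert_length_def Let_def by (simp only: poly_add poly_mult poly_power poly_numeral poly_1 poly_pCons poly_0 mult_1_right add_0_left mult_zero_right add_0_right)

lemma verifier_complete:
  fixes E :: "nat \<Rightarrow> rat" and m n k g r :: nat
  defines "x \<equiv> encode (inst m n k g r E)"
  assumes yes: "if pess then pessimistic F (inst m n k g r E) else optimistic F (inst m n k g r E)"
  shows "\<exists>w. length w \<le> poly cert_length (length x) \<and> accepts (verifier tot_expr (blocks pess F)) (pair_word x w)"
proof -
  define T where "T = entries m n k g r"
  define L where "L = tot_size m n k g r"
  define num where "num = (\<lambda>i. fst (quotient_of (E i)))"
  define den where "den = (\<lambda>i. snd (quotient_of (E i)))"
  \<comment> \<open>Large enough for the linear form in \<open>small_lp_inst\<close>, whose
    coefficients are at most 8, and for the \<open>2 * length x\<close> bits of a numerator times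
    its cofactor.\<close>
  define N where "N = 20 * (length x + 1)"
  have nd: "0 < den i" "coprime (num i) (den i)" "real_of_rat (E i) = real_of_int (num i) / real_of_int (den i)" for i
  proof -
    have q: "quotient_of (E i) = (num i, den i)" by (simp add: num_def den_def)
    show d: "0 < den i" by (rule quotient_of_denom_pos[OF q])
    show "coprime (num i) (den i)" by (rule quotient_of_coprime[OF q])
    have "E i = of_int (num i) / of_int (den i)" by (rule quotient_of_div[OF q])
    then show "real_of_rat (E i) = real_of_int (num i) / real_of_int (den i)" by (simp add: of_rat_divide)
  qed
  have enc: "x = enc_dim m @ enc_dim n @ enc_dim k @ enc_dim g @ enc_dim r @ concat (map (enc_rat \<circ> E) [0..<T])"
    unfolding x_def encode_inst T_def ..
  have lx: "length x = m + n + k + g + r + 5 + (\<Sum>i<T. length (enc_rat (E i)))"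
    unfolding enc by (simp add: length_concat_upt enc_dim_def)
  have "(\<Sum>i<T. 1) \<le> (\<Sum>i<T. length (enc_rat (E i)))" by (intro sum_mono enc_rat_bounds)
  then have Tx: "T + m + n + k + g + r + 5 \<le> length x" unfolding lx by simp
  have le_x: "length (enc_rat (E i)) \<le> length x" if "i < T" for i
    using member_le_sum[of i "{..<T}" "\<lambda>i. length (enc_rat (E i))"] that unfolding lx by simp
  have num_small: "\<bar>num i\<bar> < 2 ^ length x" and den_small: "den i \<le> 2 ^ length x" if "i < T" for i
  proof -
    have "nat \<bar>num i\<bar> < 2 ^ (length (enc_rat (E i)) - 1)" unfolding num_def by (rule enc_rat_bounds)
    also have "\<dots> \<le> 2 ^ length x" using le_x[OF that] by (intro power_increasing) auto
    finally show "\<bar>num i\<bar> < 2 ^ length x" by (simp add: nat_less_iff)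
    have "nat (den i) \<le> 2 ^ length (enc_rat (E i))" unfolding den_def by (rule enc_rat_bounds)
    also have "\<dots> \<le> 2 ^ length x" using le_x[OF that] by (intro power_increasing) auto
    finally show "den i \<le> 2 ^ length x" by (simp add: nat_le_iff)
  qed
  \<comment> \<open>The product of all denominators is a common denominator. Its bit length is at
    most the sum of the lengths of the encoded entries, hence at most
    \<open>length x\<close>.\<close>
  define \<Delta> where "\<Delta> = (\<Prod>i<T. den i)"
  have \<Delta>0: "0 < \<Delta>" unfolding \<Delta>_def using nd(1) by (intro prod_pos) auto
  have \<Delta>x: "\<Delta> \<le> 2 ^ length x"
  proof -
    have "\<Delta> \<le> (\<Prod>i<T. 2 ^ length (enc_rat (E i)))" unfolding \<Delta>_def
    proof (intro prod_mono conjI)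
      fix i
      show "0 \<le> den i" using nd(1)[of i] by simp
      have "nat (den i) \<le> 2 ^ length (enc_rat (E i))" unfolding den_def by (rule enc_rat_bounds)
      then show "den i \<le> 2 ^ length (enc_rat (E i))" by (simp add: nat_le_iff)
    qed
    also have "\<dots> = 2 ^ (\<Sum>i<T. length (enc_rat (E i)))" by (simp add: power_sum)
    also have "\<dots> \<le> 2 ^ length x" unfolding lx by (intro power_increasing) auto
    finally show ?thesis .
  qed
  define Ei where "Ei = (\<lambda>i. num i * (\<Delta> div den i))"
  have den_\<Delta>: "den i * (\<Delta> div den i) = \<Delta>" if "i < T" for i
    using that unfolding \<Delta>_def by (intro dvd_mult_div_cancel dvd_prodI) auto
  have xN: "length x \<le> N" "length x + length x \<le> N" by (simp_all add: N_def)
  have fN: "fits N z" if "\<bar>z\<bar> \<le> 2 ^ length x" for z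
  proof -
    have "fits (length x) z" using that by (simp add: fits_def)
    then show ?thesis using xN(1) by (rule fits_mono)
  qed
  have Ei_small: "\<bar>Ei i\<bar> \<le> 2 ^ N" if "i < T" for i
  proof -
    have "0 \<le> \<Delta> div den i" using \<Delta>0 nd(1)[of i] by (simp add: pos_imp_zdiv_nonneg_iff)
    moreover have "1 * (\<Delta> div den i) \<le> den i * (\<Delta> div den i)"
      using nd(1)[of i] calculation by (intro mult_right_mono) auto
    ultimately have "fits (length x) (\<Delta> div den i)" using den_\<Delta>[OF that] \<Delta>x by (simp add: fits_def)
    moreover have "fits (length x) (num i)" using num_small[OF that] by (simp add: fits_def)
    ultimately have "fits (length x + length x) (Ei i)" unfolding Ei_def by (intro fits_mult)
    from fits_mono[OF this xN(2)] show ?thesis by (simp add: fits_def)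
  qed
  have "small_lp_inst m n k g r E Ei \<Delta> N"
  proof
    show "real_of_rat (E i) = real_of_int (Ei i) / real_of_int \<Delta>" if "i < entries m n k g r" for i
    proof -
      have "real_of_int (den i * (\<Delta> div den i)) = real_of_int \<Delta>" using den_\<Delta> that by (simp only: T_def)
      moreover have "0 < real_of_int (den i)" using nd(1) by simp
      moreover have "0 < real_of_int \<Delta>" using \<Delta>0 by simp
      ultimately show ?thesis unfolding nd(3) Ei_def by (simp add: frac_eq_eq mult_ac)
    qed
    show "entries m n k g r + 2 * k + 7 * n + 8 * m + g + r + 3 \<le> N" using Tx unfolding T_def N_def by simp
    show "\<Delta> \<le> 2 ^ N" by (rule order.trans[OF \<Delta>x]) (simp add: N_def power_increasing)
    show "\<bar>Ei i\<bar> \<le> 2 ^ N" if "i < entries m n k g r" for i using Ei_small that by (simp add: T_def)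
  qed (rule \<Delta>0)
  then interpret small_lp_inst F m n k g r E Ei \<Delta> N .
  obtain q \<xi> y p del mu K where pd: "primal_dual q \<xi> y p" and cert: "if pess then farkas_cert q \<xi> y del mu K else target_cert q y"
    and del: "1 \<le> del" and small: "q \<le> bd" "\<forall>l<k. \<bar>\<xi> l\<bar> \<le> bd" "\<forall>j<n. \<bar>y j\<bar> \<le> bd" "\<forall>i\<in>rows F m n. p i \<le> bd" "del \<le> bd"
      "\<forall>i<r. 0 \<le> K i \<and> K i \<le> bd" "\<forall>i<r. \<forall>h\<in>rows F m n. 0 \<le> mu i h \<and> mu i h \<le> bd"
    using certificate[OF yes] by blast
  have "\<forall>i. \<exists>u v. \<bar>num i\<bar> * u + den i * v = 1 \<and> \<bar>u\<bar> \<le> den i \<and> \<bar>v\<bar> \<le> \<bar>num i\<bar> + 1"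
  proof
    fix i
    have "coprime (nat \<bar>num i\<bar>) (nat (den i))" using nd(1,2)[of i] by (simp add: coprime_int_iff[symmetric])
    from small_bezout[OF this] show "\<exists>u v. \<bar>num i\<bar> * u + den i * v = 1 \<and> \<bar>u\<bar> \<le> den i \<and> \<bar>v\<bar> \<le> \<bar>num i\<bar> + 1"
      using nd(1)[of i] by simp
  qed
  then obtain uu vv where uv: "\<And>i. \<bar>num i\<bar> * uu i + den i * vv i = 1" "\<And>i. \<bar>uu i\<bar> \<le> den i" "\<And>i. \<bar>vv i\<bar> \<le> \<bar>num i\<bar> + 1"
    by metis
  define zz where "zz = (\<lambda>i. if num i < 0 then \<bar>num i\<bar> - 1 else 0)"
  have inp: "fits N (uu i)" "fits N (vv i)" "fits N (zz i)" if "i < entries m n k g r" for i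
  proof -
    have i: "i < T" using that by (simp add: T_def)
    show "fits N (uu i)" using uv(2)[of i] den_small[OF i] by (intro fN) linarith
    show "fits N (vv i)" using uv(3)[of i] num_small[OF i] by (intro fN) linarith
    show "fits N (zz i)" using num_small[OF i] by (intro fN) (auto simp: zz_def)
  qed
  let ?vs = "arrays pess q \<xi> y p del mu K uu vv zz"
  define e where "e = 7 * e0"
  have fit: "list_all2 (\<lambda>f b. \<forall>i<b. fits e (f i)) ?vs (array_sizes m n k g r)"
    unfolding e_def using small by (intro arrays_fit[OF pd cert del] inp) auto
  define z where "z = (\<lambda>j. if j mod 20 < 17 \<and> fits e ((?vs ! (j mod 20)) (j div 20)) then (?vs ! (j mod 20)) (j div 20) else 0)"
  have zfit: "fits e (z j)" for j by (simp add: z_def fits_def)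
  define its where "its = map (\<lambda>i. (of_bool (num i < 0), bin (nat \<bar>num i\<bar>), bin (nat (den i)))) [0..<T] @
     (2, [], []) # map (\<lambda>j. (0 :: int, bin (nat (z j)), bin (nat (- z j)))) [0..<20 * L]"
  \<comment> \<open>The separator acts as a sign symbol, so the certificate starts with two empty
    numbers that complete this item.\<close>
  define w where "w = nat_bits [] @ nat_bits [] @
     concat (map (\<lambda>j. False # nat_bits (bin (nat (z j))) @ nat_bits (bin (nat (- z j)))) [0..<20 * L])"
  define u where "u = pair_word x w"
  have u: "u = bits (enc_dim m) @ bits (enc_dim n) @ bits (enc_dim k) @ bits (enc_dim g) @ bits (enc_dim r) @
     concat (map item_bits its) @ []"
  proof -
    have "bits (concat (map (enc_rat \<circ> E) [0..<T])) =
      concat (map item_bits (map (\<lambda>i. (of_bool (num i < 0), bin (nat \<bar>num i\<bar>), bin (nat (den i)))) [0..<T]))"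
      by (simp add: map_concat comp_def enc_rat_bits item_bits_def num_def den_def)
    moreover have "2 # bits w = concat (map item_bits ((2, [], []) # map (\<lambda>j. (0, bin (nat (z j)), bin (nat (- z j)))) [0..<20 * L]))"
      by (simp add: w_def map_concat comp_def item_bits_def)
    ultimately show ?thesis unfolding u_def pair_word_def enc its_def by simp
  qed
  note dims = dims_enc[OF u]
  have Tu: "entries_at u = T" unfolding entries_at_def dims T_def ..
  have tot: "tot_at u = length its" unfolding tot_at_def Tu dims by (simp add: its_def L_def)
  obtain H where H: "\<And>i c. i < tot_at u \<Longrightarrow> c < 5 \<Longrightarrow> H c i = cellv c ((item_rest ^^ i) (items_at u))"
    and acc: "accepts (verifier tot_expr (blocks pess F)) u \<longleftrightarrow> equations pess F m n k g r T H"
    using verifier_spec[OF digit_word_pair[of x w], of pess F] unfolding u_def[symmetric] dims Tu by blast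
  have cell: "H c i = item_cell c (its ! i)" if "i < length its" "c < 5" for c i
    using H[of i c] that cellv_items[OF that(1), of c "[]"] unfolding dims tot by simp
  have len: "length its = T + 1 + 20 * L" by (simp add: its_def)
  have arr: "pos_at H T a i = max ((?vs ! a) i) 0 \<and> neg_at H T a i = max (- (?vs ! a) i) 0"
    if a: "a < 17" "i < array_sizes m n k g r ! a" for a i
  proof -
    have iL: "i < L" using array_sizes_le[OF a(1)] a(2) by (auto simp: L_def intro: less_le_trans)
    define j where "j = a + 20 * i"
    have j: "j mod 20 = a" "j div 20 = i" "j < 20 * L" using a(1) iL by (auto simp: j_def)
    have "fits e ((?vs ! a) i)" using list_all2_nthD2[OF fit, of a] a by (simp add: array_sizes_def Let_def)
    then have zj: "z j = (?vs ! a) i" unfolding z_def j using a(1) by simp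
    have idx: "T + (1 + a) + 20 * i = T + Suc j" by (simp add: j_def)
    have "its ! (T + Suc j) = (0, bin (nat (z j)), bin (nat (- z j)))"
      using j(3) by (simp add: its_def nth_append)
    then show ?thesis
      unfolding pos_at_def neg_at_def idx using cell[of "T + Suc j" 1] cell[of "T + Suc j" 3] j(3)
      by (simp add: len item_cell_simps bval_bin zj del: One_nat_def)
  qed
  have nm: "num_at H T a i = (?vs ! a) i" if "a < 17" "i < array_sizes m n k g r ! a" for a i
    using arr[OF that] by (auto simp: num_at_def pos_at_def neg_at_def)
  have io: "input_ok T H"
    unfolding input_ok_def
  proof (intro conjI allI impI)
    show "H 0 T = 2" using cell[of T 0] by (simp add: len its_def nth_append item_cell_simps)
    fix i assume i: "i < T"
    have "its ! i = (of_bool (num i < 0), bin (nat \<bar>num i\<bar>), bin (nat (den i)))" using i by (simp add: its_def nth_append)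
    then have h: "H 0 i = of_bool (num i < 0)" "H 1 i = \<bar>num i\<bar>" "H 2 i = 1" "H 3 i = den i" "H 4 i = 1"
      using cell[of i 0] cell[of i 1] cell[of i 2] cell[of i 3] cell[of i 4] i nd(1)[of i]
      by (simp_all add: len item_cell_simps bval_bin dlast_bin del: One_nat_def)
    have sz: "i < array_sizes m n k g r ! a" if "a \<in> {1, 2, 3, 4}" for a
      using i that by (auto simp: array_sizes_def Let_def T_def)
    have v: "num_at H T 1 i = Ei i" "num_at H T 2 i = uu i" "num_at H T 3 i = vv i" "pos_at H T 4 i = zz i"
      using nm[of 1 i] nm[of 2 i] nm[of 3 i] arr[of 4 i] sz[of 1] sz[of 2] sz[of 3] sz[of 4]
      by (simp_all add: arrays_def zz_def del: One_nat_def)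
    have v0: "1 + pos_at H T 0 0 = \<Delta>" using arr[of 0 0] \<Delta>0 by (simp add: arrays_def array_sizes_def Let_def)
    show "H 2 i = 1" "H 4 i = 1" by (rule h)+
    show "H 1 i * num_at H T 2 i + H 3 i * num_at H T 3 i = 1" unfolding h v by (rule uv)
    show "H 0 i * (H 1 i - 1 - pos_at H T 4 i) = 0" unfolding h v by (simp add: zz_def)
    have "num_at H T 1 i * H 3 i = num i * (den i * (\<Delta> div den i))" unfolding h v Ei_def by (simp only: mult_ac)
    also have "\<dots> = num i * \<Delta>" unfolding den_\<Delta>[OF i] ..
    also have "num i = (1 - 2 * of_bool (num i < 0)) * \<bar>num i\<bar>" by simp
    finally show "num_at H T 1 i * H 3 i = (1 - 2 * H 0 i) * (H 1 i * (1 + pos_at H T 0 0))"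
      unfolding h v0 by (simp only: mult.assoc)
  qed
  have "equations pess F m n k g r T H"
    unfolding T_def by (rule equations_complete[OF pd cert del]) (use io arr in \<open>auto simp: T_def\<close>)
  then have "accepts (verifier tot_expr (blocks pess F)) (pair_word x w)" using acc by (simp add: u_def)
  moreover have "length w \<le> poly cert_length (length x)"
  proof -
    have lb: "length (bin (nat a)) \<le> Suc e" if "fits e a" for a
    proof (rule length_bin_le)
      have "a \<le> 2 ^ e" "(2 :: int) ^ e < 2 ^ Suc e" using that by (auto simp: fits_def)
      then have "a < 2 ^ Suc e" by linarith
      then show "nat a < 2 ^ Suc e" by (simp add: nat_less_iff del: power_Suc)
    qed
    have "length w = 2 + (\<Sum>j<20 * L. 3 + 2 * length (bin (nat (z j))) + 2 * length (bin (nat (- z j))))"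
      unfolding w_def by (simp add: length_concat_upt length_nat_bits numeral_3_eq_3)
    also have "\<dots> \<le> 2 + (\<Sum>j<20 * L. 3 + 2 * Suc e + 2 * Suc e)"
    proof (intro add_left_mono sum_mono add_mono mult_le_mono2 order.refl lb zfit)
      show "fits e (- z j)" for j using zfit[of j] by (simp add: fits_def)
    qed
    also have "\<dots> = 2 + 20 * L * (7 + 4 * e)" by simp
    also have "4 * e = 700 * N ^ 3" by (simp add: e_def e0_def)
    also have "2 + 20 * L * (7 + 700 * N ^ 3) \<le> 2 + 20 * N ^ 2 * (7 + 700 * N ^ 3)"
    proof (intro add_left_mono mult_le_mono1 mult_le_mono2)
      have "r * m \<le> length x * length x" using Tx by (intro mult_le_mono) auto
      then have "L \<le> length x + length x * length x" using Tx by (simp add: L_def tot_size_def T_def)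
      also have "\<dots> \<le> N ^ 2" by (simp add: N_def power2_eq_square algebra_simps)
      finally show "L \<le> N ^ 2" .
    qed
    finally show ?thesis unfolding poly_cert_length Let_def N_def .
  qed
  ultimately show ?thesis by blast
qed

lemma ILFP_in_NP: "(if pess then pessimistic_ILFP F else optimistic_ILFP F) \<in> NP" (is "?L \<in> NP")
proof -
  let ?V = "verifier tot_expr (blocks pess F)"
  have halt: "halts_within ?V (pair_word x w) (poly run_time (length (pair_word x w)))" for x w
    using verifier_spec[OF digit_word_pair[of x w], of pess F] by blast
  have "x \<in> ?L" if acc: "accepts ?V (pair_word x w)" for x w
    using verifier_spec[OF digit_word_pair[of x w], of pess F] acc verifier_sound[OF refl, of x w _ pess F] by blast
  moreover have "\<exists>w. length w \<le> poly cert_length (length x) \<and> accepts ?V (pair_word x w)" if xL: "x \<in> ?L" for x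
  proof -
    obtain I where I: "x = encode I" "wf_ilfp I" "if pess then pessimistic F I else optimistic F I"
      using xL by (cases pess) (auto simp: pessimistic_ILFP_def optimistic_ILFP_def)
    obtain E where "I = inst (dim_m I) (dim_n I) (dim_k I) (dim_g I) (dim_r I) E" using wf_imp_inst[OF I(2)] by blast
    then show ?thesis using verifier_complete[of pess F] I(1,3) by metis
  qed
  ultimately show ?thesis unfolding NP_def using halt by blast
qed

theorem theorem8:
  fixes F :: lp_form
  shows "optimistic_ILFP F \<in> NP \<and> pessimistic_ILFP F \<in> NP"
  using ILFP_in_NP[of False F] ILFP_in_NP[of True F] by simp

end
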